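(* Let $\gamma>0$, $\tau<0$, $\rho = \gamma\tau$. Let $F \in \mathcal{F}(\gamma,\tau)$ with $F(0)=0$, with associated functions $\delta$ and $a$ (defined in the context), and let $X_1,\ldots,X_n$ be independent random variables with common distribution function $F$. Let $k = k_n \in \{1,\ldots,n-1\}$ be an intermediate integer sequence, that is, $k \to \infty$ and $k/n \to 0$ as $n\to\infty$, satisfying $\sqrt{k}\, a(n/k) \to \lambda \in \mathbb{R}$ as $n \to \infty$. Put $\delta_n = \delta(X_{n-k:n})$. Let $\hat\rho_n$ be an estimator sequence with $\hat{\rho}_n = \rho + o_p(1)$ as $n \to \infty$, and let $\hat\gamma_{k,n}$, $\hat\delta_{k,n}$, $Z_{k,n}$ be as defined in the context. Then $\sqrt{k}\,\delta_n = \lambda + o_p(1)$ as $n\to\infty$ and $$\Bigl( \sqrt{k}(\hat\gamma_{k,n} - \gamma),\ \sqrt{k}(\hat\delta_{k,n} - \delta_n),\ Z_{k,n} \Bigr) \rightsquigarrow N_3(\boldsymbol{0},\Sigma), \qquad n \to \infty,$$ a trivariate normal distribution with mean vector zero and covariance matrix $$\Sigma = \begin{pmatrix} \gamma^2 \frac{(1-\rho)^2}{\rho^2} & -\gamma^2\frac{(1-2\rho)(1-\rho)}{\rho^3} & 0 \\ -\gamma^2\frac{(1-2\rho)(1-\rho)}{\rho^3} & \gamma^2\frac{(1-2\rho)(1-\rho)^2}{\rho^4} & 0 \\ 0 & 0 & 1 \end{pmatrix}.$$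
   Context: The arrow $\rightsquigarrow$ denotes convergence in distribution, and $o_p(1)$ denotes convergence to zero in probability. For a distribution function $F$ write $\overline{F} = 1-F$. A positive measurable function $f$ defined in a right neighborhood of infinity is regularly varying with index $\beta \in \mathbb{R}$, written $f \in \mathcal{R}_\beta$, if $\lim_{u\to\infty} f(ux)/f(u) = x^\beta$ for all $x \in (0,\infty)$. The class $\mathcal{F}(\gamma,\tau)$ ($\gamma>0$, $\tau<0$): a distribution function $F$ belongs to $\mathcal{F}(\gamma,\tau)$ if $x^{1/\gamma}\overline{F}(x) \to C \in (0,\infty)$ as $x \to \infty$ and if the function $\delta$ defined via $\overline{F}(x) = C x^{-1/\gamma}\{1 + \gamma^{-1}\delta(x)\}$ is eventually nonzero and of constant sign and satisfies $|\delta| \in \mathcal{R}_\tau$. Tail quantile function: $U(y) = Q(1-1/y)$ for $y \in (1,\infty)$, where $Q(p) = \inf\{x \in \mathbb{R} : F(x) \geq p\}$, $p \in (0,1)$. The function $a$ is defined implicitly by $U(y) = C^\gamma y^\gamma\{1 + a(y)\}$, with $C = \lim_{x\to\infty} x^{1/\gamma}\overline{F}(x)$. Order statistics of the sample are denoted $X_{1:n} \leq \cdots \leq X_{n:n}$. Define $$H_{k,n} = \frac1k\sum_{i=1}^k \log(X_{n-k+i:n}/X_{n-k:n}), \qquad E_{k,n}(s) = \frac1k \sum_{i=1}^k (X_{n-k+i:n}/X_{n-k:n})^s,\quad s \leq 0,$$ $$\hat\delta_{k,n} = H_{k,n}(1-2\hat\rho_n)(1-\hat\rho_n)^3\hat\rho_n^{-4}\left(E_{k,n}(\hat\rho_n/H_{k,n})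 - \frac{1}{1-\hat\rho_n}\right),$$ $$\hat\gamma_{k,n} = H_{k,n} - \hat\delta_{k,n}\frac{\hat\rho_n}{1-\hat\rho_n}, \qquad Z_{k,n} = \sqrt{k}\,\{n\overline{F}(X_{n-k:n})/k - 1\}.$$ The estimators may be given arbitrary values on events where these expressions are undefined (for instance when $\hat\rho_n \geq 0$ or $H_{k,n}=0$). *)

theory Defs
  imports "HOL-Probability.Probability"
begin

section \<open>Modes of convergence\<close>

text \<open>
  The random elements \<open>Y n\<close> may live on a different probability space \<open>M n\<close> for each \<open>n\<close>.
  Measurability (for all large \<open>n\<close>) is part of both notions, so that neither can hold
  merely because the measure of a nonmeasurable set or the integral of a nonmeasurable
  function is \<open>0\<close> by convention.
\<close>

definition converges_in_probability ::
    "(nat \<Rightarrow> 'a measure) \<Rightarrow> (nat \<Rightarrow> 'a \<Rightarrow> real) \<Rightarrow> real \<Rightarrow> bool" where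
  "converges_in_probability M Y c \<longleftrightarrow>
     (\<forall>\<^sub>F n in sequentially. Y n \<in> borel_measurable (M n)) \<and>
     (\<forall>\<epsilon>>0. (\<lambda>n. measure (M n) {\<omega> \<in> space (M n). \<bar>Y n \<omega> - c\<bar> > \<epsilon>}) \<longlonglongrightarrow> 0)"

definition converges_in_distribution ::
    "(nat \<Rightarrow> 'a measure) \<Rightarrow> (nat \<Rightarrow> 'a \<Rightarrow> 'b::metric_space) \<Rightarrow> 'b measure \<Rightarrow> bool" where
  "converges_in_distribution M Y N \<longleftrightarrow>
     (\<forall>\<^sub>F n in sequentially. Y n \<in> borel_measurable (M n)) \<and>
     (\<forall>f::'b \<Rightarrow> real. continuous_on UNIV f \<and> bounded (range f) \<longrightarrow>
        (\<lambda>n. \<integral>\<omega>. f (Y n \<omega>) \<partial>(M n)) \<longlonglongrightarrow> (\<integral>y. f y \<partial>N))"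

text \<open>The nondegenerate normal law; meaningful for symmetric positive definite \<open>S\<close>.\<close>

definition mv_normal :: "real ^ 'n \<Rightarrow> real ^ 'n ^ 'n \<Rightarrow> (real ^ 'n) measure" where
  "mv_normal m S = density lborel (\<lambda>x. ennreal
     (exp (- ((x - m) \<bullet> (matrix_inv S *v (x - m))) / 2) / sqrt ((2 * pi) ^ CARD('n) * det S)))"

section \<open>The class of distribution functions\<close>

definition regularly_varying :: "real \<Rightarrow> (real \<Rightarrow> real) \<Rightarrow> bool" where
  "regularly_varying \<beta> f \<longleftrightarrow>
     (\<exists>x0. (\<forall>x>x0. f x > 0) \<and> f \<in> borel_measurable (restrict_space borel {x0<..})) \<and>
     (\<forall>x>0. ((\<lambda>u. f (u * x) / f u) \<longlongrightarrow> x powr \<beta>) at_top)"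

definition tail_const :: "real \<Rightarrow> (real \<Rightarrow> real) \<Rightarrow> real" where
  "tail_const \<gamma> F = Lim at_top (\<lambda>x. x powr (1 / \<gamma>) * (1 - F x))"

text \<open>
  \<open>tail_delta \<gamma> F\<close> and \<open>tail_a \<gamma> F\<close> are the functions \<open>\<delta>\<close> and \<open>a\<close>, obtained by solving
  their implicit defining equations; see \<open>tail_delta_eq\<close> and \<open>tail_a_eq\<close> below.
\<close>

definition tail_delta :: "real \<Rightarrow> (real \<Rightarrow> real) \<Rightarrow> real \<Rightarrow> real" where
  "tail_delta \<gamma> F x = \<gamma> * ((1 - F x) / (tail_const \<gamma> F * x powr (- 1 / \<gamma>)) - 1)"

definition heavy_tailed :: "real \<Rightarrow> real \<Rightarrow> (real \<Rightarrow> real) \<Rightarrow> bool" where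
  "heavy_tailed \<gamma> \<tau> F \<longleftrightarrow>
     (\<exists>P. real_distribution P \<and> F = cdf P) \<and>
     ((\<lambda>x. x powr (1 / \<gamma>) * (1 - F x)) \<longlongrightarrow> tail_const \<gamma> F) at_top \<and>
     0 < tail_const \<gamma> F \<and>
     ((\<forall>\<^sub>F x in at_top. tail_delta \<gamma> F x > 0) \<or> (\<forall>\<^sub>F x in at_top. tail_delta \<gamma> F x < 0)) \<and>
     regularly_varying \<tau> (\<lambda>x. \<bar>tail_delta \<gamma> F x\<bar>)"

definition quantile :: "(real \<Rightarrow> real) \<Rightarrow> real \<Rightarrow> real" where
  "quantile F p = Inf {x. F x \<ge> p}"

definition tail_quantile :: "(real \<Rightarrow> real) \<Rightarrow> real \<Rightarrow> real" where
  "tail_quantile F y = quantile F (1 - 1 / y)"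

definition tail_a :: "real \<Rightarrow> (real \<Rightarrow> real) \<Rightarrow> real \<Rightarrow> real" where
  "tail_a \<gamma> F y = tail_quantile F y / (tail_const \<gamma> F powr \<gamma> * y powr \<gamma>) - 1"

lemma tail_delta_eq:
  assumes "\<gamma> > 0" "heavy_tailed \<gamma> \<tau> F" "x > 0"
  shows "1 - F x = tail_const \<gamma> F * x powr (- 1 / \<gamma>) * (1 + tail_delta \<gamma> F x / \<gamma>)"
  using assms by (simp add: tail_delta_def heavy_tailed_def)

lemma tail_a_eq:
  assumes "heavy_tailed \<gamma> \<tau> F" "y > 1"
  shows "tail_quantile F y = tail_const \<gamma> F powr \<gamma> * y powr \<gamma> * (1 + tail_a \<gamma> F y)"
  using assms by (simp add: tail_a_def heavy_tailed_def)

section \<open>Order statistics and estimators\<close>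

text \<open>
  A sample \<open>x\<close> is indexed by \<open>{1..n}\<close>, and \<open>order_stat x n i\<close> is the \<open>i\<close>-th smallest of
  \<open>x 1, \<dots>, x n\<close>, for \<open>1 \<le> i \<le> n\<close>.
\<close>

definition order_stat :: "(nat \<Rightarrow> real) \<Rightarrow> nat \<Rightarrow> nat \<Rightarrow> real" where
  "order_stat x n i = sort (map x [1..<Suc n]) ! (i - 1)"

definition hill :: "(nat \<Rightarrow> real) \<Rightarrow> nat \<Rightarrow> nat \<Rightarrow> real" where
  "hill x k n = (\<Sum>i=1..k. ln (order_stat x n (n - k + i) / order_stat x n (n - k))) / real k"

definition excess_moment :: "(nat \<Rightarrow> real) \<Rightarrow> nat \<Rightarrow> nat \<Rightarrow> real \<Rightarrow> real" where
  "excess_moment x k n s =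
     (\<Sum>i=1..k. (order_stat x n (n - k + i) / order_stat x n (n - k)) powr s) / real k"

text \<open>The argument \<open>r\<close> is the value of the estimator of \<open>\<rho>\<close>.\<close>

definition delta_est :: "(nat \<Rightarrow> real) \<Rightarrow> nat \<Rightarrow> nat \<Rightarrow> real \<Rightarrow> real" where
  "delta_est x k n r =
     hill x k n * (1 - 2 * r) * (1 - r) ^ 3 / r ^ 4 *
       (excess_moment x k n (r / hill x k n) - 1 / (1 - r))"

definition gamma_est :: "(nat \<Rightarrow> real) \<Rightarrow> nat \<Rightarrow> nat \<Rightarrow> real \<Rightarrow> real" where
  "gamma_est x k n r = hill x k n - delta_est x k n r * (r / (1 - r))"

text \<open>Outside this event the estimators may take arbitrary values.\<close>

definition est_defined :: "(nat \<Rightarrow> real) \<Rightarrow> nat \<Rightarrow> nat \<Rightarrow> real \<Rightarrow> bool" where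
  "est_defined x k n r \<longleftrightarrow> order_stat x n (n - k) > 0 \<and> hill x k n > 0 \<and> r < 0"

definition tail_count_dev :: "(real \<Rightarrow> real) \<Rightarrow> (nat \<Rightarrow> real) \<Rightarrow> nat \<Rightarrow> nat \<Rightarrow> real" where
  "tail_count_dev F x k n =
     sqrt (real k) * (real n * (1 - F (order_stat x n (n - k))) / real k - 1)"

definition limit_cov :: "real \<Rightarrow> real \<Rightarrow> real ^ 3 ^ 3" where
  "limit_cov \<gamma> \<rho> = vector
     [vector [\<gamma>\<^sup>2 * ((1 - \<rho>)\<^sup>2 / \<rho>\<^sup>2), - \<gamma>\<^sup>2 * ((1 - 2 * \<rho>) * (1 - \<rho>) / \<rho> ^ 3), 0],
      vector [- \<gamma>\<^sup>2 * ((1 - 2 * \<rho>) * (1 - \<rho>) / \<rho> ^ 3), \<gamma>\<^sup>2 * ((1 - 2 * \<rho>) * (1 - \<rho>)\<^sup>2 / \<rho> ^ 4), 0],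
      vector [0, 0, 1]]"

lemma det_limit_cov:
  assumes "\<rho> \<noteq> 0"
  shows "det (limit_cov \<gamma> \<rho>) = \<gamma> ^ 4 * (1 - 2 * \<rho>) * (1 - \<rho>)\<^sup>2 / \<rho> ^ 4"
  using assms
  by (simp add: limit_cov_def det_3 vector_3 field_simps) algebra

end

theory Submission
  imports Defs
begin

text \<open>
  The three statistics are, up to terms that vanish in probability, linear statistics of
  the observations above a deterministic threshold; a central limit theorem for triangular
  arrays then gives the limit.

  Let \<open>t\<close> be the level at which the leading term of the survival function equals \<open>k/n\<close>, and
  let \<open>G x\<close> be the tail empirical process on the log scale: \<open>sqrt k\<close> times the difference
  between the number of observations above \<open>t * exp x\<close>, divided by \<open>k\<close>, and \<open>exp (- x / \<gamma>)\<close>.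
  Its mean is of the exact order of the second-order term \<open>\<delta>\<close>; the hypothesis on \<open>a\<close> amounts
  to \<open>sqrt k * \<delta> t\<close> tending to \<open>lam\<close> (\<open>delta_t\<close>). With \<open>P = G 0\<close>, \<open>Q\<close> the integral of \<open>G\<close> over
  \<open>{0..}\<close>, and \<open>D r\<close> the integral of \<open>r * exp (r * x)\<close> times \<open>G\<close>, four facts carry the proof.

  (1) The random threshold \<open>u\<close>, the order statistic, lies above a level exactly when more than \<open>k\<close>
  observations do. Since the increments of \<open>G\<close> over shrinking distances vanish, \<open>sqrt k * ln (u / t)\<close>
  equals \<open>\<gamma> * P\<close> up to a vanishing term (\<open>bahadur\<close>).

  (2) Changing the threshold from \<open>t\<close> to \<open>u\<close> in a sum of log excesses or of power excesses has
  an explicit effect, up to an error bounded pathwise by the deviation of the exceedance count from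
  \<open>k\<close> (\<open>log_excess_threshold_change\<close>, \<open>power_excess_threshold_change\<close>). Hence \<open>sqrt k * (H - \<gamma>)\<close> is
  close to \<open>Q - \<gamma> * P\<close>.

  (3) The exponent at which the power moment is evaluated is random and is only known to be consistent.
  This is harmless because \<open>D r\<close> is Lipschitz in \<open>r\<close> with a constant, the integral of the
  absolute value of \<open>G\<close>, that is bounded in probability (\<open>power_process_lipschitz\<close>, \<open>R_Op\<close>).

  (4) By (1)-(3) every linear combination of the three statistics is one linear statistic with test
  function \<open>al + be * x + ka * (exp (\<tau> * x) - 1)\<close> plus a constant. Its characteristic function
  converges to that of a normal law (\<open>lin_char\<close>), whose mean cancels the constant and whose variance is
  the quadratic form of the covariance matrix (\<open>limit_variance_identity\<close>).

  Convergence of the characteristic functions together with tightness yields convergence in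
  distribution (\<open>converges_in_distribution_char\<close>). The means in (4) need dominated convergence for
  \<open>\<delta> (t * exp x) / \<delta> t\<close> over all \<open>x \<ge> 0\<close>; the bound is of Potter type and comes from the
  uniform convergence theorem for regularly varying functions (\<open>regularly_varying_ln_uniform\<close>).
\<close>

section \<open>Characteristic functions and convergence in distribution\<close>

text \<open>
  The integral of such a function against a law is a linear combination of values of
  the characteristic function of that law.
\<close>

inductive trig_poly :: "('a::euclidean_space \<Rightarrow> real) \<Rightarrow> bool" where
  trig_cos: "trig_poly (\<lambda>y. cos (\<theta> \<bullet> y))"
| trig_sin: "trig_poly (\<lambda>y. sin (\<theta> \<bullet> y))"
| trig_add: "trig_poly p \<Longrightarrow> trig_poly q \<Longrightarrow> trig_poly (\<lambda>y. p y + q y)"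
| trig_scale: "trig_poly p \<Longrightarrow> trig_poly (\<lambda>y. c * p y)"

lemma trig_poly_const: "trig_poly (\<lambda>y. c)"
  using trig_scale[OF trig_cos[of 0], of c] by simp

lemma trig_poly_cos_mult: "trig_poly q \<Longrightarrow> trig_poly (\<lambda>y. cos (\<theta> \<bullet> y) * q y)"
proof (induction rule: trig_poly.induct)
  case (trig_cos \<eta>)
  have "(\<lambda>y. cos (\<theta> \<bullet> y) * cos (\<eta> \<bullet> y)) =
     (\<lambda>y. (1/2) * (cos ((\<theta> - \<eta>) \<bullet> y) + cos ((\<theta> + \<eta>) \<bullet> y)))"
    by (simp add: cos_times_cos inner_diff_left inner_add_left)
  then show ?case by (metis trig_poly.intros)
next
  case (trig_sin \<eta>)
  have "(\<lambda>y. cos (\<theta> \<bullet> y) * sin (\<eta> \<bullet> y)) =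
     (\<lambda>y. (1/2) * (sin ((\<theta> + \<eta>) \<bullet> y) + (-1) * sin ((\<theta> - \<eta>) \<bullet> y)))"
    by (simp add: cos_times_sin inner_diff_left inner_add_left)
  then show ?case by (metis trig_poly.intros)
next
  case (trig_add p q)
  then show ?case using trig_poly.trig_add by (simp add: algebra_simps) 
next
  case (trig_scale p c)
  show ?case using trig_poly.trig_scale[OF trig_scale.IH, of c] by (simp add: algebra_simps)
qed

lemma trig_poly_sin_mult: "trig_poly q \<Longrightarrow> trig_poly (\<lambda>y. sin (\<theta> \<bullet> y) * q y)"
proof (induction rule: trig_poly.induct)
  case (trig_cos \<eta>)
  show ?case using trig_poly_cos_mult[OF trig_poly.trig_sin[of \<theta>], of \<eta>] by (simp add: mult.commute)
next
  case (trig_sin \<eta>)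
  have "(\<lambda>y. sin (\<theta> \<bullet> y) * sin (\<eta> \<bullet> y)) =
     (\<lambda>y. (1/2) * (cos ((\<theta> - \<eta>) \<bullet> y) + (-1) * cos ((\<theta> + \<eta>) \<bullet> y)))"
    by (simp add: sin_times_sin inner_diff_left inner_add_left)
  then show ?case by (metis trig_poly.intros)
next
  case (trig_add p q)
  then show ?case using trig_poly.trig_add by (simp add: algebra_simps) 
next
  case (trig_scale p c)
  show ?case using trig_poly.trig_scale[OF trig_scale.IH, of c] by (simp add: algebra_simps)
qed

text \<open>
  The addition theorems make the trigonometric polynomials an algebra.
\<close>

lemma trig_poly_mult: "trig_poly p \<Longrightarrow> trig_poly q \<Longrightarrow> trig_poly (\<lambda>y. p y * q y)"
proof (induction rule: trig_poly.induct)
  case (trig_add p p')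
  then show ?case using trig_poly.trig_add by (simp add: algebra_simps)
next
  case (trig_scale p c)
  show ?case using trig_poly.trig_scale[OF trig_scale.IH, of c] trig_scale.prems by (simp add: algebra_simps)
qed (use trig_poly_cos_mult trig_poly_sin_mult in auto)

lemma trig_poly_sum: "finite A \<Longrightarrow> (\<And>i. i \<in> A \<Longrightarrow> trig_poly (p i)) \<Longrightarrow> trig_poly (\<lambda>y. \<Sum>i\<in>A. p i y)"
  by (induction A rule: finite_induct) (auto intro: trig_poly_const trig_add)

lemma continuous_trig_poly: "trig_poly p \<Longrightarrow> continuous_on UNIV p"
  by (induction rule: trig_poly.induct) (auto intro!: continuous_intros)

text \<open>
  Each coordinate is wrapped around a circle of circumference \<open>2 * pi * R\<close>. Polynomials on the
  bounded image are trigonometric polynomials in \<open>y\<close>, which opens the way to the Weierstrass theorem.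
\<close>

definition torus_map :: "real \<Rightarrow> 'a::euclidean_space \<Rightarrow> 'a \<times> 'a" where
  "torus_map R y = ((\<Sum>b\<in>Basis. cos ((y \<bullet> b) / R) *\<^sub>R b), (\<Sum>b\<in>Basis. sin ((y \<bullet> b) / R) *\<^sub>R b))"

lemma trig_poly_polynomial_torus_map:
  fixes g :: "'a::euclidean_space \<times> 'a \<Rightarrow> real"
  shows "real_polynomial_function g \<Longrightarrow> trig_poly (\<lambda>y. g (torus_map R y))"
proof (induction rule: real_polynomial_function.induct)
  case (linear f)
  have eq: "f (torus_map R y) = (\<Sum>b\<in>Basis. f (b, 0) * cos ((b /\<^sub>R R) \<bullet> y) + f (0, b) * sin ((b /\<^sub>R R) \<bullet> y))" for y
  proof -
    have "torus_map R y = (\<Sum>b\<in>Basis. cos ((y \<bullet> b) / R) *\<^sub>R (b, 0) + sin ((y \<bullet> b) / R) *\<^sub>R (0, b))"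
      by (simp add: torus_map_def prod_eq_iff fst_sum snd_sum)
    then have "f (torus_map R y) = (\<Sum>b\<in>Basis. cos ((y \<bullet> b) / R) * f (b, 0) + sin ((y \<bullet> b) / R) * f (0, b))"
      using bounded_linear.linear[OF linear] by (simp only: linear_sum linear_add linear_scale) simp
    then show ?thesis
      by (simp add: inner_commute divide_inverse mult_ac)
  qed
  show ?case unfolding eq
    by (intro trig_poly_sum trig_add trig_scale trig_cos trig_sin) auto
next
  case (const c)
  then show ?case by (rule trig_poly_const)
next
  case (add f g)
  then show ?case by (intro trig_add)
next
  case (mult f g)
  then show ?case by (intro trig_poly_mult)
qed

text \<open>
  The function approximated on the torus is \<open>f\<close>, read off the sine coordinates and damped by the
  positive parts of the cosines. The damping removes the half of each circle on which the sine no
  longer determines the point, it never raises the supremum, and it is close to 1 on the given ball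
  when \<open>R\<close> is large. The bound on \<open>q\<close> off the ball lets tightness absorb what happens there.
\<close>

lemma trig_poly_approximation:
  fixes f :: "'a::euclidean_space \<Rightarrow> real"
  assumes f: "continuous_on UNIV f" and B: "\<And>y. \<bar>f y\<bar> \<le> B" and r: "r > 0" and e: "e > 0"
  shows "\<exists>q. trig_poly q \<and> (\<forall>y. \<bar>q y\<bar> \<le> B + e) \<and> (\<forall>y. norm y \<le> r \<longrightarrow> \<bar>f y - q y\<bar> \<le> e)"
proof -
  have B0: "B \<ge> 0" using B[of undefined] by linarith
  have lim: "((\<lambda>R. cos (r / R) ^ DIM('a)) \<longlongrightarrow> cos 0 ^ DIM('a)) at_top"
    by (intro tendsto_intros tendsto_divide_0[OF tendsto_const] filterlim_at_top_imp_at_infinity filterlim_ident)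
  have "\<forall>\<^sub>F R in at_top. dist (cos (r / R) ^ DIM('a)) 1 < e / (2 * (B + 1))"
    using tendstoD[OF lim, of "e / (2 * (B + 1))"] e B0 by simp
  then have "\<forall>\<^sub>F R in at_top. dist (cos (r / R) ^ DIM('a)) 1 < e / (2 * (B + 1)) \<and> R > r"
    using eventually_gt_at_top[of r] by (rule eventually_conj)
  then obtain R where R: "dist (cos (r / R) ^ DIM('a)) 1 < e / (2 * (B + 1))" "R > r"
    using eventually_happens' [of at_top] by (metis (mono_tags, lifting) trivial_limit_at_top_linorder)
  have R0: "R > 0" using R r by simp
  define h :: "'a \<times> 'a \<Rightarrow> real" where
    "h = (\<lambda>x. f (\<Sum>b\<in>Basis. (R * arcsin (snd x \<bullet> b)) *\<^sub>R b) * (\<Prod>b\<in>Basis. max 0 (fst x \<bullet> b)))"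
  let ?S = "cbox (- One :: 'a) One \<times> cbox (- One :: 'a) One"
  have inS: "torus_map R y \<in> ?S" for y
    by (auto simp: torus_map_def mem_box)
  have conth: "continuous_on ?S h"
    unfolding h_def
    by (intro continuous_intros continuous_on_compose2[OF f]) (auto simp: mem_box)
  have "\<exists>g. real_polynomial_function g \<and> (\<forall>x\<in>?S. \<bar>h x - g x\<bar> < e / 2)"
    using Stone_Weierstrass_real_polynomial_function[OF compact_Times conth, of "e/2"] e
    by (metis compact_cbox half_gt_zero)
  then obtain g where g: "real_polynomial_function g" "\<And>x. x \<in> ?S \<Longrightarrow> \<bar>h x - g x\<bar> < e / 2" by blast
  let ?q = "\<lambda>y. g (torus_map R y)"
  have prod1: "0 \<le> (\<Prod>b\<in>Basis. max 0 (c \<bullet> b)) \<and> (\<Prod>b\<in>Basis. max 0 (c \<bullet> b)) \<le> 1"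
    if "c \<in> cbox (- One) One" for c :: 'a
    using that by (auto simp: mem_box intro!: prod_nonneg prod_le_1)
  have hB: "\<bar>h x\<bar> \<le> B" if "x \<in> ?S" for x
  proof -
    have "fst x \<in> cbox (- One) One" using that by (cases x) auto
    from prod1[OF this] B show ?thesis unfolding h_def abs_mult
      by (smt (verit, best) mult_left_le mult_mono B0)
  qed
  have main: "\<bar>f y - h (torus_map R y)\<bar> \<le> e / 2" if y: "norm y \<le> r" for y
  proof -
    have yb: "\<bar>y \<bullet> b\<bar> \<le> r" if "b \<in> Basis" for b
      using y Basis_le_norm[OF that, of y] by linarith
    have q1: "\<bar>(y \<bullet> b) / R\<bar> \<le> r / R" if "b \<in> Basis" for b
      using yb[OF that] R0 by (simp add: divide_right_mono)
    have q2: "r / R < 1" using R R0 by simp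
    have pi: "pi / 2 > 1" using pi_gt3 by simp
    have a1: "R * arcsin (sin ((y \<bullet> b) / R)) = y \<bullet> b" if "b \<in> Basis" for b
    proof -
      have "\<bar>(y \<bullet> b) / R\<bar> \<le> pi / 2" using q1[OF that] q2 pi by linarith
      then show ?thesis using R0 by (subst arcsin_sin) (auto simp: abs_le_iff simp del: abs_divide)
    qed
    have a2: "cos (r / R) \<le> cos ((y \<bullet> b) / R)" if "b \<in> Basis" for b
    proof -
      have "cos (r / R) \<le> cos \<bar>(y \<bullet> b) / R\<bar>"
        using q1[OF that] q2 pi by (intro cos_monotone_0_pi_le) auto
      then show ?thesis by (simp only: cos_abs_real)
    qed
    have c0: "cos (r / R) > 0" using q2 pi divide_pos_pos[OF r R0] by (intro cos_gt_zero_pi) linarith+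
    let ?P = "\<Prod>b\<in>Basis. max 0 (cos ((y \<bullet> b) / R))"
    have "(\<Prod>b\<in>(Basis::'a set). cos (r / R)) \<le> ?P"
      using a2 c0 by (intro prod_mono) (auto simp: le_max_iff_disj)
    then have P1: "?P \<ge> cos (r / R) ^ DIM('a)" by simp
    have P2: "?P \<le> 1" by (auto intro!: prod_le_1)
    have "(\<Sum>b\<in>Basis. (R * arcsin (snd (torus_map R y) \<bullet> b)) *\<^sub>R b) = (\<Sum>b\<in>Basis. (y \<bullet> b) *\<^sub>R b)"
      using a1 by (intro sum.cong) (auto simp: torus_map_def)
    then have "h (torus_map R y) = f y * ?P"
      unfolding h_def by (simp add: euclidean_representation) (simp add: torus_map_def)
    then have "\<bar>f y - h (torus_map R y)\<bar> = \<bar>f y\<bar> * (1 - ?P)"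
      using P2 by (simp add: right_diff_distrib[of "f y" 1, simplified, symmetric] abs_mult)
    also have "\<dots> \<le> (B + 1) * (e / (2 * (B + 1)))"
      using B[of y] B0 P1 P2 R by (intro mult_mono) (auto simp: dist_real_def)
    also have "\<dots> = e / 2" using B0 by (simp add: field_simps)
    finally show ?thesis .
  qed
  show ?thesis
  proof (intro exI[of _ ?q] conjI allI impI)
    show "trig_poly ?q" by (rule trig_poly_polynomial_torus_map[OF g(1)])
    fix y show "\<bar>?q y\<bar> \<le> B + e" using hB[OF inS[of y]] g(2)[OF inS[of y]] e by linarith
    assume "norm y \<le> r"
    then show "\<bar>f y - ?q y\<bar> \<le> e" using main[of y] g(2)[OF inS[of y]] by linarith
  qed
qed


lemma trig_poly_integral_tendsto:
  fixes Y :: "nat \<Rightarrow> 'a \<Rightarrow> 'b::euclidean_space"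
  assumes M: "\<And>n. prob_space (M n)" and N: "prob_space N" "sets N = sets borel"
    and Y: "\<forall>\<^sub>F n in sequentially. Y n \<in> borel_measurable (M n)"
    and ch: "\<And>\<theta>. (\<lambda>n. \<integral>\<omega>. iexp (\<theta> \<bullet> Y n \<omega>) \<partial>M n) \<longlonglongrightarrow> (\<integral>y. iexp (\<theta> \<bullet> y) \<partial>N)"
    and q: "trig_poly q"
  shows "(\<lambda>n. \<integral>\<omega>. q (Y n \<omega>) \<partial>M n) \<longlonglongrightarrow> (\<integral>y. q y \<partial>N) \<and>
    (\<forall>\<^sub>F n in sequentially. integrable (M n) (\<lambda>\<omega>. q (Y n \<omega>))) \<and> integrable N q"
proof -
  note [measurable_cong] = N(2)
  interpret N: prob_space N by (rule N)
  have fin: "finite_measure (M n)" for n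
    using M[of n] by (simp add: prob_space_def)
  have e: "\<forall>\<^sub>F n in sequentially. integrable (M n) (\<lambda>\<omega>. iexp (\<theta> \<bullet> Y n \<omega>))" for \<theta>
    using Y
  proof eventually_elim
    case (elim n)
    note elim[measurable]
    show ?case by (rule finite_measure.integrable_const_bound[OF fin, of _ 1]) auto
  qed
  have eN: "integrable N (\<lambda>y. iexp (\<theta> \<bullet> y))" for \<theta>
    by (rule N.integrable_const_bound[of _ 1]) auto
  show ?thesis using q
  proof (induction rule: trig_poly.induct)
    case (trig_cos \<theta>)
    have "(\<lambda>n. Re (\<integral>\<omega>. iexp (\<theta> \<bullet> Y n \<omega>) \<partial>M n)) \<longlonglongrightarrow> Re (\<integral>y. iexp (\<theta> \<bullet> y) \<partial>N)"
      by (intro tendsto_intros ch)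
    moreover have "\<forall>\<^sub>F n in sequentially. Re (\<integral>\<omega>. iexp (\<theta> \<bullet> Y n \<omega>) \<partial>M n) = (\<integral>\<omega>. cos (\<theta> \<bullet> Y n \<omega>) \<partial>M n)"
      using e[of \<theta>] by eventually_elim (subst integral_Re[symmetric], auto simp: Re_exp)
    moreover have "Re (\<integral>y. iexp (\<theta> \<bullet> y) \<partial>N) = (\<integral>y. cos (\<theta> \<bullet> y) \<partial>N)"
      using eN[of \<theta>] by (subst integral_Re[symmetric]) (auto simp: Re_exp)
    moreover have "\<forall>\<^sub>F n in sequentially. integrable (M n) (\<lambda>\<omega>. cos (\<theta> \<bullet> Y n \<omega>))"
      using e[of \<theta>] by eventually_elim (drule integrable_Re, auto simp: Re_exp)
    moreover have "integrable N (\<lambda>y. cos (\<theta> \<bullet> y))"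
      using integrable_Re[OF eN[of \<theta>]] by (auto simp: Re_exp)
    ultimately show ?case by (simp add: tendsto_cong)
  next
    case (trig_sin \<theta>)
    have "(\<lambda>n. Im (\<integral>\<omega>. iexp (\<theta> \<bullet> Y n \<omega>) \<partial>M n)) \<longlonglongrightarrow> Im (\<integral>y. iexp (\<theta> \<bullet> y) \<partial>N)"
      by (intro tendsto_intros ch)
    moreover have "\<forall>\<^sub>F n in sequentially. Im (\<integral>\<omega>. iexp (\<theta> \<bullet> Y n \<omega>) \<partial>M n) = (\<integral>\<omega>. sin (\<theta> \<bullet> Y n \<omega>) \<partial>M n)"
      using e[of \<theta>] by eventually_elim (subst integral_Im[symmetric], auto simp: Im_exp)
    moreover have "Im (\<integral>y. iexp (\<theta> \<bullet> y) \<partial>N) = (\<integral>y. sin (\<theta> \<bullet> y) \<partial>N)"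
      using eN[of \<theta>] by (subst integral_Im[symmetric]) (auto simp: Im_exp)
    moreover have "\<forall>\<^sub>F n in sequentially. integrable (M n) (\<lambda>\<omega>. sin (\<theta> \<bullet> Y n \<omega>))"
      using e[of \<theta>] by eventually_elim (drule integrable_Im, auto simp: Im_exp)
    moreover have "integrable N (\<lambda>y. sin (\<theta> \<bullet> y))"
      using integrable_Im[OF eN[of \<theta>]] by (auto simp: Im_exp)
    ultimately show ?case by (simp add: tendsto_cong)
  next
    case (trig_add p q)
    have ev: "\<forall>\<^sub>F n in sequentially. integrable (M n) (\<lambda>\<omega>. p (Y n \<omega>)) \<and> integrable (M n) (\<lambda>\<omega>. q (Y n \<omega>))"
      using trig_add.IH by (auto intro: eventually_conj)
    have "\<forall>\<^sub>F n in sequentially. (\<integral>\<omega>. p (Y n \<omega>) \<partial>M n) + (\<integral>\<omega>. q (Y n \<omega>) \<partial>M n) = (\<integral>\<omega>. p (Y n \<omega>) + q (Y n \<omega>) \<partial>M n)"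
      using ev by eventually_elim simp
    moreover have "(\<lambda>n. (\<integral>\<omega>. p (Y n \<omega>) \<partial>M n) + (\<integral>\<omega>. q (Y n \<omega>) \<partial>M n)) \<longlonglongrightarrow> (\<integral>y. p y \<partial>N) + (\<integral>y. q y \<partial>N)"
      using trig_add.IH by (intro tendsto_add) auto
    moreover have "\<forall>\<^sub>F n in sequentially. integrable (M n) (\<lambda>\<omega>. p (Y n \<omega>) + q (Y n \<omega>))"
      using ev by eventually_elim simp
    ultimately show ?case using trig_add.IH by (simp add: tendsto_cong)
  next
    case (trig_scale p c)
    then have "(\<lambda>n. c * (\<integral>\<omega>. p (Y n \<omega>) \<partial>M n)) \<longlonglongrightarrow> c * (\<integral>y. p y \<partial>N)" by (intro tendsto_intros) auto
    moreover have "\<forall>\<^sub>F n in sequentially. integrable (M n) (\<lambda>\<omega>. c * p (Y n \<omega>))"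
      using trig_scale.IH by (auto elim: eventually_mono)
    ultimately show ?case using trig_scale.IH by auto
  qed
qed

text \<open>
  Continuity theorem in several dimensions, for tight sequences: a bounded continuous function
  is replaced by a trigonometric polynomial that is close to it on a large ball and bounded outside.
\<close>

theorem converges_in_distribution_char:
  fixes Y :: "nat \<Rightarrow> 'a \<Rightarrow> 'b::euclidean_space"
  assumes M: "\<And>n. prob_space (M n)" and N: "prob_space N" "sets N = sets borel"
    and Y: "\<forall>\<^sub>F n in sequentially. Y n \<in> borel_measurable (M n)"
    and tight: "\<And>\<eta>. \<eta> > 0 \<Longrightarrow> \<exists>B. \<forall>\<^sub>F n in sequentially. measure (M n) {\<omega> \<in> space (M n). norm (Y n \<omega>) > B} \<le> \<eta>"
    and ch: "\<And>\<theta>. (\<lambda>n. \<integral>\<omega>. iexp (\<theta> \<bullet> Y n \<omega>) \<partial>M n) \<longlonglongrightarrow> (\<integral>y. iexp (\<theta> \<bullet> y) \<partial>N)"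
  shows "converges_in_distribution M Y N"
  unfolding converges_in_distribution_def
proof (intro conjI allI impI)
  show "\<forall>\<^sub>F n in sequentially. Y n \<in> borel_measurable (M n)" by (rule Y)
  fix f :: "'b \<Rightarrow> real" assume f: "continuous_on UNIV f \<and> bounded (range f)"
  note [measurable_cong] = N(2)
  interpret N: prob_space N by (rule N)
  have fm[measurable]: "f \<in> borel_measurable borel" using f by (auto intro: borel_measurable_continuous_onI)
  from f obtain B where B: "\<bar>f y\<bar> \<le> B" for y
    unfolding bounded_iff by auto
  have B0: "B \<ge> 0" using B[of undefined] by linarith
  have dev: "\<bar>(\<integral>\<omega>. f (Z \<omega>) \<partial>Q) - (\<integral>\<omega>. q (Z \<omega>) \<partial>Q)\<bar> \<le> e + (2 * B + e) * measure Q {\<omega> \<in> space Q. norm (Z \<omega>) > r}"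
    if Q: "prob_space Q" and Z[measurable]: "Z \<in> borel_measurable Q" and e: "e > 0" and q: "trig_poly q"
      "\<And>y. \<bar>q y\<bar> \<le> B + e" "\<And>y. norm y \<le> r \<Longrightarrow> \<bar>f y - q y\<bar> \<le> e" for Q :: "'c measure" and Z :: "'c \<Rightarrow> 'b" and e q r
  proof -
    interpret Q: prob_space Q by (rule Q)
    have qm[measurable]: "q \<in> borel_measurable borel" using continuous_trig_poly[OF q(1)] by (rule borel_measurable_continuous_onI)
    have i1: "integrable Q (\<lambda>\<omega>. f (Z \<omega>))" using B by (intro Q.integrable_const_bound[of _ B]) auto
    have i2: "integrable Q (\<lambda>\<omega>. q (Z \<omega>))" using q(2) by (intro Q.integrable_const_bound[of _ "B + e"]) auto
    let ?A = "{\<omega> \<in> space Q. norm (Z \<omega>) > r}"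
    have "\<bar>(\<integral>\<omega>. f (Z \<omega>) \<partial>Q) - (\<integral>\<omega>. q (Z \<omega>) \<partial>Q)\<bar> = \<bar>\<integral>\<omega>. f (Z \<omega>) - q (Z \<omega>) \<partial>Q\<bar>"
      using i1 i2 by simp
    also have "\<dots> \<le> (\<integral>\<omega>. \<bar>f (Z \<omega>) - q (Z \<omega>)\<bar> \<partial>Q)" using integral_norm_bound[of Q "\<lambda>\<omega>. f (Z \<omega>) - q (Z \<omega>)"] by simp
    also have "\<dots> \<le> (\<integral>\<omega>. e + (2 * B + e) * indicator ?A \<omega> \<partial>Q)"
    proof (rule integral_mono)
      fix \<omega> assume "\<omega> \<in> space Q"
      then show "\<bar>f (Z \<omega>) - q (Z \<omega>)\<bar> \<le> e + (2 * B + e) * indicator ?A \<omega>"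
        using q(3)[of "Z \<omega>"] q(2)[of "Z \<omega>"] B[of "Z \<omega>"] e by (auto simp: indicator_def)
    qed (use i1 i2 in \<open>auto intro!: integrable_real_indicator simp: Q.emeasure_eq_measure\<close>)
    also have "\<dots> = e + (2 * B + e) * measure Q ?A" by (simp add: Q.prob_space Q.emeasure_eq_measure)
    finally show ?thesis .
  qed
  show "(\<lambda>n. \<integral>\<omega>. f (Y n \<omega>) \<partial>M n) \<longlonglongrightarrow> (\<integral>y. f y \<partial>N)"
  proof (rule tendstoI)
    fix \<epsilon> :: real assume \<epsilon>: "\<epsilon> > 0"
    define e where "e = min 1 (\<epsilon> / 6)"
    define \<eta> where "\<eta> = \<epsilon> / (6 * (2 * B + 2))"
    have e: "e > 0" "e \<le> \<epsilon> / 6" "e \<le> 1" and \<eta>: "\<eta> > 0" using \<epsilon> B0 by (auto simp: e_def \<eta>_def)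
    obtain r1 where r1: "\<forall>\<^sub>F n in sequentially. measure (M n) {\<omega> \<in> space (M n). norm (Y n \<omega>) > r1} \<le> \<eta>"
      using tight[OF \<eta>] by blast
    have "(\<lambda>m. measure N {y \<in> space N. norm y > real m}) \<longlonglongrightarrow> measure N (\<Inter>m. {y \<in> space N. norm y > real m})"
      by (intro N.finite_Lim_measure_decseq) (auto simp: decseq_def)
    moreover have "(\<Inter>m. {y \<in> space N. norm y > real m}) = {}"
      by (auto dest: less_asym intro: reals_Archimedean2) (meson less_asym reals_Archimedean2)
    ultimately have "(\<lambda>m. measure N {y \<in> space N. norm y > real m}) \<longlonglongrightarrow> 0" by simp
    from order_tendstoD(2)[OF this \<eta>] obtain m where m: "measure N {y \<in> space N. norm y > real m} < \<eta>"
      by (auto simp: eventually_sequentially)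
    define r where "r = max 1 (max r1 (real m))"
    have r0: "r > 0" by (simp add: r_def)
    obtain q where q: "trig_poly q" "\<And>y. \<bar>q y\<bar> \<le> B + e" "\<And>y. norm y \<le> r \<Longrightarrow> \<bar>f y - q y\<bar> \<le> e"
      using trig_poly_approximation[of f B r e, OF conjunct1[OF f] B r0 e(1)] by blast
    have small: "e + (2 * B + e) * x \<le> \<epsilon> / 3" if "0 \<le> x" "x \<le> \<eta>" for x
    proof -
      have "(2 * B + e) * x \<le> (2 * B + 2) * \<eta>" using that e B0 by (intro mult_mono) auto
      also have "\<dots> = \<epsilon> / 6" using B0 by (simp add: \<eta>_def field_simps)
      finally show ?thesis using e by simp
    qed
    have N3: "\<bar>(\<integral>y. f y \<partial>N) - (\<integral>y. q y \<partial>N)\<bar> \<le> \<epsilon> / 3"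
    proof -
      have "measure N {y \<in> space N. norm y > r} \<le> measure N {y \<in> space N. norm y > real m}"
        by (intro N.finite_measure_mono) (auto simp: r_def)
      then have "e + (2 * B + e) * measure N {y \<in> space N. norm y > r} \<le> \<epsilon> / 3"
        using small m by simp
      moreover have "\<bar>(\<integral>y. f y \<partial>N) - (\<integral>y. q y \<partial>N)\<bar> \<le> e + (2 * B + e) * measure N {y \<in> space N. norm y > r}"
        by (rule dev[OF N(1) _ e(1) q]) auto
      ultimately show ?thesis by linarith
    qed
    have tq: "(\<lambda>n. \<integral>\<omega>. q (Y n \<omega>) \<partial>M n) \<longlonglongrightarrow> (\<integral>y. q y \<partial>N)"
      using trig_poly_integral_tendsto[OF M N Y ch q(1)] by blast
    have "\<forall>\<^sub>F n in sequentially. dist (\<integral>\<omega>. q (Y n \<omega>) \<partial>M n) (\<integral>y. q y \<partial>N) < \<epsilon> / 3"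
      using \<epsilon> by (intro tendstoD[OF tq]) simp
    with Y r1 show "\<forall>\<^sub>F n in sequentially. dist (\<integral>\<omega>. f (Y n \<omega>) \<partial>M n) (\<integral>y. f y \<partial>N) < \<epsilon>"
    proof eventually_elim
      case (elim n)
      interpret Mn: prob_space "M n" by (rule M)
      have "measure (M n) {y \<in> space (M n). norm (Y n y) > r} \<le> measure (M n) {\<omega> \<in> space (M n). norm (Y n \<omega>) > r1}"
        using elim(1) by (intro Mn.finite_measure_mono) (auto simp: r_def)
      then have "\<bar>(\<integral>\<omega>. f (Y n \<omega>) \<partial>M n) - (\<integral>\<omega>. q (Y n \<omega>) \<partial>M n)\<bar> \<le> \<epsilon> / 3"
        using dev[OF M elim(1) e(1) q] small[of "measure (M n) {y \<in> space (M n). norm (Y n y) > r}"] elim(2)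
        by fastforce
      then show ?case using elim(3) N3 unfolding dist_real_def by linarith
    qed
  qed
qed

section \<open>The limiting normal law\<close>

lemma inner_vec3: "(x :: real^3) \<bullet> y = x$1 * y$1 + x$2 * y$2 + x$3 * y$3"
  by (simp add: inner_vec_def sum_3)

lemma borel_measurable_vector3 [measurable]:
  fixes f g h :: "'a \<Rightarrow> real"
  assumes [measurable]: "f \<in> borel_measurable M" "g \<in> borel_measurable M" "h \<in> borel_measurable M"
  shows "(\<lambda>x. vector [f x, g x, h x] :: real^3) \<in> borel_measurable M"
proof (subst borel_measurable_iff_halfspace_less, safe)
  fix i :: "real^3" and a :: real assume "i \<in> Basis"
  then obtain j where j: "i = axis j 1" by (auto simp: Basis_vec_def)
  have "\<forall>j::3. j = 1 \<or> j = 2 \<or> j = 3" by (metis exhaust_3)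
  then consider "j = 1" | "j = 2" | "j = 3" by blast
  then show "{w \<in> space M. (vector [f w, g w, h w] :: real^3) \<bullet> i < a} \<in> sets M"
    by cases (simp_all add: j inner_axis vector_3)
qed

lemma prod_Basis_vec3: "(\<Prod>b\<in>Basis. (x :: real^3) \<bullet> b) = x$1 * x$2 * x$3"
proof -
    have Bv: "(Basis :: (real^3) set) = range (\<lambda>i. axis i 1)" by (auto simp: Basis_vec_def)
    have inj: "inj (\<lambda>i. axis i 1 :: real^3)" by (auto simp: inj_on_def axis_eq_axis)
    have "(\<Prod>b\<in>Basis. x \<bullet> b) = (\<Prod>i\<in>UNIV. x \<bullet> axis i 1)"
      unfolding Bv by (subst prod.reindex[OF inj]) (simp only: o_def)
    also have "\<dots> = (\<Prod>i\<in>UNIV. x $ i)" by (simp add: inner_axis)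
    also have "\<dots> = x$1 * x$2 * x$3" unfolding UNIV_3 by (simp add: ac_simps)
    finally show ?thesis .
qed
text \<open>
  Turns integrals over the cartesian space into integrals over a product, to which Fubini applies.
\<close>

lemma lborel_vector3:
  "distr (lborel :: (real \<times> real \<times> real) measure) borel (\<lambda>(a, b, d). vector [a, b, d] :: real^3) = lborel"
proof (rule lborel_eqI[symmetric])
  fix l u :: "real^3" assume lu: "\<And>b. b \<in> Basis \<Longrightarrow> l \<bullet> b \<le> u \<bullet> b"
  have lu': "l $ i \<le> u $ i" for i
    using lu[of "axis i 1"] by (simp add: inner_axis axis_in_Basis_iff)
  have eq: "(\<lambda>(a, b, d). vector [a, b, d] :: real^3) -` box l u =
     box (l$1, l$2, l$3) (u$1, u$2, u$3)"
    by (auto simp: mem_box Basis_vec_def inner_axis forall_3 Basis_prod_def vector_3)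
  have "emeasure (distr (lborel :: (real \<times> real \<times> real) measure) borel (\<lambda>(a, b, d). vector [a, b, d] :: real^3)) (box l u)
     = emeasure (lborel :: (real \<times> real \<times> real) measure) (box (l$1, l$2, l$3) (u$1, u$2, u$3))"
    proof (subst emeasure_distr)
    show "(\<lambda>(a, b, d). vector [a, b, d] :: real^3) \<in> measurable lborel borel"
      unfolding split_beta' lborel_prod[symmetric] by measurable
  qed (simp_all add: eq)
  also have "\<dots> = (u$1 - l$1) * (u$2 - l$2) * (u$3 - l$3)"
    using lu' by (subst emeasure_lborel_box)
      (auto simp: Basis_prod_def prod.union_disjoint prod.reindex inj_on_def mult_ac)
  also have "\<dots> = (\<Prod>b\<in>Basis. (u - l) \<bullet> b)"
    by (simp only: prod_Basis_vec3 vector_minus_component)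
  finally show "emeasure (distr (lborel :: (real \<times> real \<times> real) measure) borel (\<lambda>(a, b, d). vector [a, b, d] :: real^3)) (box l u) =
    ennreal (\<Prod>b\<in>Basis. (u - l) \<bullet> b)" .
qed simp

lemma matrix_inv_eqI:
  fixes A B :: "'a::field ^ 'n ^ 'n"
  assumes "A ** B = mat 1" "B ** A = mat 1"
  shows "matrix_inv A = B"
proof -
  have "A ** matrix_inv A = mat 1 \<and> matrix_inv A ** A = mat 1"
    unfolding matrix_inv_def by (rule someI[of _ B]) (use assms in simp)
  then show ?thesis
    using assms by (metis matrix_mul_assoc matrix_mul_lid matrix_mul_rid)
qed

abbreviation normal_law :: "real \<Rightarrow> real measure" where
  "normal_law s \<equiv> density lborel (normal_density 0 s)"

lemma char_normal_law:
  assumes "s > 0"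
  shows "char (normal_law s) t = of_real (exp (- (s * t)\<^sup>2 / 2))"
proof -
  interpret prob_space "std_normal_distribution" using prob_space_normal_density[of 1 0] by simp
  have "distributed std_normal_distribution lborel (\<lambda>x. x) (normal_density 0 1)"
    by (auto simp: distributed_def distr_id2)
  from normal_density_affine[OF this zero_less_one, of s 0] assms
  have "distributed std_normal_distribution lborel (\<lambda>x. s * x) (normal_density 0 s)" by simp
  then have "normal_law s = distr std_normal_distribution lborel (\<lambda>x. s * x)"
    by (auto simp: distributed_def)
  also have "\<dots> = distr std_normal_distribution borel (\<lambda>x. s * x)"
    by (rule distr_cong) auto
  finally have "char (normal_law s) t = (CLINT x|std_normal_distribution. iexp (t * (s * x)))"
    unfolding char_def by (simp add: integral_distr)
  also have "\<dots> = char std_normal_distribution (s * t)"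
    unfolding char_def by (simp add: mult_ac)
  finally show ?thesis by (simp add: char_std_normal_distribution)
qed

text \<open>
  Completing the square: the quadratic form of the inverse matrix is
  \<open>(x1 + c * x2)^2 / \<gamma>^2 + x2^2 / s^2 + x3^2\<close>, so the law is the image of three independent
  normal variables under a shear.
\<close>

lemma mv_normal_limit_cov_eq_distr:
  fixes \<gamma> \<rho> :: real
  assumes g: "\<gamma> > 0" and r: "\<rho> < 0"
  defines "c \<equiv> \<rho> / (1 - \<rho>)" and "s \<equiv> \<gamma> * sqrt (1 - 2 * \<rho>) * (1 - \<rho>) / \<rho>\<^sup>2"
  shows "mv_normal 0 (limit_cov \<gamma> \<rho>) =
     distr (normal_law \<gamma> \<Otimes>\<^sub>M (normal_law s \<Otimes>\<^sub>M normal_law 1)) borel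
       (\<lambda>(a, b, d). vector [a - c * b, b, d])"
proof -
  have s0: "s > 0" using g r by (simp add: s_def)
  have s2: "s\<^sup>2 = \<gamma>\<^sup>2 * ((1 - 2 * \<rho>) * (1 - \<rho>)\<^sup>2 / \<rho> ^ 4)"
    using r by (simp add: s_def power_mult_distrib power_divide real_sqrt_pow2 flip: power_mult)
  have cs: "c * s\<^sup>2 = \<gamma>\<^sup>2 * ((1 - 2 * \<rho>) * (1 - \<rho>) / \<rho> ^ 3)"
    using r g by (simp add: s2 c_def divide_simps) (simp add: power2_eq_square power3_eq_cube power4_eq_xxxx)
  have ccs: "\<gamma>\<^sup>2 + c\<^sup>2 * s\<^sup>2 = \<gamma>\<^sup>2 * ((1 - \<rho>)\<^sup>2 / \<rho>\<^sup>2)"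
    using r g by (simp add: s2 c_def divide_simps) (simp add: power2_eq_square power3_eq_cube power4_eq_xxxx algebra_simps)
  have S: "limit_cov \<gamma> \<rho> = vector [vector [\<gamma>\<^sup>2 + c\<^sup>2 * s\<^sup>2, - (c * s\<^sup>2), 0], vector [- (c * s\<^sup>2), s\<^sup>2, 0], vector [0,0,1]]"
    unfolding ccs cs unfolding s2 limit_cov_def by simp
  let ?B = "vector [vector [1 / \<gamma>\<^sup>2, c / \<gamma>\<^sup>2, 0], vector [c / \<gamma>\<^sup>2, c\<^sup>2 / \<gamma>\<^sup>2 + 1 / s\<^sup>2, 0], vector [0,0,1]] :: real^3^3"
  have inv: "matrix_inv (limit_cov \<gamma> \<rho>) = ?B"
    using g s0 unfolding S
    by (intro matrix_inv_eqI)
       (simp_all add: vec_eq_iff matrix_matrix_mult_def forall_3 sum_3 vector_3 mat_def field_simps power2_eq_square)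
  have det: "det (limit_cov \<gamma> \<rho>) = \<gamma>\<^sup>2 * s\<^sup>2"
    unfolding S by (simp add: det_3 vector_3 algebra_simps power2_eq_square)
  let ?q = "\<lambda>x::real^3. (x$1 + c * x$2)\<^sup>2 / \<gamma>\<^sup>2 + (x$2)\<^sup>2 / s\<^sup>2 + (x$3)\<^sup>2"
  have q: "x \<bullet> (?B *v x) = ?q x" for x
    using g s0 by (simp add: inner_vec3 matrix_vector_mult_def sum_3 vector_3 field_simps power2_eq_square)
  have dens: "exp (- (x \<bullet> (matrix_inv (limit_cov \<gamma> \<rho>) *v x)) / 2) / sqrt ((2 * pi) ^ CARD(3) * det (limit_cov \<gamma> \<rho>))
     = normal_density 0 \<gamma> (x$1 + c * x$2) * (normal_density 0 s (x$2) * normal_density 0 1 (x$3))" for x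
  proof -
    have e: "exp (- (x \<bullet> (matrix_inv (limit_cov \<gamma> \<rho>) *v x)) / 2) =
      exp (- (x$1 + c * x$2)\<^sup>2 / (2 * \<gamma>\<^sup>2)) * (exp (- (x$2)\<^sup>2 / (2 * s\<^sup>2)) * exp (- (x$3)\<^sup>2 / 2))"
      unfolding inv q by (simp add: field_simps flip: exp_add)
    have "sqrt ((2 * pi) ^ CARD(3) * det (limit_cov \<gamma> \<rho>)) = sqrt (2 * pi * \<gamma>\<^sup>2) * (sqrt (2 * pi * s\<^sup>2) * sqrt (2 * pi))"
      unfolding det by (simp add: power3_eq_cube real_sqrt_mult[symmetric] mult_ac)
    then show ?thesis unfolding e by (simp add: normal_density_def)
  qed
  let ?D = "\<lambda>(a, b, d). ennreal (normal_density 0 \<gamma> a) * (ennreal (normal_density 0 s b) * ennreal (normal_density 0 1 d))"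
  have prodD: "normal_law \<gamma> \<Otimes>\<^sub>M (normal_law s \<Otimes>\<^sub>M normal_law 1) = density (lborel \<Otimes>\<^sub>M (lborel \<Otimes>\<^sub>M lborel)) ?D"
  proof -
    have sf: "sigma_finite_measure (normal_law t)" if "t > 0" for t
      using prob_space_normal_density[OF that, of 0] by (simp add: prob_space_imp_sigma_finite)
    have 1: "normal_law s \<Otimes>\<^sub>M normal_law 1 = density (lborel \<Otimes>\<^sub>M lborel) (\<lambda>(b, d). ennreal (normal_density 0 s b) * ennreal (normal_density 0 1 d))"
      using sf s0 by (subst pair_measure_density) (auto simp: sigma_finite_lborel)
    have sf2: "sigma_finite_measure (lborel \<Otimes>\<^sub>M lborel :: (real \<times> real) measure)"
      unfolding lborel_prod by (rule sigma_finite_lborel)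
    have sf3: "sigma_finite_measure (normal_law s \<Otimes>\<^sub>M normal_law 1)"
    proof -
      interpret A: prob_space "normal_law s" using prob_space_normal_density[OF s0, of 0] by simp
      interpret B: prob_space "normal_law 1" using prob_space_normal_density[of 1 0] by simp
      interpret pair_prob_space "normal_law s" "normal_law 1" ..
      show ?thesis by (rule prob_space_imp_sigma_finite) unfold_locales
    qed
    show ?thesis unfolding 1 using sf2 sf3
      by (subst pair_measure_density) (auto simp: sigma_finite_lborel 1 fun_eq_iff intro!: arg_cong2[where f=density])
  qed
  show ?thesis
  proof (rule measure_eqI)
    fix A assume "A \<in> sets (mv_normal 0 (limit_cov \<gamma> \<rho>))"
    then have A[measurable]: "A \<in> sets borel" by (simp add: mv_normal_def)
    have mm[measurable]: "(\<lambda>x::real^3. x $ i) \<in> borel_measurable borel" for i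
      by (intro borel_measurable_continuous_onI continuous_intros)
    let ?v = "\<lambda>a b d. vector [a, b, d] :: real^3"
    let ?f = "\<lambda>b d. ennreal (normal_density 0 s b) * ennreal (normal_density 0 1 d)"
    have vm[measurable]: "(\<lambda>(a, b, d). ?v a b d) \<in> borel_measurable (lborel \<Otimes>\<^sub>M (lborel \<Otimes>\<^sub>M lborel))"
      unfolding split_beta' by measurable
    have wm[measurable]: "(\<lambda>(a, b, d). ?v (a - c * b) b d) \<in> borel_measurable (lborel \<Otimes>\<^sub>M (lborel \<Otimes>\<^sub>M lborel))"
      unfolding split_beta' by measurable
    have wA: "(\<lambda>x. ?v (fst x - c * fst (snd x)) (fst (snd x)) (snd (snd x))) -` A \<in> sets (borel \<Otimes>\<^sub>M (borel \<Otimes>\<^sub>M borel))"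
    proof -
      have "(\<lambda>x. ?v (fst x - c * fst (snd x)) (fst (snd x)) (snd (snd x))) \<in> borel_measurable (borel \<Otimes>\<^sub>M (borel \<Otimes>\<^sub>M borel))"
        by measurable
      from measurable_sets[OF this A] show ?thesis by (simp add: space_pair_measure)
    qed
    interpret P: pair_sigma_finite "lborel :: real measure" "lborel \<Otimes>\<^sub>M lborel :: (real \<times> real) measure"
      unfolding lborel_prod by (rule pair_sigma_finite.intro) (rule sigma_finite_lborel)+
    have "emeasure (mv_normal 0 (limit_cov \<gamma> \<rho>)) A = (\<integral>\<^sup>+x. ennreal (normal_density 0 \<gamma> (x$1 + c * x$2)) * ?f (x$2) (x$3) * indicator A x \<partial>lborel)"
      unfolding mv_normal_def diff_zero dens by (subst emeasure_density) (auto simp: ennreal_mult)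
    also have "\<dots> = (\<integral>\<^sup>+(a, b, d). ennreal (normal_density 0 \<gamma> (a + c * b)) * ?f b d * indicator A (?v a b d) \<partial>(lborel \<Otimes>\<^sub>M (lborel \<Otimes>\<^sub>M lborel)))"
      unfolding lborel_vector3[symmetric] lborel_prod[symmetric]
      by (subst nn_integral_distr[OF vm]) (auto simp: split_beta' vector_3)
    also have "\<dots> = (\<integral>\<^sup>+y. \<integral>\<^sup>+a. ennreal (normal_density 0 \<gamma> (a + c * fst y)) * ?f (fst y) (snd y) * indicator A (?v a (fst y) (snd y)) \<partial>lborel \<partial>(lborel \<Otimes>\<^sub>M lborel))"
      by (subst P.nn_integral_snd[symmetric]) (auto simp: split_beta')
    also have "\<dots> = (\<integral>\<^sup>+y. \<integral>\<^sup>+a. ennreal (normal_density 0 \<gamma> a) * ?f (fst y) (snd y) * indicator A (?v (a - c * fst y) (fst y) (snd y)) \<partial>lborel \<partial>(lborel \<Otimes>\<^sub>M lborel))"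
    proof (rule nn_integral_cong)
      fix y :: "real \<times> real"
      show "(\<integral>\<^sup>+a. ennreal (normal_density 0 \<gamma> (a + c * fst y)) * ?f (fst y) (snd y) * indicator A (?v a (fst y) (snd y)) \<partial>lborel) =
        (\<integral>\<^sup>+a. ennreal (normal_density 0 \<gamma> a) * ?f (fst y) (snd y) * indicator A (?v (a - c * fst y) (fst y) (snd y)) \<partial>lborel)"
        by (subst nn_integral_real_affine[of _ 1 "- c * fst y"]) auto
    qed
    also have "\<dots> = (\<integral>\<^sup>+(a, b, d). ennreal (normal_density 0 \<gamma> a) * ?f b d * indicator A (?v (a - c * b) b d) \<partial>(lborel \<Otimes>\<^sub>M (lborel \<Otimes>\<^sub>M lborel)))"
      by (subst P.nn_integral_snd[symmetric]) (auto simp: split_beta')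
    also have "\<dots> = emeasure (distr (normal_law \<gamma> \<Otimes>\<^sub>M (normal_law s \<Otimes>\<^sub>M normal_law 1)) borel (\<lambda>(a, b, d). vector [a - c * b, b, d])) A"
      unfolding prodD
      by (subst emeasure_distr, use wm in simp, rule A, subst emeasure_density)
         (use wm wA in \<open>auto simp: split_beta' space_pair_measure intro!: nn_integral_cong split: split_indicator\<close>)
    finally show "emeasure (mv_normal 0 (limit_cov \<gamma> \<rho>)) A = emeasure (distr (normal_law \<gamma> \<Otimes>\<^sub>M (normal_law s \<Otimes>\<^sub>M normal_law 1)) borel (\<lambda>(a, b, d). vector [a - c * b, b, d])) A" .
  qed (simp add: mv_normal_def)
qed

lemma
  fixes \<gamma> \<rho> :: real
  assumes g: "\<gamma> > 0" and r: "\<rho> < 0"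
  defines "c \<equiv> \<rho> / (1 - \<rho>)" and "s \<equiv> \<gamma> * sqrt (1 - 2 * \<rho>) * (1 - \<rho>) / \<rho>\<^sup>2"
  shows prob_space_mv_normal_limit_cov: "prob_space (mv_normal 0 (limit_cov \<gamma> \<rho>))"
    and char_mv_normal_limit_cov: "(\<integral>y. iexp (\<theta> \<bullet> y) \<partial>mv_normal 0 (limit_cov \<gamma> \<rho>)) =
       of_real (exp (- ((\<gamma> * \<theta>$1)\<^sup>2 + (s * (\<theta>$2 - c * \<theta>$1))\<^sup>2 + (\<theta>$3)\<^sup>2) / 2))"
proof -
  have s0: "s > 0" using g r by (simp add: s_def)
  interpret A: prob_space "normal_law \<gamma>" using prob_space_normal_density[OF g, of 0] by simp
  interpret B: prob_space "normal_law s" using prob_space_normal_density[OF s0, of 0] by simp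
  interpret C: prob_space "normal_law 1" using prob_space_normal_density[of 1 0] by simp
  interpret BC: pair_prob_space "normal_law s" "normal_law 1" ..
  interpret ABC: pair_prob_space "normal_law \<gamma>" "normal_law s \<Otimes>\<^sub>M normal_law 1" ..
  have eq: "mv_normal 0 (limit_cov \<gamma> \<rho>) = distr (normal_law \<gamma> \<Otimes>\<^sub>M (normal_law s \<Otimes>\<^sub>M normal_law 1)) borel
       (\<lambda>(a, b, d). vector [a - c * b, b, d])"
    using mv_normal_limit_cov_eq_distr[OF g r] by (simp add: c_def s_def)
  have vm[measurable]: "(\<lambda>(a, b, d). vector [a - c * b, b, d] :: real^3) \<in> borel_measurable (normal_law \<gamma> \<Otimes>\<^sub>M (normal_law s \<Otimes>\<^sub>M normal_law 1))"
    unfolding split_beta' by measurable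
  show "prob_space (mv_normal 0 (limit_cov \<gamma> \<rho>))"
    unfolding eq by (rule ABC.prob_space_distr) measurable
  have "(\<integral>y. iexp (\<theta> \<bullet> y) \<partial>mv_normal 0 (limit_cov \<gamma> \<rho>)) =
    (\<integral>(a, b, d). iexp (\<theta>$1 * a) * (iexp ((\<theta>$2 - c * \<theta>$1) * b) * iexp (\<theta>$3 * d)) \<partial>(normal_law \<gamma> \<Otimes>\<^sub>M (normal_law s \<Otimes>\<^sub>M normal_law 1)))"
    unfolding eq
    by (subst integral_distr) (auto simp: split_beta' inner_vec3 vector_3 algebra_simps simp flip: exp_add intro!: Bochner_Integration.integral_cong)
  also have "\<dots> = (\<integral>a. (\<integral>(b, d). iexp (\<theta>$1 * a) * (iexp ((\<theta>$2 - c * \<theta>$1) * b) * iexp (\<theta>$3 * d)) \<partial>(normal_law s \<Otimes>\<^sub>M normal_law 1)) \<partial>normal_law \<gamma>)"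
    by (subst ABC.integral_fst'[symmetric]) (auto simp: split_beta' norm_mult intro!: ABC.integrable_const_bound[of _ 1])
  also have "\<dots> = char (normal_law \<gamma>) (\<theta>$1) * (\<integral>(b, d). iexp ((\<theta>$2 - c * \<theta>$1) * b) * iexp (\<theta>$3 * d) \<partial>(normal_law s \<Otimes>\<^sub>M normal_law 1))"
    by (simp add: split_beta' char_def)
  also have "(\<integral>(b, d). iexp ((\<theta>$2 - c * \<theta>$1) * b) * iexp (\<theta>$3 * d) \<partial>(normal_law s \<Otimes>\<^sub>M normal_law 1)) =
     (\<integral>b. \<integral>d. iexp ((\<theta>$2 - c * \<theta>$1) * b) * iexp (\<theta>$3 * d) \<partial>normal_law 1 \<partial>normal_law s)"
    by (subst BC.integral_fst'[symmetric]) (auto simp: split_beta' norm_mult intro!: BC.integrable_const_bound[of _ 1])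
  also have "\<dots> = char (normal_law s) (\<theta>$2 - c * \<theta>$1) * char (normal_law 1) (\<theta>$3)"
    by (simp add: char_def)
  finally show "(\<integral>y. iexp (\<theta> \<bullet> y) \<partial>mv_normal 0 (limit_cov \<gamma> \<rho>)) =
       of_real (exp (- ((\<gamma> * \<theta>$1)\<^sup>2 + (s * (\<theta>$2 - c * \<theta>$1))\<^sup>2 + (\<theta>$3)\<^sup>2) / 2))"
    using g s0 by (simp add: char_normal_law flip: of_real_mult exp_add)
qed

section \<open>Uniformity in regular variation\<close>

text \<open>
  Uniform convergence theorem, in additive form. If it failed along \<open>x n\<close> and \<open>u n\<close>, consider the
  shifts \<open>w\<close> in \<open>{0..2}\<close> for which the increments of \<open>h\<close> from \<open>x m\<close>, respectively from \<open>x m + u m\<close>,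
  are small for all \<open>m \<ge> n\<close>. Both sets fill \<open>{0..2}\<close> in measure as \<open>n\<close> grows, so the first one and the
  translate of the second one by \<open>u n\<close> meet inside \<open>{0..3}\<close>; a common point bounds the increment
  from \<open>x n\<close> to \<open>x n + u n\<close>.
\<close>

lemma locally_uniform_shift_limit:
  fixes h :: "real \<Rightarrow> real"
  assumes h[measurable]: "h \<in> borel_measurable borel"
    and lim: "\<And>u. ((\<lambda>x. h (x + u) - h x) \<longlongrightarrow> 0) at_top"
    and e: "e > 0"
  shows "\<exists>X. \<forall>x\<ge>X. \<forall>u. 0 \<le> u \<and> u \<le> 1 \<longrightarrow> \<bar>h (x + u) - h x\<bar> \<le> e"
proof (rule ccontr)
  assume "\<not> ?thesis"
  then have "\<forall>n::nat. \<exists>x u. real n \<le> x \<and> 0 \<le> u \<and> u \<le> 1 \<and> e < \<bar>h (x + u) - h x\<bar>"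
    by (meson not_le)
  then obtain x u where xu: "\<And>n. real n \<le> x n" "\<And>n. 0 \<le> u n" "\<And>n. u n \<le> 1" "\<And>n. e < \<bar>h (x n + u n) - h (x n)\<bar>"
    by metis
  have xinf: "filterlim x at_top sequentially"
    using xu(1) filterlim_at_top_mono[OF filterlim_real_sequentially] by auto
  define V where "V y n = {w \<in> {0..2}. \<forall>m\<ge>n. \<bar>h (y m + w) - h (y m)\<bar> \<le> e / 2}" for y :: "nat \<Rightarrow> real" and n :: nat
  have Vb: "V y n \<in> sets lborel" for y n unfolding V_def by measurable
  have big: "\<forall>\<^sub>F n in sequentially. measure lborel (V y n) > 3 / 2" if y: "filterlim y at_top sequentially" for y
  proof -
    have un: "(\<Union>n. V y n) = {0..2}"
    proof (intro equalityI subsetI)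
      fix w :: real assume w: "w \<in> {0..2}"
      have "(\<lambda>n. h (y n + w) - h (y n)) \<longlonglongrightarrow> 0"
        by (rule filterlim_compose[OF lim y])
      then have "\<forall>\<^sub>F n in sequentially. \<bar>h (y n + w) - h (y n)\<bar> < e / 2"
        using e by (auto dest!: tendstoD[of _ _ _ "e/2"] simp: dist_real_def)
      then show "w \<in> (\<Union>n. V y n)" using w by (auto simp: V_def eventually_sequentially intro: less_imp_le)
    qed (auto simp: V_def)
    have "(\<lambda>n. measure lborel (V y n)) \<longlonglongrightarrow> measure lborel (\<Union>n. V y n)"
      by (rule Lim_measure_incseq) (use Vb un in \<open>auto simp: incseq_def V_def\<close>)
    then have "(\<lambda>n. measure lborel (V y n)) \<longlonglongrightarrow> 2" by (simp add: un)
    then show ?thesis by (rule order_tendstoD) simp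
  qed
  have "filterlim (\<lambda>n. x n + u n) at_top sequentially"
    using xu(2) by (intro filterlim_at_top_mono[OF xinf]) auto
  from big[OF this] big[OF xinf]
  have "\<forall>\<^sub>F n in sequentially. measure lborel (V x n) > 3 / 2 \<and> measure lborel (V (\<lambda>n. x n + u n) n) > 3 / 2"
    by eventually_elim auto
  then obtain n where n: "measure lborel (V x n) > 3 / 2" "measure lborel (V (\<lambda>n. x n + u n) n) > 3 / 2"
    by (auto simp: eventually_sequentially)
  let ?W = "(+) (u n) ` V (\<lambda>n. x n + u n) n"
  have fmV: "V y m \<in> lmeasurable" for y m
    by (rule bounded_set_imp_lmeasurable) (use Vb in \<open>auto simp: V_def intro: bounded_subset[OF bounded_closed_interval[of 0 2]]\<close>)
  have fmW: "?W \<in> lmeasurable"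
    using fmV by (rule measurable_translation)
  have mW: "measure lebesgue ?W > 3 / 2" using n(2) Vb by (simp add: measure_translation)
  have mV: "measure lebesgue (V x n) > 3 / 2" using n(1) Vb by simp
  \<comment> \<open>two sets of measure above 3/2 inside an interval of length 3\<close>
  have "V x n \<inter> ?W \<noteq> {}"
  proof
    assume "V x n \<inter> ?W = {}"
    then have "measure lebesgue (V x n \<union> ?W) = measure lebesgue (V x n) + measure lebesgue ?W"
      using fmV fmW by (subst measure_Un3) auto
    moreover have "measure lebesgue (V x n \<union> ?W) \<le> measure lebesgue {0..3::real}"
          proof (intro measure_mono_fmeasurable)
      have "V x n \<subseteq> {0..2}" "V (\<lambda>n. x n + u n) n \<subseteq> {0..2}" by (auto simp: V_def)
      then show "V x n \<union> ?W \<subseteq> {0..3}" using xu(2)[of n] xu(3)[of n] by fastforce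
    qed (use fmV fmW in \<open>auto intro: fmeasurableD\<close>)
    ultimately show False using mW mV by simp
  qed
  then obtain w where w: "w \<in> V x n" "w - u n \<in> V (\<lambda>n. x n + u n) n"
    by (metis (no_types, lifting) add_diff_cancel_left' disjoint_iff imageE)
  from w(1) have "\<bar>h (x n + w) - h (x n)\<bar> \<le> e / 2" by (auto simp: V_def)
  moreover have "\<bar>h (x n + w) - h (x n + u n)\<bar> \<le> e / 2"
  proof -
    have "\<bar>h (x n + u n + (w - u n)) - h (x n + u n)\<bar> \<le> e / 2" using w(2) unfolding V_def by blast
    then show ?thesis by simp
  qed
  ultimately have "\<bar>h (x n + u n) - h (x n)\<bar> \<le> e" by linarith
  then show False using xu(4)[of n] by simp
qed

text \<open>
  Chaining unit steps of the locally uniform statement gives an error that grows only linearly in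
  \<open>u\<close>, with an arbitrarily small slope: Potter's bound on the log scale.
\<close>

lemma regularly_varying_ln_uniform:
  assumes f: "regularly_varying \<beta> f" and e: "e > 0"
  shows "\<exists>X. \<forall>x\<ge>X. f x > 0 \<and> (\<forall>u\<ge>0. f (x * exp u) > 0 \<and> \<bar>ln (f (x * exp u)) - ln (f x) - \<beta> * u\<bar> \<le> e * (u + 1))"
proof -
  from f obtain x0 where x0: "\<And>x. x > x0 \<Longrightarrow> f x > 0" "f \<in> borel_measurable (restrict_space borel {x0<..})"
    and lim: "\<And>x. x > 0 \<Longrightarrow> ((\<lambda>u. f (u * x) / f u) \<longlongrightarrow> x powr \<beta>) at_top"
    unfolding regularly_varying_def by auto
  define g where "g = (\<lambda>x. if x > x0 then f x else 1)"
  have g[measurable]: "g \<in> borel_measurable borel"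
  proof -
    have "(\<lambda>x. if x \<in> {x0<..} then f x else 1) \<in> borel_measurable borel"
      using x0(2) by (subst measurable_If_restrict_space_iff) (auto simp: Collect_mem_eq simp del: greaterThan_iff)
    then show ?thesis by (simp add: g_def)
  qed
  have gpos: "g x > 0" for x using x0(1) by (auto simp: g_def)
  define h where "h = (\<lambda>y. ln (g (exp y)) - \<beta> * y)"
  have hm: "h \<in> borel_measurable borel" unfolding h_def by measurable
  have hl: "((\<lambda>x. h (x + u) - h x) \<longlongrightarrow> 0) at_top" for u
  proof -
    have "((\<lambda>y. f (exp y * exp u) / f (exp y)) \<longlongrightarrow> exp u powr \<beta>) at_top"
      by (rule filterlim_compose[OF lim exp_at_top]) simp
    then have "((\<lambda>y. ln (f (exp y * exp u) / f (exp y)) - \<beta> * u) \<longlongrightarrow> ln (exp u powr \<beta>) - \<beta> * u) at_top"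
      by (intro tendsto_intros) auto
    then have L: "((\<lambda>y. ln (f (exp y * exp u) / f (exp y)) - \<beta> * u) \<longlongrightarrow> 0) at_top"
      by (simp add: ln_powr)
    have "\<forall>\<^sub>F y in at_top. exp y > x0 \<and> exp (y + u) > x0"
      using eventually_gt_at_top[of "max x0 (x0 - u)"]
    proof eventually_elim
      case (elim y)
      then show ?case using exp_ge_add_one_self[of y] exp_ge_add_one_self[of "y + u"] by linarith
    qed
    then have "\<forall>\<^sub>F y in at_top. ln (f (exp y * exp u) / f (exp y)) - \<beta> * u = h (y + u) - h y"
      proof eventually_elim
      case (elim y)
      then have "f (exp y) > 0" "f (exp y * exp u) > 0" using x0(1) by (auto simp: exp_add)
      then show ?case using elim by (simp add: h_def g_def ln_div exp_add algebra_simps)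
    qed
    from Lim_transform_eventually[OF L this] show ?thesis .
  qed
  obtain Y where Y: "\<And>x u. x \<ge> Y \<Longrightarrow> 0 \<le> u \<Longrightarrow> u \<le> 1 \<Longrightarrow> \<bar>h (x + u) - h x\<bar> \<le> e"
    using locally_uniform_shift_limit[OF hm hl e] by blast
  have chain: "\<bar>h (x + real m) - h x\<bar> \<le> e * real m" if "x \<ge> Y" for x m
  proof (induction m)
    case (Suc m)
    have "\<bar>h ((x + real m) + 1) - h (x + real m)\<bar> \<le> e" using that by (intro Y) auto
    with Suc show ?case by (simp add: algebra_simps)
  qed simp
  have main: "\<bar>h (x + u) - h x\<bar> \<le> e * (u + 1)" if "x \<ge> Y" "u \<ge> 0" for x u
  proof -
    let ?m = "nat \<lfloor>u\<rfloor>"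
    have m: "real ?m \<le> u" "u \<le> real ?m + 1" using that by linarith+
    have "\<bar>h (x + u) - h x\<bar> \<le> \<bar>h ((x + real ?m) + (u - real ?m)) - h (x + real ?m)\<bar> + \<bar>h (x + real ?m) - h x\<bar>"
      by simp
    also have "\<dots> \<le> e + e * real ?m"
    proof (intro add_mono chain Y)
      show "Y \<le> x + real ?m" "0 \<le> u - real ?m" "u - real ?m \<le> 1" using that m by linarith+
    qed (rule that)
    also have "\<dots> \<le> e * (u + 1)" using m e by (simp add: algebra_simps)
    finally show ?thesis .
  qed
  show ?thesis
  proof (intro exI[of _ "max (exp Y) (max 1 (x0 + 1))"] allI impI)
    fix x assume x: "x \<ge> max (exp Y) (max 1 (x0 + 1))"
    have lnx: "ln x \<ge> Y" "x > 0" "x > x0" using x by (auto simp: ln_ge_iff)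
    show "f x > 0 \<and> (\<forall>u\<ge>0. f (x * exp u) > 0 \<and> \<bar>ln (f (x * exp u)) - ln (f x) - \<beta> * u\<bar> \<le> e * (u + 1))"
    proof (intro conjI allI impI)
      fix u :: real assume u: "u \<ge> 0"
      have xu: "x * exp u \<ge> x" using lnx u by (simp add: mult_le_cancel_left1)
      then have xu0: "x * exp u > x0" using lnx by linarith
      then show "f (x * exp u) > 0" by (rule x0(1))
      have "h (ln x + u) - h (ln x) = ln (f (x * exp u)) - ln (f x) - \<beta> * u"
        using lnx xu0 by (simp add: h_def g_def exp_add algebra_simps)
      then show "\<bar>ln (f (x * exp u)) - ln (f x) - \<beta> * u\<bar> \<le> e * (u + 1)"
        using main[OF lnx(1) u] by simp
    qed (use lnx x0 in auto)
  qed
qed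

section \<open>The second-order tail function\<close>

locale heavy_tail =
  fixes \<gamma> \<tau> :: real and F :: "real \<Rightarrow> real"
  assumes gamma_pos: "\<gamma> > 0" and tau_neg: "\<tau> < 0" and heavy: "heavy_tailed \<gamma> \<tau> F"
begin

abbreviation "C \<equiv> tail_const \<gamma> F"
abbreviation "\<delta> \<equiv> tail_delta \<gamma> F"

lemma C_pos: "C > 0" using heavy by (simp add: heavy_tailed_def)

lemma F_law: "\<exists>P. real_distribution P \<and> F = cdf P" using heavy by (simp add: heavy_tailed_def)

lemma survival_eq: "x > 0 \<Longrightarrow> 1 - F x = C * x powr (- 1 / \<gamma>) * (1 + \<delta> x / \<gamma>)"
  using tail_delta_eq[OF gamma_pos heavy] .

lemma delta_sign: "\<exists>X. \<forall>x\<ge>X. \<forall>y\<ge>X. \<delta> x * \<delta> y > 0"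
proof -
  have "(\<forall>\<^sub>F x in at_top. \<delta> x > 0) \<or> (\<forall>\<^sub>F x in at_top. \<delta> x < 0)"
    using heavy by (simp add: heavy_tailed_def)
  then show ?thesis
    by (auto simp: eventually_at_top_linorder intro: mult_pos_pos mult_neg_neg)
qed

lemma delta_ratio:
  assumes "e > 0"
  shows "\<exists>X>0. \<forall>x\<ge>X. \<delta> x \<noteq> 0 \<and> (\<forall>u\<ge>0. \<delta> (x * exp u) / \<delta> x > 0 \<and> \<bar>ln (\<delta> (x * exp u) / \<delta> x) - \<tau> * u\<bar> \<le> e * (u + 1))"
proof -
  obtain X1 where X1: "\<And>x y. x \<ge> X1 \<Longrightarrow> y \<ge> X1 \<Longrightarrow> \<delta> x * \<delta> y > 0" using delta_sign by blast
  have "regularly_varying \<tau> (\<lambda>x. \<bar>\<delta> x\<bar>)" using heavy by (simp add: heavy_tailed_def)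
  from regularly_varying_ln_uniform[OF this assms] obtain X2 where
    X2: "\<And>x u. x \<ge> X2 \<Longrightarrow> u \<ge> 0 \<Longrightarrow> \<bar>ln \<bar>\<delta> (x * exp u)\<bar> - ln \<bar>\<delta> x\<bar> - \<tau> * u\<bar> \<le> e * (u + 1)"
    by blast
  show ?thesis
  proof (rule exI[of _ "max 1 (max X1 X2)"], intro conjI allI impI)
    fix x u assume x: "x \<ge> max 1 (max X1 X2)" and u: "(0::real) \<le> u"
    have "x * 1 \<le> x * exp u" using x u by (intro mult_left_mono) auto
    then have "x * exp u \<ge> X1" "x \<ge> X1" using x by linarith+
    then have "\<delta> (x * exp u) * \<delta> x > 0" by (rule X1)
    then have pos: "\<delta> (x * exp u) / \<delta> x > 0" by (simp add: zero_less_divide_iff zero_less_mult_iff)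
    then show "\<delta> (x * exp u) / \<delta> x > 0" .
    have "ln (\<delta> (x * exp u) / \<delta> x) = ln (\<bar>\<delta> (x * exp u)\<bar> / \<bar>\<delta> x\<bar>)"
      using pos by (simp flip: abs_divide)
    also have "\<dots> = ln \<bar>\<delta> (x * exp u)\<bar> - ln \<bar>\<delta> x\<bar>"
      using pos by (subst ln_div) auto
    finally show "\<bar>ln (\<delta> (x * exp u) / \<delta> x) - \<tau> * u\<bar> \<le> e * (u + 1)" using X2[of x u] x u by simp
  next
    fix x assume "x \<ge> max 1 (max X1 X2)"
    then show "\<delta> x \<noteq> 0" using X1[of x x] by auto
  qed auto
qed

text \<open>
  The Potter exponent \<open>\<tau> + e\<close> stays nonpositive because \<open>\<tau>\<close> is negative.
\<close>

lemma delta_bounded: "\<exists>X>0. \<forall>x\<ge>X. \<forall>u\<ge>0. \<bar>\<delta> (x * exp u)\<bar> \<le> 2 * \<bar>\<delta> x\<bar>"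
proof -
  define e where "e = min (- \<tau>) (ln 2)"
  have e: "e > 0" "e \<le> - \<tau>" "e \<le> ln 2" using tau_neg by (auto simp: e_def)
  obtain X where X: "X > 0" "\<And>x. x \<ge> X \<Longrightarrow> \<delta> x \<noteq> 0"
     "\<And>x u. x \<ge> X \<Longrightarrow> u \<ge> 0 \<Longrightarrow> \<delta> (x * exp u) / \<delta> x > 0"
     "\<And>x u. x \<ge> X \<Longrightarrow> u \<ge> 0 \<Longrightarrow> \<bar>ln (\<delta> (x * exp u) / \<delta> x) - \<tau> * u\<bar> \<le> e * (u + 1)"
    using delta_ratio[OF e(1)] by blast
  show ?thesis
  proof (intro exI[of _ X] conjI allI impI)
    fix x u :: real assume x: "x \<ge> X" and u: "u \<ge> 0"
    have "ln (\<delta> (x * exp u) / \<delta> x) \<le> (\<tau> + e) * u + e" using X(4)[OF x u] by (simp add: algebra_simps)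
    also have "\<dots> \<le> ln 2" using e u mult_nonpos_nonneg[of "\<tau> + e" u] by linarith
    finally have "\<delta> (x * exp u) / \<delta> x \<le> 2" using X(3)[OF x u] by (simp add: ln_le_cancel_iff)
    then have "\<bar>\<delta> (x * exp u) / \<delta> x\<bar> \<le> 2" using X(3)[OF x u] by simp
    then show "\<bar>\<delta> (x * exp u)\<bar> \<le> 2 * \<bar>\<delta> x\<bar>" using X(2)[OF x] by (simp add: field_simps)
  qed (rule X)
qed

lemma delta_local:
  assumes "\<epsilon> > 0"
  shows "\<exists>\<eta>>0. \<exists>X>0. \<forall>x\<ge>X. \<forall>u. \<bar>u\<bar> \<le> \<eta> \<longrightarrow> \<bar>\<delta> (x * exp u) - \<delta> x\<bar> \<le> \<epsilon> * \<bar>\<delta> x\<bar>"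
proof -
  have "(exp \<longlongrightarrow> exp (0::real)) (nhds 0)"
    unfolding tendsto_at_iff_tendsto_nhds[symmetric] by (intro tendsto_intros)
  then have "(exp \<longlongrightarrow> (1::real)) (nhds 0)" by simp
  from tendstoD[OF this assms] obtain \<kappa>0 where \<kappa>0: "\<kappa>0 > 0" "\<And>z. \<bar>z\<bar> < \<kappa>0 \<Longrightarrow> \<bar>exp z - 1\<bar> < \<epsilon>"
    by (auto simp: eventually_nhds_metric dist_real_def)
  define \<kappa> where "\<kappa> = \<kappa>0 / 2"
  have \<kappa>: "\<kappa> > 0" "\<And>z. \<bar>z\<bar> \<le> \<kappa> \<Longrightarrow> \<bar>exp z - 1\<bar> \<le> \<epsilon>"
    using \<kappa>0 by (auto simp: \<kappa>_def intro: less_imp_le)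
  define \<eta> where "\<eta> = min 1 (\<kappa> / (2 * (- \<tau>)))"
  have \<eta>: "\<eta> > 0" "\<eta> \<le> 1" "- \<tau> * \<eta> \<le> \<kappa> / 2"
  proof -
    have "\<kappa> / (2 * (- \<tau>)) > 0" using \<kappa>(1) tau_neg by (intro divide_pos_pos) auto
    then show "\<eta> > 0" "\<eta> \<le> 1" unfolding \<eta>_def by linarith+
    have "- \<tau> * \<eta> \<le> - \<tau> * (\<kappa> / (2 * (- \<tau>)))" using tau_neg by (intro mult_left_mono) (auto simp: \<eta>_def)
    then show "- \<tau> * \<eta> \<le> \<kappa> / 2" using tau_neg by simp
  qed
  have e: "\<kappa> / 4 > 0" using \<kappa> by simp
  obtain X where X: "X > 0" "\<And>x. x \<ge> X \<Longrightarrow> \<delta> x \<noteq> 0"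
     "\<And>x u. x \<ge> X \<Longrightarrow> u \<ge> 0 \<Longrightarrow> \<delta> (x * exp u) / \<delta> x > 0"
     "\<And>x u. x \<ge> X \<Longrightarrow> u \<ge> 0 \<Longrightarrow> \<bar>ln (\<delta> (x * exp u) / \<delta> x) - \<tau> * u\<bar> \<le> \<kappa> / 4 * (u + 1)"
    using delta_ratio[OF e] by blast
  have up: "\<bar>ln (\<delta> (x * exp u) / \<delta> x)\<bar> \<le> \<kappa>" if "x \<ge> X" "0 \<le> u" "u \<le> \<eta>" for x u
  proof -
    have "\<kappa> / 4 * (u + 1) \<le> \<kappa> / 4 * 2" using that \<eta> \<kappa> by (intro mult_left_mono) auto
    moreover have "- \<tau> * u \<le> - \<tau> * \<eta>" using that tau_neg by (intro mult_left_mono) auto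
    moreover have "- \<tau> * u \<ge> 0" using that tau_neg by (simp add: mult_nonpos_nonneg)
    ultimately show ?thesis using X(4)[OF that(1,2)] \<eta>(3) unfolding abs_le_iff by linarith
  qed
  show ?thesis
  proof (rule exI[of _ \<eta>], rule conjI[OF \<eta>(1)], rule exI[of _ "X * exp 1"], intro conjI allI impI)
    fix x u assume x: "x \<ge> X * exp 1" and u: "\<bar>u\<bar> \<le> \<eta>"
    have Xe: "X \<le> X * exp 1" using X(1) by simp
    have x': "x \<ge> X" using x Xe by linarith
    have "\<exists>z. \<bar>z\<bar> \<le> \<kappa> \<and> \<delta> (x * exp u) = \<delta> x * exp z"
    proof (cases "u \<ge> 0")
      case True
      then show ?thesis using up[OF x' True] u X(2,3)[OF x'] 
        by (intro exI[of _ "ln (\<delta> (x * exp u) / \<delta> x)"]) simp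
    next
      case False
      let ?y = "x * exp u"
      have "X = X * exp 1 * exp (- 1)" by (simp add: exp_minus)
      also have "\<dots> \<le> x * exp u" using x False u \<eta> X(1) x' by (intro mult_mono) auto
      finally have y: "?y \<ge> X" .
      have yx: "?y * exp (- u) = x" by (simp add: exp_minus)
      have "\<bar>ln (\<delta> x / \<delta> ?y)\<bar> \<le> \<kappa>" "\<delta> x / \<delta> ?y > 0" using up[OF y, of "- u"] X(3)[OF y, of "- u"] False u yx by auto
      then show ?thesis using X(2)[OF y] X(2)[OF x'] 
        by (intro exI[of _ "- ln (\<delta> x / \<delta> ?y)"]) (simp add: exp_minus)
    qed
    then obtain z where z: "\<bar>z\<bar> \<le> \<kappa>" "\<delta> (x * exp u) = \<delta> x * exp z" by blast
    have "\<bar>\<delta> (x * exp u) - \<delta> x\<bar> = \<bar>exp z - 1\<bar> * \<bar>\<delta> x\<bar>" unfolding z(2) by (simp add: abs_mult[symmetric] algebra_simps)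
    also have "\<dots> \<le> \<epsilon> * \<bar>\<delta> x\<bar>" using \<kappa>(2)[OF z(1)] by (intro mult_right_mono) auto
    finally show "\<bar>\<delta> (x * exp u) - \<delta> x\<bar> \<le> \<epsilon> * \<bar>\<delta> x\<bar>" .
  qed (use X in simp)
qed

lemma delta_limit: "((\<lambda>x. \<delta> (x * exp u) / \<delta> x) \<longlongrightarrow> exp (\<tau> * u)) at_top"
proof -
  have "regularly_varying \<tau> (\<lambda>x. \<bar>\<delta> x\<bar>)" using heavy by (simp add: heavy_tailed_def)
  then have L: "((\<lambda>x. \<bar>\<delta> (x * exp u)\<bar> / \<bar>\<delta> x\<bar>) \<longlongrightarrow> exp u powr \<tau>) at_top"
    by (auto simp: regularly_varying_def)
  obtain X1 where X1: "\<And>x y. x \<ge> X1 \<Longrightarrow> y \<ge> X1 \<Longrightarrow> \<delta> x * \<delta> y > 0" using delta_sign by blast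
  have "\<forall>\<^sub>F x in at_top. \<bar>\<delta> (x * exp u)\<bar> / \<bar>\<delta> x\<bar> = \<delta> (x * exp u) / \<delta> x"
    using eventually_ge_at_top[of "max X1 (X1 / exp u)"]
  proof eventually_elim
    case (elim x)
    then have "\<delta> (x * exp u) * \<delta> x > 0" by (intro X1) (auto simp: field_simps)
    then have "\<delta> (x * exp u) / \<delta> x \<ge> 0" by (simp add: zero_le_divide_iff zero_less_mult_iff) linarith
    then show ?case by (simp flip: abs_divide)
  qed
  from Lim_transform_eventually[OF L this] show ?thesis by (simp add: powr_def mult.commute)
qed

end

locale intermediate_tail = heavy_tail +
  fixes k :: "nat \<Rightarrow> nat" and lam :: real
  assumes k_range: "\<And>n. n \<ge> 2 \<Longrightarrow> k n \<in> {1..n - 1}"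
    and k_inf: "filterlim k at_top sequentially"
    and k_small: "(\<lambda>n. real (k n) / real n) \<longlonglongrightarrow> 0"
    and a_lim: "(\<lambda>n. sqrt (real (k n)) * tail_a \<gamma> F (real n / real (k n))) \<longlonglongrightarrow> lam"
begin

text \<open>
  The level at which the leading term \<open>C * x powr (- 1 / \<gamma>)\<close> of the survival function equals
  \<open>k n / n\<close>. With this choice, rather than the quantile itself, the rescaled survival function above
  the level is explicit.
\<close>

definition t :: "nat \<Rightarrow> real" where "t n = (C * (real n / real (k n))) powr \<gamma>"

abbreviation "rk n \<equiv> sqrt (real (k n))"

lemma k_pos: "n \<ge> 2 \<Longrightarrow> k n > 0" "n \<ge> 2 \<Longrightarrow> k n < n"
  using k_range[of n] by auto

lemma t_pos: "n \<ge> 2 \<Longrightarrow> t n > 0"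
  using C_pos k_pos[of n] by (simp add: t_def)

lemma rk_pos: "n \<ge> 2 \<Longrightarrow> rk n > 0" using k_pos[of n] by simp

lemma rk_inf: "filterlim rk at_top sequentially"
  by (intro filterlim_compose[OF sqrt_at_top] filterlim_compose[OF filterlim_real_sequentially k_inf])

lemma ratio_inf: "filterlim (\<lambda>n. real n / real (k n)) at_top sequentially"
proof -
  have "filterlim (\<lambda>n. inverse (real (k n) / real n)) at_top sequentially"
    by (rule filterlim_inverse_at_top[OF k_small])
       (use k_pos in \<open>auto simp: eventually_sequentially intro!: exI[of _ 2]\<close>)
  then show ?thesis by (simp add: inverse_eq_divide)
qed

lemma powr_at_top: "a > 0 \<Longrightarrow> filterlim (\<lambda>x::real. x powr a) at_top at_top"
  using real_powr_at_top by blast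

lemma t_inf: "filterlim t at_top sequentially"
  unfolding t_def
  by (rule filterlim_compose[OF powr_at_top[OF gamma_pos]])
     (rule filterlim_tendsto_pos_mult_at_top[OF tendsto_const C_pos ratio_inf])

lemma survival_t: 
  assumes "n \<ge> 2"
  shows "real n / real (k n) * (1 - F (t n * exp x)) = exp (- x / \<gamma>) * (1 + \<delta> (t n * exp x) / \<gamma>)"
proof -
  have "(t n * exp x) powr (- 1 / \<gamma>) = (C * (real n / real (k n))) powr (- 1) * exp (- x / \<gamma>)"
    using gamma_pos C_pos t_pos[OF assms]
    by (simp add: t_def powr_mult powr_powr exp_powr_real)
  also have "C * \<dots> = real (k n) / real n * exp (- x / \<gamma>)"
    using C_pos k_pos[OF assms] by (simp add: powr_minus field_simps)
  finally show ?thesis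
    using survival_eq[of "t n * exp x"] t_pos[OF assms] k_pos[OF assms] by simp
qed

lemma tail_a_small: "(\<lambda>n. tail_a \<gamma> F (real n / real (k n))) \<longlonglongrightarrow> 0"
proof -
  have "(\<lambda>n. rk n * tail_a \<gamma> F (real n / real (k n)) * inverse (rk n)) \<longlonglongrightarrow> lam * 0"
    by (intro tendsto_mult a_lim tendsto_inverse_0_at_top rk_inf)
  moreover have "\<forall>\<^sub>F n in sequentially. rk n * tail_a \<gamma> F (real n / real (k n)) * inverse (rk n) = tail_a \<gamma> F (real n / real (k n))"
    using eventually_ge_at_top[of 2] by eventually_elim (use rk_pos in \<open>auto simp: field_simps\<close>)
  ultimately show ?thesis by (simp add: tendsto_cong)
qed

text \<open>
  Let \<open>w = t * (1 + a)\<close> be the quantile \<open>U (n / k)\<close>. The survival function is at most \<open>k / n\<close> at \<open>w\<close> and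
  larger than \<open>k / n\<close> just below \<open>w\<close>. In terms of \<open>b = \<gamma> * ((1 + a) powr (1 / \<gamma>) - 1)\<close>, which is
  asymptotic to \<open>a\<close>, this says \<open>\<delta> w \<le> b\<close> and \<open>b \<le> \<delta> w + e * \<bar>\<delta> w\<bar>\<close>, since \<open>\<delta>\<close> varies by a small
  relative amount near \<open>w\<close>; in particular jumps of \<open>F\<close> are negligible. The same local bound moves
  the statement from \<open>w\<close> to \<open>t\<close>.
\<close>

lemma delta_t: "(\<lambda>n. rk n * \<delta> (t n)) \<longlonglongrightarrow> lam"
proof -
  obtain P where P: "real_distribution P" "F = cdf P" using F_law by blast
  interpret law: cdf_distribution P using P(1) by (simp add: cdf_distribution_def)
  have pinv: "p \<le> F x \<longleftrightarrow> quantile F p \<le> x" if "0 < p" "p < 1" for p x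
    using law.pseudoinverse[OF that, of x] by (simp add: P(2) quantile_def)
  define a where "a n = tail_a \<gamma> F (real n / real (k n))" for n
  define w where "w n = tail_quantile F (real n / real (k n))" for n
  define b where "b n = \<gamma> * ((1 + a n) powr (1 / \<gamma>) - 1)" for n
  have a0: "a \<longlonglongrightarrow> 0" using tail_a_small by (simp add: a_def[abs_def])
  have weq: "w n = t n * (1 + a n)" if "n \<ge> 2" for n
  proof -
    have y: "real n / real (k n) > 1" using k_pos[OF that] by simp
    have e: "(C * (real n / real (k n))) powr \<gamma> = C powr \<gamma> * (real n / real (k n)) powr \<gamma>"
      by (rule powr_mult)
    show ?thesis unfolding w_def a_def t_def e by (rule tail_a_eq[OF heavy y])
  qed
  have winf: "filterlim w at_top sequentially"
  proof -
    have "filterlim (\<lambda>n. (1 + a n) * t n) at_top sequentially"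
      by (rule filterlim_tendsto_pos_mult_at_top[OF tendsto_add[OF tendsto_const a0] _ t_inf]) simp
    moreover have "\<forall>\<^sub>F n in sequentially. (1 + a n) * t n = w n"
      using eventually_ge_at_top[of 2] by eventually_elim (simp add: weq mult.commute)
    ultimately show ?thesis by (simp add: filterlim_cong)
  qed
  have apos: "\<forall>\<^sub>F n in sequentially. 1 + a n > 1 / 2"
    using order_tendstoD(1)[OF a0, of "- 1 / 2"] by (simp add: eventually_mono)
  have key: "\<delta> (w n) \<le> b n \<and> (\<forall>u>0. \<gamma> * ((1 + a n) powr (1 / \<gamma>) * exp (- u / \<gamma>) - 1) \<le> \<delta> (w n * exp (- u)))"
    if n: "n \<ge> 2" and an: "1 + a n > 1 / 2" for n
  proof -
    let ?y = "real n / real (k n)"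
    have y: "?y > 1" using k_pos[OF n] by simp
    have p: "0 < 1 - 1 / ?y" "1 - 1 / ?y < 1" using k_pos[OF n] by auto
    have wq: "w n = quantile F (1 - 1 / ?y)" by (simp add: w_def tail_quantile_def)
    have wpos: "w n > 0" using weq[OF n] t_pos[OF n] an by simp
    have form: "?y * (1 - F (w n * exp x)) = (1 + a n) powr (- 1 / \<gamma>) * exp (- x / \<gamma>) * (1 + \<delta> (w n * exp x) / \<gamma>)" for x
    proof -
      have "w n * exp x = t n * exp (x + ln (1 + a n))" using weq[OF n] an by (simp add: exp_add)
      moreover have "exp (- (x + ln (1 + a n)) / \<gamma>) = (1 + a n) powr (- 1 / \<gamma>) * exp (- x / \<gamma>)"
        using an by (simp add: powr_def exp_add[symmetric] diff_divide_distrib)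
      ultimately show ?thesis using survival_t[OF n, of "x + ln (1 + a n)"] by simp
    qed
    let ?A = "(1 + a n) powr (1 / \<gamma>)"
    have A: "?A > 0" "(1 + a n) powr (- 1 / \<gamma>) = 1 / ?A" using an by (auto simp: powr_minus_divide)
    have "1 - 1 / ?y \<le> F (w n)" using pinv[OF p, of "w n"] wq by simp
    then have "?y * (1 - F (w n)) \<le> ?y * (1 / ?y)" using y by (intro mult_left_mono) auto
    moreover have one: "?y * (1 / ?y) = 1" using k_pos[OF n] by simp
    ultimately have "?y * (1 - F (w n * exp 0)) \<le> 1" by simp
    then have "1 / ?A * (1 + \<delta> (w n) / \<gamma>) \<le> 1" unfolding form A(2) by simp
    then have "1 + \<delta> (w n) / \<gamma> \<le> ?A" using A(1) by (simp add: field_simps)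
    then have "\<delta> (w n) \<le> b n" using gamma_pos by (simp add: b_def field_simps)
    moreover have "\<gamma> * (?A * exp (- u / \<gamma>) - 1) \<le> \<delta> (w n * exp (- u))" if "u > 0" for u
    proof -
      have "w n * exp (- u) < w n" using wpos that by simp
      then have "\<not> 1 - 1 / ?y \<le> F (w n * exp (- u))" using pinv[OF p, of "w n * exp (- u)"] wq by simp
      then have "?y * (1 / ?y) \<le> ?y * (1 - F (w n * exp (- u)))" using y by (intro mult_left_mono) auto
      then have "1 \<le> 1 / ?A * exp (u / \<gamma>) * (1 + \<delta> (w n * exp (- u)) / \<gamma>)" unfolding form A(2) one by simp
      then have "?A * exp (- u / \<gamma>) \<le> 1 + \<delta> (w n * exp (- u)) / \<gamma>" using A(1) by (simp add: exp_minus field_simps)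
      then show ?thesis using gamma_pos by (simp add: field_simps)
    qed
    ultimately show ?thesis by blast
  qed
  have blim: "(\<lambda>n. rk n * b n) \<longlonglongrightarrow> lam"
  proof -
    have "((\<lambda>x. (1 + x) powr (1 / \<gamma>)) has_real_derivative (1 / \<gamma>)) (at 0)"
      using gamma_pos by (auto intro!: derivative_eq_intros)
    then have D: "((\<lambda>x. ((1 + x) powr (1 / \<gamma>) - 1) / x) \<longlongrightarrow> 1 / \<gamma>) (at 0)"
      by (simp add: DERIV_def)
    define g where "g x = (if x = 0 then 1 / \<gamma> else ((1 + x) powr (1 / \<gamma>) - 1) / x)" for x
    have "(g \<longlongrightarrow> 1 / \<gamma>) (at 0)"
      using D by (rule Lim_transform_eventually) (auto simp: g_def eventually_at_filter)
    then have "(g \<longlongrightarrow> g 0) (at 0)" by (simp add: g_def)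
    then have "(g \<longlongrightarrow> g 0) (nhds 0)" by (simp only: tendsto_at_iff_tendsto_nhds)
    from filterlim_compose[OF this a0] have "(\<lambda>n. g (a n)) \<longlonglongrightarrow> 1 / \<gamma>" by (simp add: g_def)
    then have "(\<lambda>n. \<gamma> * g (a n) * (rk n * a n)) \<longlonglongrightarrow> \<gamma> * (1 / \<gamma>) * lam"
      using a_lim by (intro tendsto_intros) (simp_all add: a_def)
    moreover have "\<gamma> * g (a n) * (rk n * a n) = rk n * b n" for n by (simp add: g_def b_def)
    ultimately show ?thesis using gamma_pos by simp
  qed
  have wlim: "(\<lambda>n. rk n * \<delta> (w n)) \<longlonglongrightarrow> lam"
  proof -
    have "(\<lambda>n. rk n * (b n - \<delta> (w n))) \<longlonglongrightarrow> 0"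
    proof (rule tendstoI)
      fix \<epsilon> :: real assume \<epsilon>: "\<epsilon> > 0"
      define e where "e = min (1/2) (\<epsilon> / (4 * (\<bar>lam\<bar> + 1)))"
      have "\<epsilon> / (4 * (\<bar>lam\<bar> + 1)) > 0" using \<epsilon> by (intro divide_pos_pos) auto
      then have e: "e > 0" "e \<le> 1/2" "e \<le> \<epsilon> / (4 * (\<bar>lam\<bar> + 1))" unfolding e_def by linarith+
      obtain \<eta> X where \<eta>: "\<eta> > 0" "X > 0" "\<And>x u. x \<ge> X \<Longrightarrow> \<bar>u\<bar> \<le> \<eta> \<Longrightarrow> \<bar>\<delta> (x * exp u) - \<delta> x\<bar> \<le> e * \<bar>\<delta> x\<bar>"
        using delta_local[OF e(1)] by blast
      have "\<forall>\<^sub>F n in sequentially. \<bar>rk n * b n\<bar> < \<bar>lam\<bar> + 1"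
        using order_tendstoD(2)[OF tendsto_rabs[OF blim], of "\<bar>lam\<bar> + 1"] by simp
      moreover have "\<forall>\<^sub>F n in sequentially. w n \<ge> X" using winf by (simp add: filterlim_at_top)
      ultimately show "\<forall>\<^sub>F n in sequentially. dist (rk n * (b n - \<delta> (w n))) 0 < \<epsilon>"
        using apos eventually_ge_at_top[of 2]
      proof eventually_elim
        case (elim n)
        let ?A = "(1 + a n) powr (1 / \<gamma>)"
        have le: "\<delta> (w n) \<le> b n" using key[OF elim(4,3)] by blast
        \<comment> \<open>the bound holds at every point just below the quantile; let it approach the quantile\<close>
    have "b n \<le> \<delta> (w n) + e * \<bar>\<delta> (w n)\<bar>"
        proof (rule tendsto_upperbound)
          have "((\<lambda>u. \<gamma> * (?A * exp (- u / \<gamma>) - 1)) \<longlongrightarrow> \<gamma> * (?A * exp (- 0 / \<gamma>) - 1)) (at_right 0)"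
            using gamma_pos by (intro tendsto_intros) auto
          then show "((\<lambda>u. \<gamma> * (?A * exp (- u / \<gamma>) - 1)) \<longlongrightarrow> b n) (at_right 0)" by (simp add: b_def)
          show "\<forall>\<^sub>F u in at_right 0. \<gamma> * (?A * exp (- u / \<gamma>) - 1) \<le> \<delta> (w n) + e * \<bar>\<delta> (w n)\<bar>"
          proof (rule eventually_at_rightI[of 0 \<eta>])
            fix u assume u: "u \<in> {0<..<\<eta>}"
            have "\<gamma> * (?A * exp (- u / \<gamma>) - 1) \<le> \<delta> (w n * exp (- u))"
              using key[OF elim(4,3)] u by simp
            moreover have "\<bar>\<delta> (w n * exp (- u)) - \<delta> (w n)\<bar> \<le> e * \<bar>\<delta> (w n)\<bar>"
              using elim(2) u by (intro \<eta>(3)) auto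
            ultimately show "\<gamma> * (?A * exp (- u / \<gamma>) - 1) \<le> \<delta> (w n) + e * \<bar>\<delta> (w n)\<bar>" by linarith
          qed (rule \<eta>)
        qed simp
        then have 1: "\<bar>b n - \<delta> (w n)\<bar> \<le> e * \<bar>\<delta> (w n)\<bar>" using le by simp
        also have "\<dots> \<le> 1/2 * \<bar>\<delta> (w n)\<bar>" using e by (intro mult_right_mono) auto
        finally have "\<bar>\<delta> (w n)\<bar> \<le> 2 * \<bar>b n\<bar>" by linarith
        then have "\<bar>b n - \<delta> (w n)\<bar> \<le> e * (2 * \<bar>b n\<bar>)"
          using 1 e by (meson mult_left_mono less_imp_le order_trans)
        then have "rk n * \<bar>b n - \<delta> (w n)\<bar> \<le> rk n * (e * (2 * \<bar>b n\<bar>))"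
          by (intro mult_left_mono) auto
        also have "\<dots> = 2 * e * \<bar>rk n * b n\<bar>" by (simp add: abs_mult)
        also have "\<dots> \<le> 2 * (\<epsilon> / (4 * (\<bar>lam\<bar> + 1))) * (\<bar>lam\<bar> + 1)"
          using elim(1) e \<epsilon> by (intro mult_mono) auto
        also have "\<dots> = \<epsilon> / 2"
        proof -
          have "x + 1 > 0 \<Longrightarrow> 2 * (\<epsilon> / (4 * (x + 1))) * (x + 1) = \<epsilon> / 2" for x
            by (simp add: field_simps)
          then show ?thesis by simp
        qed
        also have "\<dots> < \<epsilon>" using \<epsilon> by simp
        finally show ?case by (simp add: dist_real_def abs_mult)
      qed
    qed
    from tendsto_diff[OF blim this] show ?thesis by (simp add: algebra_simps)
  qed
  have "(\<lambda>n. rk n * (\<delta> (t n) - \<delta> (w n))) \<longlonglongrightarrow> 0"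
  proof (rule tendstoI)
    fix \<epsilon> :: real assume \<epsilon>: "\<epsilon> > 0"
    define e where "e = \<epsilon> / (2 * (\<bar>lam\<bar> + 1))"
    have e: "e > 0" using \<epsilon> unfolding e_def by (intro divide_pos_pos) auto
    obtain \<eta> X where \<eta>: "\<eta> > 0" "X > 0" "\<And>x u. x \<ge> X \<Longrightarrow> \<bar>u\<bar> \<le> \<eta> \<Longrightarrow> \<bar>\<delta> (x * exp u) - \<delta> x\<bar> \<le> e * \<bar>\<delta> x\<bar>"
      using delta_local[OF e] by blast
    have "\<forall>\<^sub>F n in sequentially. \<bar>rk n * \<delta> (w n)\<bar> < \<bar>lam\<bar> + 1"
      using order_tendstoD(2)[OF tendsto_rabs[OF wlim], of "\<bar>lam\<bar> + 1"] by simp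
    moreover have "\<forall>\<^sub>F n in sequentially. w n \<ge> X" using winf by (simp add: filterlim_at_top)
    moreover have "\<forall>\<^sub>F n in sequentially. \<bar>ln (1 + a n)\<bar> < \<eta>"
    proof -
      have "(\<lambda>n. ln (1 + a n)) \<longlonglongrightarrow> ln (1 + 0)" by (intro tendsto_intros a0) auto
      then have "(\<lambda>n. ln (1 + a n)) \<longlonglongrightarrow> 0" by simp
      from tendstoD[OF this \<eta>(1)] show ?thesis by (simp add: dist_real_def)
    qed
    ultimately show "\<forall>\<^sub>F n in sequentially. dist (rk n * (\<delta> (t n) - \<delta> (w n))) 0 < \<epsilon>"
      using apos eventually_ge_at_top[of 2]
    proof eventually_elim
      case (elim n)
      have "t n = w n * exp (- ln (1 + a n))" using weq[OF elim(5)] elim(4) by (simp add: exp_minus)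
      then have "\<bar>\<delta> (t n) - \<delta> (w n)\<bar> \<le> e * \<bar>\<delta> (w n)\<bar>" using \<eta>(3)[OF elim(2), of "- ln (1 + a n)"] elim(3) by simp
      then have "rk n * \<bar>\<delta> (t n) - \<delta> (w n)\<bar> \<le> rk n * (e * \<bar>\<delta> (w n)\<bar>)"
        by (intro mult_left_mono) auto
      also have "\<dots> = e * \<bar>rk n * \<delta> (w n)\<bar>" by (simp add: abs_mult)
      also have "\<dots> \<le> e * (\<bar>lam\<bar> + 1)"
        using elim(1) e \<epsilon> by (intro mult_left_mono) auto
      also have "\<dots> = \<epsilon> / 2"
      proof -
        have "x + 1 > 0 \<Longrightarrow> \<epsilon> / (2 * (x + 1)) * (x + 1) = \<epsilon> / 2" for x
          by (simp add: field_simps)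
        then show ?thesis by (simp add: e_def)
      qed
      also have "\<dots> < \<epsilon>" using \<epsilon> by simp
      finally show ?case by (simp add: dist_real_def abs_mult)
    qed
  qed
  from tendsto_add[OF this wlim] show ?thesis by (simp add: algebra_simps)
qed

end

section \<open>Stochastic order symbols\<close>

text \<open>
  Stated through inner approximation by events, so that the calculus below applies to pathwise
  expressions of any kind; measurability enters only in the passage to and from probabilities.
\<close>

definition with_high_prob :: "(nat \<Rightarrow> 'a measure) \<Rightarrow> (nat \<Rightarrow> 'a \<Rightarrow> bool) \<Rightarrow> bool" where
  "with_high_prob M P \<longleftrightarrow> (\<forall>\<eta>>0. \<forall>\<^sub>F n in sequentially.
     \<exists>A\<in>sets (M n). measure (M n) A \<ge> 1 - \<eta> \<and> (\<forall>\<omega>\<in>A. P n \<omega>))"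

definition small_in_prob :: "(nat \<Rightarrow> 'a measure) \<Rightarrow> (nat \<Rightarrow> 'a \<Rightarrow> real) \<Rightarrow> bool" where
  "small_in_prob M Y \<longleftrightarrow> (\<forall>\<epsilon>>0. with_high_prob M (\<lambda>n \<omega>. \<bar>Y n \<omega>\<bar> \<le> \<epsilon>))"

definition bounded_in_prob :: "(nat \<Rightarrow> 'a measure) \<Rightarrow> (nat \<Rightarrow> 'a \<Rightarrow> real) \<Rightarrow> bool" where
  "bounded_in_prob M Y \<longleftrightarrow> (\<forall>\<eta>>0. \<exists>B. \<forall>\<^sub>F n in sequentially.
     \<exists>A\<in>sets (M n). measure (M n) A \<ge> 1 - \<eta> \<and> (\<forall>\<omega>\<in>A. \<bar>Y n \<omega>\<bar> \<le> B))"

locale prob_seq =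
  fixes M :: "nat \<Rightarrow> 'a measure"
  assumes prob_M: "prob_space (M n)"
begin

abbreviation "whp \<equiv> with_high_prob M"
abbreviation "op \<equiv> small_in_prob M"
abbreviation "Op \<equiv> bounded_in_prob M"

lemma Int_prob:
  assumes "A \<in> sets (M n)" "B \<in> sets (M n)" "measure (M n) A \<ge> 1 - \<eta>1" "measure (M n) B \<ge> 1 - \<eta>2"
  shows "measure (M n) (A \<inter> B) \<ge> 1 - (\<eta>1 + \<eta>2)"
proof -
  interpret prob_space "M n" by (rule prob_M)
  have "prob (A \<union> B) = prob A + prob B - prob (A \<inter> B)"
    using assms(1,2) by (intro measure_Un3) (simp_all only: fmeasurable_eq_sets)
  then show ?thesis using assms prob_le_1[of "A \<union> B"] by linarith
qed

lemma whp_mono: 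
  assumes P: "whp P" and PQ: "\<And>n \<omega>. P n \<omega> \<Longrightarrow> Q n \<omega>" shows "whp Q"
  unfolding with_high_prob_def
proof (intro allI impI)
  fix \<eta> :: real assume "\<eta> > 0"
  from P[unfolded with_high_prob_def, rule_format, OF this]
  show "\<forall>\<^sub>F n in sequentially. \<exists>A\<in>sets (M n). measure (M n) A \<ge> 1 - \<eta> \<and> (\<forall>\<omega>\<in>A. Q n \<omega>)"
    by eventually_elim (use PQ in blast)
qed

lemma whp_conj: 
  assumes P: "whp P" and Q: "whp Q" shows "whp (\<lambda>n \<omega>. P n \<omega> \<and> Q n \<omega>)"
  unfolding with_high_prob_def
proof (intro allI impI)
  fix \<eta> :: real assume "\<eta> > 0"
  then have e: "\<eta> / 2 > 0" by simp
  show "\<forall>\<^sub>F n in sequentially. \<exists>A\<in>sets (M n). measure (M n) A \<ge> 1 - \<eta> \<and> (\<forall>\<omega>\<in>A. P n \<omega> \<and> Q n \<omega>)"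
    using P[unfolded with_high_prob_def, rule_format, OF e] Q[unfolded with_high_prob_def, rule_format, OF e]
  proof eventually_elim
    case (elim n)
    then obtain A B where "A \<in> sets (M n)" "B \<in> sets (M n)" "measure (M n) A \<ge> 1 - \<eta>/2" "measure (M n) B \<ge> 1 - \<eta>/2"
      "\<forall>\<omega>\<in>A. P n \<omega>" "\<forall>\<omega>\<in>B. Q n \<omega>" by blast
    then show ?case using Int_prob[of A n B "\<eta>/2" "\<eta>/2"] by (intro bexI[of _ "A \<inter> B"]) auto
  qed
qed

lemma whp_eventually: 
  assumes "\<forall>\<^sub>F n in sequentially. \<forall>\<omega>\<in>space (M n). P n \<omega>" shows "whp P"
  unfolding with_high_prob_def
proof (intro allI impI)
  fix \<eta> :: real assume "\<eta> > 0"
  show "\<forall>\<^sub>F n in sequentially. \<exists>A\<in>sets (M n). measure (M n) A \<ge> 1 - \<eta> \<and> (\<forall>\<omega>\<in>A. P n \<omega>)"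
    using assms by eventually_elim (use \<open>\<eta> > 0\<close> in \<open>auto simp: prob_space.prob_space[OF prob_M] intro!: bexI[of _ "space (M _)"]\<close>)
qed

lemma whp_finite: "finite J \<Longrightarrow> (\<And>j. j \<in> J \<Longrightarrow> whp (P j)) \<Longrightarrow> whp (\<lambda>n \<omega>. \<forall>j\<in>J. P j n \<omega>)"
proof (induction J rule: finite_induct)
  case empty
  then show ?case by (intro whp_eventually) auto
next
  case (insert j J)
  then have "whp (\<lambda>n \<omega>. P j n \<omega> \<and> (\<forall>j\<in>J. P j n \<omega>))" by (intro whp_conj) auto
  then show ?case by (rule whp_mono) auto
qed

lemma op_whp: "op Y \<Longrightarrow> \<epsilon> > 0 \<Longrightarrow> whp (\<lambda>n \<omega>. \<bar>Y n \<omega>\<bar> \<le> \<epsilon>)"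
  by (simp add: small_in_prob_def)

lemma op_le: 
  assumes "op Y" "whp (\<lambda>n \<omega>. \<bar>Z n \<omega>\<bar> \<le> \<bar>Y n \<omega>\<bar>)" shows "op Z"
  unfolding small_in_prob_def
proof (intro allI impI)
  fix \<epsilon> :: real assume "\<epsilon> > 0"
  from whp_conj[OF op_whp[OF assms(1) this] assms(2)]
  show "whp (\<lambda>n \<omega>. \<bar>Z n \<omega>\<bar> \<le> \<epsilon>)" by (rule whp_mono) auto
qed

lemma op_cong: "op Y \<Longrightarrow> whp (\<lambda>n \<omega>. Z n \<omega> = Y n \<omega>) \<Longrightarrow> op Z"
  by (erule op_le, erule whp_mono) auto

lemma op_add: 
  assumes "op Y" "op Z" shows "op (\<lambda>n \<omega>. Y n \<omega> + Z n \<omega>)"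
  unfolding small_in_prob_def
proof (intro allI impI)
  fix \<epsilon> :: real assume "\<epsilon> > 0"
  then have e: "\<epsilon> / 2 > 0" by simp
  from whp_conj[OF op_whp[OF assms(1) e] op_whp[OF assms(2) e]]
  show "whp (\<lambda>n \<omega>. \<bar>Y n \<omega> + Z n \<omega>\<bar> \<le> \<epsilon>)" by (rule whp_mono) auto
qed

lemma Op_whp_bound:
  assumes "Op Y" "\<eta> > 0"
  obtains B where "B > 0" "\<forall>\<^sub>F n in sequentially. \<exists>A\<in>sets (M n). measure (M n) A \<ge> 1 - \<eta> \<and> (\<forall>\<omega>\<in>A. \<bar>Y n \<omega>\<bar> \<le> B)"
proof -
  from assms obtain B where B: "\<forall>\<^sub>F n in sequentially. \<exists>A\<in>sets (M n). measure (M n) A \<ge> 1 - \<eta> \<and> (\<forall>\<omega>\<in>A. \<bar>Y n \<omega>\<bar> \<le> B)"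
    by (auto simp: bounded_in_prob_def)
  have "\<forall>\<^sub>F n in sequentially. \<exists>A\<in>sets (M n). measure (M n) A \<ge> 1 - \<eta> \<and> (\<forall>\<omega>\<in>A. \<bar>Y n \<omega>\<bar> \<le> max B 1)"
    using B by eventually_elim (meson max.coboundedI1)
  then show ?thesis by (intro that[of "max B 1"]) auto
qed

lemma op_mult_Op:
  assumes "op Y" "Op Z" shows "op (\<lambda>n \<omega>. Y n \<omega> * Z n \<omega>)"
  unfolding small_in_prob_def with_high_prob_def
proof (intro allI impI)
  fix \<epsilon> \<eta> :: real assume e: "\<epsilon> > 0" "\<eta> > 0"
  then have h: "\<eta> / 2 > 0" by simp
  obtain B where B: "B > 0" "\<forall>\<^sub>F n in sequentially. \<exists>A\<in>sets (M n). measure (M n) A \<ge> 1 - \<eta> / 2 \<and> (\<forall>\<omega>\<in>A. \<bar>Z n \<omega>\<bar> \<le> B)"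
    using Op_whp_bound[OF assms(2) h] by blast
  have "\<epsilon> / B > 0" using e B by simp
  from op_whp[OF assms(1) this, unfolded with_high_prob_def, rule_format, OF h] B(2)
  show "\<forall>\<^sub>F n in sequentially. \<exists>A\<in>sets (M n). measure (M n) A \<ge> 1 - \<eta> \<and> (\<forall>\<omega>\<in>A. \<bar>Y n \<omega> * Z n \<omega>\<bar> \<le> \<epsilon>)"
  proof eventually_elim
    case (elim n)
    then obtain A A' where A: "A \<in> sets (M n)" "A' \<in> sets (M n)" "measure (M n) A \<ge> 1 - \<eta>/2" "measure (M n) A' \<ge> 1 - \<eta>/2"
      "\<forall>\<omega>\<in>A. \<bar>Y n \<omega>\<bar> \<le> \<epsilon> / B" "\<forall>\<omega>\<in>A'. \<bar>Z n \<omega>\<bar> \<le> B" by blast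
    have "\<bar>Y n \<omega> * Z n \<omega>\<bar> \<le> \<epsilon>" if "\<omega> \<in> A \<inter> A'" for \<omega>
    proof -
      have "\<bar>Y n \<omega>\<bar> * \<bar>Z n \<omega>\<bar> \<le> \<epsilon> / B * B" using A that e B by (intro mult_mono) auto
      then show ?thesis using B by (simp add: abs_mult)
    qed
    then show ?case using A Int_prob[of A n A' "\<eta>/2" "\<eta>/2"] by (intro bexI[of _ "A \<inter> A'"]) auto
  qed
qed

lemma Op_binary:
  assumes Y: "Op Y" and Z: "Op Z" and f: "\<And>B B' y z. \<bar>y\<bar> \<le> B \<Longrightarrow> \<bar>z\<bar> \<le> B' \<Longrightarrow> \<bar>f y z\<bar> \<le> g B B'"
  shows "Op (\<lambda>n \<omega>. f (Y n \<omega>) (Z n \<omega>))"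
  unfolding bounded_in_prob_def
proof (intro allI impI)
  fix \<eta> :: real assume "\<eta> > 0"
  then have h: "\<eta> / 2 > 0" by simp
  obtain B where B: "B > 0" "\<forall>\<^sub>F n in sequentially. \<exists>A\<in>sets (M n). measure (M n) A \<ge> 1 - \<eta> / 2 \<and> (\<forall>\<omega>\<in>A. \<bar>Y n \<omega>\<bar> \<le> B)"
    using Op_whp_bound[OF Y h] by blast
  obtain B' where B': "B' > 0" "\<forall>\<^sub>F n in sequentially. \<exists>A\<in>sets (M n). measure (M n) A \<ge> 1 - \<eta> / 2 \<and> (\<forall>\<omega>\<in>A. \<bar>Z n \<omega>\<bar> \<le> B')"
    using Op_whp_bound[OF Z h] by blast
  from B(2) B'(2)
  have "\<forall>\<^sub>F n in sequentially. \<exists>A\<in>sets (M n). measure (M n) A \<ge> 1 - \<eta> \<and> (\<forall>\<omega>\<in>A. \<bar>f (Y n \<omega>) (Z n \<omega>)\<bar> \<le> g B B')"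
  proof eventually_elim
    case (elim n)
    then obtain A A' where A: "A \<in> sets (M n)" "A' \<in> sets (M n)" "measure (M n) A \<ge> 1 - \<eta>/2" "measure (M n) A' \<ge> 1 - \<eta>/2"
      "\<forall>\<omega>\<in>A. \<bar>Y n \<omega>\<bar> \<le> B" "\<forall>\<omega>\<in>A'. \<bar>Z n \<omega>\<bar> \<le> B'" by blast
    then show ?case using Int_prob[of A n A' "\<eta>/2" "\<eta>/2"] by (intro bexI[of _ "A \<inter> A'"]) (auto intro!: f)
  qed
  then show "\<exists>B. \<forall>\<^sub>F n in sequentially. \<exists>A\<in>sets (M n). measure (M n) A \<ge> 1 - \<eta> \<and> (\<forall>\<omega>\<in>A. \<bar>f (Y n \<omega>) (Z n \<omega>)\<bar> \<le> B)" ..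
qed

lemma Op_add: "Op Y \<Longrightarrow> Op Z \<Longrightarrow> Op (\<lambda>n \<omega>. Y n \<omega> + Z n \<omega>)"
  by (rule Op_binary[where f="\<lambda>y z. y + z" and g="\<lambda>y z. y + z"]) auto

lemma Op_mult: "Op Y \<Longrightarrow> Op Z \<Longrightarrow> Op (\<lambda>n \<omega>. Y n \<omega> * Z n \<omega>)"
  by (rule Op_binary[where f="\<lambda>y z. y * z" and g="\<lambda>y z. \<bar>y\<bar> * \<bar>z\<bar>"]) (auto simp: abs_mult intro!: mult_mono)

lemma op_imp_Op: 
  assumes "op Y" shows "Op Y"
  unfolding bounded_in_prob_def
  using op_whp[OF assms, of 1] by (auto simp: with_high_prob_def)

lemma op_seq: 
  assumes "c \<longlonglongrightarrow> 0" shows "op (\<lambda>n \<omega>. c n)"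
  unfolding small_in_prob_def
proof (intro allI impI whp_eventually)
  fix \<epsilon> :: real assume "\<epsilon> > 0"
  from tendstoD[OF assms this] show "\<forall>\<^sub>F n in sequentially. \<forall>\<omega>\<in>space (M n). \<bar>c n\<bar> \<le> \<epsilon>"
    by eventually_elim (auto simp: dist_real_def)
qed

lemma Op_const: "Op (\<lambda>n \<omega>. c)"
  unfolding bounded_in_prob_def
  by (auto intro!: exI[of _ "\<bar>c\<bar>"] always_eventually bexI[of _ "space (M _)"] simp: prob_space.prob_space[OF prob_M])

lemma op_cmult: "op Y \<Longrightarrow> op (\<lambda>n \<omega>. c * Y n \<omega>)"
  using op_mult_Op[OF _ Op_const, of Y c] by (simp add: mult.commute)

lemma Op_cmult: "Op Y \<Longrightarrow> Op (\<lambda>n \<omega>. c * Y n \<omega>)"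
  by (rule Op_mult[OF Op_const])

lemma op_uminus: "op Y \<Longrightarrow> op (\<lambda>n \<omega>. - Y n \<omega>)" using op_cmult[of Y "-1"] by simp

lemma op_diff: "op Y \<Longrightarrow> op Z \<Longrightarrow> op (\<lambda>n \<omega>. Y n \<omega> - Z n \<omega>)"
  using op_add[OF _ op_uminus] by simp

lemma Op_diff: "Op Y \<Longrightarrow> Op Z \<Longrightarrow> Op (\<lambda>n \<omega>. Y n \<omega> - Z n \<omega>)"
  using Op_add[OF _ Op_cmult, of Y Z "-1"] by simp

lemma Op_of_limit: "op (\<lambda>n \<omega>. Y n \<omega> - c) \<Longrightarrow> Op Y"
  using Op_add[OF op_imp_Op Op_const, of "\<lambda>n \<omega>. Y n \<omega> - c" c] by simp

lemma Op_of_approx: "op (\<lambda>n \<omega>. Y n \<omega> - Z n \<omega>) \<Longrightarrow> Op Z \<Longrightarrow> Op Y"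
  using Op_add[OF op_imp_Op, of "\<lambda>n \<omega>. Y n \<omega> - Z n \<omega>" Z] by simp

lemma op_continuous:
  assumes X: "op (\<lambda>n \<omega>. X n \<omega> - c)" and g: "isCont g c"
  shows "op (\<lambda>n \<omega>. g (X n \<omega>) - g c)"
  unfolding small_in_prob_def
proof (intro allI impI)
  fix \<epsilon> :: real assume "\<epsilon> > 0"
  with g obtain d where d: "d > 0" "\<And>x. \<bar>x - c\<bar> < d \<Longrightarrow> \<bar>g x - g c\<bar> < \<epsilon>"
    unfolding continuous_at_eps_delta by (auto simp: dist_real_def)
  have "whp (\<lambda>n \<omega>. \<bar>X n \<omega> - c\<bar> \<le> d / 2)" using op_whp[OF X, of "d/2"] d by simp
  then show "whp (\<lambda>n \<omega>. \<bar>g (X n \<omega>) - g c\<bar> \<le> \<epsilon>)"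
    by (rule whp_mono) (use d in \<open>auto intro: less_imp_le\<close>)
qed

lemma op_mult_limits:
  assumes "op (\<lambda>n \<omega>. X n \<omega> - a)" "op (\<lambda>n \<omega>. Y n \<omega> - b)"
  shows "op (\<lambda>n \<omega>. X n \<omega> * Y n \<omega> - a * b)"
proof -
  have "op (\<lambda>n \<omega>. (X n \<omega> - a) * Y n \<omega> + a * (Y n \<omega> - b))"
    by (intro op_add op_mult_Op op_cmult assms Op_of_limit[OF assms(2)])
  then show ?thesis by (simp add: algebra_simps)
qed

lemma op_limit_mult_approx:
  assumes "op (\<lambda>n \<omega>. X n \<omega> - a)" "op (\<lambda>n \<omega>. Y n \<omega> - Z n \<omega>)" "Op Z"
  shows "op (\<lambda>n \<omega>. X n \<omega> * Y n \<omega> - a * Z n \<omega>)"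
proof -
  have "op (\<lambda>n \<omega>. (X n \<omega> - a) * Y n \<omega> + a * (Y n \<omega> - Z n \<omega>))"
    by (intro op_add op_mult_Op op_cmult assms Op_of_approx[OF assms(2,3)])
  then show ?thesis by (simp add: algebra_simps)
qed

lemma op_whp_limit_less: 
  assumes X: "op (\<lambda>n \<omega>. X n \<omega> - a)" and "a < b" shows "whp (\<lambda>n \<omega>. X n \<omega> < b)"
proof (rule whp_mono)
  show "whp (\<lambda>n \<omega>. \<bar>X n \<omega> - a\<bar> \<le> (b - a) / 2)" by (rule op_whp[OF X]) (use \<open>a < b\<close> in simp)
  fix n \<omega> assume "\<bar>X n \<omega> - a\<bar> \<le> (b - a) / 2"
  then show "X n \<omega> < b" using \<open>a < b\<close> abs_ge_self[of "X n \<omega> - a"] abs_ge_minus_self[of "X n \<omega> - a"]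
    by (simp add: field_simps)
qed

lemma op_whp_limit_greater: 
  assumes X: "op (\<lambda>n \<omega>. X n \<omega> - a)" and "b < a" shows "whp (\<lambda>n \<omega>. b < X n \<omega>)"
proof (rule whp_mono)
  show "whp (\<lambda>n \<omega>. \<bar>X n \<omega> - a\<bar> \<le> (a - b) / 2)" by (rule op_whp[OF X]) (use \<open>b < a\<close> in simp)
  fix n \<omega> assume "\<bar>X n \<omega> - a\<bar> \<le> (a - b) / 2"
  then show "b < X n \<omega>" using \<open>b < a\<close> abs_ge_self[of "X n \<omega> - a"] abs_ge_minus_self[of "X n \<omega> - a"]
    by (simp add: field_simps)
qed

lemma whp_of_prob:
  assumes "\<forall>\<^sub>F n in sequentially. {\<omega> \<in> space (M n). \<not> P n \<omega>} \<in> sets (M n)"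
    and "(\<lambda>n. measure (M n) {\<omega> \<in> space (M n). \<not> P n \<omega>}) \<longlonglongrightarrow> 0"
  shows "whp P"
  unfolding with_high_prob_def
proof (intro allI impI)
  fix \<eta> :: real assume "\<eta> > 0"
  from order_tendstoD(2)[OF assms(2) this] assms(1)
  show "\<forall>\<^sub>F n in sequentially. \<exists>A\<in>sets (M n). measure (M n) A \<ge> 1 - \<eta> \<and> (\<forall>\<omega>\<in>A. P n \<omega>)"
  proof eventually_elim
    case (elim n)
    interpret prob_space "M n" by (rule prob_M)
    show ?case
      by (rule bexI[of _ "space (M n) - {\<omega> \<in> space (M n). \<not> P n \<omega>}"])
         (use elim prob_compl[OF elim(2)] in auto)
  qed
qed

lemma prob_of_whp:
  assumes "whp P" and "\<forall>\<^sub>F n in sequentially. {\<omega> \<in> space (M n). \<not> P n \<omega>} \<in> sets (M n)"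
  shows "(\<lambda>n. measure (M n) {\<omega> \<in> space (M n). \<not> P n \<omega>}) \<longlonglongrightarrow> 0"
proof (rule tendstoI)
  fix e :: real assume e: "e > 0"
  then have "e / 2 > 0" by simp
  from assms(1)[unfolded with_high_prob_def, rule_format, OF this] assms(2)
  show "\<forall>\<^sub>F n in sequentially. dist (measure (M n) {\<omega> \<in> space (M n). \<not> P n \<omega>}) 0 < e"
  proof eventually_elim
    case (elim n)
    interpret prob_space "M n" by (rule prob_M)
    from elim obtain A where A: "A \<in> sets (M n)" "measure (M n) A \<ge> 1 - e / 2" "\<forall>\<omega>\<in>A. P n \<omega>" by blast
    have "prob {\<omega> \<in> space (M n). \<not> P n \<omega>} \<le> prob (space (M n) - A)"
      using A elim by (intro finite_measure_mono) auto
    also have "\<dots> \<le> e / 2" using prob_compl[OF A(1)] A by simp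
    finally show ?case using e by (simp add: dist_real_def)
  qed
qed

lemma op_of_convergence:
  assumes "converges_in_probability M Y c" shows "op (\<lambda>n \<omega>. Y n \<omega> - c)"
  unfolding small_in_prob_def
proof (intro allI impI)
  fix \<epsilon> :: real assume "\<epsilon> > 0"
  have "\<forall>\<^sub>F n in sequentially. {\<omega> \<in> space (M n). \<not> \<bar>Y n \<omega> - c\<bar> \<le> \<epsilon>} \<in> sets (M n)"
    using assms[unfolded converges_in_probability_def, THEN conjunct1]
    by eventually_elim measurable
  then show "whp (\<lambda>n \<omega>. \<bar>Y n \<omega> - c\<bar> \<le> \<epsilon>)"
    by (rule whp_of_prob) (use assms \<open>\<epsilon> > 0\<close> in \<open>auto simp: converges_in_probability_def not_le\<close>)
qed

lemma convergence_of_op: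
  assumes "op (\<lambda>n \<omega>. Y n \<omega> - c)" "\<forall>\<^sub>F n in sequentially. Y n \<in> borel_measurable (M n)"
  shows "converges_in_probability M Y c"
  unfolding converges_in_probability_def
proof (intro conjI allI impI assms(2))
  fix \<epsilon> :: real assume "\<epsilon> > 0"
  have "\<forall>\<^sub>F n in sequentially. {\<omega> \<in> space (M n). \<not> \<bar>Y n \<omega> - c\<bar> \<le> \<epsilon>} \<in> sets (M n)"
    using assms(2) by eventually_elim measurable
  from prob_of_whp[OF op_whp[OF assms(1) \<open>\<epsilon> > 0\<close>] this]
  show "(\<lambda>n. measure (M n) {\<omega> \<in> space (M n). \<epsilon> < \<bar>Y n \<omega> - c\<bar>}) \<longlonglongrightarrow> 0" by (simp add: not_le)
qed

lemma markov_event: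
  assumes Y[measurable]: "Y \<in> borel_measurable (M n)" and E: "(\<integral>\<^sup>+\<omega>. ennreal \<bar>Y \<omega>\<bar> \<partial>M n) \<le> ennreal K" and B: "B > 0" "K \<ge> 0"
  shows "\<exists>A\<in>sets (M n). measure (M n) A \<ge> 1 - K / B \<and> (\<forall>\<omega>\<in>A. \<bar>Y \<omega>\<bar> \<le> B)"
proof -
  interpret prob_space "M n" by (rule prob_M)
  let ?S = "{\<omega> \<in> space (M n). \<bar>Y \<omega>\<bar> \<ge> B}"
  have "emeasure (M n) ?S \<le> ennreal (1 / B) * (\<integral>\<^sup>+\<omega>. ennreal \<bar>Y \<omega>\<bar> * indicator (space (M n)) \<omega> \<partial>M n)"
  proof -
    have "?S = {x \<in> space (M n). 1 \<le> ennreal (1 / B) * ennreal \<bar>Y x\<bar>}"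
      using B by (auto simp: ennreal_mult[symmetric] ennreal_1[symmetric] simp del: ennreal_1)
    also have "emeasure (M n) \<dots> \<le> ennreal (1 / B) * (\<integral>\<^sup>+\<omega>. ennreal \<bar>Y \<omega>\<bar> * indicator (space (M n)) \<omega> \<partial>M n)"
      by (rule nn_integral_Markov_inequality) auto
    finally show ?thesis .
  qed
  also have "\<dots> \<le> ennreal (1 / B) * ennreal K"
    using E by (intro mult_left_mono) (auto cong: nn_integral_cong simp: nn_integral_cong[of "M n" "\<lambda>\<omega>. ennreal \<bar>Y \<omega>\<bar> * indicator (space (M n)) \<omega>" "\<lambda>\<omega>. ennreal \<bar>Y \<omega>\<bar>"])
  also have "\<dots> = ennreal (K / B)" using B by (simp add: ennreal_mult'[symmetric])
  finally have S: "prob ?S \<le> K / B" using B by (simp add: emeasure_eq_measure)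
  show ?thesis
    by (rule bexI[of _ "space (M n) - ?S"]) (use prob_compl[of ?S] S in auto)
qed

lemma Op_of_moment:
  assumes Y: "\<forall>\<^sub>F n in sequentially. Y n \<in> borel_measurable (M n) \<and> (\<integral>\<^sup>+\<omega>. ennreal \<bar>Y n \<omega>\<bar> \<partial>M n) \<le> ennreal K"
  shows "Op Y"
  unfolding bounded_in_prob_def
proof (intro allI impI exI)
  fix \<eta> :: real assume "\<eta> > 0"
  show "\<forall>\<^sub>F n in sequentially. \<exists>A\<in>sets (M n). measure (M n) A \<ge> 1 - \<eta> \<and> (\<forall>\<omega>\<in>A. \<bar>Y n \<omega>\<bar> \<le> (\<bar>K\<bar> + 1) / \<eta>)"
    using Y
  proof eventually_elim
    case (elim n)
    have "ennreal K \<le> ennreal (\<bar>K\<bar> + 1)" by (intro ennreal_leI) auto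
    with elim have "(\<integral>\<^sup>+\<omega>. ennreal \<bar>Y n \<omega>\<bar> \<partial>M n) \<le> ennreal (\<bar>K\<bar> + 1)" by (meson order_trans)
    moreover have "(\<bar>K\<bar> + 1) / ((\<bar>K\<bar> + 1) / \<eta>) = \<eta>" "(\<bar>K\<bar> + 1) / \<eta> > 0" using \<open>\<eta> > 0\<close> by (auto simp: add_nonneg_pos add_eq_0_iff)
    ultimately show ?case
      using markov_event[of "Y n" n "\<bar>K\<bar> + 1" "(\<bar>K\<bar> + 1) / \<eta>"] elim by simp
  qed
qed

lemma op_of_moment:
  assumes Y: "\<forall>\<^sub>F n in sequentially. Y n \<in> borel_measurable (M n) \<and> (\<integral>\<^sup>+\<omega>. ennreal \<bar>Y n \<omega>\<bar> \<partial>M n) \<le> ennreal (K n)"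
    and K: "K \<longlonglongrightarrow> 0"
  shows "op Y"
  unfolding small_in_prob_def with_high_prob_def
proof (intro allI impI)
  fix \<epsilon> \<eta> :: real assume e: "\<epsilon> > 0" "\<eta> > 0"
  then have "\<epsilon> * \<eta> > 0" by simp
  from order_tendstoD(2)[OF K this] Y
  show "\<forall>\<^sub>F n in sequentially. \<exists>A\<in>sets (M n). measure (M n) A \<ge> 1 - \<eta> \<and> (\<forall>\<omega>\<in>A. \<bar>Y n \<omega>\<bar> \<le> \<epsilon>)"
  proof eventually_elim
    case (elim n)
    have "ennreal (K n) \<le> ennreal (\<epsilon> * \<eta>)" using elim by (intro ennreal_leI) auto
    with elim have "(\<integral>\<^sup>+\<omega>. ennreal \<bar>Y n \<omega>\<bar> \<partial>M n) \<le> ennreal (\<epsilon> * \<eta>)" by (meson order_trans)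
    then show ?case using markov_event[of "Y n" n "\<epsilon> * \<eta>" \<epsilon>] elim e by simp
  qed
qed

lemma grid_bounds:
  fixes a e p :: real assumes "e > 0"
  shows "a / e \<le> p \<Longrightarrow> a \<le> (p + 1) * e - e" "p < a / e + 1 \<Longrightarrow> (p + 1) * e < a + 2 * e"
    "p \<le> a / e \<Longrightarrow> (p - 1) * e + e \<le> a" "a / e < p + 1 \<Longrightarrow> a - 2 * e < (p - 1) * e"
  using assms by (simp_all add: field_simps)

text \<open>
  If \<open>L\<close> and \<open>A\<close> lay more than two mesh widths apart, one of the finitely many levels of a grid
  covering the range of \<open>A\<close> would separate them with room to spare; each such event is improbable.
\<close>

lemma op_by_level_events:
  assumes A: "Op A"
    and up: "\<And>z \<epsilon>. \<epsilon> > 0 \<Longrightarrow> whp (\<lambda>n \<omega>. \<not> (L n \<omega> > z \<and> A n \<omega> \<le> z - \<epsilon>))"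
    and dn: "\<And>z \<epsilon>. \<epsilon> > 0 \<Longrightarrow> whp (\<lambda>n \<omega>. \<not> (L n \<omega> \<le> z \<and> A n \<omega> \<ge> z + \<epsilon>))"
  shows "op (\<lambda>n \<omega>. L n \<omega> - A n \<omega>)"
  unfolding small_in_prob_def with_high_prob_def
proof (intro allI impI)
  fix \<epsilon> \<eta> :: real assume "\<epsilon> > 0" "\<eta> > 0"
  define e where "e = \<epsilon> / 2"
  have e: "e > 0" using \<open>\<epsilon> > 0\<close> by (simp add: e_def)
  have h: "\<eta> / 2 > 0" using \<open>\<eta> > 0\<close> by simp
  obtain B where B: "B > 0" "\<forall>\<^sub>F n in sequentially. \<exists>S\<in>sets (M n). measure (M n) S \<ge> 1 - \<eta> / 2 \<and> (\<forall>\<omega>\<in>S. \<bar>A n \<omega>\<bar> \<le> B)"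
    using Op_whp_bound[OF A h] by blast
  define J where "J = {- (\<lceil>B / e\<rceil> + 2) .. \<lceil>B / e\<rceil> + 2}"
  have J: "\<lceil>a / e\<rceil> + 1 \<in> J" "\<lfloor>a / e\<rfloor> - 1 \<in> J" if "\<bar>a\<bar> \<le> B" for a
  proof -
    have 1: "a / e \<le> B / e" using that e by (intro divide_right_mono) linarith+
    have 2: "- B / e \<le> a / e" using that e by (intro divide_right_mono) linarith+
    have 3: "\<lceil>a / e\<rceil> \<le> \<lceil>B / e\<rceil>" using 1 by (rule ceiling_mono)
    have "real_of_int (- \<lceil>B / e\<rceil>) \<le> - B / e" using le_of_int_ceiling[of "B / e"] by simp
    then have 4: "- \<lceil>B / e\<rceil> \<le> \<lfloor>a / e\<rfloor>" using 2 unfolding le_floor_iff by linarith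
    have 5: "\<lfloor>a / e\<rfloor> \<le> \<lceil>a / e\<rceil>" by (rule floor_le_ceiling)
    show "\<lceil>a / e\<rceil> + 1 \<in> J" "\<lfloor>a / e\<rfloor> - 1 \<in> J"
      unfolding J_def atLeastAtMost_iff using 3 4 5 by linarith+
  qed
  have "whp (\<lambda>n \<omega>. \<forall>j\<in>J. \<not> (L n \<omega> > real_of_int j * e \<and> A n \<omega> \<le> real_of_int j * e - e) \<and> \<not> (L n \<omega> \<le> real_of_int j * e \<and> A n \<omega> \<ge> real_of_int j * e + e))"
    by (intro whp_finite whp_conj up dn e) (simp add: J_def)
  from this[unfolded with_high_prob_def, rule_format, OF h] B(2)
  show "\<forall>\<^sub>F n in sequentially. \<exists>S\<in>sets (M n). measure (M n) S \<ge> 1 - \<eta> \<and> (\<forall>\<omega>\<in>S. \<bar>L n \<omega> - A n \<omega>\<bar> \<le> \<epsilon>)"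
  proof eventually_elim
    case (elim n)
    then obtain S S' where S: "S \<in> sets (M n)" "S' \<in> sets (M n)" "measure (M n) S \<ge> 1 - \<eta>/2" "measure (M n) S' \<ge> 1 - \<eta>/2"
      and S1: "\<And>\<omega> j. \<omega> \<in> S \<Longrightarrow> j \<in> J \<Longrightarrow> \<not> (L n \<omega> > real_of_int j * e \<and> A n \<omega> \<le> real_of_int j * e - e) \<and> \<not> (L n \<omega> \<le> real_of_int j * e \<and> A n \<omega> \<ge> real_of_int j * e + e)"
      and S2: "\<And>\<omega>. \<omega> \<in> S' \<Longrightarrow> \<bar>A n \<omega>\<bar> \<le> B" by blast
    have "\<bar>L n \<omega> - A n \<omega>\<bar> \<le> \<epsilon>" if w: "\<omega> \<in> S \<inter> S'" for \<omega>
    proof -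
      let ?a = "A n \<omega>"
      have a: "\<bar>?a\<bar> \<le> B" using S2 w by auto
      have "of_int \<lceil>?a / e\<rceil> < ?a / e + 1" "?a / e < of_int \<lfloor>?a / e\<rfloor> + 1" by linarith+
      note fc = this
      have 1: "?a \<le> real_of_int (\<lceil>?a / e\<rceil> + 1) * e - e" "real_of_int (\<lceil>?a / e\<rceil> + 1) * e < ?a + 2 * e"
        unfolding of_int_add of_int_1 
        using grid_bounds(1)[OF e le_of_int_ceiling] grid_bounds(2)[OF e fc(1)] by blast+
      have 2: "?a \<ge> real_of_int (\<lfloor>?a / e\<rfloor> - 1) * e + e" "real_of_int (\<lfloor>?a / e\<rfloor> - 1) * e > ?a - 2 * e"
        unfolding of_int_diff of_int_1 
        using grid_bounds(3)[OF e of_int_floor_le] grid_bounds(4)[OF e fc(2)] by blast+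
      have "L n \<omega> \<le> ?a + 2 * e"
      proof -
        have "\<omega> \<in> S" using w by blast
        from S1[OF this J(1)[OF a]] show ?thesis using 1 by (meson less_imp_le not_le_imp_less order_trans)
      qed
      moreover have "L n \<omega> \<ge> ?a - 2 * e"
      proof -
        have "\<omega> \<in> S" using w by blast
        from S1[OF this J(2)[OF a]] show ?thesis using 2 by (meson less_imp_le not_le_imp_less order_trans)
      qed
      ultimately show ?thesis by (simp add: e_def abs_le_iff)
    qed
    then show ?case using S Int_prob[of S n S' "\<eta>/2" "\<eta>/2"] by (intro bexI[of _ "S \<inter> S'"]) auto
  qed
qed

end

section \<open>Order statistics and exceedances of a threshold\<close>

definition exceed :: "(nat \<Rightarrow> real) \<Rightarrow> nat \<Rightarrow> real \<Rightarrow> real" where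
  "exceed x n y = (\<Sum>j=1..n. of_bool (y < x j))"

lemma sorted_nth_gt_iff:
  fixes xs :: "real list"
  assumes "sorted xs" "m < length xs"
  shows "y < xs ! m \<longleftrightarrow> length xs - m \<le> length (filter (\<lambda>z. y < z) xs)"
proof
  assume y: "y < xs ! m"
  have "filter (\<lambda>z. y < z) (drop m xs) = drop m xs"
  proof (rule filter_True, rule ballI)
    fix z assume "z \<in> set (drop m xs)"
    then obtain i where i: "i < length xs - m" "z = xs ! (m + i)" by (auto simp: in_set_conv_nth)
    then have "xs ! m \<le> z" using assms by (auto intro: sorted_nth_mono)
    with y show "y < z" by simp
  qed
  moreover have "length (filter (\<lambda>z. y < z) xs) = length (filter (\<lambda>z. y < z) (take m xs)) + length (filter (\<lambda>z. y < z) (drop m xs))"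
    by (metis append_take_drop_id filter_append length_append)
  ultimately show "length xs - m \<le> length (filter (\<lambda>z. y < z) xs)" by simp
next
  assume l: "length xs - m \<le> length (filter (\<lambda>z. y < z) xs)"
  show "y < xs ! m"
  proof (rule ccontr)
    assume "\<not> y < xs ! m"
    then have y: "xs ! m \<le> y" by simp
    have "filter (\<lambda>z. y < z) (take (Suc m) xs) = []"
    proof (rule filter_False, rule ballI)
      fix z assume "z \<in> set (take (Suc m) xs)"
      then obtain i where i: "i \<le> m" "z = xs ! i" using assms(2) by (auto simp: in_set_conv_nth less_Suc_eq_le)
      then have "z \<le> xs ! m" using assms by (auto intro: sorted_nth_mono)
      with y show "\<not> y < z" by simp
    qed
    moreover have "length (filter (\<lambda>z. y < z) xs) = length (filter (\<lambda>z. y < z) (take (Suc m) xs)) + length (filter (\<lambda>z. y < z) (drop (Suc m) xs))"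
      by (metis append_take_drop_id filter_append length_append)
    moreover have "length (filter (\<lambda>z. y < z) (drop (Suc m) xs)) \<le> length xs - Suc m"
      using length_filter_le[of "\<lambda>z. y < z" "drop (Suc m) xs"] by simp
    ultimately show False using l assms(2) by simp
  qed
qed

text \<open>
  In a sorted list the entries above a level form a final segment, so its length decides the matter.
\<close>

lemma order_stat_gt_iff:
  assumes "k < n"
  shows "y < order_stat x n (n - k) \<longleftrightarrow> real k < exceed x n y"
proof -
  let ?l = "map x [1..<Suc n]"
  have len: "length (sort ?l) = n" by simp
  have "length (filter (\<lambda>z. y < z) (sort ?l)) = length (filter (\<lambda>z. y < z) ?l)"
    by (metis mset_filter mset_sort size_mset)
  also have "\<dots> = length (filter (\<lambda>j. y < x j) [1..<Suc n])"
    by (simp add: filter_map o_def del: upt_Suc)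
  also have "\<dots> = card (set (filter (\<lambda>j. y < x j) [1..<Suc n]))"
    by (rule distinct_card[symmetric]) (simp del: upt_Suc)
  also have "set (filter (\<lambda>j. y < x j) [1..<Suc n]) = {1..n} \<inter> {j. y < x j}" by auto
  finally have c: "length (filter (\<lambda>z. y < z) (sort ?l)) = card ({1..n} \<inter> {j. y < x j})" .
  have e: "exceed x n y = real (card ({1..n} \<inter> {j. y < x j}))"
    unfolding exceed_def by (subst sum_of_bool_eq) simp_all
  have "y < order_stat x n (n - k) \<longleftrightarrow> n - (n - k - 1) \<le> card ({1..n} \<inter> {j. y < x j})"
    unfolding order_stat_def using sorted_nth_gt_iff[of "sort ?l" "n - k - 1" y] assms len c by (simp del: upt_Suc)
  also have "\<dots> \<longleftrightarrow> real k < exceed x n y" unfolding e using assms by auto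
  finally show ?thesis .
qed

text \<open>
  The top \<open>k\<close> observations are the only ones that can exceed the threshold, so sums over them are
  sums over the whole sample.
\<close>

lemma sum_top_order_stats:
  assumes k: "k < n" and g: "\<And>z. z \<le> order_stat x n (n - k) \<Longrightarrow> g z = (0::real)"
  shows "(\<Sum>i=1..k. g (order_stat x n (n - k + i))) = (\<Sum>j=1..n. g (x j))"
proof -
  let ?l = "map x [1..<Suc n]"
  let ?s = "sort ?l"
  have len: "length ?s = n" by simp
  have "(\<Sum>j=1..n. g (x j)) = sum_list (map g ?l)"
    by (simp only: map_map interv_sum_list_conv_sum_set_nat set_upt o_def atLeastLessThanSuc_atLeastAtMost)
  also have "\<dots> = sum_list (map g ?s)"
    by (metis mset_map mset_sort sum_mset_sum_list)
  also have "\<dots> = (\<Sum>m = 0..<n. g (?s ! m))" by (simp add: sum_list_sum_nth del: upt_Suc)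
  also have "\<dots> = (\<Sum>m = 0..<n-k. g (?s ! m)) + (\<Sum>m = n-k..<n. g (?s ! m))"
    using k by (simp add: sum.atLeastLessThan_concat)
  also have "(\<Sum>m = 0..<n-k. g (?s ! m)) = 0"
  proof (rule sum.neutral, rule ballI)
    fix m assume m: "m \<in> {0..<n-k}"
    have "?s ! m \<le> ?s ! (n - k - 1)" using m len by (intro sorted_nth_mono) auto
    then show "g (?s ! m) = 0" by (intro g) (simp add: order_stat_def del: upt_Suc)
  qed
  also have "(\<Sum>m = n-k..<n. g (?s ! m)) = (\<Sum>i=1..k. g (?s ! (n - k + i - 1)))"
    using k by (intro sum.reindex_bij_witness[where i="\<lambda>i. n - k + i - 1" and j="\<lambda>m. m + 1 - (n - k)"]) auto
  finally show ?thesis by (simp add: order_stat_def del: upt_Suc)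
qed

lemma order_stat_mono:
  assumes "1 \<le> i" "i \<le> j" "j \<le> n"
  shows "order_stat x n i \<le> order_stat x n j"
  unfolding order_stat_def by (rule sorted_nth_mono) (use assms in auto)

text \<open>
  Both excesses vanish at the threshold, hence ties with the order statistic contribute nothing.
\<close>

definition log_excess :: "real \<Rightarrow> real \<Rightarrow> real" where
  "log_excess t z = (if t < z then ln (z / t) else 0)"

definition power_excess :: "real \<Rightarrow> real \<Rightarrow> real \<Rightarrow> real" where
  "power_excess s t z = (if t < z then (z / t) powr s - 1 else 0)"

lemma hill_eq_log_excess:
  assumes "k < n" and u: "u = order_stat x n (n - k)" "u > 0"
  shows "hill x k n = (\<Sum>j=1..n. log_excess u (x j)) / real k"
proof -
  have "(\<Sum>i=1..k. ln (order_stat x n (n - k + i) / order_stat x n (n - k))) = (\<Sum>i=1..k. log_excess u (order_stat x n (n - k + i)))"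
  proof (rule sum.cong)
    fix i assume "i \<in> {1..k}"
    then have "u \<le> order_stat x n (n - k + i)" unfolding u(1) using assms by (intro order_stat_mono) auto
    then show "ln (order_stat x n (n - k + i) / order_stat x n (n - k)) = log_excess u (order_stat x n (n - k + i))"
      using u by (auto simp: log_excess_def)
  qed simp
  also have "\<dots> = (\<Sum>j=1..n. log_excess u (x j))"
    using assms by (intro sum_top_order_stats) (auto simp: log_excess_def)
  finally show ?thesis by (simp add: hill_def)
qed

lemma excess_moment_eq_power_excess:
  assumes "k < n" "0 < k" and u: "u = order_stat x n (n - k)" "u > 0"
  shows "excess_moment x k n s = 1 + (\<Sum>j=1..n. power_excess s u (x j)) / real k"
proof -
  have "(\<Sum>i=1..k. (order_stat x n (n - k + i) / order_stat x n (n - k)) powr s) = (\<Sum>i=1..k. 1 + power_excess s u (order_stat x n (n - k + i)))"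
  proof (rule sum.cong)
    fix i assume "i \<in> {1..k}"
    then have "u \<le> order_stat x n (n - k + i)" unfolding u(1) using assms by (intro order_stat_mono) auto
    then show "(order_stat x n (n - k + i) / order_stat x n (n - k)) powr s = 1 + power_excess s u (order_stat x n (n - k + i))"
      using u by (auto simp: power_excess_def)
  qed simp
  also have "\<dots> = real k + (\<Sum>i=1..k. power_excess s u (order_stat x n (n - k + i)))" by (simp add: sum.distrib)
  also have "(\<Sum>i=1..k. power_excess s u (order_stat x n (n - k + i))) = (\<Sum>j=1..n. power_excess s u (x j))"
    using assms by (intro sum_top_order_stats) (auto simp: power_excess_def)
  finally show ?thesis using assms by (simp add: excess_moment_def add_divide_distrib)
qed

text \<open>
  The counts above and weakly above the order statistic enclose \<open>k\<close>, also when there are ties.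
\<close>

lemma exceed_order_stat:
  assumes "k < n" and u: "u = order_stat x n (n - k)"
  shows "exceed x n u \<le> real k" "real k < (\<Sum>j=1..n. of_bool (u \<le> x j))"
proof -
  show "exceed x n u \<le> real k" using order_stat_gt_iff[OF assms(1), of u x] u by simp
  define S where "S = {y \<in> x ` {1..n}. y < u}"
  \<comment> \<open>no observation lies strictly between v and u\<close>
  define v where "v = (if S = {} then u - 1 else Max S)"
  have f: "finite S" by (simp add: S_def)
  have v: "v < u"
  proof (cases "S = {}")
    case False
    then show ?thesis using Max_in[OF f False] by (auto simp: v_def S_def)
  qed (simp add: v_def)
  have v2: "x j \<le> v" if "j \<in> {1..n}" "x j < u" for j
  proof -
    have "x j \<in> S" using that by (auto simp: S_def)
    then show ?thesis using Max_ge[OF f, of "x j"] by (auto simp: v_def)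
  qed
  have "real k < exceed x n v" using order_stat_gt_iff[OF assms(1), of v x] u v by simp
  also have "exceed x n v \<le> (\<Sum>j=1..n. of_bool (u \<le> x j))"
    unfolding exceed_def
  proof (rule sum_mono)
    fix j assume "j \<in> {1..n}"
    from v2[OF this] show "of_bool (v < x j) \<le> (of_bool (u \<le> x j) :: real)" by (cases "x j < u") auto
  qed
  finally show "real k < (\<Sum>j=1..n. of_bool (u \<le> x j))" .
qed

text \<open>
  Passing from \<open>t\<close> to \<open>u\<close> lowers the term of each observation by \<open>l\<close> if it exceeds both thresholds,
  and by an amount between \<open>0\<close> and \<open>l\<close> if it lies between them. The total is thus enclosed by \<open>l\<close>
  times the counts at \<open>t\<close> and at \<open>u\<close>; the latter encloses \<open>k\<close>, and both lie on the same side.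
\<close>

lemma log_excess_threshold_change:
  assumes k: "k < n" and u: "u = order_stat x n (n - k)" "u > 0" and t: "t > 0"
  defines "l \<equiv> ln (u / t)"
  shows "\<bar>(\<Sum>j=1..n. log_excess u (x j)) - (\<Sum>j=1..n. log_excess t (x j)) + real k * l\<bar> \<le> \<bar>l\<bar> * \<bar>exceed x n t - real k\<bar>"
proof -
  let ?D = "(\<Sum>j=1..n. log_excess u (x j) - log_excess t (x j))"
  let ?N' = "(\<Sum>j=1..n. of_bool (u \<le> x j)) :: real"
  have D: "(\<Sum>j=1..n. log_excess u (x j)) - (\<Sum>j=1..n. log_excess t (x j)) = ?D" by (simp add: sum_subtractf)
  have ll: "ln (z / t) = ln (z / u) + l" if "z > 0" for z using that u t by (simp add: l_def ln_div)
  have lpos: "l \<ge> 0 \<longleftrightarrow> t \<le> u" using u t by (simp add: l_def ln_div)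
  have mono: "ln (z / u) \<le> 0 \<longleftrightarrow> z \<le> u" if "z > 0" for z using that u by (simp add: ln_div)
  have mono': "ln (z / t) \<le> 0 \<longleftrightarrow> z \<le> t" if "z > 0" for z using that t by (simp add: ln_div)
  note ord = exceed_order_stat[OF k u(1)]
  show ?thesis
  proof (cases "t \<le> u")
    case True
    then have l: "l \<ge> 0" using lpos by simp
    have "?D \<ge> (\<Sum>j=1..n. - l * of_bool (t < x j))"
    proof (rule sum_mono)
      fix j
      show "- l * of_bool (t < x j) \<le> log_excess u (x j) - log_excess t (x j)"
        using ll[of "x j"] mono[of "x j"] True t u l by (auto simp: log_excess_def)
    qed
    then have lo: "?D \<ge> - l * exceed x n t" by (simp only: exceed_def sum_distrib_left)
    have "?D \<le> (\<Sum>j=1..n. - l * of_bool (u \<le> x j))"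
    proof (rule sum_mono)
      fix j
      show "log_excess u (x j) - log_excess t (x j) \<le> - l * of_bool (u \<le> x j)"
      proof -
        consider "u < x j" | "x j = u" | "x j < u" by linarith
        then show ?thesis
        proof cases
          case 1
          then show ?thesis using ll[of "x j"] True t u by (simp add: log_excess_def)
        next
          case 2
          have "log_excess t u = l" using True u t by (auto simp: log_excess_def l_def)
          then show ?thesis using 2 by (simp add: log_excess_def[of u])
        next
          case 3
          then show ?thesis using mono'[of "x j"] True t by (simp add: log_excess_def not_le[symmetric])
        qed
      qed
    qed
    then have "?D \<le> - l * ?N'" by (simp only: sum_distrib_left)
    also have "\<dots> \<le> - l * real k" using l ord(2) by (simp add: mult_left_mono)
    finally have hi: "?D + real k * l \<le> 0" by (simp add: mult.commute)
    have "- (?D + real k * l) \<le> l * (exceed x n t - real k)" using lo by (simp add: algebra_simps)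
    also have "\<dots> \<le> \<bar>l\<bar> * \<bar>exceed x n t - real k\<bar>" by (metis abs_ge_self abs_mult)
    finally show ?thesis unfolding D using hi by simp
  next
    case False
    then have l: "l \<le> 0" using lpos by simp
    have "?D \<ge> (\<Sum>j=1..n. - l * of_bool (t < x j))"
    proof (rule sum_mono)
      fix j
      show "- l * of_bool (t < x j) \<le> log_excess u (x j) - log_excess t (x j)"
        using ll[of "x j"] mono[of "x j"] False t u l by (auto simp: log_excess_def)
    qed
    then have lo: "?D \<ge> - l * exceed x n t" by (simp only: exceed_def sum_distrib_left)
    have "?D \<le> (\<Sum>j=1..n. - l * of_bool (u < x j))"
    proof (rule sum_mono)
      fix j
      show "log_excess u (x j) - log_excess t (x j) \<le> - l * of_bool (u < x j)"
        using ll[of "x j"] mono'[of "x j"] False t u l by (auto simp: log_excess_def)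
    qed
    then have "?D \<le> - l * exceed x n u" by (simp only: exceed_def sum_distrib_left)
    also have "\<dots> \<le> - l * real k" using l ord(1) by (intro mult_left_mono) auto
    finally have hi: "?D + real k * l \<le> 0" by (simp add: mult.commute)
    have "- (?D + real k * l) \<le> l * (exceed x n t - real k)" using lo by (simp add: algebra_simps)
    also have "\<dots> \<le> \<bar>l\<bar> * \<bar>exceed x n t - real k\<bar>" by (metis abs_ge_self abs_mult)
    finally show ?thesis unfolding D using hi by simp
  qed
qed

text \<open>
  The same enclosure, after rescaling by the factor \<open>q\<close> that makes the terms of observations above
  both thresholds agree.
\<close>

lemma power_excess_threshold_change:
  assumes k: "k < n" and u: "u = order_stat x n (n - k)" "u > 0" and t: "t > 0" and s: "s \<le> 0"
  defines "q \<equiv> (u / t) powr s"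
  shows "\<bar>q * (real k + (\<Sum>j=1..n. power_excess s u (x j))) - (real k + (\<Sum>j=1..n. power_excess s t (x j)))\<bar> \<le> \<bar>q - 1\<bar> * \<bar>exceed x n t - real k\<bar>"
proof -
  let ?D = "(\<Sum>j=1..n. power_excess s t (x j) - q * power_excess s u (x j))"
  let ?N' = "(\<Sum>j=1..n. of_bool (u \<le> x j)) :: real"
  have D: "q * (real k + (\<Sum>j=1..n. power_excess s u (x j))) - (real k + (\<Sum>j=1..n. power_excess s t (x j))) = - (?D - (q - 1) * real k)" 
    by (simp add: sum_subtractf sum_distrib_left algebra_simps)
  have qq: "(z / t) powr s = q * (z / u) powr s" if "z > 0" for z
    using that u t by (simp add: q_def powr_divide)
  note ord = exceed_order_stat[OF k u(1)]
  have anti: "(z / w) powr s \<le> 1" if "w \<le> z" "w > 0" for z w :: real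
  proof -
    have "(z / w) powr s \<le> 1 powr s" using that s by (intro powr_mono2') auto
    then show ?thesis by simp
  qed
  have anti': "(z / w) powr s \<ge> 1" if "z \<le> w" "w > 0" "z > 0" for z w :: real
  proof -
    have "1 powr s \<le> (z / w) powr s" using that s by (intro powr_mono2') auto
    then show ?thesis by simp
  qed
  have qpos: "q > 0" using u t by (simp add: q_def)
  show ?thesis
  proof (cases "t \<le> u")
    case True
    then have q: "q \<le> 1" using anti[of t u] t by (simp add: q_def)
    have "?D \<ge> (\<Sum>j=1..n. (q - 1) * of_bool (t < x j))"
    proof (rule sum_mono)
      fix j
      have "t < x j \<Longrightarrow> x j \<le> u \<Longrightarrow> q \<le> (x j / t) powr s"
        unfolding q_def using t s by (intro powr_mono2') (auto simp: divide_right_mono)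
      then show "(q - 1) * of_bool (t < x j) \<le> power_excess s t (x j) - q * power_excess s u (x j)"
        using qq[of "x j"] True t u by (auto simp: power_excess_def algebra_simps not_less)
    qed
    then have lo: "?D \<ge> (q - 1) * exceed x n t" by (simp only: exceed_def sum_distrib_left)
    have "?D \<le> (\<Sum>j=1..n. (q - 1) * of_bool (u \<le> x j))"
    proof (rule sum_mono)
      fix j
      show "power_excess s t (x j) - q * power_excess s u (x j) \<le> (q - 1) * of_bool (u \<le> x j)"
      proof -
        consider "u < x j" | "x j = u" | "x j < u" by linarith
        then show ?thesis
        proof cases
          case 1
          then show ?thesis using qq[of "x j"] True t u by (simp add: power_excess_def algebra_simps)
        next
          case 2
          have "power_excess s t u = q - 1" using True u t by (auto simp: power_excess_def q_def)
          then show ?thesis using 2 by (simp add: power_excess_def[of s u])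
        next
          case 3
          then show ?thesis using anti[of t "x j"] True t by (simp add: power_excess_def)
        qed
      qed
    qed
    then have "?D \<le> (q - 1) * ?N'" by (simp only: sum_distrib_left)
    also have "\<dots> \<le> (q - 1) * real k" using q ord(2) by (intro mult_left_mono_neg) auto
    finally have hi: "?D - (q - 1) * real k \<le> 0" by simp
    have "- (?D - (q - 1) * real k) \<le> - ((q - 1) * (exceed x n t - real k))" using lo by (simp add: algebra_simps)
    also have "\<dots> \<le> \<bar>q - 1\<bar> * \<bar>exceed x n t - real k\<bar>" by (metis abs_ge_minus_self abs_mult)
    finally show ?thesis unfolding D using hi by simp
  next
    case False
    then have q: "q \<ge> 1" using anti'[of u t] t u by (simp add: q_def)
    have "?D \<ge> (\<Sum>j=1..n. (q - 1) * of_bool (t < x j))"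
    proof (rule sum_mono)
      fix j
      have "u < x j \<Longrightarrow> q * (x j / u) powr s \<le> q" using anti[of u "x j"] u qpos by simp
      then show "(q - 1) * of_bool (t < x j) \<le> power_excess s t (x j) - q * power_excess s u (x j)"
        using qq[of "x j"] False t u by (auto simp: power_excess_def algebra_simps not_less)
    qed
    then have lo: "?D \<ge> (q - 1) * exceed x n t" by (simp only: exceed_def sum_distrib_left)
    have "?D \<le> (\<Sum>j=1..n. (q - 1) * of_bool (u < x j))"
    proof (rule sum_mono)
      fix j
      show "power_excess s t (x j) - q * power_excess s u (x j) \<le> (q - 1) * of_bool (u < x j)"
        using qq[of "x j"] False t u anti'[of "x j" t] by (auto simp: power_excess_def algebra_simps not_less)
    qed
    then have "?D \<le> (q - 1) * exceed x n u" by (simp only: exceed_def sum_distrib_left)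
    also have "\<dots> \<le> (q - 1) * real k" using q ord(1) by (intro mult_left_mono) auto
    finally have hi: "?D - (q - 1) * real k \<le> 0" by simp
    have "- (?D - (q - 1) * real k) \<le> - ((q - 1) * (exceed x n t - real k))" using lo by (simp add: algebra_simps)
    also have "\<dots> \<le> \<bar>q - 1\<bar> * \<bar>exceed x n t - real k\<bar>" by (metis abs_ge_minus_self abs_mult)
    finally show ?thesis unfolding D using hi by simp
  qed
qed

lemma borel_measurable_exceed:
  assumes "\<And>j. j \<in> {1..n} \<Longrightarrow> X j \<in> borel_measurable M"
  shows "(\<lambda>\<omega>. exceed (\<lambda>j. X j \<omega>) n y) \<in> borel_measurable M"
  unfolding exceed_def
proof (rule borel_measurable_sum)
  fix j assume "j \<in> {1..n}"
  note assms[OF this, measurable]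
  show "(\<lambda>\<omega>. of_bool (y < X j \<omega>) :: real) \<in> borel_measurable M" by measurable
qed

lemma borel_measurable_order_stat:
  assumes "k < n" "\<And>j. j \<in> {1..n} \<Longrightarrow> X j \<in> borel_measurable M"
  shows "(\<lambda>\<omega>. order_stat (\<lambda>j. X j \<omega>) n (n - k)) \<in> borel_measurable M"
proof (subst borel_measurable_iff_greater, rule allI)
  fix a
  note borel_measurable_exceed[OF assms(2), measurable]
  show "{\<omega> \<in> space M. a < order_stat (\<lambda>j. X j \<omega>) n (n - k)} \<in> sets M"
    unfolding order_stat_gt_iff[OF assms(1)] by measurable
qed

section \<open>Independent samples and a triangular array central limit theorem\<close>

lemma exp_minus_quadratic_bound:
  fixes y :: real assumes "y \<ge> 0"
  shows "\<bar>exp (- y) - (1 - y)\<bar> \<le> y\<^sup>2"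
proof -
  have 1: "exp (- y) \<ge> 1 - y" using exp_ge_add_one_self[of "- y"] by simp
  have "exp (- y) = 1 / exp y" by (simp add: exp_minus field_simps)
  also have "\<dots> \<le> 1 / (1 + y)" using assms exp_ge_add_one_self[of y] by (intro divide_left_mono) auto
  also have "\<dots> \<le> 1 - y + y\<^sup>2"
  proof -
    have "(1 + y) * (1 - y + y\<^sup>2) = 1 + y ^ 3" by (simp add: algebra_simps power2_eq_square power3_eq_cube)
    also have "\<dots> \<ge> 1" using assms by simp
    finally show ?thesis using assms by (simp add: pos_divide_le_eq mult.commute)
  qed
  finally show ?thesis using 1 by (simp add: abs_le_iff)
qed

text \<open>
  The \<open>n\<close>-th power of the characteristic function is compared with that of \<open>exp (- y n)\<close>, where
  \<open>2 * y n\<close> is the variance of one term. The error of one factor is at most a sixth of the third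
  absolute moment plus \<open>(y n)^2\<close>, and both are of smaller order than \<open>1 / n\<close>.
\<close>

lemma triangular_array_clt:
  fixes f :: "nat \<Rightarrow> 'a \<Rightarrow> real"
  assumes P: "prob_space P"
    and meas[measurable]: "\<And>n. f n \<in> borel_measurable P"
    and int: "\<forall>\<^sub>F n in sequentially. integrable P (f n) \<and> integrable P (\<lambda>z. (f n z)\<^sup>2) \<and> integrable P (\<lambda>z. \<bar>f n z\<bar> ^ 3) \<and> (\<integral>z. f n z \<partial>P) = 0"
    and v: "(\<lambda>n. real n * (\<integral>z. (f n z)\<^sup>2 \<partial>P)) \<longlonglongrightarrow> v"
    and third: "(\<lambda>n. real n * (\<integral>z. \<bar>f n z\<bar> ^ 3 \<partial>P)) \<longlonglongrightarrow> 0"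
  shows "(\<lambda>n. (\<integral>z. iexp (f n z) \<partial>P) ^ n) \<longlonglongrightarrow> of_real (exp (- v / 2))"
proof -
  interpret prob_space P by (rule P)
  define y where "y n = (\<integral>z. (f n z)\<^sup>2 \<partial>P) / 2" for n
  define \<psi> where "\<psi> n = (\<integral>z. iexp (f n z) \<partial>P)" for n
  have y0: "y n \<ge> 0" for n by (simp add: y_def)
  have ny: "(\<lambda>n. real n * y n) \<longlonglongrightarrow> v / 2"
    using tendsto_divide[OF v tendsto_const, of 2] by (simp add: y_def)
  have ylim: "y \<longlonglongrightarrow> 0"
  proof -
    have "(\<lambda>n. real n * y n * inverse (real n)) \<longlonglongrightarrow> v / 2 * 0"
      by (intro tendsto_mult ny lim_inverse_n)
    moreover have "\<forall>\<^sub>F n in sequentially. real n * y n * inverse (real n) = y n"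
      using eventually_gt_at_top[of 0] by eventually_elim simp
    ultimately show ?thesis by (simp add: tendsto_cong)
  qed
  have psi1: "cmod (\<psi> n) \<le> 1" for n
  proof -
    have "cmod (\<psi> n) \<le> (\<integral>z. cmod (iexp (f n z)) \<partial>P)" unfolding \<psi>_def by (rule integral_norm_bound)
    then show ?thesis by (simp add: prob_space)
  qed
  have ev: "\<forall>\<^sub>F n in sequentially. cmod (\<psi> n ^ n - of_real (exp (- (real n * y n)))) \<le>
      (real n * (\<integral>z. \<bar>f n z\<bar> ^ 3 \<partial>P)) / 6 + real n * y n * y n"
    using int
  proof eventually_elim
    case (elim n)
    have var: "variance (f n) = 2 * y n" using elim by (simp add: y_def)
    have "cmod (char (distr P borel (f n)) 1 - (1 - 1\<^sup>2 * (2 * y n) / 2)) \<le>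
      (1\<^sup>2 / 6) * expectation (\<lambda>z. min (6 * (f n z)\<^sup>2) (\<bar>1\<bar> * \<bar>f n z\<bar> ^ 3))"
      using elim var by (intro char_approx3') auto
    also have "char (distr P borel (f n)) 1 = \<psi> n"
      unfolding char_def \<psi>_def by (subst integral_distr) auto
    also have "expectation (\<lambda>z. min (6 * (f n z)\<^sup>2) (\<bar>1\<bar> * \<bar>f n z\<bar> ^ 3)) \<le> expectation (\<lambda>z. \<bar>f n z\<bar> ^ 3)"
      using elim by (intro integral_mono Bochner_Integration.integrable_min) auto
    finally have 1: "cmod (\<psi> n - of_real (1 - y n)) \<le> expectation (\<lambda>z. \<bar>f n z\<bar> ^ 3) / 6"
      by simp
    have "cmod (of_real (1 - y n) - of_real (exp (- y n))) = \<bar>exp (- y n) - (1 - y n)\<bar>"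
      by (metis norm_minus_commute norm_of_real of_real_diff)
    also have "\<dots> \<le> (y n)\<^sup>2" by (rule exp_minus_quadratic_bound[OF y0])
    finally have 2: "cmod (of_real (1 - y n) - of_real (exp (- y n))) \<le> (y n)\<^sup>2" .
    have "cmod (\<psi> n - of_real (exp (- y n))) \<le> expectation (\<lambda>z. \<bar>f n z\<bar> ^ 3) / 6 + (y n)\<^sup>2"
      using norm_triangle_le[OF add_mono[OF 1 2]] by simp
    moreover have "cmod (\<psi> n ^ n - of_real (exp (- y n)) ^ n) \<le> real n * cmod (\<psi> n - of_real (exp (- y n)))"
      by (rule norm_power_diff) (use psi1 y0 in auto)
    ultimately have "cmod (\<psi> n ^ n - of_real (exp (- y n)) ^ n) \<le> real n * (expectation (\<lambda>z. \<bar>f n z\<bar> ^ 3) / 6 + (y n)\<^sup>2)"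
      by (meson mult_left_mono of_nat_0_le_iff order_trans)
    moreover have "of_real (exp (- y n)) ^ n = (of_real (exp (- (real n * y n))) :: complex)"
      by (simp flip: of_real_power exp_of_nat_mult)
    ultimately show ?case by (simp add: algebra_simps power2_eq_square)
  qed
  have "(\<lambda>n. (real n * (\<integral>z. \<bar>f n z\<bar> ^ 3 \<partial>P)) / 6 + real n * y n * y n) \<longlonglongrightarrow> 0 / 6 + v / 2 * 0"
    by (intro tendsto_intros third ny ylim) auto
  then have "(\<lambda>n. (real n * (\<integral>z. \<bar>f n z\<bar> ^ 3 \<partial>P)) / 6 + real n * y n * y n) \<longlonglongrightarrow> 0" by simp
  from Lim_null_comparison[OF ev this]
  have A: "(\<lambda>n. \<psi> n ^ n - of_real (exp (- (real n * y n)))) \<longlonglongrightarrow> 0" .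
  have "(\<lambda>n. of_real (exp (- (real n * y n))) :: complex) \<longlonglongrightarrow> of_real (exp (- (v / 2)))"
    by (intro tendsto_intros ny)
  from tendsto_add[OF A this] have "(\<lambda>n. \<psi> n ^ n) \<longlonglongrightarrow> of_real (exp (- (v / 2)))"
    by simp
  then show ?thesis by (simp add: \<psi>_def)
qed

locale iid_sample = prob_space M for M :: "'a measure" +
  fixes X :: "nat \<Rightarrow> 'a \<Rightarrow> real" and n :: nat and P :: "real measure"
  assumes indep: "indep_vars (\<lambda>_. borel) X {1..n}"
    and law: "\<And>j. j \<in> {1..n} \<Longrightarrow> distr M borel (X j) = P"
    and P_prob: "prob_space P" and P_sets: "sets P = sets borel"
begin

lemma rv: "j \<in> {1..n} \<Longrightarrow> X j \<in> borel_measurable M"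
  using indep by (simp add: indep_vars_def)

lemma integral_sample:
  fixes f :: "real \<Rightarrow> 'b::{banach, second_countable_topology}"
  assumes "j \<in> {1..n}" and [measurable]: "f \<in> borel_measurable borel"
  shows "(\<integral>\<omega>. f (X j \<omega>) \<partial>M) = (\<integral>z. f z \<partial>P)" "integrable M (\<lambda>\<omega>. f (X j \<omega>)) \<longleftrightarrow> integrable P f"
  unfolding law[OF assms(1), symmetric] using rv[OF assms(1)]
  by (simp_all add: integral_distr integrable_distr_eq)

lemma indep_f:
  assumes "f \<in> borel_measurable borel" and "J \<subseteq> {1..n}"
  shows "indep_vars (\<lambda>_. borel) (\<lambda>j \<omega>. f (X j \<omega>)) J"
  using indep_vars_subset[OF indep_vars_compose2[OF indep, of "\<lambda>_. f" "\<lambda>_. borel"]] assms by simp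

lemma char_sample:
  assumes f[measurable]: "f \<in> borel_measurable borel"
  shows "(\<integral>\<omega>. iexp (\<Sum>j=1..n. f (X j \<omega>)) \<partial>M) = (\<integral>z. iexp (f z) \<partial>P) ^ n"
proof -
  interpret P: prob_space P by (rule P_prob)
  have ip: "integrable P (\<lambda>z. iexp (f z))"
    by (rule P.integrable_const_bound[of _ 1]) (auto simp: measurable_cong_sets[OF P_sets refl])
  have "(\<integral>\<omega>. iexp (\<Sum>j=1..n. f (X j \<omega>)) \<partial>M) = (\<integral>\<omega>. (\<Prod>j=1..n. iexp (f (X j \<omega>))) \<partial>M)"
    by (simp add: sum_distrib_left exp_sum)
  also have "\<dots> = (\<Prod>j=1..n. \<integral>\<omega>. iexp (f (X j \<omega>)) \<partial>M)"
  proof (rule indep_vars_lebesgue_integral)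
    show "indep_vars (\<lambda>_. borel) (\<lambda>j \<omega>. iexp (f (X j \<omega>))) {1..n}"
      by (rule indep_vars_compose2[OF indep]) measurable
    fix j assume "j \<in> {1..n}"
    then show "integrable M (\<lambda>\<omega>. iexp (f (X j \<omega>)))" using integral_sample(2)[of j "\<lambda>z. iexp (f z)"] ip by simp
  qed simp
  also have "\<dots> = (\<Prod>j=1..n. \<integral>z. iexp (f z) \<partial>P)"
    by (intro prod.cong integral_sample(1)) auto
  finally show ?thesis by simp
qed

lemma second_moment_centered_sum:
  assumes f[measurable]: "f \<in> borel_measurable borel" and i1: "integrable P f" and i2: "integrable P (\<lambda>z. (f z)\<^sup>2)"
    and zero: "(\<integral>z. f z \<partial>P) = 0"
  shows "integrable M (\<lambda>\<omega>. (\<Sum>j=1..n. f (X j \<omega>))\<^sup>2)"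
    and "(\<integral>\<omega>. (\<Sum>j=1..n. f (X j \<omega>))\<^sup>2 \<partial>M) = real n * (\<integral>z. (f z)\<^sup>2 \<partial>P)"
proof -
  have sq: "(\<Sum>j=1..n. f (X j \<omega>))\<^sup>2 = (\<Sum>i=1..n. \<Sum>j=1..n. f (X i \<omega>) * f (X j \<omega>))" for \<omega>
    by (simp add: power2_eq_square sum_product)
  have cross: "integrable M (\<lambda>\<omega>. f (X i \<omega>) * f (X j \<omega>)) \<and>
     (\<integral>\<omega>. f (X i \<omega>) * f (X j \<omega>) \<partial>M) = (if i = j then (\<integral>z. (f z)\<^sup>2 \<partial>P) else 0)"
    if ij: "i \<in> {1..n}" "j \<in> {1..n}" for i j
  proof (cases "i = j")
    case True
    have m: "(\<lambda>z. (f z)\<^sup>2) \<in> borel_measurable borel" by measurable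
    from True show ?thesis using integral_sample[OF ij(1) m] i2 by (simp add: power2_eq_square)
  next
    case False
    have ind: "indep_vars (\<lambda>_. borel) (\<lambda>j \<omega>. f (X j \<omega>)) {i, j}" by (rule indep_f) (use ij in auto)
    have ii: "integrable M (\<lambda>\<omega>. f (X l \<omega>))" if "l \<in> {i, j}" for l
      using integral_sample(2)[of l f] that ij i1 by auto
    have fin: "finite {i, j}" by simp
    from indep_vars_lebesgue_integral[OF fin ind ii] indep_vars_integrable[OF fin ind ii]
    show ?thesis using False integral_sample(1)[of i f] ij zero by simp
  qed
  show "integrable M (\<lambda>\<omega>. (\<Sum>j=1..n. f (X j \<omega>))\<^sup>2)"
    unfolding sq using cross by (intro Bochner_Integration.integrable_sum) auto
  have "(\<integral>\<omega>. (\<Sum>j=1..n. f (X j \<omega>))\<^sup>2 \<partial>M) = (\<Sum>i=1..n. \<Sum>j=1..n. (\<integral>\<omega>. f (X i \<omega>) * f (X j \<omega>) \<partial>M))"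
    unfolding sq using cross by (subst Bochner_Integration.integral_sum, auto intro!: Bochner_Integration.integrable_sum sum.cong Bochner_Integration.integral_sum)
  also have "\<dots> = (\<Sum>i=1..n. \<Sum>j=1..n. (if i = j then (\<integral>z. (f z)\<^sup>2 \<partial>P) else 0))"
    using cross by (intro sum.cong) auto
  also have "\<dots> = real n * (\<integral>z. (f z)\<^sup>2 \<partial>P)" by simp
  finally show "(\<integral>\<omega>. (\<Sum>j=1..n. f (X j \<omega>))\<^sup>2 \<partial>M) = real n * (\<integral>z. (f z)\<^sup>2 \<partial>P)" .
qed

lemma variance_sum:
  assumes f[measurable]: "f \<in> borel_measurable borel" and i1: "integrable P f" and i2: "integrable P (\<lambda>z. (f z)\<^sup>2)"
  shows "integrable M (\<lambda>\<omega>. ((\<Sum>j=1..n. f (X j \<omega>)) - real n * (\<integral>z. f z \<partial>P))\<^sup>2)"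
    and "(\<integral>\<omega>. ((\<Sum>j=1..n. f (X j \<omega>)) - real n * (\<integral>z. f z \<partial>P))\<^sup>2 \<partial>M) \<le> real n * (\<integral>z. (f z)\<^sup>2 \<partial>P)"
proof -
  interpret P: prob_space P by (rule P_prob)
  let ?m = "\<integral>z. f z \<partial>P"
  let ?g = "\<lambda>z. f z - ?m"
  have e: "(\<Sum>j=1..n. f (X j \<omega>)) - real n * ?m = (\<Sum>j=1..n. ?g (X j \<omega>))" for \<omega>
    by (simp add: sum_subtractf)
  have g2: "(?g z)\<^sup>2 = (f z)\<^sup>2 - 2 * ?m * f z + ?m\<^sup>2" for z by (simp add: power2_diff)
  have j1: "integrable P ?g" "integrable P (\<lambda>z. (?g z)\<^sup>2)" "(\<integral>z. ?g z \<partial>P) = 0"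
    using i1 i2 unfolding g2 by (auto simp: P.prob_space)
  have "(\<integral>z. (?g z)\<^sup>2 \<partial>P) = (\<integral>z. (f z)\<^sup>2 \<partial>P) - ?m\<^sup>2"
    unfolding g2 using i1 i2 by (simp add: P.prob_space power2_eq_square)
  then have "(\<integral>z. (?g z)\<^sup>2 \<partial>P) \<le> (\<integral>z. (f z)\<^sup>2 \<partial>P)" by simp
  then show "integrable M (\<lambda>\<omega>. ((\<Sum>j=1..n. f (X j \<omega>)) - real n * (\<integral>z. f z \<partial>P))\<^sup>2)"
    "(\<integral>\<omega>. ((\<Sum>j=1..n. f (X j \<omega>)) - real n * (\<integral>z. f z \<partial>P))\<^sup>2 \<partial>M) \<le> real n * (\<integral>z. (f z)\<^sup>2 \<partial>P)"
    unfolding e using second_moment_centered_sum[OF _ j1] by (auto intro!: mult_left_mono)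
qed

end

section \<open>Moments of tail excesses\<close>

lemma has_bochner_integral_power_exp:
  fixes a :: real assumes "a > 0"
  shows "has_bochner_integral lborel (\<lambda>x. x ^ m * exp (- (a * x)) * indicator {0..} x) (fact m / a ^ Suc m)"
proof -
  have "has_bochner_integral lborel (\<lambda>x::real. x ^ m * exp (- x) * indicator {0..} x) (fact m)"
  proof (rule has_bochner_integral_nn_integral)
    have "(\<integral>\<^sup>+x. ennreal (x ^ m * exp (- x) * indicator {0..} x) \<partial>lborel) = (\<integral>\<^sup>+x. ennreal (x ^ m * exp (- x)) * indicator {0..} x \<partial>lborel)"
      by (intro nn_integral_cong) (auto split: split_indicator)
    then show "(\<integral>\<^sup>+x. ennreal (x ^ m * exp (- x) * indicator {0..} x) \<partial>lborel) = ennreal (fact m)"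
      by (simp add: nn_intergal_power_times_exp_Ici)
  qed (auto split: split_indicator)
  then have "has_bochner_integral lborel (\<lambda>x. (0 + a * x) ^ m * exp (- (0 + a * x)) * indicator {0..} (0 + a * x)) (fact m /\<^sub>R \<bar>a\<bar>)"
    by (rule iffD1[OF lborel_has_bochner_integral_real_affine_iff, rotated]) (use assms in simp)
  from has_bochner_integral_mult_right[OF this, of "1 / a ^ m"]
  have "has_bochner_integral lborel (\<lambda>x. 1 / a ^ m * ((0 + a * x) ^ m * exp (- (0 + a * x)) * indicator {0..} (0 + a * x))) (1 / a ^ m * (fact m /\<^sub>R \<bar>a\<bar>))" .
  moreover have "(\<lambda>x. 1 / a ^ m * ((0 + a * x) ^ m * exp (- (0 + a * x)) * indicator {0..} (0 + a * x))) = (\<lambda>x. x ^ m * exp (- (a * x)) * indicator {0..} x)"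
    using assms by (auto simp: fun_eq_iff power_mult_distrib zero_le_mult_iff split: split_indicator)
  moreover have "1 / a ^ m * (fact m /\<^sub>R \<bar>a\<bar>) = fact m / a ^ Suc m" using assms by (simp add: divide_inverse)
  ultimately show ?thesis by simp
qed

text \<open>
  Admissible test functions on the log scale. Growth below every exponential makes them integrable
  against any Pareto tail and is preserved by products, so that statements about means also cover
  second and fourth moments.
\<close>

definition subexponential :: "(real \<Rightarrow> real) \<Rightarrow> (real \<Rightarrow> real) \<Rightarrow> bool" where
  "subexponential g g' \<longleftrightarrow> (\<forall>x. (g has_real_derivative g' x) (at x)) \<and> continuous_on UNIV g' \<and>
     (\<forall>e>0. \<exists>K. \<forall>x\<ge>0. \<bar>g x\<bar> \<le> K * exp (e * x) \<and> \<bar>g' x\<bar> \<le> K * exp (e * x))"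

lemma subexponentialD:
  assumes "subexponential g g'"
  shows "(g has_real_derivative g' x) (at x)" "continuous_on UNIV g'" "continuous_on UNIV g"
    "e > 0 \<Longrightarrow> \<exists>K. \<forall>x\<ge>0. \<bar>g x\<bar> \<le> K * exp (e * x) \<and> \<bar>g' x\<bar> \<le> K * exp (e * x)"
  using assms unfolding subexponential_def by (auto intro: DERIV_continuous_on)

lemma subexponential_add:
  assumes "subexponential f f'" "subexponential g g'"
  shows "subexponential (\<lambda>x. f x + g x) (\<lambda>x. f' x + g' x)"
  unfolding subexponential_def
proof (intro conjI allI impI)
  fix e :: real assume "e > 0"
  obtain K where K: "\<And>x. x \<ge> 0 \<Longrightarrow> \<bar>f x\<bar> \<le> K * exp (e * x)" "\<And>x. x \<ge> 0 \<Longrightarrow> \<bar>f' x\<bar> \<le> K * exp (e * x)"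
    using subexponentialD(4)[OF assms(1) \<open>e > 0\<close>] by blast
  obtain L where L: "\<And>x. x \<ge> 0 \<Longrightarrow> \<bar>g x\<bar> \<le> L * exp (e * x)" "\<And>x. x \<ge> 0 \<Longrightarrow> \<bar>g' x\<bar> \<le> L * exp (e * x)"
    using subexponentialD(4)[OF assms(2) \<open>e > 0\<close>] by blast
  show "\<exists>K. \<forall>x\<ge>0. \<bar>f x + g x\<bar> \<le> K * exp (e * x) \<and> \<bar>f' x + g' x\<bar> \<le> K * exp (e * x)"
  proof (intro exI[of _ "K + L"] allI impI conjI)
    fix x :: real assume "x \<ge> 0"
    from K[OF this] L[OF this] show "\<bar>f x + g x\<bar> \<le> (K + L) * exp (e * x)" "\<bar>f' x + g' x\<bar> \<le> (K + L) * exp (e * x)"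
      unfolding distrib_right by linarith+
  qed
qed (use subexponentialD[OF assms(1)] subexponentialD[OF assms(2)] in \<open>auto intro!: derivative_intros continuous_intros\<close>)

lemma subexponential_mult:
  assumes "subexponential f f'" "subexponential g g'"
  shows "subexponential (\<lambda>x. f x * g x) (\<lambda>x. f' x * g x + f x * g' x)"
  unfolding subexponential_def
proof (intro conjI allI impI)
  fix x
  show "((\<lambda>x. f x * g x) has_real_derivative f' x * g x + f x * g' x) (at x)"
    using DERIV_mult[OF subexponentialD(1)[OF assms(1), of x] subexponentialD(1)[OF assms(2), of x]]
    by (simp add: mult.commute)
next
  fix e :: real assume "e > 0"
  then have e: "e / 2 > 0" by simp
  obtain K where K: "\<And>x. x \<ge> 0 \<Longrightarrow> \<bar>f x\<bar> \<le> K * exp (e / 2 * x)" "\<And>x. x \<ge> 0 \<Longrightarrow> \<bar>f' x\<bar> \<le> K * exp (e / 2 * x)"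
    using subexponentialD(4)[OF assms(1) e] by blast
  obtain L where L: "\<And>x. x \<ge> 0 \<Longrightarrow> \<bar>g x\<bar> \<le> L * exp (e / 2 * x)" "\<And>x. x \<ge> 0 \<Longrightarrow> \<bar>g' x\<bar> \<le> L * exp (e / 2 * x)"
    using subexponentialD(4)[OF assms(2) e] by blast
  have KL: "\<bar>p * q\<bar> \<le> K * L * exp (e * x)" if "\<bar>p\<bar> \<le> K * exp (e / 2 * x)" "\<bar>q\<bar> \<le> L * exp (e / 2 * x)" for p q x
  proof -
    have "\<bar>p\<bar> * \<bar>q\<bar> \<le> (K * exp (e / 2 * x)) * (L * exp (e / 2 * x))" using that by (intro mult_mono) auto
    also have "\<dots> = K * L * (exp (e / 2 * x) * exp (e / 2 * x))" by simp
    also have "exp (e / 2 * x) * exp (e / 2 * x) = exp (e * x)" by (simp flip: exp_add)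
    finally show ?thesis by (simp add: abs_mult)
  qed
  show "\<exists>K. \<forall>x\<ge>0. \<bar>f x * g x\<bar> \<le> K * exp (e * x) \<and> \<bar>f' x * g x + f x * g' x\<bar> \<le> K * exp (e * x)"
  proof (intro exI[of _ "2 * (K * L)"] allI impI conjI)
    fix x :: real assume x: "x \<ge> 0"
    have 1: "\<bar>f x * g x\<bar> \<le> K * L * exp (e * x)" using K[OF x] L[OF x] by (intro KL)
    have 2: "\<bar>f' x * g x\<bar> \<le> K * L * exp (e * x)" using K[OF x] L[OF x] by (intro KL)
    have 3: "\<bar>f x * g' x\<bar> \<le> K * L * exp (e * x)" using K[OF x] L[OF x] by (intro KL)
    have 4: "2 * (K * L) * exp (e * x) = K * L * exp (e * x) + K * L * exp (e * x)" by simp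
    show "\<bar>f x * g x\<bar> \<le> 2 * (K * L) * exp (e * x)" "\<bar>f' x * g x + f x * g' x\<bar> \<le> 2 * (K * L) * exp (e * x)"
      unfolding 4 using 1 2 3 by linarith+
  qed
qed (use subexponentialD[OF assms(1)] subexponentialD[OF assms(2)] in \<open>auto intro!: continuous_intros\<close>)

lemma subexponential_const: "subexponential (\<lambda>x. c) (\<lambda>x. 0)"
  unfolding subexponential_def
proof (intro conjI allI impI)
  fix e :: real assume "e > 0"
  show "\<exists>K. \<forall>x\<ge>0. \<bar>c\<bar> \<le> K * exp (e * x) \<and> \<bar>0\<bar> \<le> K * exp (e * x)"
    using \<open>e > 0\<close> by (intro exI[of _ "\<bar>c\<bar>"]) (auto simp: mult_le_cancel_left1)
qed (auto intro!: continuous_intros)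

lemma subexponential_ident: "subexponential (\<lambda>x. x) (\<lambda>x. 1)"
  unfolding subexponential_def
proof (intro conjI allI impI)
  fix e :: real assume e: "e > 0"
  show "\<exists>K. \<forall>x\<ge>0. \<bar>x\<bar> \<le> K * exp (e * x) \<and> \<bar>1\<bar> \<le> K * exp (e * x)"
  proof (intro exI[of _ "max 1 (1 / e)"] allI impI conjI)
    fix x :: real assume x: "x \<ge> 0"
    have "e * x \<le> exp (e * x)" using exp_ge_add_one_self[of "e * x"] by linarith
    then have "\<bar>x\<bar> \<le> 1 / e * exp (e * x)" using e x by (simp add: field_simps)
    also have "1 / e * exp (e * x) \<le> max 1 (1 / e) * exp (e * x)" by (intro mult_right_mono) auto
    finally show "\<bar>x\<bar> \<le> max 1 (1 / e) * exp (e * x)" .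
    have "1 * 1 \<le> max 1 (1 / e) * exp (e * x)" using e x by (intro mult_mono) auto
    then show "\<bar>1\<bar> \<le> max 1 (1 / e) * exp (e * x)" by simp
  qed
qed (auto intro!: continuous_intros)

lemma subexponential_exp:
  assumes "s \<le> 0" shows "subexponential (\<lambda>x. exp (s * x)) (\<lambda>x. s * exp (s * x))"
  unfolding subexponential_def
proof (intro conjI allI impI)
  fix e :: real assume e: "e > 0"
  show "\<exists>K. \<forall>x\<ge>0. \<bar>exp (s * x)\<bar> \<le> K * exp (e * x) \<and> \<bar>s * exp (s * x)\<bar> \<le> K * exp (e * x)"
  proof (intro exI[of _ "max 1 \<bar>s\<bar>"] allI impI conjI)
    fix x :: real assume x: "x \<ge> 0"
    have "s * x \<le> e * x" using assms e x by (intro mult_right_mono) auto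
    then have 1: "exp (s * x) \<le> exp (e * x)" by simp
    then have "1 * exp (s * x) \<le> max 1 \<bar>s\<bar> * exp (e * x)" by (intro mult_mono) auto
    then show "\<bar>exp (s * x)\<bar> \<le> max 1 \<bar>s\<bar> * exp (e * x)" by simp
    have "\<bar>s\<bar> * exp (s * x) \<le> max 1 \<bar>s\<bar> * exp (e * x)" using 1 by (intro mult_mono) auto
    then show "\<bar>s * exp (s * x)\<bar> \<le> max 1 \<bar>s\<bar> * exp (e * x)" by (simp add: abs_mult)
  qed
qed (auto intro!: continuous_intros derivative_eq_intros)

lemma subexponential_cmult: "subexponential g g' \<Longrightarrow> subexponential (\<lambda>x. c * g x) (\<lambda>x. c * g' x)"
  using subexponential_mult[OF subexponential_const[of c], of g g'] by simp

definition tail_excess :: "(real \<Rightarrow> real) \<Rightarrow> real \<Rightarrow> real \<Rightarrow> real" where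
  "tail_excess g t z = (if t < z then g (ln (z / t)) else 0)"

lemma borel_measurable_tail_excess [measurable]:
  "continuous_on UNIV g \<Longrightarrow> tail_excess g t \<in> borel_measurable borel"
proof -
  assume "continuous_on UNIV g"
  then have [measurable]: "g \<in> borel_measurable borel" by (rule borel_measurable_continuous_onI)
  show ?thesis unfolding tail_excess_def[abs_def] by measurable
qed

lemma tail_excess_eq_integral:
  assumes t: "t > 0" and g: "\<And>x. (g has_real_derivative g' x) (at x)" "continuous_on UNIV g'"
  shows "has_bochner_integral lborel (\<lambda>x. g' x * indicator {0..} x * of_bool (t * exp x < z)) (tail_excess g t z - g 0 * of_bool (t < z))"
proof (cases "t < z")
  case True
  let ?L = "ln (z / t)"
  have L: "?L > 0" using True t by simp
  have iff: "t * exp x < z \<longleftrightarrow> x < ?L" for x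
  proof -
    have "t * exp x < z \<longleftrightarrow> exp x < z / t" using t by (simp add: field_simps)
    also have "\<dots> \<longleftrightarrow> x < ?L" using True t by (metis divide_pos_pos exp_less_cancel_iff exp_ln less_trans)
    finally show ?thesis .
  qed
  have "has_bochner_integral lborel (\<lambda>x. g' x * indicator {0..?L} x) (g ?L - g 0)"
    using L g(1) g(2) by (intro has_bochner_integral_FTC_Icc_real) (auto simp: continuous_on_eq_continuous_at)
  moreover have "AE x in lborel. g' x * indicator {0..?L} x = g' x * indicator {0..} x * of_bool (t * exp x < z)"
    using AE_lborel_singleton[of ?L] by eventually_elim (auto simp: iff split: split_indicator)
  moreover have [measurable]: "g' \<in> borel_measurable borel" using g(2) by (rule borel_measurable_continuous_onI)
  ultimately show ?thesis
    using True by (subst has_bochner_integral_cong_AE[symmetric, of "\<lambda>x. g' x * indicator {0..?L} x"]) (auto simp: tail_excess_def)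
next
  case False
  have "g' x * indicator {0..} x * of_bool (t * exp x < z) = 0" for x
  proof (cases "x \<ge> 0")
    case True
    then have "t * 1 \<le> t * exp x" using t by (intro mult_left_mono) auto
    then show ?thesis using False by auto
  qed simp
  then have "(\<lambda>x. g' x * indicator {0..} x * of_bool (t * exp x < z)) = (\<lambda>x. 0)" by (rule ext)
  then show ?thesis using False by (simp only: tail_excess_def) (simp add: has_bochner_integral_zero)
qed

text \<open>
  Integration by parts: \<open>g (ln (z / t)) - g 0\<close> is the integral of \<open>g'\<close> over the levels \<open>x \<ge> 0\<close> with
  \<open>t * exp x < z\<close>, and Fubini turns the indicator of such a level into the survival function.
\<close>

lemma tail_excess_integral:
  fixes P :: "real measure"
  assumes P: "real_distribution P" and F: "F = cdf P" and t: "t > 0" and g: "subexponential g g'"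
    and S: "\<And>x. x \<ge> 0 \<Longrightarrow> 1 - F (t * exp x) \<le> S * exp (- a * x)" and a: "a > 0"
  shows "integrable P (tail_excess g t)"
    and "(\<integral>z. tail_excess g t z \<partial>P) = g 0 * (1 - F t) + (\<integral>x. g' x * indicator {0..} x * (1 - F (t * exp x)) \<partial>lborel)"
proof -
  interpret P: real_distribution P by (rule P)
  interpret pair_sigma_finite lborel P by unfold_locales
  have g'm[measurable]: "g' \<in> borel_measurable borel" using subexponentialD(2)[OF g] by (rule borel_measurable_continuous_onI)
  have gm: "tail_excess g t \<in> borel_measurable borel" by (rule borel_measurable_tail_excess) (rule subexponentialD[OF g])
  define h where "h x z = g' x * indicator {0..} x * of_bool (t * exp x < z)" for x z
  have hm[measurable]: "case_prod h \<in> borel_measurable (lborel \<Otimes>\<^sub>M P)"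
    unfolding h_def[abs_def] split_beta' by (simp add: measurable_cong_sets[OF sets_pair_measure_cong[OF refl P.events_eq_borel] refl])
  have surv: "(\<integral>z. of_bool (y < z) \<partial>P) = 1 - F y" "integrable P (\<lambda>z. of_bool (y < z) :: real)" for y
  proof -
    have e: "(\<lambda>z. of_bool (y < z) :: real) = indicator {y<..}" by (auto split: split_indicator)
    have "P.prob {y<..} = 1 - P.prob {..y}"
      using P.prob_compl[of "{..y}"] by (simp add: Compl_eq_Diff_UNIV[symmetric])
    then show "(\<integral>z. of_bool (y < z) \<partial>P) = 1 - F y" "integrable P (\<lambda>z. of_bool (y < z) :: real)"
      unfolding e F cdf_def by (auto simp: P.emeasure_eq_measure)
  qed
  have F01: "0 \<le> 1 - F y" for y unfolding F using P.cdf_bounded_prob[of y] by simp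
  obtain K where K: "\<And>x. x \<ge> 0 \<Longrightarrow> \<bar>g' x\<bar> \<le> K * exp (a / 2 * x)"
    using subexponentialD(4)[OF g, of "a/2"] a by auto
  have dom: "integrable lborel (\<lambda>x. K * S * (exp (- (a / 2 * x)) * indicator {0..} x))"
    using has_bochner_integral_power_exp[of "a/2" 0] a by (intro integrable_mult_right) (auto simp: has_bochner_integral_iff)
  have Fm[measurable]: "F \<in> borel_measurable borel" unfolding F by (intro borel_measurable_mono monoI P.cdf_nondecreasing)
  have int1: "integrable lborel (\<lambda>x. \<integral>z. norm (h x z) \<partial>P)"
  proof -
    have e: "(\<integral>z. norm (h x z) \<partial>P) = \<bar>g' x\<bar> * indicator {0..} x * (1 - F (t * exp x))" for x
      using surv by (simp add: h_def abs_mult)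
    show ?thesis unfolding e
    proof (rule Bochner_Integration.integrable_bound[OF dom])
      show "AE x in lborel. norm (\<bar>g' x\<bar> * indicator {0..} x * (1 - F (t * exp x))) \<le> norm (K * S * (exp (- (a / 2 * x)) * indicator {0..} x))"
      proof (rule AE_I2)
        fix x
        show "norm (\<bar>g' x\<bar> * indicator {0..} x * (1 - F (t * exp x))) \<le> norm (K * S * (exp (- (a / 2 * x)) * indicator {0..} x))"
        proof (cases "x \<ge> 0")
          case True
          have "\<bar>g' x\<bar> * (1 - F (t * exp x)) \<le> (K * exp (a / 2 * x)) * (S * exp (- a * x))"
            using K[OF True] S[OF True] F01 by (intro mult_mono) auto
          also have "\<dots> = K * S * (exp (a / 2 * x) * exp (- a * x))" by simp
          also have "exp (a / 2 * x) * exp (- a * x) = exp (- (a / 2 * x))" by (simp flip: exp_add)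
          also have "K * S * exp (- (a / 2 * x)) \<le> \<bar>K * S\<bar> * exp (- (a / 2 * x))" by (intro mult_right_mono) auto
          finally show ?thesis using True F01[of "t * exp x"] by (simp add: abs_mult)
        qed simp
      qed
    qed measurable
  qed
  have int: "integrable (lborel \<Otimes>\<^sub>M P) (case_prod h)"
  proof (rule Fubini_integrable[OF hm])
    show "integrable lborel (\<lambda>x. \<integral>z. norm (case_prod h (x, z)) \<partial>P)" using int1 by simp
    show "AE x in lborel. integrable P (\<lambda>z. case_prod h (x, z))" by (intro AE_I2) (simp add: h_def surv)
  qed
  have hz: "(\<integral>x. h x z \<partial>lborel) = tail_excess g t z - g 0 * of_bool (t < z)" for z
    using tail_excess_eq_integral[OF t subexponentialD(1,2)[OF g], of z] unfolding h_def by (rule has_bochner_integral_integral_eq)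
  have "integrable P (\<lambda>z. \<integral>x. h x z \<partial>lborel)" by (rule integrable_snd[OF int])
  then have "integrable P (\<lambda>z. tail_excess g t z - g 0 * of_bool (t < z))" by (simp only: hz)
  from Bochner_Integration.integrable_add[OF this integrable_mult_right[OF surv(2), of "g 0" t]]
  show I: "integrable P (tail_excess g t)" by simp
  have "(\<integral>z. (\<integral>x. h x z \<partial>lborel) \<partial>P) = (\<integral>x. (\<integral>z. h x z \<partial>P) \<partial>lborel)"
    by (rule Fubini_integral[OF int])
  also have "\<dots> = (\<integral>x. g' x * indicator {0..} x * (1 - F (t * exp x)) \<partial>lborel)"
    by (simp add: h_def surv)
  finally have "(\<integral>z. tail_excess g t z - g 0 * of_bool (t < z) \<partial>P) = (\<integral>x. g' x * indicator {0..} x * (1 - F (t * exp x)) \<partial>lborel)"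
    by (simp only: hz)
  then show "(\<integral>z. tail_excess g t z \<partial>P) = g 0 * (1 - F t) + (\<integral>x. g' x * indicator {0..} x * (1 - F (t * exp x)) \<partial>lborel)"
    using I surv by (simp add: integrable_mult_right)
qed

context intermediate_tail
begin

text \<open>
  The common law of the observations, recovered from its distribution function.
\<close>

definition law :: "real measure" where "law = (SOME P. real_distribution P \<and> F = cdf P)"

lemma law: "real_distribution law" "cdf law = F"
  using someI_ex[OF F_law] unfolding law_def by auto

lemma F_mono: "mono F"
proof -
  interpret real_distribution law by (rule law)
  have "mono (cdf law)" by (intro monoI cdf_nondecreasing)
  then show ?thesis by (simp only: law(2))
qed

lemma borel_measurable_F [measurable]: "F \<in> borel_measurable borel"
  using F_mono by (rule borel_measurable_mono)

lemma n_ge_2: "\<forall>\<^sub>F n in sequentially. n \<ge> (2::nat)" by (rule eventually_ge_at_top)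

lemma t_ge: "\<forall>\<^sub>F n in sequentially. t n \<ge> x"
  using t_inf by (simp add: filterlim_at_top)

lemma delta_t_exp: "(\<lambda>n. rk n * \<delta> (t n * exp x)) \<longlonglongrightarrow> lam * exp (\<tau> * x)"
proof -
  obtain X where X: "\<And>x y. x \<ge> X \<Longrightarrow> y \<ge> X \<Longrightarrow> \<delta> x * \<delta> y > 0" using delta_sign by blast
  have "(\<lambda>n. rk n * \<delta> (t n) * (\<delta> (t n * exp x) / \<delta> (t n))) \<longlonglongrightarrow> lam * exp (\<tau> * x)"
    by (intro tendsto_mult delta_t filterlim_compose[OF delta_limit t_inf])
  moreover have "\<forall>\<^sub>F n in sequentially. rk n * \<delta> (t n) * (\<delta> (t n * exp x) / \<delta> (t n)) = rk n * \<delta> (t n * exp x)"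
    using t_ge[of X]
  proof eventually_elim
    case (elim n)
    from X[OF elim elim] have "\<delta> (t n) \<noteq> 0" by auto
    then show ?case by simp
  qed
  ultimately show ?thesis by (rule Lim_transform_eventually)
qed

lemma delta_t_bound: "\<exists>K>0. \<forall>\<^sub>F n in sequentially. \<forall>x\<ge>0. \<bar>rk n * \<delta> (t n * exp x)\<bar> \<le> K"
proof -
  obtain X where X: "\<And>x u. x \<ge> X \<Longrightarrow> u \<ge> 0 \<Longrightarrow> \<bar>\<delta> (x * exp u)\<bar> \<le> 2 * \<bar>\<delta> x\<bar>" using delta_bounded by blast
  have "\<forall>\<^sub>F n in sequentially. \<bar>rk n * \<delta> (t n)\<bar> < \<bar>lam\<bar> + 1"
    using order_tendstoD(2)[OF tendsto_rabs[OF delta_t], of "\<bar>lam\<bar> + 1"] by simp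
  then have "\<forall>\<^sub>F n in sequentially. \<forall>x\<ge>0. \<bar>rk n * \<delta> (t n * exp x)\<bar> \<le> 2 * (\<bar>lam\<bar> + 1)"
    using t_ge[of X]
  proof eventually_elim
    case (elim n)
    show ?case
    proof (intro allI impI)
      fix x :: real assume "x \<ge> 0"
      have "\<bar>rk n * \<delta> (t n * exp x)\<bar> \<le> rk n * (2 * \<bar>\<delta> (t n)\<bar>)"
        unfolding abs_mult using X[OF elim(2) \<open>x \<ge> 0\<close>] by (intro mult_mono) auto
      also have "\<dots> = 2 * \<bar>rk n * \<delta> (t n)\<bar>" by (simp add: abs_mult)
      also have "\<dots> \<le> 2 * (\<bar>lam\<bar> + 1)" using elim(1) by (intro mult_left_mono less_imp_le) auto
      finally show "\<bar>rk n * \<delta> (t n * exp x)\<bar> \<le> 2 * (\<bar>lam\<bar> + 1)" .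
    qed
  qed
  then show ?thesis by (intro exI[of _ "2 * (\<bar>lam\<bar> + 1)"]) (auto intro: add_nonneg_pos)
qed

lemma delta_t_uniform:
  assumes "\<epsilon> > 0"
  shows "\<exists>\<eta>>0. \<forall>\<^sub>F n in sequentially. \<forall>u. \<bar>u\<bar> \<le> \<eta> \<longrightarrow> \<bar>rk n * \<delta> (t n * exp u) - lam\<bar> \<le> \<epsilon>"
proof -
  define e where "e = \<epsilon> / (2 * (\<bar>lam\<bar> + 1))"
  have e: "e > 0" using assms unfolding e_def by (intro divide_pos_pos) auto
  have ee: "e * (\<bar>lam\<bar> + 1) = \<epsilon> / 2"
  proof -
    have "x + 1 > 0 \<Longrightarrow> \<epsilon> / (2 * (x + 1)) * (x + 1) = \<epsilon> / 2" for x by (simp add: field_simps)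
    then show ?thesis by (simp add: e_def)
  qed
  obtain \<eta> X where \<eta>: "\<eta> > 0" "\<And>x u. x \<ge> X \<Longrightarrow> \<bar>u\<bar> \<le> \<eta> \<Longrightarrow> \<bar>\<delta> (x * exp u) - \<delta> x\<bar> \<le> e * \<bar>\<delta> x\<bar>"
    using delta_local[OF e] by blast
  have "\<forall>\<^sub>F n in sequentially. \<bar>rk n * \<delta> (t n)\<bar> < \<bar>lam\<bar> + 1"
    using order_tendstoD(2)[OF tendsto_rabs[OF delta_t], of "\<bar>lam\<bar> + 1"] by simp
  moreover have "\<forall>\<^sub>F n in sequentially. dist (rk n * \<delta> (t n)) lam < \<epsilon> / 2"
    by (rule tendstoD[OF delta_t]) (use assms in simp)
  ultimately have "\<forall>\<^sub>F n in sequentially. \<forall>u. \<bar>u\<bar> \<le> \<eta> \<longrightarrow> \<bar>rk n * \<delta> (t n * exp u) - lam\<bar> \<le> \<epsilon>"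
    using t_ge[of X]
  proof eventually_elim
    case (elim n)
    show ?case
    proof (intro allI impI)
      fix u :: real assume u: "\<bar>u\<bar> \<le> \<eta>"
      have "\<bar>rk n * \<delta> (t n * exp u) - rk n * \<delta> (t n)\<bar> = rk n * \<bar>\<delta> (t n * exp u) - \<delta> (t n)\<bar>"
        by (simp add: abs_mult flip: right_diff_distrib)
      also have "\<dots> \<le> rk n * (e * \<bar>\<delta> (t n)\<bar>)" using \<eta>(2)[OF elim(3) u] by (intro mult_left_mono) auto
      also have "\<dots> = e * \<bar>rk n * \<delta> (t n)\<bar>" by (simp add: abs_mult)
      also have "\<dots> \<le> e * (\<bar>lam\<bar> + 1)" using elim(1) e by (intro mult_left_mono) auto
      finally show "\<bar>rk n * \<delta> (t n * exp u) - lam\<bar> \<le> \<epsilon>"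
        using elim(2) unfolding ee dist_real_def by linarith
    qed
  qed
  then show ?thesis using \<eta>(1) by blast
qed

lemma delta_t_near:
  assumes "x \<longlonglongrightarrow> 0" shows "(\<lambda>n. rk n * \<delta> (t n * exp (x n))) \<longlonglongrightarrow> lam"
proof (rule tendstoI)
  fix \<epsilon> :: real assume "\<epsilon> > 0"
  then have e: "\<epsilon> / 2 > 0" by simp
  obtain \<eta> where \<eta>: "\<eta> > 0" "\<forall>\<^sub>F n in sequentially. \<forall>u. \<bar>u\<bar> \<le> \<eta> \<longrightarrow> \<bar>rk n * \<delta> (t n * exp u) - lam\<bar> \<le> \<epsilon> / 2"
    using delta_t_uniform[OF e] by blast
  from \<eta>(2) tendstoD[OF assms \<eta>(1)]
  show "\<forall>\<^sub>F n in sequentially. dist (rk n * \<delta> (t n * exp (x n))) lam < \<epsilon>"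
  proof eventually_elim
    case (elim n)
    then have "\<bar>rk n * \<delta> (t n * exp (x n)) - lam\<bar> \<le> \<epsilon> / 2" by (simp add: dist_real_def)
    then show ?case using \<open>\<epsilon> > 0\<close> unfolding dist_real_def by linarith
  qed
qed

lemma survival_t_bound:
  "\<forall>\<^sub>F n in sequentially. \<forall>x\<ge>0. real n / real (k n) * (1 - F (t n * exp x)) \<le> 2 * exp (- x / \<gamma>)"
proof -
  obtain K where K: "K > 0" "\<forall>\<^sub>F n in sequentially. \<forall>x\<ge>0. \<bar>rk n * \<delta> (t n * exp x)\<bar> \<le> K" using delta_t_bound by blast
  have "\<forall>\<^sub>F n in sequentially. rk n \<ge> K / \<gamma>" using rk_inf by (simp add: filterlim_at_top)
  with K(2) n_ge_2 show ?thesis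
  proof eventually_elim
    case (elim n)
    show ?case
    proof (intro allI impI)
      fix x :: real assume x: "x \<ge> 0"
      have "rk n * \<delta> (t n * exp x) \<le> K" using elim(1) x by (auto simp: abs_le_iff)
      also have "K \<le> rk n * \<gamma>" using elim(3) gamma_pos by (simp add: field_simps)
      finally have "\<delta> (t n * exp x) \<le> \<gamma>" using rk_pos[OF elim(2)] by simp
      then have "1 + \<delta> (t n * exp x) / \<gamma> \<le> 2" using gamma_pos by simp
      then show "real n / real (k n) * (1 - F (t n * exp x)) \<le> 2 * exp (- x / \<gamma>)"
        unfolding survival_t[OF elim(2)] by (simp add: mult.commute)
    qed
  qed
qed

text \<open>
  The mean of \<open>g\<close> under the exponential law with mean \<open>\<gamma>\<close>, integrated by parts. This is the law of the
  logarithm of a Pareto variable, the limit of the log excesses.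
\<close>

definition pareto_mean :: "(real \<Rightarrow> real) \<Rightarrow> (real \<Rightarrow> real) \<Rightarrow> real" where
  "pareto_mean g g' = g 0 + (\<integral>x. g' x * indicator {0..} x * exp (- x / \<gamma>) \<partial>lborel)"

text \<open>
  The limit of \<open>sqrt k\<close> times the deviation of the rescaled mean from \<open>pareto_mean\<close>. The factor
  \<open>exp (\<tau> * x)\<close> is the limit of \<open>\<delta> (t * exp x) / \<delta> t\<close>.
\<close>

definition tail_bias :: "(real \<Rightarrow> real) \<Rightarrow> (real \<Rightarrow> real) \<Rightarrow> real" where
  "tail_bias g g' = lam / \<gamma> * (g 0 + (\<integral>x. g' x * indicator {0..} x * (exp (- x / \<gamma>) * exp (\<tau> * x)) \<partial>lborel))"

lemma tail_excess_moment:
  assumes g: "subexponential g g'"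
  shows "\<forall>\<^sub>F n in sequentially. integrable law (tail_excess g (t n)) \<and>
     real n / real (k n) * (\<integral>z. tail_excess g (t n) z \<partial>law) =
       g 0 * (real n / real (k n) * (1 - F (t n))) + (\<integral>x. g' x * indicator {0..} x * (real n / real (k n) * (1 - F (t n * exp x))) \<partial>lborel)"
  using survival_t_bound n_ge_2
proof eventually_elim
  case (elim n)
  have k: "0 < k n" "0 < n" using k_pos[OF elim(2)] elim(2) by auto
  have S: "1 - F (t n * exp x) \<le> 2 * real (k n) / real n * exp (- (1 / \<gamma>) * x)" if "x \<ge> 0" for x
    using elim(1) that k by (auto simp: field_simps)
  have a: "1 / \<gamma> > 0" using gamma_pos by simp
  note I = tail_excess_integral[OF law(1) law(2)[symmetric] t_pos[OF elim(2)] g S a]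
  have "real n / real (k n) * (\<integral>x. g' x * indicator {0..} x * (1 - F (t n * exp x)) \<partial>lborel) =
    (\<integral>x. real n / real (k n) * (g' x * indicator {0..} x * (1 - F (t n * exp x))) \<partial>lborel)" by simp
  also have "\<dots> = (\<integral>x. g' x * indicator {0..} x * (real n / real (k n) * (1 - F (t n * exp x))) \<partial>lborel)"
    by (intro Bochner_Integration.integral_cong) (auto simp: mult_ac)
  finally have eq: "real n / real (k n) * (\<integral>x. g' x * indicator {0..} x * (1 - F (t n * exp x)) \<partial>lborel) =
    (\<integral>x. g' x * indicator {0..} x * (real n / real (k n) * (1 - F (t n * exp x))) \<partial>lborel)" .
  have "real n / real (k n) * (\<integral>z. tail_excess g (t n) z \<partial>law) =
    real n / real (k n) * (g 0 * (1 - F (t n))) + real n / real (k n) * (\<integral>x. g' x * indicator {0..} x * (1 - F (t n * exp x)) \<partial>lborel)"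
    by (simp only: I(2) distrib_left)
  also have "real n / real (k n) * (g 0 * (1 - F (t n))) = g 0 * (real n / real (k n) * (1 - F (t n)))" by simp
  finally show ?case using I(1) unfolding eq by blast
qed

lemma integrable_exp_tail:
  assumes "a > 0" shows "integrable lborel (\<lambda>x. exp (- (a * x)) * indicator {0..} x :: real)"
  using has_bochner_integral_power_exp[OF assms, of 0] by (simp add: has_bochner_integral_iff)

text \<open>
  After integration by parts the deviation is an integral of \<open>g'\<close> against \<open>exp (- x / \<gamma>)\<close> times
  \<open>sqrt k * \<delta> (t * exp x) / \<gamma>\<close>, which converges pointwise and is bounded uniformly in \<open>x\<close> by Potter's
  bound.
\<close>

lemma moment_expansion:
  assumes g: "subexponential g g'"
  shows "(\<lambda>n. rk n * (real n / real (k n) * (\<integral>z. tail_excess g (t n) z \<partial>law) - pareto_mean g g')) \<longlonglongrightarrow> tail_bias g g'"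
proof -
  define a where "a = 1 / \<gamma>"
  have a: "a > 0" using gamma_pos by (simp add: a_def)
  have g'm[measurable]: "g' \<in> borel_measurable borel" using subexponentialD(2)[OF g] by (rule borel_measurable_continuous_onI)
  obtain L where L: "\<And>x. x \<ge> 0 \<Longrightarrow> \<bar>g' x\<bar> \<le> L * exp (a / 2 * x)"
    using subexponentialD(4)[OF g, of "a/2"] a by auto
  have L0: "L \<ge> 0" using L[of 0] by simp
  obtain K where K: "K > 0" "\<forall>\<^sub>F n in sequentially. \<forall>x\<ge>0. \<bar>rk n * \<delta> (t n * exp x)\<bar> \<le> K" using delta_t_bound by blast
  define w where "w x = L * (K / \<gamma>) * (exp (- (a / 2 * x)) * indicator {0..} x)" for x :: real
  have wi: "integrable lborel w" unfolding w_def using a by (intro integrable_mult_right integrable_exp_tail) auto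
  have dom: "\<bar>g' x\<bar> * exp (- x / \<gamma>) * c \<le> w x * (c * \<gamma> / K)" if "x \<ge> 0" "c \<ge> 0" for x c
  proof -
    have "\<bar>g' x\<bar> * exp (- x / \<gamma>) \<le> L * exp (a / 2 * x) * exp (- x / \<gamma>)" using L[OF that(1)] by (intro mult_right_mono) auto
    also have "\<dots> = L * (exp (a / 2 * x) * exp (- x / \<gamma>))" by simp
    also have "exp (a / 2 * x) * exp (- x / \<gamma>) = exp (- (a / 2 * x))" by (simp add: a_def field_simps flip: exp_add)
    finally have "\<bar>g' x\<bar> * exp (- x / \<gamma>) * c \<le> L * exp (- (a / 2 * x)) * c" using that by (intro mult_right_mono) auto
    also have "\<dots> = w x * (c * \<gamma> / K)" using that K gamma_pos by (simp add: w_def)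
    finally show ?thesis .
  qed
  have i0: "integrable lborel (\<lambda>x. g' x * indicator {0..} x * exp (- x / \<gamma>))"
  proof (rule Bochner_Integration.integrable_bound[OF integrable_mult_right[OF wi, of "\<gamma> / K"]])
    show "AE x in lborel. norm (g' x * indicator {0..} x * exp (- x / \<gamma>)) \<le> norm (\<gamma> / K * w x)"
    proof (rule AE_I2)
      fix x show "norm (g' x * indicator {0..} x * exp (- x / \<gamma>)) \<le> norm (\<gamma> / K * w x)"
        using dom[of x 1] K gamma_pos L0 by (cases "x \<ge> 0") (auto simp: abs_mult w_def mult_ac)
    qed
  qed measurable
  let ?f = "\<lambda>n x. g' x * indicator {0..} x * (exp (- x / \<gamma>) * (rk n * \<delta> (t n * exp x) / \<gamma>))"
  have dm[measurable]: "\<delta> \<in> borel_measurable borel"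
    unfolding tail_delta_def[abs_def] by measurable
  have bnd: "\<forall>\<^sub>F n in sequentially. \<forall>x. norm (?f n x) \<le> w x"
    using K(2)
  proof eventually_elim
    case (elim n)
    show ?case
    proof
      fix x show "norm (?f n x) \<le> w x"
      proof (cases "x \<ge> 0")
        case True
        have "norm (?f n x) = \<bar>g' x\<bar> * exp (- x / \<gamma>) * (\<bar>rk n * \<delta> (t n * exp x)\<bar> / \<gamma>)"
          using True gamma_pos by (simp add: abs_mult)
        also have "\<dots> \<le> \<bar>g' x\<bar> * exp (- x / \<gamma>) * (K / \<gamma>)"
          using elim True gamma_pos by (intro mult_left_mono divide_right_mono) auto
        also have "\<dots> \<le> w x" using dom[OF True, of "K / \<gamma>"] K gamma_pos by simp
        finally show ?thesis .
      qed (simp add: w_def)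
    qed
  qed
  have lim: "(\<lambda>n. \<integral>x. ?f n x \<partial>lborel) \<longlonglongrightarrow> (\<integral>x. g' x * indicator {0..} x * (exp (- x / \<gamma>) * (lam * exp (\<tau> * x) / \<gamma>)) \<partial>lborel)"
  proof -
    obtain N where N: "\<And>n x. n \<ge> N \<Longrightarrow> norm (?f n x) \<le> w x" using bnd by (auto simp: eventually_sequentially)
    have "(\<lambda>n. \<integral>x. ?f (n + N) x \<partial>lborel) \<longlonglongrightarrow> (\<integral>x. g' x * indicator {0..} x * (exp (- x / \<gamma>) * (lam * exp (\<tau> * x) / \<gamma>)) \<partial>lborel)"
    proof (rule integral_dominated_convergence[OF _ _ wi])
      show "AE x in lborel. (\<lambda>n. ?f (n + N) x) \<longlonglongrightarrow> g' x * indicator {0..} x * (exp (- x / \<gamma>) * (lam * exp (\<tau> * x) / \<gamma>))"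
      proof (rule AE_I2)
        fix x
        have A: "(\<lambda>n. rk (n + N) * \<delta> (t (n + N) * exp x)) \<longlonglongrightarrow> lam * exp (\<tau> * x)"
          by (rule LIMSEQ_ignore_initial_segment[OF delta_t_exp])
        have "\<gamma> \<noteq> 0" using gamma_pos by simp
        then show "(\<lambda>n. ?f (n + N) x) \<longlonglongrightarrow> g' x * indicator {0..} x * (exp (- x / \<gamma>) * (lam * exp (\<tau> * x) / \<gamma>))"
          by (intro tendsto_mult[OF tendsto_const tendsto_mult[OF tendsto_const tendsto_divide[OF A tendsto_const]]])
      qed
      show "AE x in lborel. norm (?f (n + N) x) \<le> w x" for n using N by (intro AE_I2) simp
    qed measurable
    then show ?thesis by (rule LIMSEQ_offset)
  qed
  have "(\<lambda>n. g 0 * (rk n * \<delta> (t n) / \<gamma>) + (\<integral>x. ?f n x \<partial>lborel)) \<longlonglongrightarrow>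
     g 0 * (lam / \<gamma>) + (\<integral>x. g' x * indicator {0..} x * (exp (- x / \<gamma>) * (lam * exp (\<tau> * x) / \<gamma>)) \<partial>lborel)"
    using gamma_pos by (intro tendsto_intros delta_t lim) auto
  also have "(\<integral>x. g' x * indicator {0..} x * (exp (- x / \<gamma>) * (lam * exp (\<tau> * x) / \<gamma>)) \<partial>lborel) =
     (\<integral>x. lam / \<gamma> * (g' x * indicator {0..} x * (exp (- x / \<gamma>) * exp (\<tau> * x))) \<partial>lborel)"
    by (intro Bochner_Integration.integral_cong) auto
  also have "g 0 * (lam / \<gamma>) + \<dots> = tail_bias g g'"
    unfolding tail_bias_def by (simp add: distrib_left mult_ac)
  finally have main: "(\<lambda>n. g 0 * (rk n * \<delta> (t n) / \<gamma>) + (\<integral>x. ?f n x \<partial>lborel)) \<longlonglongrightarrow> tail_bias g g'" .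
  have "\<forall>\<^sub>F n in sequentially. g 0 * (rk n * \<delta> (t n) / \<gamma>) + (\<integral>x. ?f n x \<partial>lborel) = rk n * (real n / real (k n) * (\<integral>z. tail_excess g (t n) z \<partial>law) - pareto_mean g g')"
    using tail_excess_moment[OF g] bnd n_ge_2
  proof eventually_elim
    case (elim n)
    have rk: "rk n > 0" by (rule rk_pos[OF elim(3)])
    have fi: "integrable lborel (?f n)"
      by (rule Bochner_Integration.integrable_bound[OF wi]) (use elim(2) in \<open>auto intro!: AE_I2 order_trans[OF _ abs_ge_self]\<close>)
    have s: "g' x * indicator {0..} x * (real n / real (k n) * (1 - F (t n * exp x))) = g' x * indicator {0..} x * exp (- x / \<gamma>) + 1 / rk n * ?f n x" for x
      unfolding survival_t[OF elim(3)] using rk gamma_pos by (simp add: field_simps)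
    have "(\<integral>x. g' x * indicator {0..} x * (real n / real (k n) * (1 - F (t n * exp x))) \<partial>lborel) =
       (\<integral>x. g' x * indicator {0..} x * exp (- x / \<gamma>) \<partial>lborel) + 1 / rk n * (\<integral>x. ?f n x \<partial>lborel)"
      unfolding s Bochner_Integration.integral_add[OF i0 integrable_mult_right[OF fi]] by (simp only: integral_mult_right_zero)
    moreover have "real n / real (k n) * (1 - F (t n)) = 1 + \<delta> (t n) / \<gamma>" using survival_t[OF elim(3), of 0] by simp
    ultimately have "real n / real (k n) * (\<integral>z. tail_excess g (t n) z \<partial>law) - pareto_mean g g' = g 0 * (\<delta> (t n) / \<gamma>) + 1 / rk n * (\<integral>x. ?f n x \<partial>lborel)"
    proof -
      assume I: "(\<integral>x. g' x * indicator {0..} x * (real n / real (k n) * (1 - F (t n * exp x))) \<partial>lborel) =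
         (\<integral>x. g' x * indicator {0..} x * exp (- x / \<gamma>) \<partial>lborel) + 1 / rk n * (\<integral>x. ?f n x \<partial>lborel)"
        and q: "real n / real (k n) * (1 - F (t n)) = 1 + \<delta> (t n) / \<gamma>"
      have arith: "x = g0 * (1 + d) + (A + B) \<Longrightarrow> x - (g0 + A) = g0 * d + B" for x g0 d A B :: real
        by (simp add: algebra_simps)
      show ?thesis unfolding pareto_mean_def
        by (rule arith) (use elim(1) in \<open>simp only: I q\<close>)
    qed
    then show ?case using rk by (simp add: distrib_left mult_ac)
  qed
  from Lim_transform_eventually[OF main this] show ?thesis .
qed

lemma moment_limit:
  assumes g: "subexponential g g'"
  shows "(\<lambda>n. real n / real (k n) * (\<integral>z. tail_excess g (t n) z \<partial>law)) \<longlonglongrightarrow> pareto_mean g g'"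
proof -
  let ?m = "\<lambda>n. real n / real (k n) * (\<integral>z. tail_excess g (t n) z \<partial>law)"
  have "(\<lambda>n. rk n * (?m n - pareto_mean g g') * inverse (rk n) + pareto_mean g g') \<longlonglongrightarrow> tail_bias g g' * 0 + pareto_mean g g'"
    by (intro tendsto_intros moment_expansion[OF g] tendsto_inverse_0_at_top rk_inf)
  moreover have "\<forall>\<^sub>F n in sequentially. rk n * (?m n - pareto_mean g g') * inverse (rk n) + pareto_mean g g' = ?m n"
    using n_ge_2
  proof eventually_elim
    case (elim n)
    then show ?case using rk_pos[OF elim] by (simp add: field_simps)
  qed
  ultimately show ?thesis by (simp add: tendsto_cong)
qed

end

section \<open>Linear statistics of the tail\<close>

lemma tail_excess_mult: "tail_excess f t z * tail_excess g t z = tail_excess (\<lambda>x. f x * g x) t z"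
  by (simp add: tail_excess_def)

lemma cube_le: 
  fixes y r :: real assumes "r > 0" shows "\<bar>y\<bar> ^ 3 \<le> (y\<^sup>2 / r + r * y ^ 4) / 2"
proof -
  have "0 \<le> (1 / r) * (y\<^sup>2 * (1 - r * \<bar>y\<bar>)\<^sup>2)" using assms by simp
  also have "\<dots> = y\<^sup>2 / r - 2 * (y\<^sup>2 * \<bar>y\<bar>) + r * (y\<^sup>2 * \<bar>y\<bar>\<^sup>2)"
    using assms by (simp add: power2_diff field_simps power2_eq_square)
  also have "y\<^sup>2 * \<bar>y\<bar> = \<bar>y\<bar> ^ 3" by (simp add: power3_eq_cube power2_eq_square)
  also have "y\<^sup>2 * \<bar>y\<bar>\<^sup>2 = y ^ 4" by (simp add: power2_eq_square power4_eq_xxxx)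
  finally show ?thesis by simp
qed

lemma fourth_power_diff_le: "(a - b :: real) ^ 4 \<le> 8 * (a ^ 4 + b ^ 4)"
proof -
  have "(a - b)\<^sup>2 \<le> 2 * (a\<^sup>2 + b\<^sup>2)" using sum_squares_ge_zero[of "a + b" 0] by (simp add: power2_eq_square algebra_simps)
  then have "((a - b)\<^sup>2)\<^sup>2 \<le> (2 * (a\<^sup>2 + b\<^sup>2))\<^sup>2" by (intro power_mono) auto
  also have "\<dots> \<le> 8 * ((a\<^sup>2)\<^sup>2 + (b\<^sup>2)\<^sup>2)"
    using sum_squares_ge_zero[of "a\<^sup>2 - b\<^sup>2" 0] by (simp add: power2_eq_square algebra_simps)
  finally show ?thesis by (simp flip: power_mult)
qed

text \<open>
  The derivative in the exponent is \<open>(1 + r * x) * exp (r * x)\<close>, of absolute value at most 1 when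
  \<open>r * x \<le> 0\<close>.
\<close>

lemma exp_weight_lipschitz:
  fixes s s' x :: real assumes "s \<le> 0" "s' \<le> 0" "x \<ge> 0"
  shows "\<bar>s * exp (s * x) - s' * exp (s' * x)\<bar> \<le> \<bar>s - s'\<bar>"
proof -
  have bnd: "\<bar>(1 + r * x) * exp (r * x)\<bar> \<le> 1" if "r \<le> 0" for r
  proof -
    let ?y = "- (r * x)"
    have y: "?y \<ge> 0" using that assms(3) by (simp add: mult_nonpos_nonneg)
    have "(1 - ?y) * exp (- ?y) \<le> 1 * exp (- ?y)" using y by (intro mult_right_mono) auto
    also have "\<dots> \<le> 1" using y by simp
    finally have 1: "(1 - ?y) * exp (- ?y) \<le> 1" .
    have "?y - 1 \<le> exp ?y" using exp_ge_add_one_self[of ?y] by linarith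
    then have "(?y - 1) * exp (- ?y) \<le> exp ?y * exp (- ?y)" by (intro mult_right_mono) auto
    also have "\<dots> = 1" by (simp flip: exp_add)
    finally have 2: "(?y - 1) * exp (- ?y) \<le> 1" .
    show ?thesis using 1 2 by (simp add: abs_le_iff algebra_simps)
  qed
  have "norm (s * exp (s * x) - s' * exp (s' * x)) \<le> 1 * norm (s - s')"
  proof (rule field_differentiable_bound[where S="{..0}" and f'="\<lambda>r. (1 + r * x) * exp (r * x)"])
    fix r :: real assume "r \<in> {..0}"
    show "((\<lambda>s. s * exp (s * x)) has_field_derivative (1 + r * x) * exp (r * x)) (at r within {..0})"
      by (auto intro!: derivative_eq_intros simp: algebra_simps)
    show "norm ((1 + r * x) * exp (r * x)) \<le> 1" using bnd[of r] \<open>r \<in> {..0}\<close> by simp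
  qed (use assms in auto)
  then show ?thesis by simp
qed

locale tail_sample = intermediate_tail \<gamma> \<tau> F k lam + prob_seq M
  for \<gamma> \<tau> F k lam and M :: "nat \<Rightarrow> 'a measure" +
  fixes X :: "nat \<Rightarrow> nat \<Rightarrow> 'a \<Rightarrow> real"
  assumes F0: "F 0 = 0"
    and X_indep: "\<And>n. prob_space.indep_vars (M n) (\<lambda>_. borel) (X n) {1..n}"
    and X_law: "\<And>n i. i \<in> {1..n} \<Longrightarrow> cdf (distr (M n) borel (X n i)) = F"
begin

lemma iid: "iid_sample (M n) (X n) n law"
proof -
  interpret prob_space "M n" by (rule prob_M)
  interpret L: real_distribution law by (rule law)
  have rv: "X n j \<in> borel_measurable (M n)" if "j \<in> {1..n}" for j
    using X_indep[of n] that by (simp add: indep_vars_def)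
  show ?thesis
  proof
    show "indep_vars (\<lambda>_. borel) (X n) {1..n}" by (rule X_indep)
    fix j assume "j \<in> {1..n}"
    have "cdf (distr (M n) borel (X n j)) = cdf law" unfolding law(2) by (rule X_law) fact
    then show "distr (M n) borel (X n j) = law"
      using \<open>j \<in> {1..n}\<close> by (intro cdf_unique real_distribution_distr rv law(1))
  qed (simp_all add: L.prob_space_axioms)
qed

lemma X_meas: "j \<in> {1..n} \<Longrightarrow> X n j \<in> borel_measurable (M n)"
  by (rule iid_sample.rv[OF iid])

lemma sum_meas: "f \<in> borel_measurable borel \<Longrightarrow> (\<lambda>\<omega>. \<Sum>j=1..n. f (X n j \<omega>) :: real) \<in> borel_measurable (M n)"
  by (intro borel_measurable_sum measurable_compose[OF X_meas])

lemma law_meas: "f \<in> borel_measurable borel \<Longrightarrow> f \<in> borel_measurable law"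
  unfolding measurable_cong_sets[OF real_distribution.events_eq_borel[OF law(1)] refl] .

lemma centered_sum_bound:
  assumes f: "f \<in> borel_measurable borel" "integrable law f" "integrable law (\<lambda>z. (f z)\<^sup>2)"
  shows "(\<integral>\<^sup>+\<omega>. ennreal \<bar>((\<Sum>j=1..n. f (X n j \<omega>)) - real n * (\<integral>z. f z \<partial>law))\<^sup>2\<bar> \<partial>M n) \<le> ennreal (real n * (\<integral>z. (f z)\<^sup>2 \<partial>law))"
proof -
  note V = iid_sample.variance_sum[OF iid f]
  have "(\<integral>\<^sup>+\<omega>. ennreal \<bar>((\<Sum>j=1..n. f (X n j \<omega>)) - real n * (\<integral>z. f z \<partial>law))\<^sup>2\<bar> \<partial>M n) =
    ennreal (\<integral>\<omega>. ((\<Sum>j=1..n. f (X n j \<omega>)) - real n * (\<integral>z. f z \<partial>law))\<^sup>2 \<partial>M n)"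
    using nn_integral_eq_integral[OF V(1)] by simp
  also have "\<dots> \<le> ennreal (real n * (\<integral>z. (f z)\<^sup>2 \<partial>law))" by (intro ennreal_leI V(2))
  finally show ?thesis .
qed

lemma op_of_square:
  assumes "op (\<lambda>n \<omega>. (Y n \<omega>)\<^sup>2)" shows "op Y"
  unfolding small_in_prob_def
proof (intro allI impI)
  fix \<epsilon> :: real assume e: "\<epsilon> > 0"
  then have "\<epsilon>\<^sup>2 > 0" by simp
  from op_whp[OF assms this] show "whp (\<lambda>n \<omega>. \<bar>Y n \<omega>\<bar> \<le> \<epsilon>)"
  proof (rule whp_mono)
    fix n \<omega> assume "\<bar>(Y n \<omega>)\<^sup>2\<bar> \<le> \<epsilon>\<^sup>2"
    then show "\<bar>Y n \<omega>\<bar> \<le> \<epsilon>" using e by (simp add: abs_le_square_iff[symmetric])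
  qed
qed

lemma Op_of_square:
  assumes "Op (\<lambda>n \<omega>. (Y n \<omega>)\<^sup>2)" shows "Op Y"
  unfolding bounded_in_prob_def
proof (intro allI impI)
  fix \<eta> :: real assume "\<eta> > 0"
  from Op_whp_bound[OF assms this] obtain B where B: "B > 0"
    "\<forall>\<^sub>F n in sequentially. \<exists>A\<in>sets (M n). measure (M n) A \<ge> 1 - \<eta> \<and> (\<forall>\<omega>\<in>A. \<bar>(Y n \<omega>)\<^sup>2\<bar> \<le> B)" by blast
  have imp: "\<bar>y\<bar> \<le> 1 + B" if "\<bar>y\<^sup>2\<bar> \<le> B" for y :: real
  proof -
    have "0 \<le> (\<bar>y\<bar> - 1)\<^sup>2" by simp
    then show ?thesis using that B(1) by (simp add: power2_diff)
  qed
  from B(2) have "\<forall>\<^sub>F n in sequentially. \<exists>A\<in>sets (M n). measure (M n) A \<ge> 1 - \<eta> \<and> (\<forall>\<omega>\<in>A. \<bar>Y n \<omega>\<bar> \<le> 1 + B)"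
    by eventually_elim (use imp in blast)
  then show "\<exists>B. \<forall>\<^sub>F n in sequentially. \<exists>A\<in>sets (M n). measure (M n) A \<ge> 1 - \<eta> \<and> (\<forall>\<omega>\<in>A. \<bar>Y n \<omega>\<bar> \<le> B)" ..
qed

text \<open>
  Centred by \<open>k * c\<close>, where \<open>c\<close> will be the mean in the Pareto limit and not the actual mean; hence the
  bias in the limit.
\<close>

definition linear_stat :: "(real \<Rightarrow> real) \<Rightarrow> real \<Rightarrow> nat \<Rightarrow> 'a \<Rightarrow> real" where
  "linear_stat g c n \<omega> = ((\<Sum>j=1..n. tail_excess g (t n) (X n j \<omega>)) - real (k n) * c) / rk n"

definition N :: "nat \<Rightarrow> real \<Rightarrow> 'a \<Rightarrow> real" where "N n x \<omega> = exceed (\<lambda>j. X n j \<omega>) n (t n * exp x)"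

text \<open>
  The tail empirical process on the log scale.
\<close>

definition G :: "nat \<Rightarrow> real \<Rightarrow> 'a \<Rightarrow> real" where
  "G n x \<omega> = (N n x \<omega> - real (k n) * exp (- x / \<gamma>)) / rk n"

lemma rk_sq: "rk n * rk n = real (k n)" by simp

text \<open>
  The summands, centred by their mean and divided by \<open>sqrt k\<close>, form a triangular array. Only a fraction
  \<open>k / n\<close> of the observations contributes, so the squared mean is negligible against the second moment,
  and fourth moments of order \<open>1 / (n * k)\<close> control the third ones. The deterministic remainder is the
  deviation treated in \<open>moment_expansion\<close>.
\<close>

lemma 
  assumes g: "subexponential g g'"
  defines "c \<equiv> pareto_mean g g'" and "v \<equiv> pareto_mean (\<lambda>x. g x * g x) (\<lambda>x. g' x * g x + g x * g' x)"
  shows lin_char: "(\<lambda>n. \<integral>\<omega>. iexp (linear_stat g c n \<omega>) \<partial>M n) \<longlonglongrightarrow> iexp (tail_bias g g') * of_real (exp (- v / 2))"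
    and lin_Op: "Op (linear_stat g c)"
proof -
  interpret L: real_distribution law by (rule law)
  have pU: "measure law UNIV = 1" using L.prob_space by simp
  define Z where "Z n = tail_excess g (t n)" for n
  define \<mu> where "\<mu> n = (\<integral>z. Z n z \<partial>law)" for n
  define f where "f n z = (Z n z - \<mu> n) / rk n" for n z
  note g2 = subexponential_mult[OF g g]
  note g4 = subexponential_mult[OF g2 g2]
  define w where "w = pareto_mean (\<lambda>x. g x * g x * (g x * g x)) (\<lambda>x. (g' x * g x + g x * g' x) * (g x * g x) + (g x * g x) * (g' x * g x + g x * g' x))"
  have Zm[measurable]: "Z n \<in> borel_measurable borel" for n unfolding Z_def
    by (rule borel_measurable_tail_excess) (rule subexponentialD[OF g])
  have fm[measurable]: "f n \<in> borel_measurable borel" for n unfolding f_def[abs_def] by measurable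
  have Z2: "(Z n z)\<^sup>2 = tail_excess (\<lambda>x. g x * g x) (t n) z" for n z
    unfolding Z_def tail_excess_mult[symmetric] by (rule power2_eq_square)
  have Z4: "(Z n z) ^ 4 = tail_excess (\<lambda>x. g x * g x * (g x * g x)) (t n) z" for n z
    unfolding Z_def tail_excess_mult[symmetric] by (simp add: power4_eq_xxxx)
  have m1: "(\<lambda>n. real n / real (k n) * \<mu> n) \<longlonglongrightarrow> c"
    using moment_limit[OF g] by (simp add: \<mu>_def Z_def c_def)
  have m2: "(\<lambda>n. real n / real (k n) * (\<integral>z. (Z n z)\<^sup>2 \<partial>law)) \<longlonglongrightarrow> v"
    unfolding Z2 v_def by (rule moment_limit[OF g2])
  have m4: "(\<lambda>n. real n / real (k n) * (\<integral>z. (Z n z) ^ 4 \<partial>law)) \<longlonglongrightarrow> w"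
    unfolding Z4 w_def by (rule moment_limit[OF g4])
  have ints: "\<forall>\<^sub>F n in sequentially. integrable law (Z n) \<and> integrable law (\<lambda>z. (Z n z)\<^sup>2) \<and> integrable law (\<lambda>z. (Z n z) ^ 4)"
    unfolding Z2 Z4 unfolding Z_def
    using tail_excess_moment[OF g] tail_excess_moment[OF g2] tail_excess_moment[OF g4]
    by eventually_elim blast
  have fi: "\<forall>\<^sub>F n in sequentially. integrable law (f n) \<and> integrable law (\<lambda>z. (f n z)\<^sup>2) \<and> integrable law (\<lambda>z. (f n z) ^ 4) \<and> integrable law (\<lambda>z. \<bar>f n z\<bar> ^ 3) \<and>
     (\<integral>z. f n z \<partial>law) = 0 \<and> 
     real n * (\<integral>z. (f n z)\<^sup>2 \<partial>law) = real n / real (k n) * (\<integral>z. (Z n z)\<^sup>2 \<partial>law) - (real n / real (k n) * \<mu> n)\<^sup>2 * (real (k n) / real n) \<and>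
     real n * (\<integral>z. \<bar>f n z\<bar> ^ 3 \<partial>law) \<le> (real n * (\<integral>z. (f n z)\<^sup>2 \<partial>law) + 8 * (real n / real (k n) * (\<integral>z. (Z n z) ^ 4 \<partial>law) + (real n / real (k n) * \<mu> n) ^ 4 * (real (k n) / real n) ^ 3)) / (2 * rk n)"
    using ints n_ge_2
  proof eventually_elim
    case (elim n)
    have kn: "real (k n) > 0" "real n > 0" "rk n > 0" using k_pos[OF elim(2)] elim(2) by auto
    have f2: "(f n z)\<^sup>2 = 1 / real (k n) * ((Z n z)\<^sup>2 - 2 * \<mu> n * Z n z + (\<mu> n)\<^sup>2)" for z
      using kn by (simp add: f_def power_divide power2_diff mult_ac)
    have i1: "integrable law (f n)" unfolding f_def using elim(1) by auto
    have i2: "integrable law (\<lambda>z. (f n z)\<^sup>2)" unfolding f2 using elim(1) by auto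
    have f4: "(f n z) ^ 4 \<le> 8 / (real (k n))\<^sup>2 * ((Z n z) ^ 4 + (\<mu> n) ^ 4)" for z
    proof -
      have "rk n ^ 4 = (real (k n))\<^sup>2" using power_mult[of "rk n" 2 2] by simp
      then show ?thesis using fourth_power_diff_le[of "Z n z" "\<mu> n"] kn by (simp add: f_def power_divide divide_right_mono)
    qed
    have i4': "integrable law (\<lambda>z. 8 / (real (k n))\<^sup>2 * ((Z n z) ^ 4 + (\<mu> n) ^ 4))" using elim(1) by auto
    have i4: "integrable law (\<lambda>z. (f n z) ^ 4)"
      by (rule Bochner_Integration.integrable_bound[OF i4']) (auto simp: law_meas intro!: AE_I2 order_trans[OF f4] abs_ge_self)
    have i3': "integrable law (\<lambda>z. ((f n z)\<^sup>2 / rk n + rk n * (f n z) ^ 4) / 2)" using i2 i4 by auto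
    have i3: "integrable law (\<lambda>z. \<bar>f n z\<bar> ^ 3)"
    proof (rule Bochner_Integration.integrable_bound[OF i3'])
      show "AE z in law. norm (\<bar>f n z\<bar> ^ 3) \<le> norm (((f n z)\<^sup>2 / rk n + rk n * (f n z) ^ 4) / 2)"
      proof (rule AE_I2)
        fix z show "norm (\<bar>f n z\<bar> ^ 3) \<le> norm (((f n z)\<^sup>2 / rk n + rk n * (f n z) ^ 4) / 2)"
          using order_trans[OF cube_le[OF kn(3), of "f n z"] abs_ge_self] by simp
      qed
    qed (auto intro: law_meas)
    have z: "(\<integral>z. f n z \<partial>law) = 0" unfolding f_def using elim(1) by (simp add: \<mu>_def L.prob_space pU)
    have s2: "real n * (\<integral>z. (f n z)\<^sup>2 \<partial>law) = real n / real (k n) * (\<integral>z. (Z n z)\<^sup>2 \<partial>law) - (real n / real (k n) * \<mu> n)\<^sup>2 * (real (k n) / real n)"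
    proof -
      have "(\<integral>z. (Z n z)\<^sup>2 - 2 * \<mu> n * Z n z + (\<mu> n)\<^sup>2 \<partial>law) = (\<integral>z. (Z n z)\<^sup>2 \<partial>law) - (\<mu> n)\<^sup>2"
        using elim(1) by (simp add: L.prob_space pU \<mu>_def power2_eq_square)
      then have "(\<integral>z. (f n z)\<^sup>2 \<partial>law) = 1 / real (k n) * ((\<integral>z. (Z n z)\<^sup>2 \<partial>law) - (\<mu> n)\<^sup>2)"
        unfolding f2 by (simp only: integral_mult_right_zero)
      then have "real n * (\<integral>z. (f n z)\<^sup>2 \<partial>law) = real n * (1 / real (k n) * ((\<integral>z. (Z n z)\<^sup>2 \<partial>law) - (\<mu> n)\<^sup>2))" by simp
      also have "\<dots> = real n / real (k n) * (\<integral>z. (Z n z)\<^sup>2 \<partial>law) - (real n / real (k n) * \<mu> n)\<^sup>2 * (real (k n) / real n)"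
        using kn by (simp add: field_simps power2_eq_square)
      finally show ?thesis .
    qed
    have "(\<integral>z. \<bar>f n z\<bar> ^ 3 \<partial>law) \<le> (\<integral>z. ((f n z)\<^sup>2 / rk n + rk n * (f n z) ^ 4) / 2 \<partial>law)"
      by (rule integral_mono[OF i3 i3' cube_le[OF kn(3)]])
    also have "\<dots> = ((\<integral>z. (f n z)\<^sup>2 \<partial>law) / rk n + rk n * (\<integral>z. (f n z) ^ 4 \<partial>law)) / 2" using i2 i4 by simp
    also have "(\<integral>z. (f n z) ^ 4 \<partial>law) \<le> (\<integral>z. 8 / (real (k n))\<^sup>2 * ((Z n z) ^ 4 + (\<mu> n) ^ 4) \<partial>law)"
      by (rule integral_mono[OF i4 i4' f4])
    also have "\<dots> = 8 / (real (k n))\<^sup>2 * ((\<integral>z. (Z n z) ^ 4 \<partial>law) + (\<mu> n) ^ 4)"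
      using elim(1) by (simp add: L.prob_space pU)
    finally have "(\<integral>z. \<bar>f n z\<bar> ^ 3 \<partial>law) \<le> ((\<integral>z. (f n z)\<^sup>2 \<partial>law) / rk n + rk n * (8 / (real (k n))\<^sup>2 * ((\<integral>z. (Z n z) ^ 4 \<partial>law) + (\<mu> n) ^ 4))) / 2"
      using kn by simp
    then have "real n * (\<integral>z. \<bar>f n z\<bar> ^ 3 \<partial>law) \<le> real n * (((\<integral>z. (f n z)\<^sup>2 \<partial>law) / rk n + rk n * (8 / (real (k n))\<^sup>2 * ((\<integral>z. (Z n z) ^ 4 \<partial>law) + (\<mu> n) ^ 4))) / 2)"
      by (intro mult_left_mono) auto
    also have "\<dots> = (real n * (\<integral>z. (f n z)\<^sup>2 \<partial>law) + 8 * (real n / real (k n) * (\<integral>z. (Z n z) ^ 4 \<partial>law) + (real n / real (k n) * \<mu> n) ^ 4 * (real (k n) / real n) ^ 3)) / (2 * rk n)"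
    proof -
      have a: "rk n * (8 / (real (k n))\<^sup>2 * q) = 8 * q / real (k n) / rk n" for q
      proof -
        have "rk n / real (k n) = 1 / rk n" using kn by (simp add: field_simps)
        then have "8 * q / real (k n) * (rk n / real (k n)) = 8 * q / real (k n) * (1 / rk n)" by simp
        then show ?thesis by (simp add: power2_eq_square mult_ac)
      qed
      have b: "(real n / real (k n) * \<mu> n) ^ 4 * (real (k n) / real n) ^ 3 = real n / real (k n) * \<mu> n ^ 4"
        using kn by (simp add: power_mult_distrib power_divide power4_eq_xxxx power3_eq_cube)
      show ?thesis unfolding a b using kn by (simp add: field_simps)
    qed
    finally show ?case using i1 i2 i3 i4 z s2 by blast
  qed
  have kn0: "(\<lambda>n. (real n / real (k n) * \<mu> n)\<^sup>2 * (real (k n) / real n)) \<longlonglongrightarrow> c\<^sup>2 * 0"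
    "(\<lambda>n. (real n / real (k n) * \<mu> n) ^ 4 * (real (k n) / real n) ^ 3) \<longlonglongrightarrow> c ^ 4 * 0 ^ 3"
    by (intro tendsto_intros m1 k_small)+
  have var: "(\<lambda>n. real n * (\<integral>z. (f n z)\<^sup>2 \<partial>law)) \<longlonglongrightarrow> v"
  proof (rule Lim_transform_eventually)
    show "(\<lambda>n. real n / real (k n) * (\<integral>z. (Z n z)\<^sup>2 \<partial>law) - (real n / real (k n) * \<mu> n)\<^sup>2 * (real (k n) / real n)) \<longlonglongrightarrow> v"
      using tendsto_diff[OF m2 kn0(1)] by simp
    show "\<forall>\<^sub>F n in sequentially. real n / real (k n) * (\<integral>z. (Z n z)\<^sup>2 \<partial>law) - (real n / real (k n) * \<mu> n)\<^sup>2 * (real (k n) / real n) = real n * (\<integral>z. (f n z)\<^sup>2 \<partial>law)"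
      using fi by eventually_elim simp
  qed
  have third: "(\<lambda>n. real n * (\<integral>z. \<bar>f n z\<bar> ^ 3 \<partial>law)) \<longlonglongrightarrow> 0"
  proof (rule tendsto_sandwich[OF _ _ tendsto_const])
    show "\<forall>\<^sub>F n in sequentially. 0 \<le> real n * (\<integral>z. \<bar>f n z\<bar> ^ 3 \<partial>law)" by (intro always_eventually allI) simp
    show "\<forall>\<^sub>F n in sequentially. real n * (\<integral>z. \<bar>f n z\<bar> ^ 3 \<partial>law) \<le> (real n * (\<integral>z. (f n z)\<^sup>2 \<partial>law) + 8 * (real n / real (k n) * (\<integral>z. (Z n z) ^ 4 \<partial>law) + (real n / real (k n) * \<mu> n) ^ 4 * (real (k n) / real n) ^ 3)) * (1 / 2 * inverse (rk n))"
    proof -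
      have e: "q * (1 / 2 * inverse r) = q / (2 * r)" for q r :: real by (cases "r = 0") (simp_all add: field_simps)
      show ?thesis unfolding e using fi by (rule eventually_mono) (elim conjE, assumption)
    qed
    have "(\<lambda>n. (real n * (\<integral>z. (f n z)\<^sup>2 \<partial>law) + 8 * (real n / real (k n) * (\<integral>z. (Z n z) ^ 4 \<partial>law) + (real n / real (k n) * \<mu> n) ^ 4 * (real (k n) / real n) ^ 3)) * (1 / 2 * inverse (rk n))) \<longlonglongrightarrow>
       (v + 8 * (w + c ^ 4 * 0 ^ 3)) * (1 / 2 * 0)"
      by (intro tendsto_mult tendsto_add tendsto_const var m4 kn0(2) tendsto_inverse_0_at_top rk_inf)
    then show "(\<lambda>n. (real n * (\<integral>z. (f n z)\<^sup>2 \<partial>law) + 8 * (real n / real (k n) * (\<integral>z. (Z n z) ^ 4 \<partial>law) + (real n / real (k n) * \<mu> n) ^ 4 * (real (k n) / real n) ^ 3)) * (1 / 2 * inverse (rk n))) \<longlonglongrightarrow> 0"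
      by simp
  qed
  define b where "b n = rk n * (real n / real (k n) * \<mu> n - c)" for n
  have blim: "b \<longlonglongrightarrow> tail_bias g g'"
    unfolding b_def[abs_def] using moment_expansion[OF g] by (simp add: \<mu>_def Z_def c_def)
  have dec: "linear_stat g c n \<omega> = b n + (\<Sum>j=1..n. f n (X n j \<omega>))" if "n \<ge> 2" for n \<omega>
  proof -
    have r: "rk n > 0" by (rule rk_pos[OF that])
    have "real (k n) / rk n = rk n" using r by (simp add: field_simps)
    then have "real (k n) * c / rk n = rk n * c" by (metis times_divide_eq_left)
    moreover have "(\<Sum>j=1..n. f n (X n j \<omega>)) = ((\<Sum>j=1..n. Z n (X n j \<omega>)) - real n * \<mu> n) / rk n"
      by (simp add: f_def sum_divide_distrib[symmetric] sum_subtractf)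
    moreover have "rk n * (real n / real (k n) * \<mu> n) = real n * \<mu> n / rk n"
      using r rk_sq[of n] by (simp add: field_simps)
    ultimately show ?thesis by (simp add: linear_stat_def b_def Z_def right_diff_distrib diff_divide_distrib)
  qed
  have P: "prob_space law" by (rule L.prob_space_axioms)
  have fi': "\<forall>\<^sub>F n in sequentially. integrable law (f n) \<and> integrable law (\<lambda>z. (f n z)\<^sup>2) \<and> integrable law (\<lambda>z. \<bar>f n z\<bar> ^ 3) \<and> (\<integral>z. f n z \<partial>law) = 0"
    using fi by eventually_elim blast
  have "(\<lambda>n. iexp (b n) * (\<integral>z. iexp (f n z) \<partial>law) ^ n) \<longlonglongrightarrow> iexp (tail_bias g g') * of_real (exp (- v / 2))"
    by (intro tendsto_intros blim triangular_array_clt[OF P _ fi' var third] law_meas fm)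
  moreover have "\<forall>\<^sub>F n in sequentially. iexp (b n) * (\<integral>z. iexp (f n z) \<partial>law) ^ n = (\<integral>\<omega>. iexp (linear_stat g c n \<omega>) \<partial>M n)"
    using n_ge_2
  proof eventually_elim
    case (elim n)
    have "(\<integral>\<omega>. iexp (linear_stat g c n \<omega>) \<partial>M n) = (\<integral>\<omega>. iexp (b n) * iexp (\<Sum>j=1..n. f n (X n j \<omega>)) \<partial>M n)"
      unfolding dec[OF elim] by (simp add: distrib_left exp_add)
    also have "\<dots> = iexp (b n) * (\<integral>\<omega>. iexp (\<Sum>j=1..n. f n (X n j \<omega>)) \<partial>M n)" by simp
    finally show ?case unfolding iid_sample.char_sample[OF iid fm] by simp
  qed
  ultimately show "(\<lambda>n. \<integral>\<omega>. iexp (linear_stat g c n \<omega>) \<partial>M n) \<longlonglongrightarrow> iexp (tail_bias g g') * of_real (exp (- v / 2))"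
    by (rule Lim_transform_eventually)
  have "Op (\<lambda>n \<omega>. (\<Sum>j=1..n. f n (X n j \<omega>))\<^sup>2)"
  proof (rule Op_of_moment)
    have "\<forall>\<^sub>F n in sequentially. real n * (\<integral>z. (f n z)\<^sup>2 \<partial>law) < v + 1" by (rule order_tendstoD[OF var]) simp
    with fi' show "\<forall>\<^sub>F n in sequentially. (\<lambda>\<omega>. (\<Sum>j=1..n. f n (X n j \<omega>))\<^sup>2) \<in> borel_measurable (M n) \<and>
      (\<integral>\<^sup>+\<omega>. ennreal \<bar>(\<Sum>j=1..n. f n (X n j \<omega>))\<^sup>2\<bar> \<partial>M n) \<le> ennreal (v + 1)"
    proof eventually_elim
      case (elim n)
      note sm[measurable] = sum_meas[OF fm, of n n]
      have meas: "(\<lambda>\<omega>. (\<Sum>j=1..n. f n (X n j \<omega>))\<^sup>2) \<in> borel_measurable (M n)" by measurable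
      have "(\<integral>\<^sup>+\<omega>. ennreal \<bar>(\<Sum>j=1..n. f n (X n j \<omega>))\<^sup>2\<bar> \<partial>M n) \<le> ennreal (real n * (\<integral>z. (f n z)\<^sup>2 \<partial>law))"
        using centered_sum_bound[OF fm, of n n] elim by simp
      also have "\<dots> \<le> ennreal (v + 1)" using elim by (intro ennreal_leI) auto
      finally show ?case using meas by blast
    qed
  qed
  then have "Op (\<lambda>n \<omega>. \<Sum>j=1..n. f n (X n j \<omega>))" by (rule Op_of_square)
  moreover have "Op (\<lambda>n \<omega>. b n)"
    by (rule Op_of_limit[of _ "tail_bias g g'"], rule op_seq) (use tendsto_diff[OF blim tendsto_const[of "tail_bias g g'"]] in simp)
  ultimately have "Op (\<lambda>n \<omega>. b n + (\<Sum>j=1..n. f n (X n j \<omega>)))" by (intro Op_add)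
  moreover have "op (\<lambda>n \<omega>. linear_stat g c n \<omega> - (b n + (\<Sum>j=1..n. f n (X n j \<omega>))))"
  proof (rule op_cong[OF op_seq[OF tendsto_const]])
    show "whp (\<lambda>n \<omega>. linear_stat g c n \<omega> - (b n + (\<Sum>j=1..n. f n (X n j \<omega>))) = 0)"
      by (rule whp_eventually) (use n_ge_2 in \<open>eventually_elim, simp add: dec\<close>)
  qed
  ultimately show "Op (linear_stat g c)" by (rule Op_of_approx[rotated])
qed

end

section \<open>The tail empirical process and the random threshold\<close>

context tail_sample
begin

lemma whp_n2: "whp (\<lambda>n \<omega>. n \<ge> 2)"
  by (rule whp_eventually, rule eventually_mono[OF n_ge_2]) blast

lemma law_survival: "(\<integral>z. of_bool (y < z) \<partial>law) = 1 - F y" "integrable law (\<lambda>z. of_bool (y < z) :: real)"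
proof -
  interpret L: real_distribution law by (rule law)
  have e: "(\<lambda>z. of_bool (y < z) :: real) = indicator {y<..}" by (auto split: split_indicator)
  have "L.prob {y<..} = 1 - L.prob {..y}"
    using L.prob_compl[of "{..y}"] by (simp add: Compl_eq_Diff_UNIV[symmetric])
  also have "L.prob {..y} = F y" by (metis law(2) cdf_def)
  finally show "(\<integral>z. of_bool (y < z) \<partial>law) = 1 - F y" "integrable law (\<lambda>z. of_bool (y < z) :: real)"
    unfolding e by (auto simp: L.emeasure_eq_measure)
qed

lemma borel_measurable_N [measurable]: "N n x \<in> borel_measurable (M n)"
  unfolding N_def[abs_def] by (rule borel_measurable_exceed) (rule X_meas)

lemma borel_measurable_G [measurable]: "G n x \<in> borel_measurable (M n)"
  unfolding G_def[abs_def] by measurable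

definition G_mean :: "nat \<Rightarrow> real \<Rightarrow> real" where
  "G_mean n x = exp (- x / \<gamma>) * (rk n * \<delta> (t n * exp x)) / \<gamma>"

definition G_step :: "nat \<Rightarrow> real \<Rightarrow> real \<Rightarrow> real" where
  "G_step n x z = of_bool (t n * exp x < z) / rk n"

lemma G_step_meas [measurable]: "G_step n x \<in> borel_measurable borel"
  unfolding G_step_def[abs_def] by measurable

lemma G_step_integrable: "integrable law (G_step n x)"
  unfolding G_step_def using law_survival(2) by simp

lemma scaled_survival:
  assumes "n \<ge> 2"
  shows "real n * (\<integral>z. G_step n x z \<partial>law) = rk n * exp (- x / \<gamma>) + G_mean n x"
proof -
  have r: "rk n > 0" using rk_pos[OF assms] .
  have "real n * (\<integral>z. G_step n x z \<partial>law) = rk n * (real n / real (k n) * (1 - F (t n * exp x)))"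
    using r rk_sq[of n] by (simp add: G_step_def law_survival field_simps)
  also have "\<dots> = rk n * exp (- x / \<gamma>) + G_mean n x"
    unfolding survival_t[OF assms] using gamma_pos by (simp add: G_mean_def field_simps)
  finally show ?thesis .
qed

lemma G_decompose:
  assumes "n \<ge> 2"
  shows "G n x \<omega> = ((\<Sum>j=1..n. G_step n x (X n j \<omega>)) - real n * (\<integral>z. G_step n x z \<partial>law)) + G_mean n x"
proof -
  have r: "rk n > 0" using rk_pos[OF assms] .
  have "(\<Sum>j=1..n. G_step n x (X n j \<omega>)) = N n x \<omega> / rk n"
    by (simp only: G_step_def N_def exceed_def sum_divide_distrib)
  moreover have "real (k n) * exp (- x / \<gamma>) / rk n = rk n * exp (- x / \<gamma>)"
    using r rk_sq[of n] by (simp add: field_simps)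
  ultimately show ?thesis unfolding scaled_survival[OF assms] G_def diff_divide_distrib by simp
qed

text \<open>
  The count is a sum of independent indicators, so its variance is at most its mean, and the bias is
  bounded by Potter's bound.
\<close>

lemma G_second_moment:
  "\<exists>K>0. \<forall>\<^sub>F n in sequentially. \<forall>x\<ge>0. (\<integral>\<^sup>+\<omega>. ennreal ((G n x \<omega>)\<^sup>2) \<partial>M n) \<le> ennreal (K * exp (- x / \<gamma>))"
proof -
  obtain K0 where K0: "K0 > 0" "\<forall>\<^sub>F n in sequentially. \<forall>x\<ge>0. \<bar>rk n * \<delta> (t n * exp x)\<bar> \<le> K0" using delta_t_bound by blast
  let ?K = "4 + 2 * (K0 / \<gamma>)\<^sup>2"
  have "\<forall>\<^sub>F n in sequentially. \<forall>x\<ge>0. (\<integral>\<^sup>+\<omega>. ennreal ((G n x \<omega>)\<^sup>2) \<partial>M n) \<le> ennreal (?K * exp (- x / \<gamma>))"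
    using K0(2) survival_t_bound n_ge_2
  proof eventually_elim
    case (elim n)
    have r: "rk n > 0" using rk_pos[OF elim(3)] .
    show ?case
    proof (intro allI impI)
      fix x :: real assume x: "x \<ge> 0"
      let ?Y = "\<lambda>\<omega>. (\<Sum>j=1..n. G_step n x (X n j \<omega>)) - real n * (\<integral>z. G_step n x z \<partial>law)"
      note sm[measurable] = sum_meas[OF G_step_meas[of n x], of n]
      have sq: "(G_step n x z)\<^sup>2 = of_bool (t n * exp x < z) / real (k n)" for z
        by (simp add: G_step_def power_divide of_bool_def)
      have i2: "integrable law (\<lambda>z. (G_step n x z)\<^sup>2)" unfolding sq using law_survival(2) by simp
      have "real n * (\<integral>z. (G_step n x z)\<^sup>2 \<partial>law) \<le> 2 * exp (- x / \<gamma>)"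
        unfolding sq using elim(2) x by (simp add: law_survival)
      then have Y: "(\<integral>\<^sup>+\<omega>. ennreal \<bar>(?Y \<omega>)\<^sup>2\<bar> \<partial>M n) \<le> ennreal (2 * exp (- x / \<gamma>))"
        using centered_sum_bound[OF G_step_meas G_step_integrable i2, of n] by (meson ennreal_leI order_trans)
      have "(G_mean n x)\<^sup>2 \<le> (K0 / \<gamma> * exp (- x / \<gamma>))\<^sup>2"
      proof (rule power2_le_iff_abs_le[THEN iffD2])
        show "\<bar>G_mean n x\<bar> \<le> K0 / \<gamma> * exp (- x / \<gamma>)"
          using elim(1) x gamma_pos by (simp add: G_mean_def abs_mult field_simps)
      qed (use K0 gamma_pos in simp)
      also have "\<dots> = (K0 / \<gamma>)\<^sup>2 * (exp (- x / \<gamma>) * exp (- x / \<gamma>))" by (simp add: power2_eq_square)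
      also have "\<dots> \<le> (K0 / \<gamma>)\<^sup>2 * (exp (- x / \<gamma>) * 1)" using x gamma_pos by (intro mult_left_mono) auto
      finally have m: "(G_mean n x)\<^sup>2 \<le> (K0 / \<gamma>)\<^sup>2 * exp (- x / \<gamma>)" by simp
      have pt: "(G n x \<omega>)\<^sup>2 \<le> 2 * \<bar>(?Y \<omega>)\<^sup>2\<bar> + 2 * (G_mean n x)\<^sup>2" for \<omega>
      proof -
        have "(a + b)\<^sup>2 \<le> 2 * \<bar>a\<^sup>2\<bar> + 2 * b\<^sup>2" for a b :: real
          using sum_squares_ge_zero[of "a - b" 0] by (simp add: power2_eq_square algebra_simps)
        then show ?thesis unfolding G_decompose[OF elim(3)] .
      qed
      define Z where "Z \<omega> = \<bar>(?Y \<omega>)\<^sup>2\<bar>" for \<omega>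
      have [measurable]: "Z \<in> borel_measurable (M n)" unfolding Z_def[abs_def] by measurable
      note Y' = Y[folded Z_def] and pt' = pt[folded Z_def]
      have Z0: "Z \<omega> \<ge> 0" for \<omega> by (simp add: Z_def)
      have "(\<integral>\<^sup>+\<omega>. ennreal ((G n x \<omega>)\<^sup>2) \<partial>M n) \<le> (\<integral>\<^sup>+\<omega>. 2 * ennreal (Z \<omega>) + ennreal (2 * (G_mean n x)\<^sup>2) \<partial>M n)"
      proof (rule nn_integral_mono)
        fix \<omega>
        have "ennreal ((G n x \<omega>)\<^sup>2) \<le> ennreal (2 * Z \<omega> + 2 * (G_mean n x)\<^sup>2)" by (intro ennreal_leI pt')
        then show "ennreal ((G n x \<omega>)\<^sup>2) \<le> 2 * ennreal (Z \<omega>) + ennreal (2 * (G_mean n x)\<^sup>2)"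
          using Z0[of \<omega>] by (simp add: ennreal_mult')
      qed
      also have "\<dots> = 2 * (\<integral>\<^sup>+\<omega>. ennreal (Z \<omega>) \<partial>M n) + ennreal (2 * (G_mean n x)\<^sup>2)"
        by (subst nn_integral_add) (auto simp: nn_integral_cmult prob_space.emeasure_space_1[OF prob_M])
      also have "\<dots> \<le> 2 * ennreal (2 * exp (- x / \<gamma>)) + ennreal (2 * ((K0 / \<gamma>)\<^sup>2 * exp (- x / \<gamma>)))"
        using Y' m by (intro add_mono mult_left_mono ennreal_leI) auto
      also have "\<dots> = ennreal (2 * (2 * exp (- x / \<gamma>)) + 2 * ((K0 / \<gamma>)\<^sup>2 * exp (- x / \<gamma>)))"
        by (simp add: ennreal_mult')
      also have "2 * (2 * exp (- x / \<gamma>)) + 2 * ((K0 / \<gamma>)\<^sup>2 * exp (- x / \<gamma>)) = ?K * exp (- x / \<gamma>)"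
        by (simp add: algebra_simps)
      finally show "(\<integral>\<^sup>+\<omega>. ennreal ((G n x \<omega>)\<^sup>2) \<partial>M n) \<le> ennreal (?K * exp (- x / \<gamma>))" .
    qed
  qed
  then show ?thesis by (intro exI[of _ ?K]) (auto intro: add_pos_nonneg)
qed

lemma G_mean_near:
  assumes "x \<longlonglongrightarrow> 0" shows "(\<lambda>n. G_mean n (x n)) \<longlonglongrightarrow> lam / \<gamma>"
proof -
  have "(\<lambda>n. exp (- x n / \<gamma>) * (rk n * \<delta> (t n * exp (x n))) / \<gamma>) \<longlonglongrightarrow> exp (- 0 / \<gamma>) * lam / \<gamma>"
    using gamma_pos by (intro tendsto_divide tendsto_mult tendsto_exp tendsto_minus assms tendsto_const delta_t_near) auto
  then show ?thesis by (simp add: G_mean_def)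
qed

text \<open>
  The variance of the increment is at most \<open>n / k\<close> times the probability of the interval between the two
  levels, which vanishes.
\<close>

lemma G_increment:
  assumes x: "x \<longlonglongrightarrow> 0"
  shows "op (\<lambda>n \<omega>. G n (x n) \<omega> - G n 0 \<omega>)"
proof -
  define f where "f n z = G_step n (x n) z - G_step n 0 z" for n z
  have fm[measurable]: "f n \<in> borel_measurable borel" for n unfolding f_def[abs_def] by measurable
  have fi: "integrable law (f n)" for n unfolding f_def by (intro Bochner_Integration.integrable_diff G_step_integrable)
  define p where "p n y = real n / real (k n) * (1 - F (t n * exp y))" for n y
  have sq: "(f n z)\<^sup>2 = (if x n \<ge> 0 then 1 else - 1) * (of_bool (t n * exp 0 < z) - of_bool (t n * exp (x n) < z)) / real (k n)" if n: "n \<ge> 2" for n z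
  proof (cases "x n \<ge> 0")
    case True
    then have "t n * exp 0 \<le> t n * exp (x n)" using t_pos[OF n] by (intro mult_left_mono) auto
    then show ?thesis using True by (auto simp: f_def G_step_def power_divide diff_divide_distrib[symmetric])
  next
    case False
    then have "t n * exp (x n) \<le> t n * exp 0" using t_pos[OF n] by (intro mult_left_mono) auto
    then show ?thesis using False by (auto simp: f_def G_step_def power_divide diff_divide_distrib[symmetric])
  qed
  have f2: "integrable law (\<lambda>z. (f n z)\<^sup>2) \<and> real n * (\<integral>z. (f n z)\<^sup>2 \<partial>law) \<le> \<bar>p n 0 - p n (x n)\<bar>" if n: "n \<ge> 2" for n
  proof -
    have "integrable law (\<lambda>z. (f n z)\<^sup>2)" unfolding sq[OF n]
      using law_survival(2) by (intro integrable_divide integrable_mult_right Bochner_Integration.integrable_diff) auto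
    moreover have I: "(\<integral>z. (f n z)\<^sup>2 \<partial>law) = (if x n \<ge> 0 then 1 else - 1) * ((1 - F (t n * exp 0)) - (1 - F (t n * exp (x n)))) / real (k n)"
      unfolding sq[OF n] using Bochner_Integration.integral_diff[OF law_survival(2) law_survival(2)] law_survival(1)
      by (simp only: integral_divide_zero integral_mult_right_zero)
    have "real n * (\<integral>z. (f n z)\<^sup>2 \<partial>law) = (if x n \<ge> 0 then 1 else - 1) * (p n 0 - p n (x n))"
      unfolding I p_def by (cases "x n \<ge> 0") (simp_all add: algebra_simps diff_divide_distrib)
    then have "real n * (\<integral>z. (f n z)\<^sup>2 \<partial>law) \<le> \<bar>p n 0 - p n (x n)\<bar>" by (cases "x n \<ge> 0") simp_all
    ultimately show ?thesis by blast
  qed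
  have plim: "(\<lambda>n. p n (y n)) \<longlonglongrightarrow> 1" if y: "y \<longlonglongrightarrow> 0" for y
  proof -
    have "(\<lambda>n. exp (- y n / \<gamma>) * (1 + rk n * \<delta> (t n * exp (y n)) * inverse (rk n) / \<gamma>)) \<longlonglongrightarrow> exp (- 0 / \<gamma>) * (1 + lam * 0 / \<gamma>)"
      using gamma_pos by (intro tendsto_divide tendsto_mult[OF _ tendsto_add] tendsto_mult[OF delta_t_near[OF y]] tendsto_exp tendsto_minus y tendsto_const tendsto_inverse_0_at_top rk_inf) auto
    moreover have "\<forall>\<^sub>F n in sequentially. exp (- y n / \<gamma>) * (1 + rk n * \<delta> (t n * exp (y n)) * inverse (rk n) / \<gamma>) = p n (y n)"
      using n_ge_2
    proof eventually_elim
      case (elim n)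
      show ?case unfolding p_def survival_t[OF elim] using rk_pos[OF elim] by simp
    qed
    ultimately show ?thesis by (simp add: tendsto_cong)
  qed
  let ?Y = "\<lambda>n \<omega>. (\<Sum>j=1..n. f n (X n j \<omega>)) - real n * (\<integral>z. f n z \<partial>law)"
  have "op (\<lambda>n \<omega>. (?Y n \<omega>)\<^sup>2)"
  proof (rule op_of_moment)
    show "(\<lambda>n. \<bar>p n 0 - p n (x n)\<bar>) \<longlonglongrightarrow> 0"
      using tendsto_rabs[OF tendsto_diff[OF plim[OF tendsto_const] plim[OF x]]] by simp
    show "\<forall>\<^sub>F n in sequentially. (\<lambda>\<omega>. (?Y n \<omega>)\<^sup>2) \<in> borel_measurable (M n) \<and> (\<integral>\<^sup>+\<omega>. ennreal \<bar>(?Y n \<omega>)\<^sup>2\<bar> \<partial>M n) \<le> ennreal \<bar>p n 0 - p n (x n)\<bar>"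
      using n_ge_2
    proof eventually_elim
      case (elim n)
      note sum_meas[OF fm, of n n, measurable]
      have meas: "(\<lambda>\<omega>. (?Y n \<omega>)\<^sup>2) \<in> borel_measurable (M n)" by measurable
      have "(\<integral>\<^sup>+\<omega>. ennreal \<bar>(?Y n \<omega>)\<^sup>2\<bar> \<partial>M n) \<le> ennreal (real n * (\<integral>z. (f n z)\<^sup>2 \<partial>law))"
        using f2[OF elim] by (intro centered_sum_bound fm fi) auto
      also have "\<dots> \<le> ennreal \<bar>p n 0 - p n (x n)\<bar>" using f2[OF elim] by (intro ennreal_leI) auto
      finally show ?case using meas by blast
    qed
  qed
  then have Y: "op ?Y" by (rule op_of_square)
  have "(\<lambda>n. G_mean n (x n) - G_mean n 0) \<longlonglongrightarrow> lam / \<gamma> - lam / \<gamma>"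
    by (intro tendsto_diff G_mean_near x tendsto_const)
  then have "op (\<lambda>n \<omega>. G_mean n (x n) - G_mean n 0)" by (intro op_seq) simp
  from op_add[OF Y this] show ?thesis
  proof (rule op_cong)
    show "whp (\<lambda>n \<omega>. G n (x n) \<omega> - G n 0 \<omega> = ?Y n \<omega> + (G_mean n (x n) - G_mean n 0))"
    proof (rule whp_eventually, use n_ge_2 in eventually_elim, rule ballI)
      fix n \<omega> assume n: "n \<ge> (2::nat)"
      have "(\<integral>z. f n z \<partial>law) = (\<integral>z. G_step n (x n) z \<partial>law) - (\<integral>z. G_step n 0 z \<partial>law)"
        unfolding f_def by (rule Bochner_Integration.integral_diff[OF G_step_integrable G_step_integrable])
      then show "G n (x n) \<omega> - G n 0 \<omega> = ?Y n \<omega> + (G_mean n (x n) - G_mean n 0)"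
        unfolding G_decompose[OF n] by (simp add: f_def sum_subtractf right_diff_distrib)
    qed
  qed
qed

text \<open>
  The Lipschitz constant, in the exponent, of the power statistics.
\<close>

definition R :: "nat \<Rightarrow> 'a \<Rightarrow> real" where
  "R n \<omega> = (\<integral>x. indicator {0..} x * \<bar>G n x \<omega>\<bar> \<partial>lborel)"

lemma pareto_integral_exp:
  assumes "s \<le> 0"
  shows "has_bochner_integral lborel (\<lambda>x. exp (s * x) * indicator {0..} x * exp (- x / \<gamma>)) (\<gamma> / (1 - \<gamma> * s))"
proof -
  have a: "1 / \<gamma> - s > 0" using gamma_pos assms by (smt (verit) divide_pos_pos)
  have e: "(\<lambda>x. x ^ 0 * exp (- ((1 / \<gamma> - s) * x)) * indicator {0..} x) = (\<lambda>x. exp (s * x) * indicator {0..} x * exp (- x / \<gamma>))"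
    by (auto simp: fun_eq_iff algebra_simps simp flip: exp_add split: split_indicator)
  have "fact 0 / (1 / \<gamma> - s) ^ Suc 0 = \<gamma> / (1 - \<gamma> * s)" using gamma_pos by (simp add: field_simps)
  then show ?thesis using has_bochner_integral_power_exp[OF a, of 0] unfolding e by simp
qed

lemma pareto_mean_exp:
  assumes "s \<le> 0"
  shows "pareto_mean (\<lambda>x. exp (s * x) - 1) (\<lambda>x. s * exp (s * x)) = \<gamma> * s / (1 - \<gamma> * s)"
proof -
  have "(\<integral>x. s * exp (s * x) * indicator {0..} x * exp (- x / \<gamma>) \<partial>lborel) = s * (\<gamma> / (1 - \<gamma> * s))"
    using has_bochner_integral_mult_right[OF pareto_integral_exp[OF assms], of s]
    by (simp add: has_bochner_integral_iff mult_ac)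
  then show ?thesis by (simp add: pareto_mean_def)
qed

text \<open>
  Linear statistics with vanishing test function at \<open>0\<close> are integrals of the tail empirical process.
\<close>

lemma G_weighted_integral:
  assumes n: "n \<ge> 2" and g: "\<And>x. (g has_real_derivative g' x) (at x)" "continuous_on UNIV g'" "g 0 = 0"
    and c: "has_bochner_integral lborel (\<lambda>x. g' x * indicator {0..} x * exp (- x / \<gamma>)) c"
  shows "has_bochner_integral lborel (\<lambda>x. g' x * indicator {0..} x * G n x \<omega>) (linear_stat g c n \<omega>)"
proof -
  have "has_bochner_integral lborel (\<lambda>x. \<Sum>j=1..n. g' x * indicator {0..} x * of_bool (t n * exp x < X n j \<omega>)) (\<Sum>j=1..n. tail_excess g (t n) (X n j \<omega>))"
    using tail_excess_eq_integral[OF t_pos[OF n] g(1,2)] g(3) by (intro has_bochner_integral_sum) auto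
  from has_bochner_integral_divide_zero[OF has_bochner_integral_diff[OF this has_bochner_integral_mult_right[OF c, of "real (k n)"]], of "rk n"]
  have "has_bochner_integral lborel (\<lambda>x. ((\<Sum>j=1..n. g' x * indicator {0..} x * of_bool (t n * exp x < X n j \<omega>)) - real (k n) * (g' x * indicator {0..} x * exp (- x / \<gamma>))) / rk n) (linear_stat g c n \<omega>)"
    unfolding linear_stat_def by simp
  moreover have "((\<Sum>j=1..n. g' x * indicator {0..} x * of_bool (t n * exp x < X n j \<omega>)) - real (k n) * (g' x * indicator {0..} x * exp (- x / \<gamma>))) / rk n = g' x * indicator {0..} x * G n x \<omega>" for x
    unfolding G_def N_def exceed_def sum_distrib_left[symmetric] by (simp add: algebra_simps diff_divide_distrib)
  ultimately show ?thesis by simp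
qed

lemma integrable_G:
  assumes n: "n \<ge> 2" shows "integrable lborel (\<lambda>x. indicator {0..} x * G n x \<omega>)"
proof -
  have "has_bochner_integral lborel (\<lambda>x. 1 * indicator {0..} x * exp (- x / \<gamma>)) \<gamma>"
    using pareto_integral_exp[of 0] by simp
  from G_weighted_integral[OF n _ _ _ this, of "\<lambda>x. x" \<omega>]
  have "has_bochner_integral lborel (\<lambda>x. 1 * indicator {0..} x * G n x \<omega>) (linear_stat (\<lambda>x. x) \<gamma> n \<omega>)"
    by (auto intro!: derivative_eq_intros)
  then show ?thesis by (simp add: has_bochner_integral_iff)
qed

lemma power_process_lipschitz:
  assumes n: "n \<ge> 2" and s: "s \<le> 0" "s' \<le> 0"
  shows "\<bar>linear_stat (\<lambda>x. exp (s * x) - 1) (\<gamma> * s / (1 - \<gamma> * s)) n \<omega> - linear_stat (\<lambda>x. exp (s' * x) - 1) (\<gamma> * s' / (1 - \<gamma> * s')) n \<omega>\<bar> \<le> \<bar>s - s'\<bar> * R n \<omega>"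
proof -
  have hb: "has_bochner_integral lborel (\<lambda>x. r * exp (r * x) * indicator {0..} x * G n x \<omega>) (linear_stat (\<lambda>x. exp (r * x) - 1) (\<gamma> * r / (1 - \<gamma> * r)) n \<omega>)" if r: "r \<le> 0" for r
  proof (rule G_weighted_integral[OF n])
    have "has_bochner_integral lborel (\<lambda>x. r * (exp (r * x) * indicator {0..} x * exp (- x / \<gamma>))) (r * (\<gamma> / (1 - \<gamma> * r)))"
      by (rule has_bochner_integral_mult_right[OF pareto_integral_exp[OF r]])
    then show "has_bochner_integral lborel (\<lambda>x. r * exp (r * x) * indicator {0..} x * exp (- x / \<gamma>)) (\<gamma> * r / (1 - \<gamma> * r))"
      by (simp add: mult_ac)
  qed (auto intro!: derivative_eq_intros continuous_intros)
  have d: "has_bochner_integral lborel (\<lambda>x. s * exp (s * x) * indicator {0..} x * G n x \<omega> - s' * exp (s' * x) * indicator {0..} x * G n x \<omega>)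
     (linear_stat (\<lambda>x. exp (s * x) - 1) (\<gamma> * s / (1 - \<gamma> * s)) n \<omega> - linear_stat (\<lambda>x. exp (s' * x) - 1) (\<gamma> * s' / (1 - \<gamma> * s')) n \<omega>)" (is "has_bochner_integral _ ?h ?d")
    by (rule has_bochner_integral_diff[OF hb[OF s(1)] hb[OF s(2)]])
  have "\<bar>?d\<bar> \<le> (\<integral>x. \<bar>?h x\<bar> \<partial>lborel)"
    using d integral_norm_bound[of lborel ?h] by (simp add: has_bochner_integral_iff)
  also have "\<dots> \<le> (\<integral>x. \<bar>s - s'\<bar> * (indicator {0..} x * \<bar>G n x \<omega>\<bar>) \<partial>lborel)"
  proof (rule integral_mono)
    show "integrable lborel (\<lambda>x. \<bar>?h x\<bar>)" using d by (auto simp: has_bochner_integral_iff)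
    show "integrable lborel (\<lambda>x. \<bar>s - s'\<bar> * (indicator {0..} x * \<bar>G n x \<omega>\<bar>))"
      using integrable_abs[OF integrable_G[OF n, of \<omega>]] by (intro integrable_mult_right) (simp add: abs_mult)
    fix x
    show "\<bar>?h x\<bar> \<le> \<bar>s - s'\<bar> * (indicator {0..} x * \<bar>G n x \<omega>\<bar>)"
    proof (cases "x \<ge> 0")
      case True
      have "\<bar>?h x\<bar> = \<bar>s * exp (s * x) - s' * exp (s' * x)\<bar> * \<bar>G n x \<omega>\<bar>"
        using True by (simp flip: abs_mult left_diff_distrib)
      also have "\<dots> \<le> \<bar>s - s'\<bar> * \<bar>G n x \<omega>\<bar>" by (intro mult_right_mono exp_weight_lipschitz s True) auto
      finally show ?thesis using True by simp
    qed simp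
  qed
  also have "\<dots> = \<bar>s - s'\<bar> * R n \<omega>" by (simp add: R_def)
  finally show ?thesis .
qed

text \<open>
  By \<open>G_second_moment\<close> and the inequality between arithmetic and geometric mean, the expected
  absolute value of \<open>G n x\<close> decays like \<open>exp (- x / (2 * \<gamma>))\<close>, which is integrable.
\<close>

lemma R_Op: "Op R"
proof -
  obtain K where K: "K > 0" "\<forall>\<^sub>F n in sequentially. \<forall>x\<ge>0. (\<integral>\<^sup>+\<omega>. ennreal ((G n x \<omega>)\<^sup>2) \<partial>M n) \<le> ennreal (K * exp (- x / \<gamma>))"
    using G_second_moment by blast
  define a where "a = 1 / (2 * \<gamma>)"
  have a: "a > 0" using gamma_pos by (simp add: a_def)
  show ?thesis
  proof (rule Op_of_moment)
    show "\<forall>\<^sub>F n in sequentially. R n \<in> borel_measurable (M n) \<and> (\<integral>\<^sup>+\<omega>. ennreal \<bar>R n \<omega>\<bar> \<partial>M n) \<le> ennreal ((1 + K) / 2 * (1 / a))"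
      using K(2) n_ge_2
    proof eventually_elim
      case (elim n)
      interpret Mn: prob_space "M n" by (rule prob_M)
      interpret pair_sigma_finite "M n" "lborel :: real measure" by unfold_locales
      have jm[measurable]: "(\<lambda>(\<omega>, x). G n x \<omega>) \<in> borel_measurable (M n \<Otimes>\<^sub>M lborel)"
      proof -
        have "(\<lambda>p. \<Sum>j=1..n. of_bool (t n * exp (snd p) < X n j (fst p)) :: real) \<in> borel_measurable (M n \<Otimes>\<^sub>M lborel)"
        proof (rule borel_measurable_sum)
          fix j assume "j \<in> {1..n}"
          note X_meas[OF this, measurable]
          show "(\<lambda>p. of_bool (t n * exp (snd p) < X n j (fst p)) :: real) \<in> borel_measurable (M n \<Otimes>\<^sub>M lborel)" by measurable
        qed
        then show ?thesis unfolding G_def N_def exceed_def split_beta' by measurable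
      qed
      have Rm: "R n \<in> borel_measurable (M n)" unfolding R_def[abs_def] by measurable
      have lin_ennreal: "ennreal (a + b * c) = ennreal a + ennreal b * ennreal c" if "a \<ge> 0" "b \<ge> 0" "c \<ge> 0" for a b c :: real
        using that by (simp add: ennreal_plus ennreal_mult)
      \<comment> \<open>the weight exp (- a x) balances the two terms: the square of G contributes exp (- 2 a x)\<close>
      have EG: "(\<integral>\<^sup>+\<omega>. ennreal \<bar>G n x \<omega>\<bar> \<partial>M n) \<le> ennreal ((1 + K) / 2 * exp (- (a * x)))" if x: "x \<ge> 0" for x
      proof -
        let ?e = "exp (- (a * x))"
        have pt: "\<bar>y\<bar> \<le> 1 / 2 * ?e + 1 / (2 * ?e) * y\<^sup>2" for y :: real
        proof -
          have "\<bar>y\<bar> \<le> 1 / 2 * e + 1 / (2 * e) * y\<^sup>2" if e: "e > 0" for e :: real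
          proof -
            have "(e - \<bar>y\<bar>) * (e - \<bar>y\<bar>) = e * e - 2 * e * \<bar>y\<bar> + y * y" by (simp add: algebra_simps)
            moreover have "(e - \<bar>y\<bar>) * (e - \<bar>y\<bar>) \<ge> 0" by (rule zero_le_square)
            ultimately have "2 * e * \<bar>y\<bar> \<le> e * e + y * y" by linarith
            then have "\<bar>y\<bar> \<le> (e * e + y * y) / (2 * e)" using e by (simp add: pos_le_divide_eq mult_ac)
            also have "\<dots> = 1 / 2 * e + 1 / (2 * e) * y\<^sup>2" using e by (simp add: add_divide_distrib power2_eq_square)
            finally show ?thesis .
          qed
          then show ?thesis by simp
        qed
        have "(\<integral>\<^sup>+\<omega>. ennreal \<bar>G n x \<omega>\<bar> \<partial>M n) \<le> (\<integral>\<^sup>+\<omega>. ennreal (1 / 2 * ?e) + ennreal (1 / (2 * ?e)) * ennreal ((G n x \<omega>)\<^sup>2) \<partial>M n)"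
        proof (rule nn_integral_mono)
          fix \<omega>
          have "ennreal \<bar>G n x \<omega>\<bar> \<le> ennreal (1 / 2 * ?e + 1 / (2 * ?e) * (G n x \<omega>)\<^sup>2)" by (intro ennreal_leI pt)
          also have "\<dots> = ennreal (1 / 2 * ?e) + ennreal (1 / (2 * ?e)) * ennreal ((G n x \<omega>)\<^sup>2)"
            by (rule lin_ennreal) auto
          finally show "ennreal \<bar>G n x \<omega>\<bar> \<le> ennreal (1 / 2 * ?e) + ennreal (1 / (2 * ?e)) * ennreal ((G n x \<omega>)\<^sup>2)" .
        qed
        also have "\<dots> = ennreal (1 / 2 * ?e) + ennreal (1 / (2 * ?e)) * (\<integral>\<^sup>+\<omega>. ennreal ((G n x \<omega>)\<^sup>2) \<partial>M n)"
          by (subst nn_integral_add) (auto simp: nn_integral_cmult Mn.emeasure_space_1)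
        also have "\<dots> \<le> ennreal (1 / 2 * ?e) + ennreal (1 / (2 * ?e)) * ennreal (K * exp (- x / \<gamma>))"
          using elim(1) x by (intro add_mono mult_left_mono) auto
        also have "\<dots> = ennreal (1 / 2 * ?e + 1 / (2 * ?e) * (K * exp (- x / \<gamma>)))"
          using K(1) by (subst ennreal_mult'[symmetric], simp, subst ennreal_plus[symmetric]) auto
        also have "exp (- x / \<gamma>) = ?e * ?e" using gamma_pos by (simp add: a_def flip: exp_add)
        also have "1 / 2 * ?e + 1 / (2 * ?e) * (K * (?e * ?e)) = (1 + K) / 2 * ?e" by (simp add: field_simps)
        finally show ?thesis .
      qed
      have "(\<integral>\<^sup>+\<omega>. ennreal \<bar>R n \<omega>\<bar> \<partial>M n) = (\<integral>\<^sup>+\<omega>. (\<integral>\<^sup>+x. ennreal (indicator {0..} x * \<bar>G n x \<omega>\<bar>) \<partial>lborel) \<partial>M n)"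
      proof (rule nn_integral_cong)
        fix \<omega>
        have "integrable lborel (\<lambda>x. indicator {0..} x * \<bar>G n x \<omega>\<bar>)"
          using integrable_abs[OF integrable_G[OF elim(2), of \<omega>]] by (simp add: abs_mult)
        then have "(\<integral>\<^sup>+x. ennreal (indicator {0..} x * \<bar>G n x \<omega>\<bar>) \<partial>lborel) = ennreal (R n \<omega>)"
          unfolding R_def by (rule nn_integral_eq_integral) auto
        moreover have "R n \<omega> \<ge> 0" unfolding R_def by (rule integral_nonneg_AE) auto
        ultimately show "ennreal \<bar>R n \<omega>\<bar> = (\<integral>\<^sup>+x. ennreal (indicator {0..} x * \<bar>G n x \<omega>\<bar>) \<partial>lborel)" by simp
      qed
      also have "\<dots> = (\<integral>\<^sup>+x. (\<integral>\<^sup>+\<omega>. ennreal (indicator {0..} x * \<bar>G n x \<omega>\<bar>) \<partial>M n) \<partial>lborel)"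
        by (rule Fubini'[symmetric]) measurable
      also have "\<dots> \<le> (\<integral>\<^sup>+x. ennreal ((1 + K) / 2 * (exp (- (a * x)) * indicator {0..} x)) \<partial>lborel)"
      proof (rule nn_integral_mono)
        fix x :: real
        show "(\<integral>\<^sup>+\<omega>. ennreal (indicator {0..} x * \<bar>G n x \<omega>\<bar>) \<partial>M n) \<le> ennreal ((1 + K) / 2 * (exp (- (a * x)) * indicator {0..} x))"
          using EG[of x] by (cases "x \<ge> 0") auto
      qed
      also have "\<dots> = ennreal ((1 + K) / 2 * (1 / a))"
      proof -
        have h: "has_bochner_integral lborel (\<lambda>x. (1 + K) / 2 * (exp (- (a * x)) * indicator {0..} x)) ((1 + K) / 2 * (1 / a))"
          using has_bochner_integral_mult_right[OF has_bochner_integral_power_exp[OF a, of 0], of "(1 + K) / 2"] by simp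
        have "(\<integral>\<^sup>+x. ennreal ((1 + K) / 2 * (exp (- (a * x)) * indicator {0..} x)) \<partial>lborel) =
          ennreal (\<integral>x. (1 + K) / 2 * (exp (- (a * x)) * indicator {0..} x) \<partial>lborel)"
          using h K(1) by (intro nn_integral_eq_integral) (auto simp: has_bochner_integral_iff)
        then show ?thesis unfolding has_bochner_integral_integral_eq[OF h] .
      qed
      finally show ?case using Rm by blast
    qed
  qed
qed

text \<open>
  The random threshold.
\<close>

definition U :: "nat \<Rightarrow> 'a \<Rightarrow> real" where "U n \<omega> = order_stat (\<lambda>j. X n j \<omega>) n (n - k n)"

text \<open>
  The logarithmic distance from the deterministic to the random threshold, on the scale on which it has
  a limit.
\<close>

definition L :: "nat \<Rightarrow> 'a \<Rightarrow> real" where "L n \<omega> = rk n * ln (U n \<omega> / t n)"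

text \<open>
  Almost surely all observations are positive, because \<open>F\<close> vanishes at \<open>0\<close>.
\<close>

lemma U_pos: "whp (\<lambda>n \<omega>. U n \<omega> > 0)"
proof -
  have "whp (\<lambda>n \<omega>. n \<ge> 2 \<longrightarrow> U n \<omega> > 0)"
  proof (rule whp_of_prob)
    have S: "{\<omega> \<in> space (M n). \<not> (n \<ge> 2 \<longrightarrow> U n \<omega> > 0)} \<in> sets (M n)" for n
    proof (cases "n \<ge> 2")
      case True
      have "U n \<in> borel_measurable (M n)" unfolding U_def[abs_def]
        by (rule borel_measurable_order_stat[OF k_pos(2)[OF True] X_meas])
      then show ?thesis by measurable
    qed simp
    show "\<forall>\<^sub>F n in sequentially. {\<omega> \<in> space (M n). \<not> (n \<ge> 2 \<longrightarrow> U n \<omega> > 0)} \<in> sets (M n)"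
      using S by (intro always_eventually allI)
    have Z: "measure (M n) {\<omega> \<in> space (M n). \<not> (n \<ge> 2 \<longrightarrow> U n \<omega> > 0)} = 0" for n
    proof (cases "n \<ge> 2")
      case True
      interpret Mn: prob_space "M n" by (rule prob_M)
      have AEj: "AE \<omega> in M n. X n j \<omega> > 0" if j: "j \<in> {1..n}" for j
      proof -
        note X_meas[OF j, measurable]
        have "cdf (distr (M n) borel (X n j)) 0 = 0" using X_law[OF j] F0 by simp
        then have "Mn.prob (X n j -` {..0} \<inter> space (M n)) = 0"
          by (simp add: cdf_def measure_distr)
        moreover have "X n j -` {..0} \<inter> space (M n) = {\<omega> \<in> space (M n). \<not> X n j \<omega> > 0}" by auto
        ultimately show ?thesis by (subst AE_iff_measurable[OF _ refl]) (auto simp: Mn.emeasure_eq_measure)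
      qed
      have "AE \<omega> in M n. \<forall>j\<in>{1..n}. X n j \<omega> > 0" using AEj by (intro AE_finite_allI) auto
      then have "AE \<omega> in M n. (n \<ge> 2 \<longrightarrow> U n \<omega> > 0)"
      proof eventually_elim
        case (elim \<omega>)
        have "exceed (\<lambda>j. X n j \<omega>) n 0 = (\<Sum>j=1..n. 1)" unfolding exceed_def using elim by (intro sum.cong) auto
        then have "exceed (\<lambda>j. X n j \<omega>) n 0 = real n" by simp
        then show ?case using order_stat_gt_iff[OF k_pos(2)[OF True], of 0 "\<lambda>j. X n j \<omega>"] k_pos(2)[OF True] by (simp add: U_def)
      qed
      then have "emeasure (M n) {\<omega> \<in> space (M n). \<not> (n \<ge> 2 \<longrightarrow> U n \<omega> > 0)} = 0"
        by (rule iffD1[OF AE_iff_measurable[OF S[of n] refl]])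
      then show ?thesis unfolding measure_def by (simp only: enn2real_0)
    qed simp
    show "(\<lambda>n. measure (M n) {\<omega> \<in> space (M n). \<not> (n \<ge> 2 \<longrightarrow> U n \<omega> > 0)}) \<longlonglongrightarrow> 0"
      unfolding Z by (rule tendsto_const)
  qed
  then have "whp (\<lambda>n \<omega>. (n \<ge> 2 \<longrightarrow> U n \<omega> > 0) \<and> n \<ge> 2)" by (intro whp_conj whp_n2)
  then show ?thesis by (rule whp_mono) auto
qed

lemma G_zero_Op: "Op (\<lambda>n \<omega>. G n 0 \<omega>)"
proof -
  have "Op (\<lambda>n \<omega>. (G n 0 \<omega>)\<^sup>2)"
  proof -
    obtain K where K: "\<forall>\<^sub>F n in sequentially. \<forall>x\<ge>0. (\<integral>\<^sup>+\<omega>. ennreal ((G n x \<omega>)\<^sup>2) \<partial>M n) \<le> ennreal (K * exp (- x / \<gamma>))"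
      using G_second_moment by blast
    show ?thesis
    proof (rule Op_of_moment)
      show "\<forall>\<^sub>F n in sequentially. (\<lambda>\<omega>. (G n 0 \<omega>)\<^sup>2) \<in> borel_measurable (M n) \<and> (\<integral>\<^sup>+\<omega>. ennreal \<bar>(G n 0 \<omega>)\<^sup>2\<bar> \<partial>M n) \<le> ennreal K"
        using K
      proof eventually_elim
        case (elim n)
        from elim[rule_format, of 0] have "(\<integral>\<^sup>+\<omega>. ennreal \<bar>(G n 0 \<omega>)\<^sup>2\<bar> \<partial>M n) \<le> ennreal K" by simp
        moreover have "(\<lambda>\<omega>. (G n 0 \<omega>)\<^sup>2) \<in> borel_measurable (M n)" by measurable
        ultimately show ?case by blast
      qed
    qed
  qed
  then show ?thesis by (rule Op_of_square)
qed

lemma level_iff: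
  assumes "n \<ge> 2" "U n \<omega> > 0"
  shows "L n \<omega> > z \<longleftrightarrow> G n (z / rk n) \<omega> > rk n * (1 - exp (- (z / rk n) / \<gamma>))"
proof -
  have r: "rk n > 0" and tp: "t n > 0" using rk_pos[OF assms(1)] t_pos[OF assms(1)] by auto
  have "L n \<omega> > z \<longleftrightarrow> z / rk n < ln (U n \<omega> / t n)" using r by (simp add: L_def field_simps)
  also have "\<dots> \<longleftrightarrow> exp (z / rk n) < U n \<omega> / t n" using assms(2) tp by (metis divide_pos_pos exp_less_cancel_iff exp_ln)
  also have "\<dots> \<longleftrightarrow> t n * exp (z / rk n) < U n \<omega>" using tp by (simp add: field_simps)
  also have "\<dots> \<longleftrightarrow> real (k n) < N n (z / rk n) \<omega>"
    unfolding U_def N_def by (rule order_stat_gt_iff[OF k_pos(2)[OF assms(1)]])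
  also have "\<dots> \<longleftrightarrow> real (k n) / rk n - real (k n) * exp (- (z / rk n) / \<gamma>) / rk n < G n (z / rk n) \<omega>"
    unfolding G_def diff_divide_distrib using r by (simp add: divide_less_cancel)
  also have "real (k n) / rk n - real (k n) * exp (- (z / rk n) / \<gamma>) / rk n = rk n * (1 - exp (- (z / rk n) / \<gamma>))"
    using r rk_sq[of n] by (simp add: field_simps)
  finally show ?thesis .
qed

lemma level_lim: "(\<lambda>n. rk n * (1 - exp (- (z / rk n) / \<gamma>))) \<longlonglongrightarrow> z / \<gamma>"
proof -
  have "((\<lambda>y. 1 - exp (- (z * y) / \<gamma>)) has_real_derivative z / \<gamma>) (at 0)"
    using gamma_pos by (auto intro!: derivative_eq_intros)
  then have D: "((\<lambda>y. (1 - exp (- (z * y) / \<gamma>)) / y) \<longlongrightarrow> z / \<gamma>) (at 0)" by (simp add: DERIV_def)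
  have "filterlim (\<lambda>n. inverse (rk n)) (at 0) sequentially"
    by (rule filterlim_atI[OF tendsto_inverse_0_at_top[OF rk_inf]]) (use n_ge_2 in \<open>eventually_elim, use rk_pos in force\<close>)
  from filterlim_compose[OF D this] show ?thesis by (simp add: divide_inverse mult_ac)
qed

text \<open>
  Inversion of the count: by \<open>level_iff\<close>, \<open>L > z\<close> means that \<open>G\<close> at \<open>z / sqrt k\<close> exceeds a number tending to
  \<open>z / \<gamma>\<close>, and there \<open>G\<close> may be replaced by its value at \<open>0\<close>.
\<close>

lemma bahadur: "op (\<lambda>n \<omega>. L n \<omega> - \<gamma> * G n 0 \<omega>)"
proof (rule op_by_level_events)
  show "Op (\<lambda>n \<omega>. \<gamma> * G n 0 \<omega>)" by (rule Op_cmult[OF G_zero_Op])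
  have x0: "(\<lambda>n. z / rk n) \<longlonglongrightarrow> 0" for z
    using tendsto_mult[OF tendsto_const[of z] tendsto_inverse_0_at_top[OF rk_inf]] by (simp add: divide_inverse)
  have close: "whp (\<lambda>n \<omega>. n \<ge> 2 \<and> U n \<omega> > 0 \<and> \<bar>G n (z / rk n) \<omega> - G n 0 \<omega>\<bar> \<le> \<epsilon> / (4 * \<gamma>) \<and> \<bar>rk n * (1 - exp (- (z / rk n) / \<gamma>)) - z / \<gamma>\<bar> \<le> \<epsilon> / (4 * \<gamma>))" if e: "\<epsilon> > 0" for z \<epsilon>
  proof -
    have e4: "\<epsilon> / (4 * \<gamma>) > 0" using e gamma_pos by simp
    have "whp (\<lambda>n \<omega>. \<bar>rk n * (1 - exp (- (z / rk n) / \<gamma>)) - z / \<gamma>\<bar> \<le> \<epsilon> / (4 * \<gamma>))"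
      using op_whp[OF op_seq e4, of "\<lambda>n. rk n * (1 - exp (- (z / rk n) / \<gamma>)) - z / \<gamma>"] tendsto_diff[OF level_lim[of z] tendsto_const[of "z / \<gamma>"]] by simp
    then show ?thesis by (intro whp_conj whp_n2 U_pos op_whp[OF G_increment[OF x0] e4])
  qed
  fix z \<epsilon> :: real assume e: "\<epsilon> > 0"
  have q: "\<gamma> * (\<epsilon> / (4 * \<gamma>)) = \<epsilon> / 4" "\<gamma> * (z / \<gamma>) = z" using gamma_pos by auto
  show "whp (\<lambda>n \<omega>. \<not> (L n \<omega> > z \<and> \<gamma> * G n 0 \<omega> \<le> z - \<epsilon>))"
  proof (rule whp_mono[OF close[OF e, of z]], elim conjE, rule notI, elim conjE)
    fix n \<omega> assume n: "n \<ge> 2" "U n \<omega> > 0"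
      and c: "\<bar>G n (z / rk n) \<omega> - G n 0 \<omega>\<bar> \<le> \<epsilon> / (4 * \<gamma>)" "\<bar>rk n * (1 - exp (- (z / rk n) / \<gamma>)) - z / \<gamma>\<bar> \<le> \<epsilon> / (4 * \<gamma>)"
      and h: "z < L n \<omega>" "\<gamma> * G n 0 \<omega> \<le> z - \<epsilon>"
    define y where "y = rk n * (1 - exp (- (z / rk n) / \<gamma>))"
    have "y < G n (z / rk n) \<omega>" using h(1) level_iff[OF n] by (simp add: y_def)
    then have "G n 0 \<omega> \<ge> z / \<gamma> - 2 * (\<epsilon> / (4 * \<gamma>))" using c unfolding y_def[symmetric] by linarith
    then have "\<gamma> * G n 0 \<omega> \<ge> \<gamma> * (z / \<gamma> - 2 * (\<epsilon> / (4 * \<gamma>)))" using gamma_pos by (intro mult_left_mono) auto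
    also have "\<gamma> * (z / \<gamma> - 2 * (\<epsilon> / (4 * \<gamma>))) = z - \<epsilon> / 2" using gamma_pos by (simp add: field_simps)
    finally show False using h(2) e by linarith
  qed
  show "whp (\<lambda>n \<omega>. \<not> (L n \<omega> \<le> z \<and> \<gamma> * G n 0 \<omega> \<ge> z + \<epsilon>))"
  proof (rule whp_mono[OF close[OF e, of z]], elim conjE, rule notI, elim conjE)
    fix n \<omega> assume n: "n \<ge> 2" "U n \<omega> > 0"
      and c: "\<bar>G n (z / rk n) \<omega> - G n 0 \<omega>\<bar> \<le> \<epsilon> / (4 * \<gamma>)" "\<bar>rk n * (1 - exp (- (z / rk n) / \<gamma>)) - z / \<gamma>\<bar> \<le> \<epsilon> / (4 * \<gamma>)"
      and h: "L n \<omega> \<le> z" "\<gamma> * G n 0 \<omega> \<ge> z + \<epsilon>"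
    define y where "y = rk n * (1 - exp (- (z / rk n) / \<gamma>))"
    have "\<not> y < G n (z / rk n) \<omega>" using h(1) level_iff[OF n, of z] by (simp add: y_def)
    then have "G n 0 \<omega> \<le> z / \<gamma> + 2 * (\<epsilon> / (4 * \<gamma>))" using c unfolding y_def[symmetric] by linarith
    then have "\<gamma> * G n 0 \<omega> \<le> \<gamma> * (z / \<gamma> + 2 * (\<epsilon> / (4 * \<gamma>)))" using gamma_pos by (intro mult_left_mono) auto
    also have "\<gamma> * (z / \<gamma> + 2 * (\<epsilon> / (4 * \<gamma>))) = z + \<epsilon> / 2" using gamma_pos by (simp add: field_simps)
    finally show False using h(2) e by linarith
  qed
qed

end

section \<open>Expansions of the estimators\<close>

text \<open>
  The difference quotient of the exponential function, continuously extended to \<open>0\<close>; it allows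
  \<open>exp y - 1\<close> to be linearised without separating the case \<open>y = 0\<close>.
\<close>

definition exp_quot :: "real \<Rightarrow> real" where
  "exp_quot y = (if y = 0 then 1 else (exp y - 1) / y)"

lemma exp_quot_mult: "exp y - 1 = exp_quot y * y"
  by (simp add: exp_quot_def)

lemma isCont_exp_quot: "isCont exp_quot 0"
proof -
  have "((\<lambda>y::real. (exp (0 + y) - exp 0) / y) \<longlongrightarrow> exp 0) (at 0)"
    using DERIV_exp[of 0] by (simp add: DERIV_def)
  then have "((\<lambda>y::real. (exp y - 1) / y) \<longlongrightarrow> 1) (at 0)" by simp
  then have "(exp_quot \<longlongrightarrow> 1) (at 0)"
    by (rule Lim_transform_eventually) (auto simp: exp_quot_def eventually_at_filter)
  then show ?thesis by (simp add: isCont_def exp_quot_def)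
qed

locale tail_estimation = tail_sample +
  fixes rho_hat gamma_hat delta_hat :: "nat \<Rightarrow> 'a \<Rightarrow> real"
  assumes rho_conv: "op (\<lambda>n \<omega>. rho_hat n \<omega> - \<gamma> * \<tau>)"
    and delta_hat_eq: "\<And>n \<omega>. n \<ge> 2 \<Longrightarrow> \<omega> \<in> space (M n) \<Longrightarrow>
           est_defined (\<lambda>i. X n i \<omega>) (k n) n (rho_hat n \<omega>) \<Longrightarrow>
           delta_hat n \<omega> = delta_est (\<lambda>i. X n i \<omega>) (k n) n (rho_hat n \<omega>)"
    and gamma_hat_eq: "\<And>n \<omega>. n \<ge> 2 \<Longrightarrow> \<omega> \<in> space (M n) \<Longrightarrow>
           est_defined (\<lambda>i. X n i \<omega>) (k n) n (rho_hat n \<omega>) \<Longrightarrow>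
           gamma_hat n \<omega> = gamma_est (\<lambda>i. X n i \<omega>) (k n) n (rho_hat n \<omega>)"
begin

text \<open>
  The ingredients of the estimators: \<open>H\<close> is the Hill statistic, \<open>s\<close> the exponent at which the power moment
  \<open>E\<close> is evaluated, \<open>l\<close> the log ratio of the thresholds. The statistics \<open>P\<close>, \<open>Q\<close> and \<open>D\<close> refer to the
  deterministic threshold.
\<close>

definition "\<rho> = \<gamma> * \<tau>"
definition H :: "nat \<Rightarrow> 'a \<Rightarrow> real" where "H n \<omega> = hill (\<lambda>i. X n i \<omega>) (k n) n"
definition s :: "nat \<Rightarrow> 'a \<Rightarrow> real" where "s n \<omega> = rho_hat n \<omega> / H n \<omega>"
definition l :: "nat \<Rightarrow> 'a \<Rightarrow> real" where "l n \<omega> = ln (U n \<omega> / t n)"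
definition E :: "nat \<Rightarrow> 'a \<Rightarrow> real" where "E n \<omega> = excess_moment (\<lambda>i. X n i \<omega>) (k n) n (s n \<omega>)"
definition P :: "nat \<Rightarrow> 'a \<Rightarrow> real" where "P n \<omega> = G n 0 \<omega>"
definition Q :: "nat \<Rightarrow> 'a \<Rightarrow> real" where "Q n \<omega> = linear_stat (\<lambda>x. x) \<gamma> n \<omega>"
definition D :: "real \<Rightarrow> nat \<Rightarrow> 'a \<Rightarrow> real" where "D r n \<omega> = linear_stat (\<lambda>x. exp (r * x) - 1) (\<gamma> * r / (1 - \<gamma> * r)) n \<omega>"

lemma rho_neg: "\<rho> < 0" using gamma_pos tau_neg by (simp add: \<rho>_def mult_pos_neg)

lemma P_Op: "Op P" using G_zero_Op by (simp add: P_def[abs_def])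

lemma L_P: "op (\<lambda>n \<omega>. L n \<omega> - \<gamma> * P n \<omega>)" using bahadur by (simp add: P_def)

lemma L_Op: "Op L" by (rule Op_of_approx[OF L_P Op_cmult[OF P_Op]])

lemma pareto_mean_ident: "pareto_mean (\<lambda>x. x) (\<lambda>x. 1) = \<gamma>"
  using pareto_integral_exp[of 0] by (simp add: pareto_mean_def has_bochner_integral_iff)

lemma Q_Op: "Op Q" using lin_Op[OF subexponential_ident] by (simp add: pareto_mean_ident Q_def[abs_def])

lemma subexponential_power: "r \<le> 0 \<Longrightarrow> subexponential (\<lambda>x. exp (r * x) - 1) (\<lambda>x. r * exp (r * x))"
  using subexponential_add[OF subexponential_exp[of r] subexponential_const[of "- 1"]] by simp

lemma D_Op: "r \<le> 0 \<Longrightarrow> Op (D r)"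
  using lin_Op[OF subexponential_power[of r]] by (simp add: pareto_mean_exp D_def[abs_def])

lemma op_inverse_rk: "op (\<lambda>n \<omega>. inverse (rk n))"
  by (rule op_seq[OF tendsto_inverse_0_at_top[OF rk_inf]])

lemma l_eq: "n \<ge> 2 \<Longrightarrow> l n \<omega> = L n \<omega> * inverse (rk n)"
  using rk_pos[of n] by (simp add: l_def L_def field_simps)

lemma l_op: "op l"
proof (rule op_cong)
  have "op (\<lambda>n \<omega>. inverse (rk n) * L n \<omega>)" by (rule op_mult_Op[OF op_inverse_rk L_Op])
  then show "op (\<lambda>n \<omega>. L n \<omega> * inverse (rk n))" by (simp add: mult.commute)
  show "whp (\<lambda>n \<omega>. l n \<omega> = L n \<omega> * inverse (rk n))"
    by (rule whp_mono[OF whp_n2]) (rule l_eq)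
qed

lemma l_lim: "op (\<lambda>n \<omega>. l n \<omega> - 0)" using l_op by simp

lemma N_zero: "n \<ge> 2 \<Longrightarrow> \<bar>exceed (\<lambda>i. X n i \<omega>) n (t n) - real (k n)\<bar> = rk n * \<bar>P n \<omega>\<bar>"
  using rk_pos[of n] by (simp add: P_def G_def N_def abs_divide)

text \<open>
  Changing the threshold costs \<open>L\<close>, up to an error \<open>l * P\<close>, and \<open>L\<close> is close to \<open>\<gamma> * P\<close>.
\<close>

lemma hill_expansion: "op (\<lambda>n \<omega>. rk n * (H n \<omega> - \<gamma>) - (Q n \<omega> - \<gamma> * P n \<omega>))"
proof -
  have A: "op (\<lambda>n \<omega>. rk n * (H n \<omega> - \<gamma>) - (Q n \<omega> - L n \<omega>))"
  proof (rule op_le)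
    show "op (\<lambda>n \<omega>. l n \<omega> * P n \<omega>)" by (rule op_mult_Op[OF l_op P_Op])
    show "whp (\<lambda>n \<omega>. \<bar>rk n * (H n \<omega> - \<gamma>) - (Q n \<omega> - L n \<omega>)\<bar> \<le> \<bar>l n \<omega> * P n \<omega>\<bar>)"
    proof (rule whp_mono[OF whp_conj[OF whp_n2 U_pos]], elim conjE)
      fix n \<omega> assume n: "2 \<le> n" and U: "0 < U n \<omega>"
      have r: "rk n > 0" using rk_pos[OF n] .
      let ?SU = "\<Sum>j=1..n. log_excess (U n \<omega>) (X n j \<omega>)" and ?St = "\<Sum>j=1..n. log_excess (t n) (X n j \<omega>)"
      have b: "\<bar>?SU - ?St + real (k n) * l n \<omega>\<bar> \<le> \<bar>l n \<omega>\<bar> * (rk n * \<bar>P n \<omega>\<bar>)"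
        using log_excess_threshold_change[OF k_pos(2)[OF n] U_def U t_pos[OF n]] N_zero[OF n, of \<omega>] by (simp add: l_def)
      have h: "H n \<omega> = ?SU / real (k n)"
        unfolding H_def by (rule hill_eq_log_excess[OF k_pos(2)[OF n] U_def U])
      have le: "log_excess (t n) z = tail_excess (\<lambda>x. x) (t n) z" for z
        by (simp add: log_excess_def tail_excess_def)
      have kk: "y / real (k n) * rk n = y / rk n" for y using r rk_sq[of n] by (simp add: field_simps)
      have "rk n * (H n \<omega> - \<gamma>) - (Q n \<omega> - L n \<omega>) = (?SU - ?St + real (k n) * l n \<omega>) / rk n"
      proof -
        have "rk n * H n \<omega> = ?SU / rk n" unfolding h using kk[of ?SU] by (simp add: mult.commute)
        moreover have "Q n \<omega> = ?St / rk n - rk n * \<gamma>" using r rk_sq[of n] by (simp add: Q_def linear_stat_def le field_simps)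
        moreover have "L n \<omega> = real (k n) * l n \<omega> / rk n" using r rk_sq[of n] by (simp add: L_def l_def field_simps)
        ultimately show ?thesis by (simp add: right_diff_distrib add_divide_distrib diff_divide_distrib)
      qed
      then have "\<bar>rk n * (H n \<omega> - \<gamma>) - (Q n \<omega> - L n \<omega>)\<bar> = \<bar>?SU - ?St + real (k n) * l n \<omega>\<bar> / rk n"
        using r by (simp add: abs_divide)
      also have "\<dots> \<le> \<bar>l n \<omega>\<bar> * (rk n * \<bar>P n \<omega>\<bar>) / rk n" using b r by (intro divide_right_mono) auto
      also have "\<dots> = \<bar>l n \<omega> * P n \<omega>\<bar>" using r by (simp add: abs_mult)
      finally show "\<bar>rk n * (H n \<omega> - \<gamma>) - (Q n \<omega> - L n \<omega>)\<bar> \<le> \<bar>l n \<omega> * P n \<omega>\<bar>" .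
    qed
  qed
  from op_diff[OF A L_P] show ?thesis by (simp add: algebra_simps)
qed

definition h :: "nat \<Rightarrow> 'a \<Rightarrow> real" where "h n \<omega> = Q n \<omega> - \<gamma> * P n \<omega>"

lemma h_Op: "Op h" unfolding h_def[abs_def] by (intro Op_diff Op_cmult Q_Op P_Op)

lemma H_h: "op (\<lambda>n \<omega>. rk n * (H n \<omega> - \<gamma>) - h n \<omega>)" using hill_expansion by (simp add: h_def)

lemma H_lim: "op (\<lambda>n \<omega>. H n \<omega> - \<gamma>)"
proof (rule op_cong)
  show "op (\<lambda>n \<omega>. inverse (rk n) * (rk n * (H n \<omega> - \<gamma>)))"
    by (rule op_mult_Op[OF op_inverse_rk Op_of_approx[OF H_h h_Op]])
  show "whp (\<lambda>n \<omega>. H n \<omega> - \<gamma> = inverse (rk n) * (rk n * (H n \<omega> - \<gamma>)))"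
    by (rule whp_mono[OF whp_n2]) (use rk_pos in force)
qed

lemma r_lim: "op (\<lambda>n \<omega>. rho_hat n \<omega> - \<rho>)" using rho_conv by (simp add: \<rho>_def)

lemma s_lim: "op (\<lambda>n \<omega>. s n \<omega> - \<tau>)"
proof -
  have "op (\<lambda>n \<omega>. inverse (H n \<omega>) - inverse \<gamma>)"
    using gamma_pos by (intro op_continuous[OF H_lim]) (auto intro!: continuous_intros)
  have eq: "\<rho> * inverse \<gamma> = \<tau>" using gamma_pos by (simp add: \<rho>_def)
  from op_mult_limits[OF r_lim \<open>op (\<lambda>n \<omega>. inverse (H n \<omega>) - inverse \<gamma>)\<close>] show ?thesis
    unfolding eq s_def divide_inverse .
qed

lemma good_event: "whp (\<lambda>n \<omega>. n \<ge> 2 \<and> U n \<omega> > 0 \<and> H n \<omega> > 0 \<and> rho_hat n \<omega> < 0 \<and> s n \<omega> < 0)"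
  by (intro whp_conj whp_n2 U_pos op_whp_limit_greater[OF H_lim gamma_pos] op_whp_limit_less[OF r_lim rho_neg] op_whp_limit_less[OF s_lim tau_neg])

definition q :: "nat \<Rightarrow> 'a \<Rightarrow> real" where "q n \<omega> = exp (s n \<omega> * l n \<omega>)"

lemma sl_lim: "op (\<lambda>n \<omega>. s n \<omega> * l n \<omega> - 0)" using op_mult_limits[OF s_lim l_lim] by simp

lemma q_lim: "op (\<lambda>n \<omega>. q n \<omega> - 1)"
  using op_continuous[OF sl_lim, of exp] by (simp add: q_def)

definition e :: "nat \<Rightarrow> 'a \<Rightarrow> real" where "e n \<omega> = rk n * (E n \<omega> - 1 / (1 - \<gamma> * s n \<omega>))"

lemma rho1: "1 - \<rho> \<noteq> 0" "1 - \<gamma> * \<tau> \<noteq> 0" using rho_neg by (auto simp: \<rho>_def)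

text \<open>
  Changing the threshold multiplies the power moment by \<open>1 / q\<close>, where \<open>q = exp (s * l)\<close>, up to an error
  \<open>(q - 1) * P\<close>. The factor contributes \<open>sqrt k * (1 - q) / (1 - \<gamma> * s)\<close>, which is linear in \<open>L\<close> to first
  order, and \<open>D\<close> at the random exponent may be replaced by \<open>D\<close> at \<open>\<tau>\<close> by the Lipschitz bound.
\<close>

lemma moment_expansion_random: "op (\<lambda>n \<omega>. e n \<omega> - (D \<tau> n \<omega> - \<rho> / (1 - \<rho>) * P n \<omega>))"
proof -
  define a where "a n \<omega> = - (s n \<omega> * exp_quot (s n \<omega> * l n \<omega>) * inverse (1 - \<gamma> * s n \<omega>))" for n \<omega>
  have "op (\<lambda>n \<omega>. exp_quot (s n \<omega> * l n \<omega>) - 1)"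
    using op_continuous[OF sl_lim isCont_exp_quot] by (simp add: exp_quot_def)
  moreover have "op (\<lambda>n \<omega>. inverse (1 - \<gamma> * s n \<omega>) - inverse (1 - \<gamma> * \<tau>))"
    using rho1 by (intro op_continuous[OF s_lim]) (auto intro!: continuous_intros)
  ultimately have "op (\<lambda>n \<omega>. s n \<omega> * exp_quot (s n \<omega> * l n \<omega>) * inverse (1 - \<gamma> * s n \<omega>) - \<tau> * 1 * inverse (1 - \<gamma> * \<tau>))"
    by (intro op_mult_limits s_lim)
  from op_uminus[OF this] have a_lim: "op (\<lambda>n \<omega>. a n \<omega> - (- \<tau> * inverse (1 - \<gamma> * \<tau>)))"
    by (simp add: a_def)
  have A: "op (\<lambda>n \<omega>. a n \<omega> * L n \<omega> - (- \<tau> * inverse (1 - \<gamma> * \<tau>)) * (\<gamma> * P n \<omega>))"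
    by (rule op_limit_mult_approx[OF a_lim L_P Op_cmult[OF P_Op]])
  have B: "op (\<lambda>n \<omega>. D (s n \<omega>) n \<omega> - D \<tau> n \<omega>)"
  proof (rule op_le[OF op_mult_Op[OF s_lim R_Op]], rule whp_mono[OF good_event], elim conjE)
    fix n \<omega> assume n: "2 \<le> n" and s: "s n \<omega> < 0"
    have "\<bar>D (s n \<omega>) n \<omega> - D \<tau> n \<omega>\<bar> \<le> \<bar>s n \<omega> - \<tau>\<bar> * R n \<omega>"
      unfolding D_def using power_process_lipschitz[OF n, of "s n \<omega>" \<tau>] s tau_neg by simp
    also have "\<dots> \<le> \<bar>(s n \<omega> - \<tau>) * R n \<omega>\<bar>" unfolding abs_mult by (intro mult_left_mono) auto
    finally show "\<bar>D (s n \<omega>) n \<omega> - D \<tau> n \<omega>\<bar> \<le> \<bar>(s n \<omega> - \<tau>) * R n \<omega>\<bar>" .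
  qed
  have C: "op (\<lambda>n \<omega>. q n \<omega> * e n \<omega> - (a n \<omega> * L n \<omega> + D (s n \<omega>) n \<omega>))"
  proof (rule op_le[OF op_mult_Op[OF q_lim P_Op]], rule whp_mono[OF good_event], elim conjE)
    fix n \<omega> assume n: "2 \<le> n" and U: "0 < U n \<omega>" and s: "s n \<omega> < 0"
    have r: "rk n > 0" using rk_pos[OF n] .
    let ?s = "s n \<omega>"
    let ?SU = "\<Sum>j=1..n. power_excess ?s (U n \<omega>) (X n j \<omega>)" and ?St = "\<Sum>j=1..n. power_excess ?s (t n) (X n j \<omega>)"
    have g1: "1 - \<gamma> * ?s > 0" using s gamma_pos by (smt (verit) mult_pos_neg)
    have qq: "(U n \<omega> / t n) powr ?s = q n \<omega>"
      using U t_pos[OF n] by (simp add: powr_def q_def l_def)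
    have b: "\<bar>q n \<omega> * (real (k n) + ?SU) - (real (k n) + ?St)\<bar> \<le> \<bar>q n \<omega> - 1\<bar> * (rk n * \<bar>P n \<omega>\<bar>)"
      using power_excess_threshold_change[OF k_pos(2)[OF n] U_def U t_pos[OF n], of ?s] s N_zero[OF n, of \<omega>] by (simp add: qq)
    have EE: "E n \<omega> = (real (k n) + ?SU) / real (k n)"
      unfolding E_def using excess_moment_eq_power_excess[OF k_pos(2)[OF n] k_pos(1)[OF n] U_def U, of ?s] k_pos(1)[OF n]
      by (simp add: add_divide_distrib)
    have pe: "power_excess ?s (t n) z = tail_excess (\<lambda>x. exp (?s * x) - 1) (t n) z" for z
      using t_pos[OF n] by (auto simp: power_excess_def tail_excess_def powr_def)
    have Dt: "D ?s n \<omega> = (?St - real (k n) * (\<gamma> * ?s / (1 - \<gamma> * ?s))) / rk n"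
      unfolding D_def linear_stat_def pe ..
    have rkk: "rk n / real (k n) = 1 / rk n" "real (k n) / rk n = rk n" using r by (auto simp: field_simps)
    have qe: "q n \<omega> * e n \<omega> = q n \<omega> * (real (k n) + ?SU) / rk n - q n \<omega> * rk n / (1 - \<gamma> * ?s)"
    proof -
      have "rk n * E n \<omega> = (real (k n) + ?SU) * (rk n / real (k n))" unfolding EE by simp
      then show ?thesis unfolding e_def rkk right_diff_distrib by simp
    qed
    have aL: "a n \<omega> * L n \<omega> = rk n * (1 - q n \<omega>) / (1 - \<gamma> * ?s)"
    proof -
      have "q n \<omega> - 1 = exp_quot (?s * l n \<omega>) * (?s * l n \<omega>)" unfolding q_def by (rule exp_quot_mult)
      moreover have "L n \<omega> = rk n * l n \<omega>" by (simp add: L_def l_def)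
      ultimately have eL: "- (?s * exp_quot (?s * l n \<omega>)) * L n \<omega> = rk n * (1 - q n \<omega>)" by (simp add: algebra_simps)
      have "a n \<omega> * L n \<omega> = (- (?s * exp_quot (?s * l n \<omega>)) * L n \<omega>) * inverse (1 - \<gamma> * ?s)"
        by (simp add: a_def mult_ac)
      then show ?thesis unfolding eL divide_inverse .
    qed
    have tot: "(real (k n) + ?St) / rk n = D ?s n \<omega> + rk n / (1 - \<gamma> * ?s)"
    proof -
      have "1 / (1 - \<gamma> * ?s) - \<gamma> * ?s / (1 - \<gamma> * ?s) = 1"
        using g1 by (simp flip: diff_divide_distrib)
      then have "real (k n) * (1 / (1 - \<gamma> * ?s)) - real (k n) * (\<gamma> * ?s / (1 - \<gamma> * ?s)) = real (k n)"
        by (metis mult.right_neutral right_diff_distrib)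
      then have "real (k n) = real (k n) / (1 - \<gamma> * ?s) - real (k n) * (\<gamma> * ?s / (1 - \<gamma> * ?s))" by simp
      then have "real (k n) + ?St = (?St - real (k n) * (\<gamma> * ?s / (1 - \<gamma> * ?s))) + real (k n) / (1 - \<gamma> * ?s)" by linarith
      then have "(real (k n) + ?St) / rk n = D ?s n \<omega> + (real (k n) / rk n) / (1 - \<gamma> * ?s)"
        unfolding Dt by (simp only: add_divide_distrib) (simp add: divide_divide_eq_left mult.commute)
      then show ?thesis unfolding rkk .
    qed
    have "q n \<omega> * e n \<omega> - (a n \<omega> * L n \<omega> + D ?s n \<omega>) = (q n \<omega> * (real (k n) + ?SU) - (real (k n) + ?St)) / rk n"
      unfolding qe aL diff_divide_distrib[of _ _ "rk n"] tot by (simp add: algebra_simps diff_divide_distrib)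
    then have "\<bar>q n \<omega> * e n \<omega> - (a n \<omega> * L n \<omega> + D ?s n \<omega>)\<bar> = \<bar>q n \<omega> * (real (k n) + ?SU) - (real (k n) + ?St)\<bar> / rk n"
      using r by (simp add: abs_divide)
    also have "\<dots> \<le> \<bar>q n \<omega> - 1\<bar> * (rk n * \<bar>P n \<omega>\<bar>) / rk n" using b r by (intro divide_right_mono) auto
    also have "\<dots> = \<bar>(q n \<omega> - 1) * P n \<omega>\<bar>" using r by (simp add: abs_mult)
    finally show "\<bar>q n \<omega> * e n \<omega> - (a n \<omega> * L n \<omega> + D ?s n \<omega>)\<bar> \<le> \<bar>(q n \<omega> - 1) * P n \<omega>\<bar>" .
  qed
  have "op (\<lambda>n \<omega>. q n \<omega> * e n \<omega> - (D \<tau> n \<omega> - \<rho> / (1 - \<rho>) * P n \<omega>))"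
    using op_add[OF C op_add[OF A B]] by (simp add: \<rho>_def divide_inverse algebra_simps)
  moreover have "Op (\<lambda>n \<omega>. D \<tau> n \<omega> - \<rho> / (1 - \<rho>) * P n \<omega>)"
    using tau_neg by (intro Op_diff Op_cmult P_Op D_Op) auto
  moreover have "op (\<lambda>n \<omega>. inverse (q n \<omega>) - inverse 1)"
    by (rule op_continuous[OF q_lim]) (auto intro!: continuous_intros)
  ultimately have "op (\<lambda>n \<omega>. inverse (q n \<omega>) * (q n \<omega> * e n \<omega>) - inverse 1 * (D \<tau> n \<omega> - \<rho> / (1 - \<rho>) * P n \<omega>))"
    by (intro op_limit_mult_approx)
  moreover have "inverse (q n \<omega>) * (q n \<omega> * e n \<omega>) = e n \<omega>" for n \<omega> by (simp add: q_def)
  ultimately show ?thesis by simp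
qed

text \<open>
  The limit form of \<open>sqrt k\<close> times the bracket in the definition of \<open>delta_est\<close>; its last term accounts for
  the replacement of \<open>\<gamma>\<close> by \<open>H\<close> in the Pareto moment \<open>1 / (1 - \<gamma> * s)\<close>.
\<close>

definition d0 :: "nat \<Rightarrow> 'a \<Rightarrow> real" where
  "d0 n \<omega> = (D \<tau> n \<omega> - \<rho> / (1 - \<rho>) * P n \<omega>) - \<tau> / (1 - \<rho>)\<^sup>2 * h n \<omega>"

definition "\<kappa>0 = \<gamma> * (1 - 2 * \<rho>) * (1 - \<rho>) ^ 3 / \<rho> ^ 4"

lemma d0_Op: "Op d0"
  unfolding d0_def[abs_def] using tau_neg by (intro Op_diff Op_cmult P_Op D_Op h_Op) auto

text \<open>
  The estimator subtracts \<open>1 / (1 - rho_hat) = 1 / (1 - H * s)\<close>. Its difference from \<open>1 / (1 - \<gamma> * s)\<close> is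
  \<open>s * (H - \<gamma>)\<close> times a factor with a limit, so no rate for \<open>rho_hat\<close> enters.
\<close>

lemma estimating_equation: "op (\<lambda>n \<omega>. rk n * (E n \<omega> - 1 / (1 - rho_hat n \<omega>)) - d0 n \<omega>)"
proof -
  define b where "b n \<omega> = s n \<omega> * inverse (1 - \<gamma> * s n \<omega>) * inverse (1 - rho_hat n \<omega>)" for n \<omega>
  have "op (\<lambda>n \<omega>. inverse (1 - \<gamma> * s n \<omega>) - inverse (1 - \<gamma> * \<tau>))"
    using rho1 by (intro op_continuous[OF s_lim]) (auto intro!: continuous_intros)
  moreover have "op (\<lambda>n \<omega>. inverse (1 - rho_hat n \<omega>) - inverse (1 - \<rho>))"
    using rho1 by (intro op_continuous[OF r_lim]) (auto intro!: continuous_intros)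
  ultimately have "op (\<lambda>n \<omega>. b n \<omega> - \<tau> * inverse (1 - \<gamma> * \<tau>) * inverse (1 - \<rho>))"
    unfolding b_def by (intro op_mult_limits s_lim)
  from op_limit_mult_approx[OF this H_h h_Op]
  have "op (\<lambda>n \<omega>. b n \<omega> * (rk n * (H n \<omega> - \<gamma>)) - \<tau> / (1 - \<rho>)\<^sup>2 * h n \<omega>)"
    by (simp add: \<rho>_def divide_inverse power2_eq_square mult_ac)
  from op_diff[OF moment_expansion_random this]
  show ?thesis
  proof (rule op_cong)
    show "whp (\<lambda>n \<omega>. rk n * (E n \<omega> - 1 / (1 - rho_hat n \<omega>)) - d0 n \<omega> =
      e n \<omega> - (D \<tau> n \<omega> - \<rho> / (1 - \<rho>) * P n \<omega>) - (b n \<omega> * (rk n * (H n \<omega> - \<gamma>)) - \<tau> / (1 - \<rho>)\<^sup>2 * h n \<omega>))"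
    proof (rule whp_mono[OF good_event], elim conjE)
      fix n \<omega> assume "2 \<le> n" and H: "0 < H n \<omega>" and r: "rho_hat n \<omega> < 0" and s: "s n \<omega> < 0"
      let ?s = "s n \<omega>" and ?r = "rho_hat n \<omega>"
      have rs: "?r = H n \<omega> * ?s" using H by (simp add: s_def)
      have g1: "1 - \<gamma> * ?s > 0" using s gamma_pos by (smt (verit) mult_pos_neg)
      have g2: "1 - ?r > 0" using r by simp
      have "1 / (1 - \<gamma> * ?s) - 1 / (1 - ?r) = ((1 - ?r) - (1 - \<gamma> * ?s)) / ((1 - \<gamma> * ?s) * (1 - ?r))"
        using g1 g2 by (simp add: diff_frac_eq)
      also have "(1 - ?r) - (1 - \<gamma> * ?s) = - (?s * (H n \<omega> - \<gamma>))" unfolding rs by (simp add: algebra_simps)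
      also have "- (?s * (H n \<omega> - \<gamma>)) / ((1 - \<gamma> * ?s) * (1 - ?r)) = - (b n \<omega> * (H n \<omega> - \<gamma>))"
        by (simp add: b_def divide_inverse mult_ac)
      finally have inv: "1 / (1 - ?r) = 1 / (1 - \<gamma> * ?s) + b n \<omega> * (H n \<omega> - \<gamma>)" by linarith
      show "rk n * (E n \<omega> - 1 / (1 - ?r)) - d0 n \<omega> =
        e n \<omega> - (D \<tau> n \<omega> - \<rho> / (1 - \<rho>) * P n \<omega>) - (b n \<omega> * (rk n * (H n \<omega> - \<gamma>)) - \<tau> / (1 - \<rho>)\<^sup>2 * h n \<omega>)"
        unfolding e_def d0_def inv by (simp add: algebra_simps)
    qed
  qed
qed

lemma delta_hat_expansion: "op (\<lambda>n \<omega>. rk n * delta_hat n \<omega> - \<kappa>0 * d0 n \<omega>)"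
proof -
  define c where "c n \<omega> = H n \<omega> * ((1 - 2 * rho_hat n \<omega>) * (1 - rho_hat n \<omega>) ^ 3 / rho_hat n \<omega> ^ 4)" for n \<omega>
  have "op (\<lambda>n \<omega>. (1 - 2 * rho_hat n \<omega>) * (1 - rho_hat n \<omega>) ^ 3 / rho_hat n \<omega> ^ 4 - (1 - 2 * \<rho>) * (1 - \<rho>) ^ 3 / \<rho> ^ 4)"
    using rho_neg by (intro op_continuous[OF r_lim, of "\<lambda>r. (1 - 2 * r) * (1 - r) ^ 3 / r ^ 4"]) (auto intro!: continuous_intros)
  from op_mult_limits[OF H_lim this] have "op (\<lambda>n \<omega>. c n \<omega> - \<kappa>0)" by (simp add: c_def \<kappa>0_def mult.assoc)
  from op_limit_mult_approx[OF this estimating_equation d0_Op]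
  show ?thesis
  proof (rule op_cong)
    have inS: "whp (\<lambda>n \<omega>. \<omega> \<in> space (M n))" by (rule whp_eventually) simp
    show "whp (\<lambda>n \<omega>. rk n * delta_hat n \<omega> - \<kappa>0 * d0 n \<omega> = c n \<omega> * (rk n * (E n \<omega> - 1 / (1 - rho_hat n \<omega>))) - \<kappa>0 * d0 n \<omega>)"
    proof (rule whp_mono[OF whp_conj[OF good_event inS]], elim conjE)
      fix n \<omega> assume n: "2 \<le> n" and U: "0 < U n \<omega>" and H: "0 < H n \<omega>" and r: "rho_hat n \<omega> < 0" and w: "\<omega> \<in> space (M n)"
      have "est_defined (\<lambda>i. X n i \<omega>) (k n) n (rho_hat n \<omega>)"
        using U H r by (simp add: est_defined_def U_def H_def)
      from delta_hat_eq[OF n w this]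
      have "delta_hat n \<omega> = c n \<omega> * (E n \<omega> - 1 / (1 - rho_hat n \<omega>))"
        by (simp add: delta_est_def c_def E_def s_def H_def)
      then show "rk n * delta_hat n \<omega> - \<kappa>0 * d0 n \<omega> = c n \<omega> * (rk n * (E n \<omega> - 1 / (1 - rho_hat n \<omega>))) - \<kappa>0 * d0 n \<omega>"
        by simp
    qed
  qed
qed

lemma gamma_hat_expansion: "op (\<lambda>n \<omega>. rk n * (gamma_hat n \<omega> - \<gamma>) - (h n \<omega> - \<rho> / (1 - \<rho>) * (\<kappa>0 * d0 n \<omega>)))"
proof -
  have "op (\<lambda>n \<omega>. rho_hat n \<omega> / (1 - rho_hat n \<omega>) - \<rho> / (1 - \<rho>))"
    using rho1 by (intro op_continuous[OF r_lim, of "\<lambda>r. r / (1 - r)"]) (auto intro!: continuous_intros)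
  from op_diff[OF H_h op_limit_mult_approx[OF this delta_hat_expansion Op_cmult[OF d0_Op]]]
  show ?thesis
  proof (rule op_cong)
    have inS: "whp (\<lambda>n \<omega>. \<omega> \<in> space (M n))" by (rule whp_eventually) simp
    show "whp (\<lambda>n \<omega>. rk n * (gamma_hat n \<omega> - \<gamma>) - (h n \<omega> - \<rho> / (1 - \<rho>) * (\<kappa>0 * d0 n \<omega>)) =
      rk n * (H n \<omega> - \<gamma>) - h n \<omega> - (rho_hat n \<omega> / (1 - rho_hat n \<omega>) * (rk n * delta_hat n \<omega>) - \<rho> / (1 - \<rho>) * (\<kappa>0 * d0 n \<omega>)))"
    proof (rule whp_mono[OF whp_conj[OF good_event inS]], elim conjE)
      fix n \<omega> assume n: "2 \<le> n" and U: "0 < U n \<omega>" and H: "0 < H n \<omega>" and r: "rho_hat n \<omega> < 0" and w: "\<omega> \<in> space (M n)"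
      have "est_defined (\<lambda>i. X n i \<omega>) (k n) n (rho_hat n \<omega>)"
        using U H r by (simp add: est_defined_def U_def H_def)
      from gamma_hat_eq[OF n w this] delta_hat_eq[OF n w this]
      have gh: "gamma_hat n \<omega> = H n \<omega> - delta_hat n \<omega> * (rho_hat n \<omega> / (1 - rho_hat n \<omega>))"
        by (simp add: gamma_est_def H_def)
      show "rk n * (gamma_hat n \<omega> - \<gamma>) - (h n \<omega> - \<rho> / (1 - \<rho>) * (\<kappa>0 * d0 n \<omega>)) =
      rk n * (H n \<omega> - \<gamma>) - h n \<omega> - (rho_hat n \<omega> / (1 - rho_hat n \<omega>) * (rk n * delta_hat n \<omega>) - \<rho> / (1 - \<rho>) * (\<kappa>0 * d0 n \<omega>))"
        unfolding gh by (simp add: algebra_simps)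
    qed
  qed
qed

lemma U_eq: "n \<ge> 2 \<Longrightarrow> U n \<omega> > 0 \<Longrightarrow> U n \<omega> = t n * exp (l n \<omega>)"
  using t_pos[of n] by (simp add: l_def)

lemma delta_U: "op (\<lambda>n \<omega>. rk n * \<delta> (U n \<omega>) - lam)"
  unfolding small_in_prob_def
proof (intro allI impI)
  fix \<epsilon> :: real assume "\<epsilon> > 0"
  from delta_t_uniform[OF this] obtain \<eta> where \<eta>: "\<eta> > 0"
    "\<forall>\<^sub>F n in sequentially. \<forall>u. \<bar>u\<bar> \<le> \<eta> \<longrightarrow> \<bar>rk n * \<delta> (t n * exp u) - lam\<bar> \<le> \<epsilon>" by blast
  have "whp (\<lambda>n \<omega>. \<forall>u. \<bar>u\<bar> \<le> \<eta> \<longrightarrow> \<bar>rk n * \<delta> (t n * exp u) - lam\<bar> \<le> \<epsilon>)"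
    by (rule whp_eventually) (use \<eta>(2) in eventually_elim, blast)
  from whp_conj[OF whp_conj[OF this op_whp[OF l_op \<eta>(1)]] good_event]
  show "whp (\<lambda>n \<omega>. \<bar>rk n * \<delta> (U n \<omega>) - lam\<bar> \<le> \<epsilon>)"
  proof (rule whp_mono, elim conjE)
    fix n \<omega> assume "\<forall>u. \<bar>u\<bar> \<le> \<eta> \<longrightarrow> \<bar>rk n * \<delta> (t n * exp u) - lam\<bar> \<le> \<epsilon>" "\<bar>l n \<omega>\<bar> \<le> \<eta>" "2 \<le> n" "0 < U n \<omega>"
    then show "\<bar>rk n * \<delta> (U n \<omega>) - lam\<bar> \<le> \<epsilon>" unfolding U_eq[OF \<open>2 \<le> n\<close> \<open>0 < U n \<omega>\<close>] by blast
  qed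
qed

text \<open>
  At the random threshold \<open>n * (1 - F u) / k = exp (- l / \<gamma>) * (1 + \<delta> u / \<gamma>)\<close>; the first factor contributes
  \<open>- L / \<gamma>\<close>, which is close to \<open>- P\<close>, and the second one \<open>lam / \<gamma>\<close>.
\<close>

lemma tail_count_expansion: "op (\<lambda>n \<omega>. tail_count_dev F (\<lambda>i. X n i \<omega>) (k n) n - (lam / \<gamma> - P n \<omega>))"
proof -
  have x0: "op (\<lambda>n \<omega>. - (l n \<omega> / \<gamma>) - 0)" using op_cmult[OF l_op, of "- 1 / \<gamma>"] by simp
  have "op (\<lambda>n \<omega>. exp_quot (- (l n \<omega> / \<gamma>)) - 1)"
    using op_continuous[OF x0 isCont_exp_quot] by (simp add: exp_quot_def)
  from op_cmult[OF op_limit_mult_approx[OF this L_P Op_cmult[OF P_Op]], of "- 1 / \<gamma>"]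
  have A: "op (\<lambda>n \<omega>. - 1 / \<gamma> * (exp_quot (- (l n \<omega> / \<gamma>)) * L n \<omega>) - (- P n \<omega>))"
    using gamma_pos by (simp add: right_diff_distrib)
  have "op (\<lambda>n \<omega>. exp (- (l n \<omega> / \<gamma>)) - exp 0)" by (rule op_continuous[OF x0]) simp
  from op_cmult[OF op_mult_limits[OF this delta_U], of "1 / \<gamma>"]
  have B: "op (\<lambda>n \<omega>. 1 / \<gamma> * (exp (- (l n \<omega> / \<gamma>)) * (rk n * \<delta> (U n \<omega>))) - lam / \<gamma>)"
    by (simp add: right_diff_distrib)
  from op_add[OF A B] show ?thesis
  proof (rule op_cong)
    show "whp (\<lambda>n \<omega>. tail_count_dev F (\<lambda>i. X n i \<omega>) (k n) n - (lam / \<gamma> - P n \<omega>) =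
       - 1 / \<gamma> * (exp_quot (- (l n \<omega> / \<gamma>)) * L n \<omega>) - (- P n \<omega>) + (1 / \<gamma> * (exp (- (l n \<omega> / \<gamma>)) * (rk n * \<delta> (U n \<omega>))) - lam / \<gamma>))"
    proof (rule whp_mono[OF good_event], elim conjE)
      fix n \<omega> assume n: "2 \<le> n" and U: "0 < U n \<omega>"
      let ?x = "- (l n \<omega> / \<gamma>)"
      have "real n * (1 - F (U n \<omega>)) / real (k n) = real n / real (k n) * (1 - F (t n * exp (l n \<omega>)))"
        using U_eq[OF n U] by simp
      also have "\<dots> = exp ?x * (1 + \<delta> (U n \<omega>) / \<gamma>)" unfolding survival_t[OF n] using U_eq[OF n U] by simp
      finally have Z: "tail_count_dev F (\<lambda>i. X n i \<omega>) (k n) n = rk n * (exp ?x * (1 + \<delta> (U n \<omega>) / \<gamma>) - 1)"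
        unfolding tail_count_dev_def U_def[symmetric] by simp
      have x: "rk n * (exp ?x - 1) = - 1 / \<gamma> * (exp_quot ?x * L n \<omega>)"
        unfolding exp_quot_mult by (simp add: L_def l_def)
      have "rk n * (exp ?x * (1 + \<delta> (U n \<omega>) / \<gamma>) - 1) = rk n * (exp ?x - 1) + 1 / \<gamma> * (exp ?x * (rk n * \<delta> (U n \<omega>)))"
        by (simp add: algebra_simps)
      then show "tail_count_dev F (\<lambda>i. X n i \<omega>) (k n) n - (lam / \<gamma> - P n \<omega>) =
       - 1 / \<gamma> * (exp_quot ?x * L n \<omega>) - (- P n \<omega>) + (1 / \<gamma> * (exp ?x * (rk n * \<delta> (U n \<omega>))) - lam / \<gamma>)"
        unfolding Z x by simp
    qed
  qed
qed

end

section \<open>The joint limit\<close>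

lemma cmod_iexp_diff_le: "cmod (iexp x - iexp y) \<le> \<bar>x - y\<bar>"
proof -
  have "iexp x - iexp y = iexp y * (iexp (x - y) - 1)"
    by (simp add: right_diff_distrib flip: exp_add) 
  then have "cmod (iexp x - iexp y) = cmod (iexp (x - y) - 1)" by (simp add: norm_mult)
  also have "\<dots> \<le> \<bar>x - y\<bar>" using iexp_approx1[of "x - y" 0] by simp
  finally show ?thesis .
qed

context prob_seq
begin

text \<open>
  Slutsky's lemma for characteristic functions.
\<close>

lemma iexp_integral_diff:
  assumes op: "op (\<lambda>n \<omega>. A n \<omega> - B n \<omega>)"
    and meas: "\<forall>\<^sub>F n in sequentially. A n \<in> borel_measurable (M n) \<and> B n \<in> borel_measurable (M n)"
    and lim: "(\<lambda>n. \<integral>\<omega>. iexp (B n \<omega>) \<partial>M n) \<longlonglongrightarrow> c"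
  shows "(\<lambda>n. \<integral>\<omega>. iexp (A n \<omega>) \<partial>M n) \<longlonglongrightarrow> c"
proof -
  have "(\<lambda>n. (\<integral>\<omega>. iexp (A n \<omega>) \<partial>M n) - (\<integral>\<omega>. iexp (B n \<omega>) \<partial>M n)) \<longlonglongrightarrow> 0"
  proof (rule tendstoI)
    fix \<epsilon> :: real assume "\<epsilon> > 0"
    then have e4: "\<epsilon> / 4 > 0" by simp
    have S: "\<forall>\<^sub>F n in sequentially. {\<omega> \<in> space (M n). \<not> \<bar>A n \<omega> - B n \<omega>\<bar> \<le> \<epsilon> / 4} \<in> sets (M n)"
      using meas by eventually_elim (elim conjE, measurable)
    from prob_of_whp[OF op_whp[OF op e4] S]
    have "\<forall>\<^sub>F n in sequentially. measure (M n) {\<omega> \<in> space (M n). \<not> \<bar>A n \<omega> - B n \<omega>\<bar> \<le> \<epsilon> / 4} < \<epsilon> / 4"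
      using e4 by (rule order_tendstoD)
    then show "\<forall>\<^sub>F n in sequentially. dist ((\<integral>\<omega>. iexp (A n \<omega>) \<partial>M n) - (\<integral>\<omega>. iexp (B n \<omega>) \<partial>M n)) 0 < \<epsilon>"
      using meas S
    proof eventually_elim
      case (elim n)
      interpret Mn: prob_space "M n" by (rule prob_M)
      have [measurable]: "A n \<in> borel_measurable (M n)" "B n \<in> borel_measurable (M n)" using elim by auto
      let ?S = "{\<omega> \<in> space (M n). \<not> \<bar>A n \<omega> - B n \<omega>\<bar> \<le> \<epsilon> / 4}"
      have i: "integrable (M n) (\<lambda>\<omega>. iexp (A n \<omega>))" "integrable (M n) (\<lambda>\<omega>. iexp (B n \<omega>))"
        by (rule Mn.integrable_const_bound[of _ 1]; simp)+
      have "cmod ((\<integral>\<omega>. iexp (A n \<omega>) \<partial>M n) - (\<integral>\<omega>. iexp (B n \<omega>) \<partial>M n)) = cmod (\<integral>\<omega>. iexp (A n \<omega>) - iexp (B n \<omega>) \<partial>M n)"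
        using i by simp
      also have "\<dots> \<le> (\<integral>\<omega>. cmod (iexp (A n \<omega>) - iexp (B n \<omega>)) \<partial>M n)" by (rule integral_norm_bound)
      also have "\<dots> \<le> (\<integral>\<omega>. \<epsilon> / 4 + 2 * indicator ?S \<omega> \<partial>M n)"
      proof (rule integral_mono)
        show "integrable (M n) (\<lambda>\<omega>. cmod (iexp (A n \<omega>) - iexp (B n \<omega>)))" using i by (intro integrable_norm Bochner_Integration.integrable_diff)
        show "integrable (M n) (\<lambda>\<omega>. \<epsilon> / 4 + 2 * indicator ?S \<omega>)"
          using elim(3) by (auto intro!: integrable_real_indicator simp: Mn.emeasure_eq_measure)
        fix \<omega> assume w: "\<omega> \<in> space (M n)"
        show "cmod (iexp (A n \<omega>) - iexp (B n \<omega>)) \<le> \<epsilon> / 4 + 2 * indicator ?S \<omega>"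
        proof (cases "\<bar>A n \<omega> - B n \<omega>\<bar> \<le> \<epsilon> / 4")
          case True
          then show ?thesis using cmod_iexp_diff_le[of "A n \<omega>" "B n \<omega>"] by simp
        next
          case False
          have "cmod (iexp (A n \<omega>) - iexp (B n \<omega>)) \<le> 1 + 1" using norm_triangle_ineq4[of "iexp (A n \<omega>)" "iexp (B n \<omega>)"] by simp
          then show ?thesis using False w e4 by simp
        qed
      qed
      also have "\<dots> = \<epsilon> / 4 + 2 * measure (M n) ?S"
        using elim(3) by (simp add: Mn.prob_space Mn.emeasure_eq_measure)
      also have "\<dots> < \<epsilon>" using elim(1) \<open>\<epsilon> > 0\<close> by simp
      finally show ?case by (simp add: dist_norm)
    qed
  qed
  from tendsto_add[OF this lim] show ?thesis by simp
qed

lemma Op_tight: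
  assumes "Op Y" "\<forall>\<^sub>F n in sequentially. Y n \<in> borel_measurable (M n)" "\<eta> > 0"
  shows "\<exists>B. \<forall>\<^sub>F n in sequentially. measure (M n) {\<omega> \<in> space (M n). \<bar>Y n \<omega>\<bar> > B} \<le> \<eta>"
proof -
  obtain B where B: "\<forall>\<^sub>F n in sequentially. \<exists>A\<in>sets (M n). measure (M n) A \<ge> 1 - \<eta> \<and> (\<forall>\<omega>\<in>A. \<bar>Y n \<omega>\<bar> \<le> B)"
    using Op_whp_bound[OF assms(1,3)] by blast
  from B assms(2) have "\<forall>\<^sub>F n in sequentially. measure (M n) {\<omega> \<in> space (M n). \<bar>Y n \<omega>\<bar> > B} \<le> \<eta>"
  proof eventually_elim
    case (elim n)
    interpret Mn: prob_space "M n" by (rule prob_M)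
    have [measurable]: "Y n \<in> borel_measurable (M n)" by fact
    obtain A where A: "A \<in> sets (M n)" "measure (M n) A \<ge> 1 - \<eta>" "\<forall>\<omega>\<in>A. \<bar>Y n \<omega>\<bar> \<le> B" using elim by blast
    have "Mn.prob {\<omega> \<in> space (M n). \<bar>Y n \<omega>\<bar> > B} \<le> Mn.prob (space (M n) - A)"
      using A by (intro Mn.finite_measure_mono) (auto simp: not_less[symmetric])
    then show ?case using Mn.prob_compl[OF A(1)] A(2) by simp
  qed
  then show ?thesis ..
qed

end

text \<open>
  The coefficients are those of a linear combination of the three limits in terms of the test functions
  \<open>1\<close>, \<open>x\<close> and \<open>exp (\<tau> * x) - 1\<close>. The second moment splits into the squared mean \<open>\<theta>3^2\<close> and the variance of
  \<open>be * x + ka * exp (\<tau> * x)\<close> under the exponential law; completing the square in \<open>be\<close> separates the Hill part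
  \<open>\<gamma> * \<theta>1\<close> from the uncorrelated rest, and \<open>(1 - \<rho>)^2 - (1 - 2 * \<rho>) = \<rho>^2\<close> simplifies that rest.
\<close>

lemma limit_variance_identity:
  fixes \<gamma> \<rho> \<theta>1 \<phi> \<theta>3 :: real
  assumes g: "\<gamma> > 0" and r: "\<rho> < 0"
  defines "ka \<equiv> \<phi> * (\<gamma> * (1 - 2 * \<rho>) * (1 - \<rho>) ^ 3 / \<rho> ^ 4)"
  defines "be \<equiv> \<theta>1 - ka * \<rho> / (\<gamma> * (1 - \<rho>)\<^sup>2)"
  defines "al \<equiv> - \<gamma> * be - ka * \<rho> / (1 - \<rho>) - \<theta>3"
  shows "al\<^sup>2 + 2 * ((al - ka) * be * \<gamma> + (al - ka) * ka * \<rho> / (1 - \<rho>) + be\<^sup>2 * \<gamma>\<^sup>2 + be * ka * \<rho> * \<gamma> / (1 - \<rho>)\<^sup>2 + ka * be * \<gamma> / (1 - \<rho>) + ka\<^sup>2 * \<rho> / (1 - 2 * \<rho>)) =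
    (\<gamma> * \<theta>1)\<^sup>2 + (\<gamma> * sqrt (1 - 2 * \<rho>) * (1 - \<rho>) / \<rho>\<^sup>2 * \<phi>)\<^sup>2 + \<theta>3\<^sup>2" (is "?M = ?R")
    and "al + be * \<gamma> / (1 - \<rho>) + ka * \<rho> / (1 - 2 * \<rho>) = \<gamma> * (\<theta>1 * \<rho> / (1 - \<rho>) + \<phi>) - \<theta>3"
proof -
  define u where "u = 1 - \<rho>"
  define v where "v = 1 - 2 * \<rho>"
  have nz: "u > 0" "v > 0" "\<rho> \<noteq> 0" "\<gamma> \<noteq> 0" using g r by (auto simp: u_def v_def)
  have v: "v = u\<^sup>2 - \<rho>\<^sup>2" by (simp add: u_def v_def power2_eq_square algebra_simps)
  have ka: "ka * \<rho> ^ 4 = \<phi> * \<gamma> * v * u ^ 3" using nz by (simp add: ka_def u_def v_def)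
  define b where "b = be + ka * \<rho> / (\<gamma> * u\<^sup>2)"
  have b: "b = \<theta>1" by (simp add: b_def be_def u_def)
  have c: "al + be * \<gamma> + ka * \<rho> / u = - \<theta>3" by (simp add: al_def u_def)
  have "?M = (al + be * \<gamma> + ka * \<rho> / u)\<^sup>2 + (be\<^sup>2 * \<gamma>\<^sup>2 + 2 * be * ka * \<gamma> * \<rho> / u\<^sup>2) + ka\<^sup>2 * \<rho>\<^sup>2 / (v * u\<^sup>2)"
  proof -
    have r1: "ka * be * \<gamma> / u - ka * be * \<gamma> = ka * be * \<gamma> * \<rho> / u"
    proof -
      have "1 / u - 1 = \<rho> / u" using nz by (simp add: u_def field_simps)
      then have "ka * be * \<gamma> * (1 / u - 1) = ka * be * \<gamma> * (\<rho> / u)" by simp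
      then show ?thesis by (simp add: right_diff_distrib)
    qed
    have r2: "2 * \<rho> / v - 2 * \<rho> / u = \<rho>\<^sup>2 / u\<^sup>2 + \<rho>\<^sup>2 / (v * u\<^sup>2)"
    proof -
      have "2 * \<rho> / v - 2 * \<rho> / u = 2 * \<rho> * (u - v) * u / (v * u\<^sup>2)" using nz by (simp add: field_simps power2_eq_square)
      also have "2 * \<rho> * (u - v) * u = \<rho>\<^sup>2 * v + \<rho>\<^sup>2" by (simp add: u_def v_def power2_eq_square algebra_simps)
      also have "(\<rho>\<^sup>2 * v + \<rho>\<^sup>2) / (v * u\<^sup>2) = \<rho>\<^sup>2 / u\<^sup>2 + \<rho>\<^sup>2 / (v * u\<^sup>2)" using nz by (simp add: field_simps)
      finally show ?thesis .
    qed
    have "?M = al\<^sup>2 + 2 * al * be * \<gamma> + 2 * al * (ka * \<rho> / u) + 2 * be\<^sup>2 * \<gamma>\<^sup>2 + 2 * be * ka * \<rho> * \<gamma> / u\<^sup>2 + 2 * (ka * be * \<gamma> / u - ka * be * \<gamma>) + ka\<^sup>2 * (2 * \<rho> / v - 2 * \<rho> / u)"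
      unfolding u_def[symmetric] v_def[symmetric] by (simp add: algebra_simps power2_eq_square diff_divide_distrib)
    also have "\<dots> = (al + be * \<gamma> + ka * \<rho> / u)\<^sup>2 + (be\<^sup>2 * \<gamma>\<^sup>2 + 2 * be * ka * \<gamma> * \<rho> / u\<^sup>2) + ka\<^sup>2 * \<rho>\<^sup>2 / (v * u\<^sup>2)"
      unfolding r1 r2 by (simp add: algebra_simps power2_eq_square)
    finally show ?thesis .
  qed
  also have "be\<^sup>2 * \<gamma>\<^sup>2 + 2 * be * ka * \<gamma> * \<rho> / u\<^sup>2 = (\<gamma> * b)\<^sup>2 - ka\<^sup>2 * \<rho>\<^sup>2 / u ^ 4"
    unfolding b_def using nz by (simp add: field_simps power2_eq_square power4_eq_xxxx)
  also have "(al + be * \<gamma> + ka * \<rho> / u)\<^sup>2 + ((\<gamma> * b)\<^sup>2 - ka\<^sup>2 * \<rho>\<^sup>2 / u ^ 4) + ka\<^sup>2 * \<rho>\<^sup>2 / (v * u\<^sup>2) =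
    \<theta>3\<^sup>2 + (\<gamma> * \<theta>1)\<^sup>2 + ka\<^sup>2 * \<rho>\<^sup>2 * (u\<^sup>2 - v) / (v * u ^ 4)"
    unfolding b c using nz by (simp add: field_simps power2_eq_square power4_eq_xxxx)
  also have "ka\<^sup>2 * \<rho>\<^sup>2 * (u\<^sup>2 - v) = ka\<^sup>2 * \<rho> ^ 4" unfolding v by (simp add: power2_eq_square power4_eq_xxxx)
  also have "ka\<^sup>2 * \<rho> ^ 4 / (v * u ^ 4) = (ka * \<rho> ^ 4)\<^sup>2 / (\<rho> ^ 4 * (v * u ^ 4))"
    using nz by (simp add: power2_eq_square power4_eq_xxxx)
  also have "\<dots> = (\<gamma> * sqrt v * u / \<rho>\<^sup>2 * \<phi>)\<^sup>2"
    unfolding ka using nz by (simp add: power_mult_distrib power_divide field_simps power2_eq_square power3_eq_cube power4_eq_xxxx)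
  finally show "?M = ?R" by (simp add: u_def v_def)
  have "al + be * \<gamma> / u + ka * \<rho> / v = - \<theta>3 + be * \<gamma> * (1 / u - 1) + ka * \<rho> * (1 / v - 1 / u)"
    using c by (simp add: algebra_simps)
  also have "1 / u - 1 = \<rho> / u" using nz by (simp add: u_def field_simps)
  also have "1 / v - 1 / u = \<rho> / (v * u)" using nz by (simp add: u_def v_def field_simps)
  also have "be * \<gamma> * (\<rho> / u) = \<theta>1 * \<gamma> * \<rho> / u - ka * \<rho>\<^sup>2 / u ^ 3"
    unfolding be_def u_def[symmetric] using nz by (simp add: field_simps power2_eq_square power3_eq_cube)
  also have "- \<theta>3 + (\<theta>1 * \<gamma> * \<rho> / u - ka * \<rho>\<^sup>2 / u ^ 3) + ka * \<rho> * (\<rho> / (v * u)) = - \<theta>3 + \<theta>1 * \<gamma> * \<rho> / u + ka * \<rho>\<^sup>2 * (u\<^sup>2 - v) / (v * u ^ 3)"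
    using nz by (simp add: field_simps power2_eq_square power3_eq_cube)
  also have "ka * \<rho>\<^sup>2 * (u\<^sup>2 - v) = ka * \<rho> ^ 4" unfolding v by (simp add: power2_eq_square power4_eq_xxxx)
  also have "ka * \<rho> ^ 4 / (v * u ^ 3) = \<phi> * \<gamma>" unfolding ka using nz by simp
  finally show "al + be * \<gamma> / (1 - \<rho>) + ka * \<rho> / (1 - 2 * \<rho>) = \<gamma> * (\<theta>1 * \<rho> / (1 - \<rho>) + \<phi>) - \<theta>3"
    unfolding u_def[symmetric] v_def[symmetric] by (simp add: algebra_simps)
qed

context tail_estimation
begin

text \<open>
  The test functions that arise from linear combinations of the three statistics.
\<close>

definition contrast :: "real \<Rightarrow> real \<Rightarrow> real \<Rightarrow> real \<Rightarrow> real" where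
  "contrast al be ka x = al + be * x + ka * (exp (\<tau> * x) - 1)"

definition contrast' :: "real \<Rightarrow> real \<Rightarrow> real \<Rightarrow> real" where
  "contrast' be ka x = be + ka * (\<tau> * exp (\<tau> * x))"

lemma subexponential_cf: "subexponential (contrast al be ka) (contrast' be ka)"
proof -
  have "subexponential (\<lambda>x. al + be * x + ka * (exp (\<tau> * x) - 1)) (\<lambda>x. 0 + be * 1 + ka * (\<tau> * exp (\<tau> * x)))"
    using tau_neg by (intro subexponential_add subexponential_cmult subexponential_const subexponential_ident subexponential_power) auto
  then show ?thesis by (simp add: contrast_def[abs_def] contrast'_def[abs_def])
qed

lemma pareto_integral_ident_exp:
  assumes "r \<le> 0"
  shows "has_bochner_integral lborel (\<lambda>x. x * exp (r * x) * indicator {0..} x * exp (- x / \<gamma>)) ((\<gamma> / (1 - \<gamma> * r))\<^sup>2)"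
proof -
  have a: "1 / \<gamma> - r > 0" using gamma_pos assms by (smt (verit) divide_pos_pos)
  have e: "(\<lambda>x. x ^ 1 * exp (- ((1 / \<gamma> - r) * x)) * indicator {0..} x) = (\<lambda>x. x * exp (r * x) * indicator {0..} x * exp (- x / \<gamma>))"
    by (auto simp: fun_eq_iff algebra_simps simp flip: exp_add split: split_indicator)
  have "1 / \<gamma> - r = (1 - \<gamma> * r) / \<gamma>" using gamma_pos by (simp add: field_simps)
  then have "fact 1 / (1 / \<gamma> - r) ^ Suc 1 = (\<gamma> / (1 - \<gamma> * r))\<^sup>2" by (simp add: power2_eq_square)
  then show ?thesis using has_bochner_integral_power_exp[OF a, of 1] unfolding e by simp
qed

lemma pareto_mean_cf: "pareto_mean (contrast al be ka) (contrast' be ka) = al + be * \<gamma> + ka * (\<gamma> * \<tau> / (1 - \<gamma> * \<tau>))"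
proof -
  have "has_bochner_integral lborel (\<lambda>x. be * (exp (0 * x) * indicator {0..} x * exp (- x / \<gamma>)) + ka * \<tau> * (exp (\<tau> * x) * indicator {0..} x * exp (- x / \<gamma>)))
     (be * (\<gamma> / (1 - \<gamma> * 0)) + ka * \<tau> * (\<gamma> / (1 - \<gamma> * \<tau>)))"
    using tau_neg by (intro has_bochner_integral_add has_bochner_integral_mult_right pareto_integral_exp) auto
  moreover have "(\<lambda>x. be * (exp (0 * x) * indicator {0..} x * exp (- x / \<gamma>)) + ka * \<tau> * (exp (\<tau> * x) * indicator {0..} x * exp (- x / \<gamma>))) =
    (\<lambda>x. contrast' be ka x * indicator {0..} x * exp (- x / \<gamma>))"
    by (auto simp: contrast'_def algebra_simps)
  ultimately show ?thesis
    by (simp add: pareto_mean_def contrast_def has_bochner_integral_iff mult_ac)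
qed

lemma tail_bias_cf: "tail_bias (contrast al be ka) (contrast' be ka) = lam / \<gamma> * (al + be * \<gamma> / (1 - \<rho>) + ka * \<rho> / (1 - 2 * \<rho>))"
proof -
  have "has_bochner_integral lborel (\<lambda>x. be * (exp (\<tau> * x) * indicator {0..} x * exp (- x / \<gamma>)) + ka * \<tau> * (exp (2 * \<tau> * x) * indicator {0..} x * exp (- x / \<gamma>)))
     (be * (\<gamma> / (1 - \<gamma> * \<tau>)) + ka * \<tau> * (\<gamma> / (1 - \<gamma> * (2 * \<tau>))))"
    using tau_neg by (intro has_bochner_integral_add has_bochner_integral_mult_right pareto_integral_exp) auto
  moreover have "(\<lambda>x. be * (exp (\<tau> * x) * indicator {0..} x * exp (- x / \<gamma>)) + ka * \<tau> * (exp (2 * \<tau> * x) * indicator {0..} x * exp (- x / \<gamma>))) =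
    (\<lambda>x. contrast' be ka x * indicator {0..} x * (exp (- x / \<gamma>) * exp (\<tau> * x)))"
  proof
    fix x
    have e: "exp (2 * \<tau> * x) = exp (\<tau> * x) * exp (\<tau> * x)" by (simp flip: exp_add)
    show "be * (exp (\<tau> * x) * indicator {0..} x * exp (- x / \<gamma>)) + ka * \<tau> * (exp (2 * \<tau> * x) * indicator {0..} x * exp (- x / \<gamma>)) =
      contrast' be ka x * indicator {0..} x * (exp (- x / \<gamma>) * exp (\<tau> * x))"
      unfolding e contrast'_def by (simp add: algebra_simps)
  qed
  ultimately have I: "(\<integral>x. contrast' be ka x * indicator {0..} x * (exp (- x / \<gamma>) * exp (\<tau> * x)) \<partial>lborel) = be * (\<gamma> / (1 - \<gamma> * \<tau>)) + ka * \<tau> * (\<gamma> / (1 - \<gamma> * (2 * \<tau>)))"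
    by (simp add: has_bochner_integral_iff)
  show ?thesis unfolding tail_bias_def I by (simp add: contrast_def \<rho>_def mult_ac)
qed

lemma pareto_mean_cf_square:
  "pareto_mean (\<lambda>x. contrast al be ka x * contrast al be ka x) (\<lambda>x. contrast' be ka x * contrast al be ka x + contrast al be ka x * contrast' be ka x) =
    al\<^sup>2 + 2 * ((al - ka) * be * \<gamma> + (al - ka) * ka * \<rho> / (1 - \<rho>) + be\<^sup>2 * \<gamma>\<^sup>2 + be * ka * \<rho> * \<gamma> / (1 - \<rho>)\<^sup>2 + ka * be * \<gamma> / (1 - \<rho>) + ka\<^sup>2 * \<rho> / (1 - 2 * \<rho>))"
proof -
  define A where "A = al - ka"
  let ?E = "\<lambda>r x. exp (r * x) * indicator {0..} x * exp (- x / \<gamma>) :: real"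
  let ?X = "\<lambda>r x. x * exp (r * x) * indicator {0..} x * exp (- x / \<gamma>) :: real"
  have "has_bochner_integral lborel (\<lambda>x. 2 * (A * be * ?E 0 x + A * ka * \<tau> * ?E \<tau> x + be\<^sup>2 * ?X 0 x + be * ka * \<tau> * ?X \<tau> x + ka * be * ?E \<tau> x + ka\<^sup>2 * \<tau> * ?E (2 * \<tau>) x))
     (2 * (A * be * (\<gamma> / (1 - \<gamma> * 0)) + A * ka * \<tau> * (\<gamma> / (1 - \<gamma> * \<tau>)) + be\<^sup>2 * (\<gamma> / (1 - \<gamma> * 0))\<^sup>2 + be * ka * \<tau> * (\<gamma> / (1 - \<gamma> * \<tau>))\<^sup>2 + ka * be * (\<gamma> / (1 - \<gamma> * \<tau>)) + ka\<^sup>2 * \<tau> * (\<gamma> / (1 - \<gamma> * (2 * \<tau>)))))"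
    using tau_neg by (intro has_bochner_integral_add has_bochner_integral_mult_right pareto_integral_exp pareto_integral_ident_exp) auto
  moreover have "(\<lambda>x. 2 * (A * be * ?E 0 x + A * ka * \<tau> * ?E \<tau> x + be\<^sup>2 * ?X 0 x + be * ka * \<tau> * ?X \<tau> x + ka * be * ?E \<tau> x + ka\<^sup>2 * \<tau> * ?E (2 * \<tau>) x)) =
    (\<lambda>x. (contrast' be ka x * contrast al be ka x + contrast al be ka x * contrast' be ka x) * indicator {0..} x * exp (- x / \<gamma>))"
  proof
    fix x
    have e: "exp (2 * \<tau> * x) = exp (\<tau> * x) * exp (\<tau> * x)" by (simp flip: exp_add)
    show "2 * (A * be * ?E 0 x + A * ka * \<tau> * ?E \<tau> x + be\<^sup>2 * ?X 0 x + be * ka * \<tau> * ?X \<tau> x + ka * be * ?E \<tau> x + ka\<^sup>2 * \<tau> * ?E (2 * \<tau>) x) =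
      (contrast' be ka x * contrast al be ka x + contrast al be ka x * contrast' be ka x) * indicator {0..} x * exp (- x / \<gamma>)"
      unfolding e contrast'_def contrast_def A_def by (simp add: algebra_simps power2_eq_square)
  qed
  ultimately have I: "(\<integral>x. (contrast' be ka x * contrast al be ka x + contrast al be ka x * contrast' be ka x) * indicator {0..} x * exp (- x / \<gamma>) \<partial>lborel) =
     2 * (A * be * (\<gamma> / (1 - \<gamma> * 0)) + A * ka * \<tau> * (\<gamma> / (1 - \<gamma> * \<tau>)) + be\<^sup>2 * (\<gamma> / (1 - \<gamma> * 0))\<^sup>2 + be * ka * \<tau> * (\<gamma> / (1 - \<gamma> * \<tau>))\<^sup>2 + ka * be * (\<gamma> / (1 - \<gamma> * \<tau>)) + ka\<^sup>2 * \<tau> * (\<gamma> / (1 - \<gamma> * (2 * \<tau>))))"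
    by (simp add: has_bochner_integral_iff)
  show ?thesis unfolding pareto_mean_def I
    by (simp add: contrast_def \<rho>_def A_def power_divide power2_eq_square mult_ac)
qed

lemma lin_cf:
  "linear_stat (contrast al be ka) (al + be * \<gamma> + ka * (\<gamma> * \<tau> / (1 - \<gamma> * \<tau>))) n \<omega> = al * P n \<omega> + be * Q n \<omega> + ka * D \<tau> n \<omega>"
proof -
  have te: "tail_excess (contrast al be ka) (t n) z = al * of_bool (t n < z) + be * tail_excess (\<lambda>x. x) (t n) z + ka * tail_excess (\<lambda>x. exp (\<tau> * x) - 1) (t n) z" for z
    by (simp add: tail_excess_def contrast_def)
  have "(\<Sum>j=1..n. tail_excess (contrast al be ka) (t n) (X n j \<omega>)) = al * N n 0 \<omega> + be * (\<Sum>j=1..n. tail_excess (\<lambda>x. x) (t n) (X n j \<omega>)) + ka * (\<Sum>j=1..n. tail_excess (\<lambda>x. exp (\<tau> * x) - 1) (t n) (X n j \<omega>))"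
    unfolding te sum.distrib sum_distrib_left[symmetric] N_def exceed_def by simp
  moreover have "al * N n 0 \<omega> / rk n = al * P n \<omega> + al * real (k n) / rk n"
  proof -
    have "N n 0 \<omega> / rk n = P n \<omega> + real (k n) / rk n" by (simp add: P_def G_def diff_divide_distrib)
    from arg_cong[OF this, of "\<lambda>z. al * z"] show ?thesis by (simp add: distrib_left)
  qed
  ultimately show ?thesis
    unfolding linear_stat_def Q_def D_def by (simp add: add_divide_distrib diff_divide_distrib algebra_simps)
qed

lemma lin_measurable: "continuous_on UNIV g \<Longrightarrow> linear_stat g c n \<in> borel_measurable (M n)"
  unfolding linear_stat_def[abs_def] 
  by (intro borel_measurable_divide borel_measurable_diff borel_measurable_const sum_meas borel_measurable_tail_excess)

text \<open>
  The linear approximations of the three statistics.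
\<close>

definition T1 :: "nat \<Rightarrow> 'a \<Rightarrow> real" where "T1 n \<omega> = h n \<omega> - \<rho> / (1 - \<rho>) * (\<kappa>0 * d0 n \<omega>)"
definition T2 :: "nat \<Rightarrow> 'a \<Rightarrow> real" where "T2 n \<omega> = \<kappa>0 * d0 n \<omega> - lam"
definition T3 :: "nat \<Rightarrow> 'a \<Rightarrow> real" where "T3 n \<omega> = lam / \<gamma> - P n \<omega>"

lemma T_Op: "Op T1" "Op T2" "Op T3"
  unfolding T1_def[abs_def] T2_def[abs_def] T3_def[abs_def]
  by (intro Op_diff Op_cmult Op_const h_Op d0_Op P_Op)+

text \<open>
  The quadratic form of \<open>limit_cov \<gamma> \<rho>\<close>, in the form that independent normal components give it.
\<close>

definition limit_variance :: "real^3 \<Rightarrow> real" where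
  "limit_variance \<theta> = (\<gamma> * \<theta>$1)\<^sup>2 + (\<gamma> * sqrt (1 - 2 * \<rho>) * (1 - \<rho>) / \<rho>\<^sup>2 * (\<theta>$2 - \<rho> / (1 - \<rho>) * \<theta>$1))\<^sup>2 + (\<theta>$3)\<^sup>2"

text \<open>
  The linear combination is a single linear statistic with test function \<open>contrast\<close> plus the constant \<open>b\<close>, and the
  bias of that statistic is \<open>- b\<close>.
\<close>

lemma char_T:
  fixes \<theta> :: "real^3"
  defines "B \<equiv> \<lambda>n \<omega>. \<theta>$1 * T1 n \<omega> + \<theta>$2 * T2 n \<omega> + \<theta>$3 * T3 n \<omega>"
  shows "(\<lambda>n. \<integral>\<omega>. iexp (B n \<omega>) \<partial>M n) \<longlonglongrightarrow> of_real (exp (- limit_variance \<theta> / 2))" and "B n \<in> borel_measurable (M n)"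
proof -
  define \<phi> where "\<phi> = \<theta>$2 - \<rho> / (1 - \<rho>) * \<theta>$1"
  define ka where "ka = \<phi> * \<kappa>0"
  define be where "be = \<theta>$1 - ka * \<rho> / (\<gamma> * (1 - \<rho>)\<^sup>2)"
  define al where "al = - \<gamma> * be - ka * \<rho> / (1 - \<rho>) - \<theta>$3"
  define b where "b = \<theta>$3 * (lam / \<gamma>) - \<theta>$2 * lam"
  have variance: "al\<^sup>2 + 2 * ((al - ka) * be * \<gamma> + (al - ka) * ka * \<rho> / (1 - \<rho>) + be\<^sup>2 * \<gamma>\<^sup>2 + be * ka * \<rho> * \<gamma> / (1 - \<rho>)\<^sup>2 + ka * be * \<gamma> / (1 - \<rho>) + ka\<^sup>2 * \<rho> / (1 - 2 * \<rho>)) = limit_variance \<theta>"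
    unfolding limit_variance_def \<phi>_def[symmetric] unfolding al_def be_def ka_def \<kappa>0_def
    by (rule limit_variance_identity(1)[OF gamma_pos rho_neg])
  have mean: "al + be * \<gamma> / (1 - \<rho>) + ka * \<rho> / (1 - 2 * \<rho>) = \<gamma> * (\<theta>$1 * \<rho> / (1 - \<rho>) + \<phi>) - \<theta>$3"
    unfolding al_def be_def ka_def \<kappa>0_def
    by (rule limit_variance_identity(2)[OF gamma_pos rho_neg])
  define c where "c = al + be * \<gamma> + ka * (\<gamma> * \<tau> / (1 - \<gamma> * \<tau>))"
  have taur: "ka * (\<tau> / r) = ka * \<rho> / (\<gamma> * r)" for r using gamma_pos by (simp add: \<rho>_def)
  have Beq: "B n \<omega> = linear_stat (contrast al be ka) c n \<omega> + b" for n \<omega>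
  proof -
    let ?p = "P n \<omega>" and ?q = "Q n \<omega>" and ?d = "D \<tau> n \<omega>"
    have be': "ka * (\<tau> / (1 - \<rho>)\<^sup>2) = \<theta>$1 - be" unfolding be_def taur by simp
    have "B n \<omega> = \<theta>$1 * h n \<omega> + ka * d0 n \<omega> - \<theta>$3 * ?p + b"
      unfolding B_def T1_def T2_def T3_def ka_def \<phi>_def b_def by (simp add: algebra_simps)
    also have "ka * d0 n \<omega> = ka * ?d - ka * \<rho> / (1 - \<rho>) * ?p - (ka * (\<tau> / (1 - \<rho>)\<^sup>2)) * h n \<omega>"
      unfolding d0_def by (simp add: algebra_simps)
    also have "\<theta>$1 * h n \<omega> + (ka * ?d - ka * \<rho> / (1 - \<rho>) * ?p - (ka * (\<tau> / (1 - \<rho>)\<^sup>2)) * h n \<omega>) - \<theta>$3 * ?p + b = al * ?p + be * ?q + ka * ?d + b"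
      unfolding be' h_def al_def by (simp add: algebra_simps)
    finally show ?thesis unfolding c_def lin_cf .
  qed
  show "B n \<in> borel_measurable (M n)"
    unfolding Beq[abs_def] using lin_measurable[OF subexponentialD(3)[OF subexponential_cf]] by measurable
  have bias: "tail_bias (contrast al be ka) (contrast' be ka) = - b"
    unfolding tail_bias_cf mean unfolding \<phi>_def b_def using gamma_pos by (simp add: field_simps)
  have "(\<lambda>n. \<integral>\<omega>. iexp (linear_stat (contrast al be ka) c n \<omega>) \<partial>M n) \<longlonglongrightarrow> iexp (- b) * of_real (exp (- limit_variance \<theta> / 2))"
    using lin_char[OF subexponential_cf[of al be ka]]
    unfolding pareto_mean_cf pareto_mean_cf_square bias variance c_def[symmetric] .
  from tendsto_mult[OF tendsto_const[of "iexp b"] this]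
  have "(\<lambda>n. iexp b * (\<integral>\<omega>. iexp (linear_stat (contrast al be ka) c n \<omega>) \<partial>M n)) \<longlonglongrightarrow> of_real (exp (- limit_variance \<theta> / 2))"
    by (simp add: mult.assoc[symmetric] flip: exp_add)
  moreover have "iexp b * (\<integral>\<omega>. iexp (linear_stat (contrast al be ka) c n \<omega>) \<partial>M n) = (\<integral>\<omega>. iexp (B n \<omega>) \<partial>M n)" for n
    unfolding Beq by (simp add: distrib_left exp_add mult.commute)
  ultimately show "(\<lambda>n. \<integral>\<omega>. iexp (B n \<omega>) \<partial>M n) \<longlonglongrightarrow> of_real (exp (- limit_variance \<theta> / 2))" by simp
qed

lemma Op_abs_add: "Op Y \<Longrightarrow> Op Z \<Longrightarrow> Op (\<lambda>n \<omega>. \<bar>Y n \<omega>\<bar> + \<bar>Z n \<omega>\<bar>)"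
  by (rule Op_binary[where f="\<lambda>y z. \<bar>y\<bar> + \<bar>z\<bar>" and g="\<lambda>y z. y + z"]) auto

lemma U_measurable: "n \<ge> 2 \<Longrightarrow> U n \<in> borel_measurable (M n)"
  unfolding U_def[abs_def] by (rule borel_measurable_order_stat[OF k_pos(2) X_meas])

text \<open>
  The three statistics inherit the limiting characteristic function from their linear approximations, and
  tightness from boundedness in probability.
\<close>

theorem joint_convergence:
  assumes gm: "\<And>n. gamma_hat n \<in> borel_measurable (M n)" and dm: "\<And>n. delta_hat n \<in> borel_measurable (M n)"
  shows "converges_in_distribution M
     (\<lambda>n \<omega>. vector [rk n * (gamma_hat n \<omega> - \<gamma>), rk n * (delta_hat n \<omega> - \<delta> (U n \<omega>)), tail_count_dev F (\<lambda>i. X n i \<omega>) (k n) n] :: real^3)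
     (mv_normal 0 (limit_cov \<gamma> \<rho>))"
    (is "converges_in_distribution M (\<lambda>n \<omega>. vector [?Y1 n \<omega>, ?Y2 n \<omega>, ?Y3 n \<omega>]) ?N")
proof -
  define Y where "Y n \<omega> = (vector [?Y1 n \<omega>, ?Y2 n \<omega>, ?Y3 n \<omega>] :: real^3)" for n \<omega>
  have o1: "op (\<lambda>n \<omega>. ?Y1 n \<omega> - T1 n \<omega>)" using gamma_hat_expansion by (simp add: T1_def)
  have o2: "op (\<lambda>n \<omega>. ?Y2 n \<omega> - T2 n \<omega>)"
    using op_diff[OF delta_hat_expansion delta_U] by (simp add: T2_def algebra_simps)
  have o3: "op (\<lambda>n \<omega>. ?Y3 n \<omega> - T3 n \<omega>)" using tail_count_expansion by (simp add: T3_def)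
  have m: "?Y1 n \<in> borel_measurable (M n)" "?Y2 n \<in> borel_measurable (M n)" "?Y3 n \<in> borel_measurable (M n)" if n: "n \<ge> 2" for n
  proof -
    note [measurable] = gm dm U_measurable[OF n]
    have [measurable]: "\<delta> \<in> borel_measurable borel" unfolding tail_delta_def[abs_def] by measurable
    show "?Y1 n \<in> borel_measurable (M n)" "?Y2 n \<in> borel_measurable (M n)" by measurable
    show "?Y3 n \<in> borel_measurable (M n)" unfolding tail_count_dev_def U_def[symmetric] by measurable
  qed
  have Ym: "\<forall>\<^sub>F n in sequentially. Y n \<in> borel_measurable (M n)"
    using n_ge_2
  proof eventually_elim
    case (elim n)
    show ?case unfolding Y_def[abs_def] by (intro borel_measurable_vector3 m elim)
  qed
  have "converges_in_distribution M Y ?N"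
  proof (rule converges_in_distribution_char[OF prob_M prob_space_mv_normal_limit_cov[OF gamma_pos rho_neg] _ Ym])
    show "sets ?N = sets borel" by (simp add: mv_normal_def)
  next
    fix \<eta> :: real assume \<eta>: "\<eta> > 0"
    let ?W = "\<lambda>n \<omega>. \<bar>\<bar>?Y1 n \<omega>\<bar> + \<bar>?Y2 n \<omega>\<bar>\<bar> + \<bar>?Y3 n \<omega>\<bar>"
    have "Op ?W"
      by (intro Op_abs_add Op_of_approx[OF o1 T_Op(1)] Op_of_approx[OF o2 T_Op(2)] Op_of_approx[OF o3 T_Op(3)])
    moreover have Wm: "\<forall>\<^sub>F n in sequentially. ?W n \<in> borel_measurable (M n)"
      using n_ge_2
    proof eventually_elim
      case (elim n)
      note [measurable] = m[OF elim]
      show ?case by measurable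
    qed
    ultimately obtain B where B: "\<forall>\<^sub>F n in sequentially. measure (M n) {\<omega> \<in> space (M n). \<bar>?W n \<omega>\<bar> > B} \<le> \<eta>"
      using Op_tight[OF _ _ \<eta>] by blast
    have "\<forall>\<^sub>F n in sequentially. measure (M n) {\<omega> \<in> space (M n). norm (Y n \<omega>) > B} \<le> \<eta>"
      using B Wm
    proof eventually_elim
      case (elim n)
      interpret Mn: prob_space "M n" by (rule prob_M)
      have [measurable]: "?W n \<in> borel_measurable (M n)" by (rule elim(2))
      have le: "norm (Y n \<omega>) \<le> \<bar>?W n \<omega>\<bar>" for \<omega>
        using norm_le_l1_cart[of "Y n \<omega>"] by (simp add: Y_def sum_3 vector_3)
      have "Mn.prob {\<omega> \<in> space (M n). norm (Y n \<omega>) > B} \<le> Mn.prob {\<omega> \<in> space (M n). \<bar>?W n \<omega>\<bar> > B}"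
      proof (rule Mn.finite_measure_mono)
        show "{\<omega> \<in> space (M n). norm (Y n \<omega>) > B} \<subseteq> {\<omega> \<in> space (M n). \<bar>?W n \<omega>\<bar> > B}"
          using less_le_trans[OF _ le] by blast
        show "{\<omega> \<in> space (M n). \<bar>?W n \<omega>\<bar> > B} \<in> Mn.events" by measurable
      qed
      then show ?case using elim(1) by linarith
    qed
    then show "\<exists>B. \<forall>\<^sub>F n in sequentially. measure (M n) {\<omega> \<in> space (M n). norm (Y n \<omega>) > B} \<le> \<eta>" ..
  next
    fix \<theta> :: "real^3"
    let ?A = "\<lambda>n \<omega>. \<theta>$1 * ?Y1 n \<omega> + \<theta>$2 * ?Y2 n \<omega> + \<theta>$3 * ?Y3 n \<omega>"
    let ?B = "\<lambda>n \<omega>. \<theta>$1 * T1 n \<omega> + \<theta>$2 * T2 n \<omega> + \<theta>$3 * T3 n \<omega>"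
    have "op (\<lambda>n \<omega>. \<theta>$1 * (?Y1 n \<omega> - T1 n \<omega>) + \<theta>$2 * (?Y2 n \<omega> - T2 n \<omega>) + \<theta>$3 * (?Y3 n \<omega> - T3 n \<omega>))"
      by (intro op_add op_cmult o1 o2 o3)
    moreover have "\<theta>$1 * (y1 - t1) + \<theta>$2 * (y2 - t2) + \<theta>$3 * (y3 - t3) = (\<theta>$1 * y1 + \<theta>$2 * y2 + \<theta>$3 * y3) - (\<theta>$1 * t1 + \<theta>$2 * t2 + \<theta>$3 * t3)" for y1 y2 y3 t1 t2 t3
      by (simp add: algebra_simps)
    ultimately have opAB: "op (\<lambda>n \<omega>. ?A n \<omega> - ?B n \<omega>)" by (simp only:)
    have "\<forall>\<^sub>F n in sequentially. ?A n \<in> borel_measurable (M n) \<and> ?B n \<in> borel_measurable (M n)"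
      using n_ge_2
    proof eventually_elim
      case (elim n)
      note [measurable] = m[OF elim]
      have "?A n \<in> borel_measurable (M n)" by measurable
      then show ?case using char_T(2)[of \<theta> n] by blast
    qed
    from iexp_integral_diff[OF opAB this char_T(1)]
    have "(\<lambda>n. \<integral>\<omega>. iexp (?A n \<omega>) \<partial>M n) \<longlonglongrightarrow> of_real (exp (- limit_variance \<theta> / 2))" .
    then show "(\<lambda>n. \<integral>\<omega>. iexp (\<theta> \<bullet> Y n \<omega>) \<partial>M n) \<longlonglongrightarrow> (\<integral>y. iexp (\<theta> \<bullet> y) \<partial>?N)"
      unfolding char_mv_normal_limit_cov[OF gamma_pos rho_neg] by (simp add: Y_def inner_vec3 vector_3 limit_variance_def)
  qed
  then show ?thesis by (simp add: Y_def[abs_def])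
qed

end

theorem theorem3p1:
  fixes \<gamma> \<tau> \<rho> lam :: real
    and F :: "real \<Rightarrow> real"
    and M :: "nat \<Rightarrow> 'a measure"
    and X :: "nat \<Rightarrow> nat \<Rightarrow> 'a \<Rightarrow> real"
    and k :: "nat \<Rightarrow> nat"
    and rho_hat gamma_hat delta_hat delta_n :: "nat \<Rightarrow> 'a \<Rightarrow> real"
  assumes "\<gamma> > 0" and "\<tau> < 0" and "\<rho> = \<gamma> * \<tau>"
    and "heavy_tailed \<gamma> \<tau> F" and "F 0 = 0"
    and "\<And>n. prob_space (M n)"
    and "\<And>n. prob_space.indep_vars (M n) (\<lambda>_. borel) (X n) {1..n}"
    and "\<And>n i. i \<in> {1..n} \<Longrightarrow> cdf (distr (M n) borel (X n i)) = F"
    and "\<And>n. n \<ge> 2 \<Longrightarrow> k n \<in> {1..n - 1}"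
    and "filterlim k at_top sequentially"
    and "(\<lambda>n. real (k n) / real n) \<longlonglongrightarrow> 0"
    and "(\<lambda>n. sqrt (real (k n)) * tail_a \<gamma> F (real n / real (k n))) \<longlonglongrightarrow> lam"
    and "\<And>n. rho_hat n \<in> borel_measurable (M n)"
    and "converges_in_probability M rho_hat \<rho>"
    and "\<And>n. gamma_hat n \<in> borel_measurable (M n)"
    and "\<And>n. delta_hat n \<in> borel_measurable (M n)"
    and "\<And>n \<omega>. n \<ge> 2 \<Longrightarrow> \<omega> \<in> space (M n) \<Longrightarrow>
           est_defined (\<lambda>i. X n i \<omega>) (k n) n (rho_hat n \<omega>) \<Longrightarrow>
           delta_hat n \<omega> = delta_est (\<lambda>i. X n i \<omega>) (k n) n (rho_hat n \<omega>)"
    and "\<And>n \<omega>. n \<ge> 2 \<Longrightarrow> \<omega> \<in> space (M n) \<Longrightarrow>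
           est_defined (\<lambda>i. X n i \<omega>) (k n) n (rho_hat n \<omega>) \<Longrightarrow>
           gamma_hat n \<omega> = gamma_est (\<lambda>i. X n i \<omega>) (k n) n (rho_hat n \<omega>)"
    and "delta_n = (\<lambda>n \<omega>. tail_delta \<gamma> F (order_stat (\<lambda>i. X n i \<omega>) n (n - k n)))"
  shows "converges_in_probability M (\<lambda>n \<omega>. sqrt (real (k n)) * delta_n n \<omega>) lam \<and>
         converges_in_distribution M
           (\<lambda>n \<omega>. vector
              [sqrt (real (k n)) * (gamma_hat n \<omega> - \<gamma>),
               sqrt (real (k n)) * (delta_hat n \<omega> - delta_n n \<omega>),
               tail_count_dev F (\<lambda>i. X n i \<omega>) (k n) n] :: real ^ 3)
           (mv_normal 0 (limit_cov \<gamma> \<rho>))"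
proof -
  interpret ps: prob_seq M by (rule prob_seq.intro) (rule assms(6))
  interpret E: tail_estimation \<gamma> \<tau> F k lam M X rho_hat gamma_hat delta_hat
  proof unfold_locales
    show "small_in_prob M (\<lambda>n \<omega>. rho_hat n \<omega> - \<gamma> * \<tau>)"
      using ps.op_of_convergence[OF assms(14)] by (simp only: assms(3))
  qed (use assms in auto)
  have U: "delta_n n \<omega> = tail_delta \<gamma> F (E.U n \<omega>)" for n \<omega>
    by (simp add: assms(19) E.U_def)
  have rho: "E.\<rho> = \<rho>" by (simp add: E.\<rho>_def assms(3))
  have "converges_in_probability M (\<lambda>n \<omega>. sqrt (real (k n)) * delta_n n \<omega>) lam"
    unfolding U
  proof (rule ps.convergence_of_op[OF E.delta_U])
    show "\<forall>\<^sub>F n in sequentially. (\<lambda>\<omega>. sqrt (real (k n)) * tail_delta \<gamma> F (E.U n \<omega>)) \<in> borel_measurable (M n)"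
      using E.n_ge_2
    proof eventually_elim
      case (elim n)
      note [measurable] = E.U_measurable[OF elim]
      have [measurable]: "tail_delta \<gamma> F \<in> borel_measurable borel" unfolding tail_delta_def[abs_def] by measurable
      show ?case by measurable
    qed
  qed
  then show ?thesis using E.joint_convergence[OF assms(15,16)] unfolding U rho by blast
qed

end
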